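(* The WSAT$^+$ problem on circuits of genus $g(n)$ is FPT if $g(n) = n^{o(1)}$, and $W[2]$-complete if $g(n) = n^{O(1)}$, where $n$ is the number of variables in the circuit.
   Context: A $\Pi_t$ circuit is a Boolean circuit in normalized form of depth at most $t$: the output gate is an AND-gate, every non-variable gate has outdegree at most 1, and starting from the output gate the gates alternate between AND-gates and OR-gates (no NOT-gates; input vertices are literals). A circuit is monotone if all its input literals are positive. The weight of an assignment is the number of variables set to 1. WSAT$^+$ (= WSAT$^+[2]$, i.e., weighted monotone CNF-SAT) is the problem: given a monotone $\Pi_2$ circuit $C$ and a parameter $k$, decide whether $C$ has a satisfying assignment of weight exactly $k$. The genus of a circuit is the genus of its underlying undirected graph after the output gate is removed. The $o(\cdot)$ notation is the effective one: $f(n)=o(g(n))$ means $f(n)\le g(n)/\mu(n)$ for some computable nondecreasing unbounded $\mu$ and all large $n$.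
   Formalization: In the W[2]-completeness part, g(n) = n^{O(1)} is read as polynomial growth, n^a ≤ g(n) ≤ n^b for large n with some a > 0; as a mere upper bound it would include g = 0, for which the problem is FPT by the first part. *)

theory Defs
  imports Complex_Main "HOL-Library.Log_Nat" "HOL-Combinatorics.Orbits"
begin

section \<open>Random access machines\<close>

text \<open>
  The machine model is the random access machine with addition, truncated subtraction, indirect
  addressing, a read-only input tape, a write-only output tape and uniform cost. One step
  lengthens the largest number in memory by at most one bit, so that this machine and Turing
  machines simulate each other with polynomial overhead. Control flow is structured instead of
  by jumps.
\<close>

datatype ram =
    Const nat nat
  | Add nat nat nat
  | Sub nat nat nat
  | Load nat nat
  | Store nat nat
  | Read nat
  | Write nat
  | Seq ram ram
  | Cond nat ram ram
  | While nat ram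

record ram_state =
  mem :: "nat \<Rightarrow> nat"
  inp :: "nat list"
  outp :: "nat list"

text \<open>Reading beyond the end of the input yields 0.\<close>

inductive exec :: "ram \<Rightarrow> ram_state \<Rightarrow> nat \<Rightarrow> ram_state \<Rightarrow> bool" where
  "exec (Const i c) s 1 (s\<lparr>mem := (mem s)(i := c)\<rparr>)"
| "exec (Add i j l) s 1 (s\<lparr>mem := (mem s)(i := mem s j + mem s l)\<rparr>)"
| "exec (Sub i j l) s 1 (s\<lparr>mem := (mem s)(i := mem s j - mem s l)\<rparr>)"
| "exec (Load i j) s 1 (s\<lparr>mem := (mem s)(i := mem s (mem s j))\<rparr>)"
| "exec (Store i j) s 1 (s\<lparr>mem := (mem s)(mem s i := mem s j)\<rparr>)"
| "exec (Read i) s 1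
     (s\<lparr>mem := (mem s)(i := (case inp s of [] \<Rightarrow> 0 | a # _ \<Rightarrow> a)), inp := tl (inp s)\<rparr>)"
| "exec (Write i) s 1 (s\<lparr>outp := outp s @ [mem s i]\<rparr>)"
| "exec p s t s' \<Longrightarrow> exec q s' t' s'' \<Longrightarrow> exec (Seq p q) s (t + t') s''"
| "mem s i \<noteq> 0 \<Longrightarrow> exec p s t s' \<Longrightarrow> exec (Cond i p q) s (t + 1) s'"
| "mem s i = 0 \<Longrightarrow> exec q s t s' \<Longrightarrow> exec (Cond i p q) s (t + 1) s'"
| "mem s i = 0 \<Longrightarrow> exec (While i p) s 1 s"
| "mem s i \<noteq> 0 \<Longrightarrow> exec p s t s' \<Longrightarrow> exec (While i p) s' t' s'' \<Longrightarrow>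
     exec (While i p) s (t + t' + 1) s''"

definition runs :: "ram \<Rightarrow> nat list \<Rightarrow> nat \<Rightarrow> nat list \<Rightarrow> bool" where
  "runs p xs t ys \<longleftrightarrow>
     (\<exists>s. exec p \<lparr>mem = (\<lambda>_. 0), inp = xs, outp = []\<rparr> t s \<and> outp s = ys)"

definition computable :: "(nat \<Rightarrow> nat) \<Rightarrow> bool" where
  "computable f \<longleftrightarrow> (\<exists>p. \<forall>n. \<exists>t. runs p [n] t [f n])"


section \<open>Parameterized problems\<close>

text \<open>
  An instance is a word together with the parameter. A problem restricted to a class of
  instances is a promise problem, given by its yes-instances and its no-instances: nothing is
  asked of an algorithm outside of the class. An ordinary parameterized problem \<open>Q\<close> is
  the pair of \<open>Q\<close> and its complement.
\<close>

type_synonym inst = "nat list \<times> nat"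

record problem =
  yes :: "inst set"
  no :: "inst set"

fun tape :: "inst \<Rightarrow> nat list" where
  "tape (w, k) = k # length w # w"

text \<open>\<open>floorlog 2 a\<close> is the number of binary digits of \<open>a\<close>.\<close>

definition word_size :: "nat list \<Rightarrow> nat" where
  "word_size w = 1 + (\<Sum>a\<leftarrow>w. 1 + floorlog 2 a)"

definition FPT :: "problem set" where
  "FPT = {Q. \<exists>p f c. computable f \<and>
     (\<forall>w k. (w, k) \<in> yes Q \<longrightarrow>
        (\<exists>t \<le> f k * word_size w ^ c. runs p (tape (w, k)) t [1])) \<and>
     (\<forall>w k. (w, k) \<in> no Q \<longrightarrow>
        (\<exists>t \<le> f k * word_size w ^ c. runs p (tape (w, k)) t [0]))}"

definition fpt_reducible :: "problem \<Rightarrow> problem \<Rightarrow> bool" where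
  "fpt_reducible Q R \<longleftrightarrow> (\<exists>p f h c. computable f \<and> computable h \<and>
     (\<forall>w k. (w, k) \<in> yes Q \<union> no Q \<longrightarrow>
        (\<exists>t w' k'. t \<le> f k * word_size w ^ c \<and> runs p (tape (w, k)) t (tape (w', k')) \<and>
           k' \<le> h k \<and>
           ((w, k) \<in> yes Q \<longrightarrow> (w', k') \<in> yes R) \<and>
           ((w, k) \<in> no Q \<longrightarrow> (w', k') \<in> no R))))"


section \<open>Circuits\<close>

datatype vlabel = Lit nat bool | AndG | OrG

abbreviation is_lit :: "vlabel \<Rightarrow> bool" where
  "is_lit l \<equiv> \<exists>x b. l = Lit x b"

text \<open>
  The vertices are the positions of \<open>labels\<close>; \<open>Lit x True\<close> is the positive and
  \<open>Lit x False\<close> the negative literal of the variable \<open>x\<close>.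
\<close>

record circuit =
  labels :: "vlabel list"
  wires :: "(nat \<times> nat) list"
  outgate :: nat

definition verts :: "circuit \<Rightarrow> nat set" where
  "verts C = {..<length (labels C)}"

definition inputs :: "circuit \<Rightarrow> nat set" where
  "inputs C = {v \<in> verts C. is_lit (labels C ! v)}"

text \<open>
  Every literal labels at most one input vertex. Without this the genus would say nothing,
  since the occurrences of a literal could be separated.
\<close>

definition wf_circuit :: "circuit \<Rightarrow> bool" where
  "wf_circuit C \<longleftrightarrow>
     distinct (wires C) \<and> set (wires C) \<subseteq> verts C \<times> verts C \<and> acyclic (set (wires C)) \<and>
     inputs C = verts C - snd ` set (wires C) \<and>
     inj_on ((!) (labels C)) (inputs C) \<and>
     outgate C \<in> verts C - inputs C \<and> outgate C \<notin> fst ` set (wires C)"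

definition Pi_circuit :: "nat \<Rightarrow> circuit \<Rightarrow> bool" where
  "Pi_circuit t C \<longleftrightarrow>
     wf_circuit C \<and>
     labels C ! outgate C = AndG \<and>
     (\<forall>v \<in> verts C - inputs C. card {u. (v, u) \<in> set (wires C)} \<le> 1) \<and>
     (\<forall>(u, v) \<in> set (wires C). u \<notin> inputs C \<longrightarrow> labels C ! u \<noteq> labels C ! v) \<and>
     (\<forall>v \<in> inputs C. \<forall>d. (v, outgate C) \<in> set (wires C) ^^ d \<longrightarrow> d \<le> t)"

definition monotone_circuit :: "circuit \<Rightarrow> bool" where
  "monotone_circuit C \<longleftrightarrow> (\<forall>x b. Lit x b \<in> set (labels C) \<longrightarrow> b)"

definition vars :: "circuit \<Rightarrow> nat set" where
  "vars C = {x. \<exists>b. Lit x b \<in> set (labels C)}"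

text \<open>An assignment is the set of the variables that are set to 1.\<close>

inductive holds :: "circuit \<Rightarrow> nat set \<Rightarrow> nat \<Rightarrow> bool" for C A where
  "v \<in> verts C \<Longrightarrow> labels C ! v = Lit x b \<Longrightarrow> (x \<in> A) = b \<Longrightarrow> holds C A v"
| "v \<in> verts C \<Longrightarrow> labels C ! v = AndG \<Longrightarrow>
     (\<forall>u. (u, v) \<in> set (wires C) \<longrightarrow> holds C A u) \<Longrightarrow> holds C A v"
| "v \<in> verts C \<Longrightarrow> labels C ! v = OrG \<Longrightarrow>
     (u, v) \<in> set (wires C) \<Longrightarrow> holds C A u \<Longrightarrow> holds C A v"

definition weight_sat :: "circuit \<Rightarrow> nat \<Rightarrow> bool" where
  "weight_sat C k \<longleftrightarrow> (\<exists>A \<subseteq> vars C. card A = k \<and> holds C A (outgate C))"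

fun enc_label :: "vlabel \<Rightarrow> nat list" where
  "enc_label AndG = [0, 0]"
| "enc_label OrG = [1, 0]"
| "enc_label (Lit x True) = [2, x]"
| "enc_label (Lit x False) = [3, x]"

definition enc_circuit :: "circuit \<Rightarrow> nat list" where
  "enc_circuit C =
     outgate C # length (labels C) # concat (map enc_label (labels C)) @
     length (wires C) # concat (map (\<lambda>(u, v). [u, v]) (wires C))"

lemma enc_label_inj: "enc_label a = enc_label b \<Longrightarrow> a = b"
  by (cases a rule: enc_label.cases; cases b rule: enc_label.cases) auto

lemma length_enc_label: "length (enc_label a) = 2"
  by (cases a rule: enc_label.cases) auto

lemma concat_block_inj:
  assumes "\<And>a. length (f a) = 2" and "inj f" and "length xs = length ys"
    and "concat (map f xs) @ us = concat (map f ys) @ vs"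
  shows "xs = ys \<and> us = vs"
  using assms(3,4)
  by (induction xs ys rule: list_induct2) (auto simp: assms(1) inj_eq[OF assms(2)])

lemma inj_enc_circuit: "inj enc_circuit"
proof (rule injI)
  fix C D :: circuit assume eq: "enc_circuit C = enc_circuit D"
  have inj_pair: "inj (\<lambda>(u, v). [u, v :: nat])" by (auto simp: inj_def)
  have inj_lab: "inj enc_label" by (auto simp: inj_def enc_label_inj)
  from eq have "labels C = labels D \<and>
      length (wires C) # concat (map (\<lambda>(u, v). [u, v]) (wires C)) =
      length (wires D) # concat (map (\<lambda>(u, v). [u, v]) (wires D))"
    by (intro concat_block_inj[OF length_enc_label inj_lab]) (auto simp: enc_circuit_def)
  moreover from this have "wires C = wires D \<and> ([] :: nat list) = []"
    by (intro concat_block_inj[OF _ inj_pair]) auto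
  ultimately show "C = D" using eq by (simp add: enc_circuit_def)
qed

definition wsat_on :: "(circuit \<Rightarrow> bool) \<Rightarrow> problem" where
  "wsat_on P =
     \<lparr>yes = {(enc_circuit C, k) | C k. P C \<and> weight_sat C k},
      no = {(enc_circuit C, k) | C k. P C \<and> \<not> weight_sat C k}\<rparr>"

text \<open>The class \<open>W[t]\<close>, for \<open>t \<ge> 2\<close>, by its canonical problem.\<close>

definition W :: "nat \<Rightarrow> problem set" where
  "W t = {Q. fpt_reducible Q (wsat_on (Pi_circuit t))}"

definition W_complete :: "nat \<Rightarrow> problem \<Rightarrow> bool" where
  "W_complete t Q \<longleftrightarrow> Q \<in> W t \<and> (\<forall>R \<in> W t. fpt_reducible R Q)"


section \<open>Genus\<close>

text \<open>
  A finite simple graph is given by its vertices \<open>V\<close> and its darts \<open>D\<close>, where each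
  edge contributes its two orientations. Cellular embeddings of a connected graph into closed
  orientable surfaces correspond to rotation systems: cyclic orders of the darts that leave each
  vertex. The faces are the orbits of the permutation that goes along a dart and turns to the
  next dart at its head. An isolated vertex has one face, which no dart witnesses. Summed over
  the connected components, Euler's formula is
  \<open>card V - card E + faces = 2 * components - 2 * genus\<close>; the genus of a graph is
  the sum of the genera of its components.
\<close>

definition rotation_system :: "('a \<times> 'a) set \<Rightarrow> ('a \<times> 'a \<Rightarrow> 'a \<times> 'a) \<Rightarrow> bool" where
  "rotation_system D \<pi> \<longleftrightarrow>
     \<pi> permutes D \<and> (\<forall>v \<in> fst ` D. cyclic_on \<pi> {d \<in> D. fst d = v})"

definition num_faces ::
    "'a set \<Rightarrow> ('a \<times> 'a) set \<Rightarrow> ('a \<times> 'a \<Rightarrow> 'a \<times> 'a) \<Rightarrow> nat" where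
  "num_faces V D \<pi> = card (orbit (\<pi> \<circ> prod.swap) ` D) + card (V - fst ` D)"

definition num_components :: "'a set \<Rightarrow> ('a \<times> 'a) set \<Rightarrow> nat" where
  "num_components V D = card ((\<lambda>v. D\<^sup>* `` {v}) ` V)"

definition graph_genus :: "'a set \<Rightarrow> ('a \<times> 'a) set \<Rightarrow> nat" where
  "graph_genus V D = (LEAST \<gamma>. \<exists>\<pi>. rotation_system D \<pi> \<and>
     int (card V) - int (card D div 2) + int (num_faces V D \<pi>) =
       2 * int (num_components V D) - 2 * int \<gamma>)"

definition circuit_genus :: "circuit \<Rightarrow> nat" where
  "circuit_genus C =
     (let V = verts C - {outgate C}
      in graph_genus V ((set (wires C) \<union> (set (wires C))\<inverse>) \<inter> V \<times> V))"

definition wsat_pos_genus :: "(nat \<Rightarrow> nat) \<Rightarrow> problem" where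
  "wsat_pos_genus g = wsat_on (\<lambda>C. Pi_circuit 2 C \<and> monotone_circuit C \<and>
     circuit_genus C \<le> g (card (vars C)))"


section \<open>Growth rates\<close>

definition eff_small_o :: "(nat \<Rightarrow> real) \<Rightarrow> (nat \<Rightarrow> real) \<Rightarrow> bool" where
  "eff_small_o f h \<longleftrightarrow> (\<exists>\<mu> :: nat \<Rightarrow> nat. computable \<mu> \<and> mono \<mu> \<and> (\<forall>b. \<exists>n. b \<le> \<mu> n) \<and>
     (\<forall>\<^sub>F n in sequentially. f n \<le> h n / real (\<mu> n)))"

definition subpolynomial :: "(nat \<Rightarrow> nat) \<Rightarrow> bool" where
  "subpolynomial g \<longleftrightarrow> (\<exists>e. eff_small_o e (\<lambda>_. 1) \<and>
     (\<forall>\<^sub>F n in sequentially. real (g n) \<le> real n powr e n))"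

text \<open>
  Here \<open>n\<^bsup>O(1)\<^esup>\<close> means of polynomial growth: the exponent lies between two positive
  constants. As a mere upper bound it would include the subpolynomial functions.
\<close>

definition polynomial_growth :: "(nat \<Rightarrow> nat) \<Rightarrow> bool" where
  "polynomial_growth g \<longleftrightarrow> (\<exists>a b :: real. 0 < a \<and>
     (\<forall>\<^sub>F n in sequentially. real n powr a \<le> real (g n) \<and> real (g n) \<le> real n powr b))"

end

theory Submission
  imports Defs
begin

text \<open>
  Tractability. A satisfying assignment of weight at most \<open>k\<close> is a hitting set for the
  clauses. Branch on the clause with the fewest variables, after identifying the variables that
  occur in the same clauses that are still to be hit. By Euler's formula such a clause has at most
  \<open>15 + 24 \<gamma>\<close> variables in genus \<open>\<gamma>\<close>, so that the search tree has at most
  \<open>(15 + 24 g(n))\<^sup>k\<close> leaves. If \<open>g(n) \<le> n\<^bsup>1/\<mu>(n)\<^esup>\<close>, this is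
  \<open>2\<^bsup>O(k)\<^esup> n\<close> as soon as \<open>k \<le> \<mu>(n)\<close>; otherwise \<open>n\<close> is bounded by a
  computable function of \<open>k\<close>.

  Completeness. Weighted satisfiability reduces to its monotone case by guessing the gaps between
  consecutive true variables, which turns negative literals into positive ones. Adding polynomially
  many unused variables then raises \<open>n\<close> until \<open>g(n)\<close> exceeds the number of edges.
\<close>

section \<open>Orbits and transpositions\<close>

text \<open>Identifying variables is unavoidable: two clauses over the same large set of variables
  form a planar graph, so the genus alone does not bound the size of clauses. Once neighbourhoods
  are distinct, variables that occur in one or two clauses are as scarce as the others. The genus
  serves only the analysis; the algorithm takes a clause of least degree and never looks for an
  embedding. As \<open>graph_genus\<close> is a \<open>LEAST\<close> over rotation systems,
  everything rests on the deletion of one edge, which lowers twice the genus of an embedding by 0 or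
  2: hence the minimum is attained, is at most the number of darts, and bounds the subgraph of the
  clauses still to be hit. The running times are the second obstacle. They are derived for a small
  language of expressions with bounded sums, whose cost is polynomial by construction; the search is
  breadth-first, so that each level is a flat list. For hardness an arbitrary reduction program is
  run inside another one on reserved memory, and its running time bounds the circuit that it
  writes.\<close>

lemma orbit_eq_of_mem: "permutation f \<Longrightarrow> y \<in> orbit f x \<Longrightarrow> orbit f y = orbit f x"
  using cyclic_on_orbit'[of f x] orbit_cyclic_eq3 by metis

lemma orbit_subset_closed: "x \<in> Z \<Longrightarrow> (\<And>y. y \<in> Z \<Longrightarrow> f y \<in> Z) \<Longrightarrow> orbit f x \<subseteq> Z"
proof
  fix y assume "y \<in> orbit f x" "x \<in> Z" and "\<And>y. y \<in> Z \<Longrightarrow> f y \<in> Z"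
  then show "y \<in> Z" by (induction rule: orbit.induct) auto
qed

lemma permutation_transpose_comp: "permutation f \<Longrightarrow> permutation (transpose a b \<circ> f)"
  by (intro permutation_compose permutation_swap_id)

lemma transpose_comp_twice: "transpose a b \<circ> (transpose a b \<circ> f) = f"
  by (auto simp: fun_eq_iff)

lemma orbit_transpose_subset:
  assumes "permutation f"
  shows "orbit (transpose a b \<circ> f) a \<union> orbit (transpose a b \<circ> f) b \<subseteq> orbit f a \<union> orbit f b"
proof -
  have ab: "a \<in> orbit f a" "b \<in> orbit f b" using assms permutation_self_in_orbit by metis+
  have "(transpose a b \<circ> f) y \<in> orbit f a \<union> orbit f b" if "y \<in> orbit f a \<union> orbit f b" for y
    using that ab by (auto simp: transpose_def intro: orbit.step)
  then show ?thesis using ab by (intro Un_least orbit_subset_closed) auto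
qed

lemma orbit_transpose_union:
  assumes "permutation f"
  shows "orbit (transpose a b \<circ> f) a \<union> orbit (transpose a b \<circ> f) b = orbit f a \<union> orbit f b"
  using orbit_transpose_subset[OF assms, of a b]
    orbit_transpose_subset[OF permutation_transpose_comp[OF assms, of a b], of a b]
  unfolding transpose_comp_twice by blast

lemma orbit_transpose_other:
  assumes "permutation f" "x \<notin> orbit f a" "x \<notin> orbit f b"
  shows "orbit (transpose a b \<circ> f) x = orbit f x"
proof (rule orbit_cong)
  show self: "x \<in> orbit f x" using assms(1) by (rule permutation_self_in_orbit)
  fix s assume s: "s \<in> orbit f x"
  then have "f s \<in> orbit f x" by (rule orbit.step)
  then have "f s \<noteq> a" "f s \<noteq> b" using orbit_eq_of_mem[OF assms(1)] self assms(2,3) by metis+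
  then show "(transpose a b \<circ> f) s = f s" by simp
qed

text \<open>The cycle of \<open>a\<close> under \<open>f\<close> is followed up to its first visit
  to \<open>b\<close>. The transposition sends that step to \<open>a\<close> instead, so the new
  cycle of \<open>a\<close> consists of the points strictly before \<open>b\<close>.\<close>

lemma transpose_orbit_split:
  assumes "permutation f" "a \<noteq> b" "b \<in> orbit f a"
  shows "b \<notin> orbit (transpose a b \<circ> f) a"
proof -
  define n where "n = (LEAST n. 0 < n \<and> (f ^^ n) a = b)"
  have ex: "\<exists>n. 0 < n \<and> (f ^^ n) a = b" using assms(3) by (auto simp: orbit_altdef)
  have n: "0 < n" "(f ^^ n) a = b" using LeastI_ex[OF ex] unfolding n_def by auto
  have least: "n \<le> i" if "0 < i" "(f ^^ i) a = b" for i
    unfolding n_def using that by (intro Least_le) simp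
  have neb: "(f ^^ i) a \<noteq> b" if "i < n" for i
    using least[of i] that assms(2) by (cases "i = 0") auto
  have nea: "(f ^^ i) a \<noteq> a" if "0 < i" "i < n" for i
  proof
    assume "(f ^^ i) a = a"
    then have "(f ^^ (n - i)) a = (f ^^ (n - i)) ((f ^^ i) a)" by simp
    also have "\<dots> = (f ^^ (n - i + i)) a" by (simp add: funpow_add)
    also have "\<dots> = b" using that n by simp
    finally show False using least[of "n - i"] that by simp
  qed
  define g where "g = transpose a b \<circ> f"
  have g_apply: "g x = transpose a b (f x)" for x by (simp add: g_def)
  have gf: "(g ^^ i) a = (f ^^ i) a" if "i < n" for i
    using that
  proof (induction i)
    case (Suc i)
    then have "(g ^^ Suc i) a = g ((f ^^ i) a)" by simp
    then have "(g ^^ Suc i) a = transpose a b ((f ^^ Suc i) a)"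
      using g_apply[of "(f ^^ i) a"] by simp
    then show ?case using neb[of "Suc i"] nea[of "Suc i"] Suc.prems by simp
  qed simp
  obtain m where m: "n = Suc m" using n(1) gr0_implies_Suc by blast
  have "(g ^^ n) a = transpose a b ((f ^^ n) a)" using gf[of m] g_apply[of "(f ^^ m) a"] by (simp add: m)
  then have "(g ^^ n) a = a" using n(2) by simp
  then have "orbit g a = {(g ^^ m) a |m. m < n}" using n(1) by (rule orbit_altdef_bounded)
  then have "b \<notin> orbit g a" using gf neb by force
  then show ?thesis unfolding g_def .
qed

text \<open>One full turn of \<open>f\<close> from \<open>a\<close> avoids \<open>b\<close>; the
  transposition sends its last step to \<open>b\<close> instead of back to \<open>a\<close>.\<close>

lemma transpose_orbit_merge:
  assumes "permutation f" "b \<notin> orbit f a"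
  shows "b \<in> orbit (transpose a b \<circ> f) a"
proof -
  define n where "n = (LEAST n. 0 < n \<and> (f ^^ n) a = a)"
  have ex: "\<exists>n. 0 < n \<and> (f ^^ n) a = a"
    using permutation_self_in_orbit[OF assms(1), of a] by (auto simp: orbit_altdef)
  have n: "0 < n" "(f ^^ n) a = a" using LeastI_ex[OF ex] unfolding n_def by auto
  have nea: "(f ^^ i) a \<noteq> a" if "0 < i" "i < n" for i
    using not_less_Least[of i "\<lambda>n. 0 < n \<and> (f ^^ n) a = a"] that unfolding n_def by auto
  have neb: "(f ^^ i) a \<noteq> b" if "0 < i" for i
    using assms(2) that by (auto simp: orbit_altdef)
  define g where "g = transpose a b \<circ> f"
  have g_apply: "g x = transpose a b (f x)" for x by (simp add: g_def)
  have gf: "(g ^^ i) a = (f ^^ i) a" if "i < n" for i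
    using that
  proof (induction i)
    case (Suc i)
    then have "(g ^^ Suc i) a = g ((f ^^ i) a)" by simp
    then have "(g ^^ Suc i) a = transpose a b ((f ^^ Suc i) a)"
      using g_apply[of "(f ^^ i) a"] by simp
    then show ?case using neb[of "Suc i"] nea[of "Suc i"] Suc.prems by simp
  qed simp
  obtain m where m: "n = Suc m" using n(1) gr0_implies_Suc by blast
  have "(g ^^ n) a = transpose a b ((f ^^ n) a)" using gf[of m] g_apply[of "(f ^^ m) a"] by (simp add: m)
  then have "(g ^^ n) a = b" using n(2) by simp
  then show ?thesis using n(1) unfolding g_def[symmetric] by (auto simp: orbit_altdef)
qed

text \<open>Only the cycle through \<open>a\<close> and \<open>b\<close> changes: by
  \<open>transpose_orbit_split\<close> it falls into two, whose union is the old one.\<close>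

lemma card_orbits_split:
  assumes "finite S" "f permutes S" "a \<in> S" "b \<in> S" "a \<noteq> b" "b \<in> orbit f a"
  shows "card (orbit (transpose a b \<circ> f) ` S) = card (orbit f ` S) + 1"
proof -
  define g where "g = transpose a b \<circ> f"
  have pf: "permutation f" using assms(1,2) permutation_permutes by blast
  have pg: "permutation g" unfolding g_def using pf by (rule permutation_transpose_comp)
  let ?Z = "orbit f a"
  have Zb: "orbit f b = ?Z" using orbit_eq_of_mem[OF pf assms(6)] .
  have un: "orbit g a \<union> orbit g b = ?Z" using orbit_transpose_union[OF pf, of a b] Zb by (simp only: g_def Un_absorb)
  have bg: "b \<notin> orbit g a" unfolding g_def using transpose_orbit_split[OF pf assms(5,6)] .
  have self: "x \<in> orbit f x" "x \<in> orbit g x" for x using pf pg permutation_self_in_orbit by metis+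
  have ZS: "?Z \<subseteq> S" using permutes_orbit_subset[OF assms(2,3)] .
  have other: "orbit g x = orbit f x" if "x \<in> S - ?Z" for x
    unfolding g_def using orbit_transpose_other[OF pf, of x a b] that Zb by blast
  have "orbit f ` S = insert ?Z (orbit f ` (S - ?Z))"
    using orbit_eq_of_mem[OF pf, of _ a] assms(3) by blast
  moreover have notin: "W \<notin> orbit f ` (S - ?Z)" if "W \<subseteq> ?Z" for W using that self by blast
  ultimately have 1: "card (orbit f ` S) = card (orbit f ` (S - ?Z)) + 1"
    using assms(1) by simp
  have gZ: "orbit g ` ?Z = {orbit g a, orbit g b}"
  proof
    show "orbit g ` ?Z \<subseteq> {orbit g a, orbit g b}"
      using un orbit_eq_of_mem[OF pg] by blast
    show "{orbit g a, orbit g b} \<subseteq> orbit g ` ?Z" using self(1)[of a] assms(6) by blast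
  qed
  have "orbit g ` S = orbit g ` ?Z \<union> orbit g ` (S - ?Z)" using ZS by blast
  also have "orbit g ` (S - ?Z) = orbit f ` (S - ?Z)" using other by (rule image_cong[OF refl])
  finally have "orbit g ` S = insert (orbit g a) (insert (orbit g b) (orbit f ` (S - ?Z)))"
    unfolding gZ by simp
  moreover have "orbit g a \<noteq> orbit g b" using bg self(2)[of b] by blast
  moreover have "orbit g a \<notin> orbit f ` (S - ?Z)" "orbit g b \<notin> orbit f ` (S - ?Z)"
    using un by (auto intro!: notin)
  ultimately have "card (orbit g ` S) = card (orbit f ` (S - ?Z)) + 2" using assms(1) by simp
  then show ?thesis using 1 by (simp only: g_def)
qed

text \<open>Composing with the same transposition twice changes nothing, so a merge is a split read
  backwards.\<close>

lemma card_orbits_merge: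
  assumes "finite S" "f permutes S" "a \<in> S" "b \<in> S" "b \<notin> orbit f a"
  shows "card (orbit f ` S) = card (orbit (transpose a b \<circ> f) ` S) + 1"
proof -
  have pf: "permutation f" using assms(1,2) permutation_permutes by blast
  have "a \<noteq> b" using assms(5) permutation_self_in_orbit[OF pf] by blast
  moreover have "(transpose a b \<circ> f) permutes S"
    using assms(2-4) by (intro permutes_compose permutes_swap_id)
  ultimately show ?thesis
    using card_orbits_split[OF assms(1) _ assms(3,4), of "transpose a b \<circ> f"]
      transpose_orbit_merge[OF pf assms(5)]
    unfolding transpose_comp_twice by blast
qed

section \<open>Rotation systems\<close>

lemma cyclic_on_fixed: "cyclic_on f S \<Longrightarrow> x \<in> S \<Longrightarrow> f x = x \<Longrightarrow> S = {x}"
  using orbit_cyclic_eq3 orbit_eq_singleton_iff by metis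

text \<open>The point mapped to \<open>e\<close> is now mapped to \<open>f e\<close>, and
  \<open>e\<close> becomes a fixed point: \<open>e\<close> is cut out of its cycle. The same
  transposition, composed with the face permutation, describes the effect on the faces.\<close>

definition del :: "'a \<Rightarrow> ('a \<Rightarrow> 'a) \<Rightarrow> 'a \<Rightarrow> 'a" where
  "del e f = transpose e (f e) \<circ> f"

lemma del_self [simp]: "del e f e = e"
  by (simp add: del_def)

text \<open>After the cut the orbit of \<open>e\<close> is \<open>{e}\<close>. Together with the
  orbit of \<open>f e\<close> it is still the old cycle, so the latter orbit is all the
  rest.\<close>

lemma cyclic_on_del:
  assumes "permutation f" "cyclic_on f S" "e \<in> S" "S \<noteq> {e}"
  shows "cyclic_on (del e f) (S - {e})"
proof -
  have pg: "permutation (del e f)"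
    unfolding del_def using assms(1) by (rule permutation_transpose_comp)
  have fe: "f e \<noteq> e" using cyclic_on_fixed[OF assms(2,3)] assms(4) by blast
  have S: "orbit f e = S" "orbit f (f e) = S"
    using assms(2,3) orbit_cyclic_eq3 cyclic_on_inI by metis+
  have o: "orbit (del e f) e = {e}" by (simp add: orbit_eq_singleton_iff)
  have "{e} \<union> orbit (del e f) (f e) = S"
    using orbit_transpose_union[OF assms(1), of e "f e"] S o by (simp add: del_def)
  moreover have "e \<notin> orbit (del e f) (f e)"
    using orbit_eq_of_mem[OF pg, of e "f e"] o permutation_self_in_orbit[OF pg, of "f e"] fe by auto
  ultimately have "orbit (del e f) (f e) = S - {e}" by blast
  then show ?thesis
    using permutation_self_in_orbit[OF pg, of "f e"] by (metis cyclic_on_singleI)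
qed

lemma rotation_system_permutation: "rotation_system D \<pi> \<Longrightarrow> finite D \<Longrightarrow> permutation \<pi>"
  unfolding rotation_system_def permutation_permutes by blast

lemma rotation_system_D:
  assumes "rotation_system D \<pi>" "d \<in> D"
  shows "\<pi> d \<in> D" "fst (\<pi> d) = fst d" "cyclic_on \<pi> {d' \<in> D. fst d' = fst d}"
proof -
  show c: "cyclic_on \<pi> {d' \<in> D. fst d' = fst d}" using assms by (auto simp: rotation_system_def)
  have "\<pi> d \<in> {d' \<in> D. fst d' = fst d}" by (rule cyclic_on_inI[OF c]) (use assms in simp)
  then show "\<pi> d \<in> D" "fst (\<pi> d) = fst d" by auto
qed

lemma rotation_system_fixed:
  assumes "rotation_system D \<pi>" "d \<in> D" "\<pi> d = d" "d' \<in> D" "fst d' = fst d"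
  shows "d' = d"
  using cyclic_on_fixed[OF rotation_system_D(3)[OF assms(1,2)] _ assms(3)] assms by blast

lemma rotation_system_not_fixed:
  assumes "rotation_system D \<pi>" "d \<in> D" "\<pi> d \<noteq> d"
  shows "\<exists>d' \<in> D. d' \<noteq> d \<and> fst d' = fst d"
  using rotation_system_D(1,2)[OF assms(1,2)] assms(3) by blast

text \<open>At the tail of \<open>e\<close> this is \<open>cyclic_on_del\<close>; at the other
  vertices the transposition moves no image.\<close>

lemma rotation_system_del:
  assumes "rotation_system D \<pi>" "finite D" "e \<in> D"
  shows "rotation_system (D - {e}) (del e \<pi>)"
proof -
  have p: "\<pi> permutes D" using assms(1) by (simp add: rotation_system_def)
  have "\<pi> e \<in> D" using assms(3) p by (simp add: permutes_in_image)
  then have "del e \<pi> permutes D" unfolding del_def using assms(3) p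
    by (intro permutes_compose permutes_swap_id)
  then have "del e \<pi> permutes D - {e}"
    by (rule permutes_superset) (auto intro: del_self)
  moreover have "cyclic_on (del e \<pi>) {d \<in> D - {e}. fst d = v}" if v: "v \<in> fst ` (D - {e})" for v
  proof (cases "fst e = v")
    case True
    have "{d \<in> D - {e}. fst d = v} = {d \<in> D. fst d = v} - {e}" by blast
    moreover have "cyclic_on (del e \<pi>) ({d \<in> D. fst d = v} - {e})"
    proof (rule cyclic_on_del[OF rotation_system_permutation[OF assms(1,2)]])
      show "cyclic_on \<pi> {d \<in> D. fst d = v}" using rotation_system_D(3)[OF assms(1,3)] True by simp
      show "e \<in> {d \<in> D. fst d = v}" using True assms(3) by simp
      obtain d where "d \<in> D - {e}" "fst d = v" using v by blast
      then show "{d \<in> D. fst d = v} \<noteq> {e}" by blast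
    qed
    ultimately show ?thesis by simp
  next
    case False
    have "{d \<in> D - {e}. fst d = v} = {d \<in> D. fst d = v}" using False by blast
    moreover have "cyclic_on \<pi> {d \<in> D. fst d = v}" using assms(1) v by (auto simp: rotation_system_def)
    moreover have "cyclic_on (del e \<pi>) {d \<in> D. fst d = v} = cyclic_on \<pi> {d \<in> D. fst d = v}"
    proof (rule cyclic_cong)
      fix d assume "d \<in> {d \<in> D. fst d = v}"
      then have "fst (\<pi> d) = v" using rotation_system_D(2)[OF assms(1)] by auto
      moreover have "fst (\<pi> e) = fst e" using rotation_system_D(2)[OF assms(1,3)] .
      ultimately have "\<pi> d \<noteq> e" "\<pi> d \<noteq> \<pi> e" using False by auto
      then show "del e \<pi> d = \<pi> d" by (simp add: del_def)
    qed
    ultimately show ?thesis by simp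
  qed
  ultimately show ?thesis by (simp add: rotation_system_def)
qed

text \<open>At a tail without darts the fixed point \<open>e\<close> is a cycle of its own.
  Otherwise the transposition merges that fixed point with the cycle of the darts at the same
  tail.\<close>

lemma rotation_system_insert:
  assumes "rotation_system D \<pi>" "finite D" "e \<notin> D"
  shows "\<exists>\<pi>'. rotation_system (insert e D) \<pi>'"
proof -
  have p: "\<pi> permutes D" using assms(1) by (simp add: rotation_system_def)
  have pi: "permutation \<pi>" using rotation_system_permutation[OF assms(1,2)] .
  have e: "\<pi> e = e" using permutes_not_in[OF p assms(3)] .
  have p': "\<pi> permutes insert e D" using p by (rule permutes_subset) blast
  show ?thesis
  proof (cases "fst e \<in> fst ` D")
    case False
    have "cyclic_on \<pi> {d \<in> insert e D. fst d = v}" if v: "v \<in> fst ` insert e D" for v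
    proof (cases "v = fst e")
      case True
      then have "{d \<in> insert e D. fst d = v} = {e}" using False by (auto simp: image_iff)
      moreover have "cyclic_on \<pi> {e}"
        using orbit_eq_singleton_iff[of \<pi> e] e by (auto simp: cyclic_on_def)
      ultimately show ?thesis by simp
    next
      case v': False
      then have "{d \<in> insert e D. fst d = v} = {d \<in> D. fst d = v}" by auto
      moreover have "v \<in> fst ` D" using v v' by auto
      ultimately show ?thesis using assms(1) by (auto simp: rotation_system_def)
    qed
    then show ?thesis using p' by (auto simp: rotation_system_def)
  next
    case True
    then obtain d where d: "d \<in> D" "fst d = fst e" by force
    let ?\<pi> = "transpose e (\<pi> d) \<circ> \<pi>"
    have pd: "\<pi> d \<in> D" "fst (\<pi> d) = fst e" using rotation_system_D[OF assms(1) d(1)] d(2) by auto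
    have perm: "?\<pi> permutes insert e D"
      using p' pd by (intro permutes_compose permutes_swap_id) auto
    have "cyclic_on ?\<pi> {d \<in> insert e D. fst d = v}" if v: "v \<in> fst ` insert e D" for v
    proof (cases "v = fst e")
      case v': True
      let ?S = "{d \<in> D. fst d = v}"
      have S: "orbit \<pi> (\<pi> d) = ?S"
        by (rule orbit_cyclic_eq3) (use rotation_system_D(3)[OF assms(1) d(1)] pd d(2) v' in auto)
      have oe: "orbit \<pi> e = {e}" using e by (simp add: orbit_eq_singleton_iff)
      have ne: "\<pi> d \<notin> orbit \<pi> e" using oe pd assms(3) by auto
      have "\<pi> d \<in> orbit ?\<pi> e" using transpose_orbit_merge[OF pi ne] .
      then have "orbit ?\<pi> (\<pi> d) = orbit ?\<pi> e"
        using orbit_eq_of_mem[OF permutation_transpose_comp[OF pi]] by metis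
      then have "orbit ?\<pi> e = {e} \<union> ?S"
        using orbit_transpose_union[OF pi, of e "\<pi> d"] S oe by simp
      moreover have "{d \<in> insert e D. fst d = v} = {e} \<union> ?S" using v' by auto
      ultimately show ?thesis by (auto simp: cyclic_on_def)
    next
      case v': False
      then have "{d \<in> insert e D. fst d = v} = {d \<in> D. fst d = v}" by auto
      moreover have "v \<in> fst ` D" using v v' by auto
      then have "cyclic_on \<pi> {d \<in> D. fst d = v}" using assms(1) by (auto simp: rotation_system_def)
      moreover have "cyclic_on ?\<pi> {d \<in> D. fst d = v} = cyclic_on \<pi> {d \<in> D. fst d = v}"
      proof (rule cyclic_cong)
        fix d' assume "d' \<in> {d \<in> D. fst d = v}"
        then have "fst (\<pi> d') = v" using rotation_system_D(2)[OF assms(1)] by auto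
        then have "\<pi> d' \<noteq> e" "\<pi> d' \<noteq> \<pi> d" using v' pd by auto
        then show "?\<pi> d' = \<pi> d'" by simp
      qed
      ultimately show ?thesis by simp
    qed
    then show ?thesis using perm by (auto simp: rotation_system_def)
  qed
qed

text \<open>Without a rotation system the \<open>LEAST\<close> in \<open>graph_genus\<close> would
  range over nothing.\<close>

lemma ex_rotation_system: "finite D \<Longrightarrow> \<exists>\<pi>. rotation_system D \<pi>"
proof (induction D rule: finite_induct)
  case empty
  then show ?case by (intro exI[of _ id]) (auto simp: rotation_system_def permutes_id)
next
  case (insert e D)
  then show ?case using rotation_system_insert by blast
qed

text \<open>\<open>prod.swap\<close> moves pairs outside of \<open>D\<close>. This variant fixes
  them, so that the face map becomes a permutation of \<open>D\<close> and the counting lemmas for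
  orbits apply.\<close>

definition flip :: "('a \<times> 'a) set \<Rightarrow> 'a \<times> 'a \<Rightarrow> 'a \<times> 'a" where
  "flip D d = (if d \<in> D then prod.swap d else d)"

lemma sym_swap: "sym D \<Longrightarrow> d \<in> D \<Longrightarrow> prod.swap d \<in> D"
  by (cases d) (auto dest: symD)

lemma flip_permutes: "sym D \<Longrightarrow> flip D permutes D"
  by (rule bij_imp_permutes[OF bij_betw_byWitness[of _ "flip D"]]) (auto simp: flip_def dest: symD)

lemma face_permutes: "rotation_system D \<pi> \<Longrightarrow> sym D \<Longrightarrow> (\<pi> \<circ> flip D) permutes D"
  using flip_permutes unfolding rotation_system_def by (metis permutes_compose)

lemma orbit_face:
  assumes "rotation_system D \<pi>" "sym D" "d \<in> D"
  shows "orbit (\<pi> \<circ> prod.swap) d = orbit (\<pi> \<circ> flip D) d"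
proof (rule orbit_cong0[OF assms(3)])
  show "\<pi> \<circ> prod.swap \<in> D \<rightarrow> D"
    using rotation_system_D(1)[OF assms(1)] sym_swap[OF assms(2)] by auto
qed (simp add: flip_def)

lemma num_faces_eq:
  "rotation_system D \<pi> \<Longrightarrow> sym D \<Longrightarrow>
    num_faces V D \<pi> = card (orbit (\<pi> \<circ> flip D) ` D) + card (V - fst ` D)"
  unfolding num_faces_def using orbit_face by (metis (mono_tags, lifting) image_cong)

lemma fst_face: "rotation_system D \<pi> \<Longrightarrow> sym D \<Longrightarrow> d \<in> D \<Longrightarrow> fst ((\<pi> \<circ> flip D) d) = snd d"
  using rotation_system_D(2)[of D \<pi> "prod.swap d"] sym_swap by (fastforce simp: flip_def)

text \<open>
  Each of the two darts is removed by composing the face permutation with a transposition. The first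
  one splits a face or merges two; afterwards both darts lie on one face, which the second one
  splits.
\<close>

lemma num_faces_delete:
  assumes rot: "rotation_system D \<pi>" and fin: "finite D" "finite V" and "sym D" "irrefl D"
    and DV: "D \<subseteq> V \<times> V" and e: "e \<in> D"
  defines "e' \<equiv> prod.swap e"
  defines "\<pi>' \<equiv> del e' (del e \<pi>)"
  shows "rotation_system (D - {e, e'}) \<pi>'"
    and "e' \<in> orbit (\<pi> \<circ> flip D) e \<Longrightarrow> num_faces V (D - {e, e'}) \<pi>' = num_faces V D \<pi> + 1"
    and "e' \<notin> orbit (\<pi> \<circ> flip D) e \<Longrightarrow> num_faces V (D - {e, e'}) \<pi>' + 1 = num_faces V D \<pi>"
proof -
  have e': "e' \<in> D" unfolding e'_def using sym_swap[OF \<open>sym D\<close> e] .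
  have fne: "fst e \<noteq> fst e'" using e \<open>irrefl D\<close> by (cases e) (auto simp: e'_def irrefl_def)
  then have ne: "e \<noteq> e'" by auto
  have sw: "prod.swap e' = e" by (simp add: e'_def)
  let ?\<pi>1 = "del e \<pi>" and ?D = "D - {e, e'}"
  have rot1: "rotation_system (D - {e}) ?\<pi>1" using rotation_system_del[OF rot fin(1) e] .
  have "rotation_system (D - {e} - {e'}) \<pi>'"
    unfolding \<pi>'_def by (rule rotation_system_del[OF rot1]) (use fin e' ne in auto)
  moreover have "D - {e} - {e'} = ?D" by blast
  ultimately show rot': "rotation_system ?D \<pi>'" by simp
  have symD: "sym ?D" using \<open>sym D\<close> unfolding sym_def e'_def by (cases e) auto
  let ?\<phi> = "\<pi> \<circ> flip D" and ?\<phi>1 = "?\<pi>1 \<circ> flip D" and ?\<phi>2 = "\<pi>' \<circ> flip D"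
  have pe: "\<pi> e \<in> D" "fst (\<pi> e) = fst e" "\<pi> e' \<in> D" "fst (\<pi> e') = fst e'"
    using rotation_system_D[OF rot] e e' by auto
  have 1: "?\<pi>1 e' = \<pi> e'"
  proof -
    have "\<pi> e' \<noteq> e" "\<pi> e' \<noteq> \<pi> e" using pe fne by auto
    then show ?thesis by (simp add: del_def)
  qed
  have eq1: "?\<phi>1 = transpose e (\<pi> e) \<circ> ?\<phi>" by (simp add: del_def comp_assoc)
  have eq2: "?\<phi>2 = transpose e' (\<pi> e') \<circ> ?\<phi>1"
    using 1 by (simp add: \<pi>'_def del_def[of e'] comp_assoc)
  have perm: "?\<phi> permutes D" using face_permutes[OF rot \<open>sym D\<close>] .
  have perm1: "?\<phi>1 permutes D" unfolding eq1 using e pe by (intro permutes_compose[OF perm] permutes_swap_id)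
  have perm2: "?\<phi>2 permutes D" unfolding eq2 using e' pe by (intro permutes_compose[OF perm1] permutes_swap_id)
  have P: "permutation ?\<phi>" "permutation ?\<phi>1" "permutation ?\<phi>2"
    using perm perm1 perm2 fin(1) permutation_permutes by blast+
  have f0: "?\<phi> e' = \<pi> e" "?\<phi> e = \<pi> e'" using e e' sw by (auto simp: flip_def e'_def)
  have f1: "?\<phi>1 e' = e" "?\<phi>1 e = \<pi> e'"
    using e e' sw 1 by (auto simp: flip_def e'_def)
  have "\<pi> e' \<noteq> e" using pe fne by auto
  then have pi'e: "\<pi>' e' = e'" "\<pi>' e = e"
    using ne 1 by (auto simp: \<pi>'_def del_def[of e'])
  have f2: "?\<phi>2 e' = e" "?\<phi>2 e = e'" using e e' sw pi'e by (auto simp: flip_def e'_def)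
  \<comment> \<open>The face map takes \<open>e'\<close> to \<open>\<pi> e\<close>, so these two lie
    on one face.\<close>
  have orb: "\<pi> e \<in> orbit ?\<phi> e \<longleftrightarrow> e' \<in> orbit ?\<phi> e"
    using permutation_orbit_step[OF P(1), of e'] f0(1) orbit_eq_of_mem[OF P(1)]
      permutation_self_in_orbit[OF P(1)] by metis
  have same1: "card (orbit ?\<phi>1 ` D) = card (orbit ?\<phi> ` D) + (if \<pi> e = e then 0 else 1)"
    if "e' \<in> orbit ?\<phi> e"
  proof (cases "\<pi> e = e")
    case True
    then show ?thesis using eq1 by simp
  next
    case False
    then show ?thesis
      using card_orbits_split[OF fin(1) perm e pe(1)] that orb unfolding eq1 by auto
  qed
  have diff1: "card (orbit ?\<phi> ` D) = card (orbit ?\<phi>1 ` D) + 1" if "e' \<notin> orbit ?\<phi> e"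
    using card_orbits_merge[OF fin(1) perm e pe(1)] that orb unfolding eq1 by auto
  have "\<pi> e' \<in> orbit ?\<phi>1 e'" using f1 orbit.intros by metis
  then have second: "card (orbit ?\<phi>2 ` D) = card (orbit ?\<phi>1 ` D) + (if \<pi> e' = e' then 0 else 1)"
    using card_orbits_split[OF fin(1) perm1 e' pe(3)] unfolding eq2 by (cases "\<pi> e' = e'") auto
  \<comment> \<open>After both cuts the deleted darts form a cycle of their own. It is not a face of
    the smaller graph, so the number of orbits has to be lowered by one.\<close>
  have o2: "orbit ?\<phi>2 e = {e, e'}"
  proof
    show "orbit ?\<phi>2 e \<subseteq> {e, e'}" by (rule orbit_subset_closed) (use f2 in auto)
    show "{e, e'} \<subseteq> orbit ?\<phi>2 e" using f2 orbit.intros by (metis insert_subset empty_subsetI)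
  qed
  have o2': "orbit ?\<phi>2 e' = {e, e'}" using orbit_eq_of_mem[OF P(3), of e' e] o2 by auto
  have orb': "orbit (\<pi>' \<circ> flip ?D) d = orbit ?\<phi>2 d" if "d \<in> ?D" for d
  proof (rule orbit_cong0[OF that])
    show "\<pi>' \<circ> flip ?D \<in> ?D \<rightarrow> ?D"
      using permutes_in_image[OF face_permutes[OF rot' symD]] by blast
  qed (auto simp: flip_def)
  have sub': "orbit ?\<phi>2 d \<subseteq> ?D" if "d \<in> ?D" for d
    using permutes_orbit_subset[OF face_permutes[OF rot' symD] that] orb'[OF that] by simp
  have "D = insert e (insert e' ?D)" using e e' by blast
  then have "orbit ?\<phi>2 ` D = insert (orbit ?\<phi>2 e) (insert (orbit ?\<phi>2 e') (orbit ?\<phi>2 ` ?D))"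
    by (metis image_insert)
  then have "orbit ?\<phi>2 ` D = insert {e, e'} (orbit ?\<phi>2 ` ?D)" using o2 o2' by simp
  moreover have "{e, e'} \<notin> orbit ?\<phi>2 ` ?D" using sub' by blast
  ultimately have "card (orbit ?\<phi>2 ` D) = card (orbit ?\<phi>2 ` ?D) + 1" using fin(1) by simp
  moreover have "orbit ?\<phi>2 ` ?D = orbit (\<pi>' \<circ> flip ?D) ` ?D" using orb' by (metis (no_types, lifting) image_cong)
  ultimately have del2: "card (orbit ?\<phi>2 ` D) = card (orbit (\<pi>' \<circ> flip ?D) ` ?D) + 1" by simp
  \<comment> \<open>If \<open>e\<close> is fixed by the rotation, the first transposition is trivial
    and splits nothing. But then \<open>e\<close> was the only dart at its tail, which becomes
    isolated and counts as a face, so the balance is the same.\<close>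
  have iso_e: "fst e \<in> fst ` ?D \<longleftrightarrow> \<pi> e \<noteq> e"
  proof
    assume "fst e \<in> fst ` ?D"
    then obtain d where "d \<in> D" "d \<noteq> e" "fst d = fst e" by force
    then show "\<pi> e \<noteq> e" using rotation_system_fixed[OF rot e] by blast
  next
    assume "\<pi> e \<noteq> e"
    then obtain d where "d \<in> D" "d \<noteq> e" "fst d = fst e" using rotation_system_not_fixed[OF rot e] by blast
    then show "fst e \<in> fst ` ?D" using fne by (intro rev_image_eqI[of d]) auto
  qed
  have iso_e': "fst e' \<in> fst ` ?D \<longleftrightarrow> \<pi> e' \<noteq> e'"
  proof
    assume "fst e' \<in> fst ` ?D"
    then obtain d where "d \<in> D" "d \<noteq> e'" "fst d = fst e'" by force
    then show "\<pi> e' \<noteq> e'" using rotation_system_fixed[OF rot e'] by blast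
  next
    assume "\<pi> e' \<noteq> e'"
    then obtain d where "d \<in> D" "d \<noteq> e'" "fst d = fst e'" using rotation_system_not_fixed[OF rot e'] by blast
    then show "fst e' \<in> fst ` ?D" using fne by (intro rev_image_eqI[of d]) auto
  qed
  have inV: "fst e \<in> V" "fst e' \<in> V" using DV e e' by auto
  have "V - fst ` ?D = (V - fst ` D) \<union> ((if \<pi> e = e then {fst e} else {}) \<union>
      (if \<pi> e' = e' then {fst e'} else {}))" (is "_ = _ \<union> ?I")
  proof -
    have "fst ` D = insert (fst e) (insert (fst e') (fst ` ?D))"
      using \<open>D = insert e (insert e' ?D)\<close> by (metis image_insert)
    then show ?thesis using iso_e iso_e' inV by auto
  qed
  moreover have "(V - fst ` D) \<inter> ?I = {}" using e e' by auto
  moreover have "finite ?I" by simp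
  moreover have "card ?I = (if \<pi> e = e then 1 else 0) + (if \<pi> e' = e' then 1 else 0)"
    using fne by simp
  ultimately have iso: "card (V - fst ` ?D) = card (V - fst ` D) +
      ((if \<pi> e = e then 1 else 0) + (if \<pi> e' = e' then 1 else 0))"
    using fin(2) by (metis card_Un_disjoint finite_Diff)
  note nf = num_faces_eq[OF rot \<open>sym D\<close>, of V] num_faces_eq[OF rot' symD, of V]
  show "num_faces V ?D \<pi>' = num_faces V D \<pi> + 1" if "e' \<in> orbit ?\<phi> e"
    using same1[OF that] second del2 iso nf by (auto split: if_splits)
  show "num_faces V ?D \<pi>' + 1 = num_faces V D \<pi>" if "e' \<notin> orbit ?\<phi> e"
  proof -
    have "\<pi> e \<noteq> e" using that orb permutation_self_in_orbit[OF P(1), of e] by metis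
    moreover have "\<pi> e' \<noteq> e'" using that f0(2) orbit.base by metis
    ultimately show ?thesis using diff1[OF that] second del2 iso nf by auto
  qed
qed

section \<open>Components\<close>

lemma rtrancl_class_eq:
  assumes "sym D" "(u, v) \<in> D\<^sup>*"
  shows "D\<^sup>* `` {u} = D\<^sup>* `` {v}"
  using assms sym_rtrancl[OF assms(1)] by (auto dest: symD intro: rtrancl_trans)

lemma num_components_delete:
  assumes "sym D" "(u, v) \<in> D" "finite V" "u \<in> V" "v \<in> V"
  defines "D' \<equiv> D - {(u, v), (v, u)}"
  shows "num_components V D \<le> num_components V D'"
    and "num_components V D' \<le> num_components V D + 1"
    and "(v, u) \<in> D'\<^sup>* \<Longrightarrow> num_components V D' = num_components V D"
proof -
  have sym': "sym D'" using assms(1) unfolding sym_def D'_def by auto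
  have sub: "D'\<^sup>* \<subseteq> D\<^sup>*" unfolding D'_def by (intro rtrancl_mono) auto
  let ?c = "\<lambda>x. D\<^sup>* `` {x}" and ?c' = "\<lambda>x. D'\<^sup>* `` {x}"
  have "?c ` V = (\<lambda>W. D\<^sup>* `` W) ` (?c' ` V)"
  proof -
    have "?c x = D\<^sup>* `` ?c' x" for x using sub by (auto intro: rtrancl_trans)
    then show ?thesis by (auto simp: image_image)
  qed
  then show "num_components V D \<le> num_components V D'"
    unfolding num_components_def using assms(3) card_image_le by (metis finite_imageI)
  have uv: "?c u = ?c v" using rtrancl_class_eq[OF assms(1)] assms(2) by blast
  \<comment> \<open>A path that leaves the smaller graph does so first at an end of the deleted
    edge.\<close>
  have path: "(x, y) \<in> D'\<^sup>* \<or> (x, u) \<in> D'\<^sup>* \<or> (x, v) \<in> D'\<^sup>*" if "(x, y) \<in> D\<^sup>*" for x y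
    using that
  proof induction
    case (step y z)
    then show ?case unfolding D'_def by (metis (no_types, lifting) DiffI Pair_inject insert_iff
      rtrancl.rtrancl_into_rtrancl singletonD)
  qed simp
  have far: "?c' x = ?c x" if "x \<notin> ?c u" for x
  proof
    show "?c' x \<subseteq> ?c x" using sub by blast
    show "?c x \<subseteq> ?c' x"
    proof
      fix y assume "y \<in> ?c x"
      then have "(x, y) \<in> D'\<^sup>* \<or> (x, u) \<in> D'\<^sup>* \<or> (x, v) \<in> D'\<^sup>*" using path by simp
      moreover have "(x, u) \<notin> D\<^sup>*" "(x, v) \<notin> D\<^sup>*"
        using that uv sym_rtrancl[OF assms(1)] by (auto dest: symD)
      ultimately show "y \<in> ?c' x" using sub by blast
    qed
  qed
  have near: "?c' x = ?c' u \<or> ?c' x = ?c' v" if "x \<in> ?c u" for x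
  proof -
    have "(x, u) \<in> D\<^sup>*" using that sym_rtrancl[OF assms(1)] by (auto dest: symD)
    then have "(x, u) \<in> D'\<^sup>* \<or> (x, v) \<in> D'\<^sup>*" using path by blast
    then show ?thesis using rtrancl_class_eq[OF sym'] by metis
  qed
  \<comment> \<open>Only the class of \<open>u\<close> can break, and only into the classes of the
    two ends.\<close>
  have sub2: "?c' ` V \<subseteq> insert (?c' u) (insert (?c' v) (?c ` V - {?c u}))"
  proof
    fix W assume "W \<in> ?c' ` V"
    then obtain x where x: "x \<in> V" "W = ?c' x" by blast
    show "W \<in> insert (?c' u) (insert (?c' v) (?c ` V - {?c u}))"
    proof (cases "x \<in> ?c u")
      case True
      then show ?thesis using near x by blast
    next
      case False
      then have "?c x \<noteq> ?c u" by blast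
      then show ?thesis using far[OF False] x by blast
    qed
  qed
  have cu: "?c u \<in> ?c ` V" using assms(4) by blast
  have fin: "finite (?c ` V)" using assms(3) by blast
  have c1: "card (?c ` V - {?c u}) + 1 = card (?c ` V)" using cu fin card_Diff_singleton
    by (metis Suc_eq_plus1 card.remove)
  have "card (?c' ` V) \<le> card (insert (?c' u) (insert (?c' v) (?c ` V - {?c u})))"
    using sub2 fin by (intro card_mono) auto
  also have "\<dots> \<le> card (?c ` V - {?c u}) + 2"
    using fin by (simp add: card_insert_if)
  finally show "num_components V D' \<le> num_components V D + 1"
    using c1 by (simp add: num_components_def)
  show "num_components V D' = num_components V D" if "(v, u) \<in> D'\<^sup>*"
  proof -
    have uv': "(u, v) \<in> D'\<^sup>*" using that sym_rtrancl[OF sym'] by (auto dest: symD)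
    have "D\<^sup>* \<subseteq> D'\<^sup>*"
    proof -
      have "D \<subseteq> D'\<^sup>*" using that uv' unfolding D'_def by auto
      then show ?thesis by (metis rtrancl_idemp rtrancl_mono)
    qed
    then show ?thesis using sub unfolding num_components_def by (metis subset_antisym)
  qed
qed

text \<open>The face of \<open>(u, v)\<close> is walked around once. After the first dart the walk
  is at \<open>v\<close>, it ends at \<open>u\<close>, and as the opposite dart lies on another face
  it never uses the edge. So an edge between two faces is no bridge.\<close>

lemma face_walk:
  assumes rot: "rotation_system D \<pi>" and "finite D" "sym D" "irrefl D" and e: "(u, v) \<in> D"
    and nin: "(v, u) \<notin> orbit (\<pi> \<circ> flip D) (u, v)"
  shows "(v, u) \<in> (D - {(u, v), (v, u)})\<^sup>*"
proof -
  let ?\<phi> = "\<pi> \<circ> flip D" and ?D = "D - {(u, v), (v, u)}"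
  have perm: "?\<phi> permutes D" using face_permutes[OF rot \<open>sym D\<close>] .
  then have P: "permutation ?\<phi>" using \<open>finite D\<close> permutation_permutes by blast
  define n where "n = (LEAST n. 0 < n \<and> (?\<phi> ^^ n) (u, v) = (u, v))"
  have ex: "\<exists>n. 0 < n \<and> (?\<phi> ^^ n) (u, v) = (u, v)"
    using permutation_self_in_orbit[OF P, of "(u, v)"] by (auto simp: orbit_altdef)
  have n: "0 < n" "(?\<phi> ^^ n) (u, v) = (u, v)" using LeastI_ex[OF ex] unfolding n_def by auto
  have ne: "(?\<phi> ^^ i) (u, v) \<noteq> (u, v)" if "0 < i" "i < n" for i
    using not_less_Least[of i "\<lambda>n. 0 < n \<and> (?\<phi> ^^ n) (u, v) = (u, v)"] that unfolding n_def by auto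
  have ne': "(?\<phi> ^^ i) (u, v) \<noteq> (v, u)" if "0 < i" for i
  proof
    assume "(?\<phi> ^^ i) (u, v) = (v, u)"
    then have "(v, u) \<in> {(?\<phi> ^^ n) (u, v) |n. 0 < n}" using that by (metis (mono_tags, lifting) mem_Collect_eq)
    then show False using nin unfolding orbit_altdef by blast
  qed
  have inD: "(?\<phi> ^^ i) (u, v) \<in> D" for i
    by (induction i) (use e permutes_in_image[OF perm] in auto)
  have "(v, fst ((?\<phi> ^^ Suc i) (u, v))) \<in> ?D\<^sup>*" if "i < n" for i
    using that
  proof (induction i)
    case 0
    then show ?case using fst_face[OF rot \<open>sym D\<close> e] by simp
  next
    case (Suc i)
    let ?d = "(?\<phi> ^^ Suc i) (u, v)"
    have "?d \<in> ?D" using inD[of "Suc i"] ne[of "Suc i"] ne'[of "Suc i"] Suc.prems by blast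
    then have "(fst ?d, snd ?d) \<in> ?D" by simp
    moreover have "fst ((?\<phi> ^^ Suc (Suc i)) (u, v)) = snd ?d"
      using fst_face[OF rot \<open>sym D\<close> inD[of "Suc i"]] by simp
    ultimately show ?case using Suc.IH Suc.prems by (metis Suc_lessD rtrancl.rtrancl_into_rtrancl)
  qed
  from this[of "n - 1"] n show ?thesis by simp
qed

section \<open>Genus\<close>

text \<open>Twice the genus of the embedding given by the rotation, according to Euler's formula. As
  an integer it makes sense before its sign and parity are known.\<close>

definition excess :: "'a set \<Rightarrow> ('a \<times> 'a) set \<Rightarrow> ('a \<times> 'a \<Rightarrow> 'a \<times> 'a) \<Rightarrow> int" where
  "excess V D \<pi> = 2 * int (num_components V D) - int (card V) + int (card D div 2) -
     int (num_faces V D \<pi>)"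

text \<open>If both darts lie on one face, the deletion gains a face: the change is 2, or 0 if a
  component splits as well. If they lie on different faces, a face is lost together with the edge,
  and by \<open>face_walk\<close> no component splits, so nothing changes.\<close>

lemma excess_delete:
  assumes rot: "rotation_system D \<pi>" and fin: "finite V" and "sym D" "irrefl D"
    and DV: "D \<subseteq> V \<times> V" and e: "(u, v) \<in> D"
  shows "\<exists>\<pi>'. rotation_system (D - {(u, v), (v, u)}) \<pi>' \<and>
    (excess V D \<pi> = excess V (D - {(u, v), (v, u)}) \<pi>' \<or>
     excess V D \<pi> = excess V (D - {(u, v), (v, u)}) \<pi>' + 2)"
proof -
  let ?D = "D - {(u, v), (v, u)}"
  have finD: "finite D" using DV fin finite_subset by blast
  have uv: "u \<in> V" "v \<in> V" "(v, u) \<in> D" "u \<noteq> v"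
    using e DV \<open>sym D\<close> \<open>irrefl D\<close> by (auto dest: symD simp: irrefl_def)
  have "D = insert (u, v) (insert (v, u) ?D)" using e uv by blast
  moreover have "card (insert (u, v) (insert (v, u) ?D)) = card ?D + 2" using finD uv by simp
  ultimately have "card D = card ?D + 2" by simp
  then have cd: "card D div 2 = card ?D div 2 + 1" by simp
  let ?\<pi> = "del (v, u) (del (u, v) \<pi>)"
  note nf = num_faces_delete[OF rot finD fin \<open>sym D\<close> \<open>irrefl D\<close> DV e, simplified]
  note nc = num_components_delete[OF \<open>sym D\<close> e fin uv(1,2)]
  show ?thesis
  proof (cases "(v, u) \<in> orbit (\<pi> \<circ> flip D) (u, v)")
    case True
    then show ?thesis using nf(1) nf(2)[OF True] nc(1,2) cd
      unfolding excess_def by (intro exI[of _ ?\<pi>]) auto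
  next
    case False
    have "num_components V ?D = num_components V D"
      using nc(3) face_walk[OF rot finD \<open>sym D\<close> \<open>irrefl D\<close> e False] by blast
    then show ?thesis using nf(1) nf(3)[OF False] cd
      unfolding excess_def by (intro exI[of _ ?\<pi>]) auto
  qed
qed

lemma excess_empty: "excess V {} \<pi> = 0"
proof -
  have "(\<lambda>v. {}\<^sup>* `` {v}) ` V = (\<lambda>v. {v}) ` V" by auto
  then have "num_components V {} = card V"
    unfolding num_components_def by (simp add: card_image)
  then show ?thesis by (simp add: excess_def num_faces_def)
qed

text \<open>Deleting edge after edge leads to the empty graph, of excess 0, and every deletion
  lowers the excess by 0 or 2. The crude bound by the darts is enough for the circuits built in the
  reduction.\<close>

lemma excess_even_bounded:
  assumes "finite V" "rotation_system D \<pi>" "sym D" "irrefl D" "D \<subseteq> V \<times> V"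
  shows "\<exists>\<gamma>. excess V D \<pi> = 2 * int \<gamma> \<and> \<gamma> \<le> card D"
  using assms(2-)
proof (induction "card D" arbitrary: D \<pi> rule: less_induct)
  case less
  show ?case
  proof (cases "D = {}")
    case True
    then show ?thesis using excess_empty by auto
  next
    case False
    then obtain u v where e: "(u, v) \<in> D" by auto
    let ?D = "D - {(u, v), (v, u)}"
    have finD: "finite D" using less.prems(4) assms(1) finite_subset by blast
    obtain \<pi>' where \<pi>': "rotation_system ?D \<pi>'"
      "excess V D \<pi> = excess V ?D \<pi>' \<or> excess V D \<pi> = excess V ?D \<pi>' + 2"
      using excess_delete[OF less.prems(1) assms(1) less.prems(2-4) e] by blast
    have "?D \<subset> D" using e by blast
    then have card: "card ?D < card D" using finD psubset_card_mono by blast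
    have "sym ?D" "irrefl ?D" "?D \<subseteq> V \<times> V"
      using less.prems by (auto simp: sym_def irrefl_def)
    from less.hyps[OF card \<pi>'(1) this] obtain \<gamma> where "excess V ?D \<pi>' = 2 * int \<gamma>" "\<gamma> \<le> card ?D"
      by blast
    then show ?thesis using \<pi>'(2) card by (auto intro: exI[of _ \<gamma>] exI[of _ "Suc \<gamma>"])
  qed
qed

text \<open>Each deletion keeps or lowers the excess. The vertex set is kept; vertices that become
  isolated do no harm, since each adds 2 as a component and takes off 1 as a vertex and 1 as a
  face.\<close>

lemma excess_subgraph:
  assumes "finite V" "rotation_system D \<pi>" "sym D" "irrefl D" "D \<subseteq> V \<times> V" "D' \<subseteq> D" "sym D'"
  shows "\<exists>\<pi>'. rotation_system D' \<pi>' \<and> excess V D' \<pi>' \<le> excess V D \<pi>"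
  using assms(2-6)
proof (induction "card D" arbitrary: D \<pi> rule: less_induct)
  case less
  show ?case
  proof (cases "D' = D")
    case True
    then show ?thesis using less.prems by blast
  next
    case False
    then obtain u v where e: "(u, v) \<in> D" "(u, v) \<notin> D'" using less.prems by auto
    let ?D = "D - {(u, v), (v, u)}"
    have finD: "finite D" using less.prems(4) assms(1) finite_subset by blast
    obtain \<pi>' where \<pi>': "rotation_system ?D \<pi>'"
      "excess V D \<pi> = excess V ?D \<pi>' \<or> excess V D \<pi> = excess V ?D \<pi>' + 2"
      using excess_delete[OF less.prems(1) assms(1) less.prems(2-4) e(1)] by blast
    have "?D \<subset> D" using e by blast
    then have card: "card ?D < card D" using finD psubset_card_mono by blast
    have "(v, u) \<notin> D'" using e(2) assms(7) by (auto dest: symD)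
    then have "sym ?D" "irrefl ?D" "?D \<subseteq> V \<times> V" "D' \<subseteq> ?D"
      using less.prems e by (auto simp: sym_def irrefl_def)
    from less.hyps[OF card \<pi>'(1) this] \<pi>'(2) show ?thesis by force
  qed
qed

lemma euler_iff: "int (card V) - int (card D div 2) + int (num_faces V D \<pi>) =
    2 * int (num_components V D) - 2 * int \<gamma> \<longleftrightarrow> excess V D \<pi> = 2 * int \<gamma>"
  unfolding excess_def by linarith

text \<open>A rotation system exists and its excess is even and nonnegative, so the minimum in
  \<open>graph_genus\<close> is attained, below the bound of
  \<open>excess_even_bounded\<close>.\<close>

lemma graph_genus_excess:
  assumes "finite V" "sym D" "irrefl D" "D \<subseteq> V \<times> V"
  shows "\<exists>\<pi>. rotation_system D \<pi> \<and> excess V D \<pi> = 2 * int (graph_genus V D)"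
    and "graph_genus V D \<le> card D"
proof -
  have "finite D" using assms finite_subset by blast
  then obtain \<pi> where \<pi>: "rotation_system D \<pi>" using ex_rotation_system by blast
  obtain \<gamma> where \<gamma>: "excess V D \<pi> = 2 * int \<gamma>" "\<gamma> \<le> card D"
    using excess_even_bounded[OF assms(1) \<pi> assms(2-)] by blast
  let ?P = "\<lambda>\<gamma>. \<exists>\<pi>. rotation_system D \<pi> \<and> excess V D \<pi> = 2 * int \<gamma>"
  have g: "graph_genus V D = (LEAST \<gamma>. ?P \<gamma>)" unfolding graph_genus_def euler_iff ..
  have "?P \<gamma>" using \<pi> \<gamma> by blast
  then show "?P (graph_genus V D)" "graph_genus V D \<le> card D"
    unfolding g using LeastI[of ?P \<gamma>] order_trans[OF Least_le[of ?P \<gamma>] \<gamma>(2)] by blast+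
qed

text \<open>An isolated vertex counts once among the vertices and once among the faces, and it is a
  component, which enters twice. Hence only the other vertices and the true faces remain.\<close>

lemma edges_le:
  assumes "finite V" "D \<subseteq> V \<times> V" "rotation_system D \<pi>" "sym D"
  shows "int (card D div 2) \<le> excess V D \<pi> + int (card (fst ` D)) + int (card (orbit (\<pi> \<circ> flip D) ` D))"
proof -
  let ?I = "V - fst ` D" and ?c = "\<lambda>v. D\<^sup>* `` {v}"
  have "?c v = {v}" if "v \<in> ?I" for v
  proof -
    have "w = v" if w: "(v, w) \<in> D\<^sup>*" for w
      using w \<open>v \<in> ?I\<close> by (cases rule: converse_rtranclE) force+
    then show ?thesis by auto
  qed
  then have "inj_on ?c ?I" by (auto intro!: inj_onI)
  then have "card ?I = card (?c ` ?I)" by (simp add: card_image)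
  also have "\<dots> \<le> num_components V D" unfolding num_components_def using assms(1)
    by (intro card_mono) auto
  finally have 1: "card ?I \<le> num_components V D" .
  have "fst ` D \<subseteq> V" using assms(2) by auto
  then have 2: "card V = card (fst ` D) + card ?I"
    using assms(1) by (metis card_Diff_subset card_mono finite_subset le_add_diff_inverse)
  show ?thesis using 1 2 unfolding excess_def num_faces_eq[OF assms(3,4)] by linarith
qed

lemma card_orbits_le:
  assumes "finite D" "f permutes D" "\<And>d. d \<in> D \<Longrightarrow> L \<le> card (orbit f d)"
  shows "L * card (orbit f ` D) \<le> card D"
proof -
  have P: "permutation f" using assms permutation_permutes by blast
  have sub: "orbit f d \<subseteq> D" if "d \<in> D" for d using permutes_orbit_subset[OF assms(2) that] .
  have "\<Union> (orbit f ` D) = D"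
    using sub permutation_self_in_orbit[OF P] by blast
  moreover have "card (\<Union> (orbit f ` D)) = (\<Sum>W\<in>orbit f ` D. card W)"
  proof (rule card_Union_disjoint)
    show "disjoint (orbit f ` D)" unfolding pairwise_def disjnt_def
    proof (intro ballI impI)
      fix W Z assume W: "W \<in> orbit f ` D" "Z \<in> orbit f ` D" "W \<noteq> Z"
      then obtain x y where "W = orbit f x" "Z = orbit f y" by blast
      then show "W \<inter> Z = {}" using orbit_eq_of_mem[OF P] W(3) by (metis disjoint_iff)
    qed
    show "finite A" if "A \<in> orbit f ` D" for A using that sub assms(1) finite_subset by blast
  qed
  moreover have "(\<Sum>W\<in>orbit f ` D. L) \<le> (\<Sum>W\<in>orbit f ` D. card W)"
    using assms(3) by (intro sum_mono) auto
  ultimately show ?thesis by (simp add: mult.commute)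
qed

section \<open>Sparsity of bipartite graphs of bounded genus\<close>

text \<open>\<open>X\<close> stands for the variables and \<open>M\<close> for the clauses still to
  be hit. The graph may contain more: only the edges between \<open>X\<close> and \<open>M\<close>
  are counted, and passing to subsets of \<open>X\<close> never raises the genus.\<close>

locale bipartite_genus =
  fixes V :: "'a set" and D :: "('a \<times> 'a) set" and X M :: "'a set"
  assumes fin: "finite V" "finite X" "finite M"
    and graph: "sym D" "irrefl D" "D \<subseteq> V \<times> V"
    and disj: "X \<inter> M = {}"
begin

definition nbh :: "'a \<Rightarrow> 'a set" where
  "nbh x = {c \<in> M. (x, c) \<in> D}"

definition darts :: "'a set \<Rightarrow> ('a \<times> 'a) set" where
  "darts Y = {(x, c). x \<in> Y \<and> c \<in> nbh x} \<union> {(c, x). x \<in> Y \<and> c \<in> nbh x}"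

definition edges :: "'a set \<Rightarrow> nat" where
  "edges Y = (\<Sum>x\<in>Y. card (nbh x))"

abbreviation \<gamma> :: nat where
  "\<gamma> \<equiv> graph_genus V D"

lemma finite_nbh: "finite (nbh x)"
  using fin by (simp add: nbh_def)

lemma darts_graph: "sym (darts Y)" "darts Y \<subseteq> D"
  using graph(1) by (auto simp: darts_def nbh_def sym_def)

lemma finite_darts: "finite (darts Y)"
  using darts_graph graph fin by (metis finite_SigmaI finite_subset)

lemma card_darts:
  assumes "Y \<subseteq> X"
  shows "card (darts Y) = 2 * edges Y"
proof -
  let ?S = "Sigma Y nbh"
  have finS: "finite ?S" using fin assms finite_nbh finite_subset by blast
  have "darts Y = ?S \<union> prod.swap ` ?S" by (auto simp: darts_def)
  moreover have "?S \<inter> prod.swap ` ?S = {}" using assms disj by (auto simp: nbh_def)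
  moreover have "card (prod.swap ` ?S) = card ?S" by (intro card_image) (auto simp: inj_on_def)
  moreover have "card ?S = edges Y" unfolding edges_def
    using fin assms finite_nbh finite_subset by (intro card_SigmaI) blast+
  ultimately show ?thesis using finS by (simp add: card_Un_disjoint)
qed

text \<open>\<open>F\<close> is the number of faces of an inherited embedding; the second inequality
  counts the darts face by face. It suffices to bound the faces through darts that leave
  \<open>Y\<close>, since every face contains one.\<close>

lemma edges_long_faces:
  assumes Y: "Y \<subseteq> X" and L: "\<And>\<pi> x c. rotation_system (darts Y) \<pi> \<Longrightarrow> x \<in> Y \<Longrightarrow> c \<in> nbh x \<Longrightarrow>
    L \<le> card (orbit (\<pi> \<circ> flip (darts Y)) (x, c))"
  shows "\<exists>F. edges Y \<le> 2 * \<gamma> + card Y + card M + F \<and> L * F \<le> 2 * edges Y"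
proof -
  let ?D = "darts Y"
  obtain \<pi>0 where "rotation_system D \<pi>0" "excess V D \<pi>0 = 2 * int \<gamma>"
    using graph_genus_excess(1)[OF fin(1) graph] by blast
  then obtain \<pi> where \<pi>: "rotation_system ?D \<pi>" "excess V ?D \<pi> \<le> 2 * int \<gamma>"
    using excess_subgraph[OF fin(1) _ graph darts_graph(2,1)] by metis
  let ?\<phi> = "\<pi> \<circ> flip ?D"
  have perm: "?\<phi> permutes ?D" using face_permutes[OF \<pi>(1) darts_graph(1)] .
  then have P: "permutation ?\<phi>" using finite_darts permutation_permutes by blast
  have "L \<le> card (orbit ?\<phi> d)" if "d \<in> ?D" for d
  proof (cases "fst d \<in> Y")
    case True
    then have "snd d \<in> nbh (fst d)" using that Y disj by (auto simp: darts_def nbh_def)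
    then show ?thesis using L[OF \<pi>(1) True, of "snd d"] by simp
  next
    case False
    then have "snd d \<in> Y" using that by (auto simp: darts_def)
    moreover have "?\<phi> d \<in> ?D" using that permutes_in_image[OF perm] by blast
    moreover have "fst (?\<phi> d) = snd d" using fst_face[OF \<pi>(1) darts_graph(1) that] .
    ultimately have "fst (?\<phi> d) \<in> Y" "snd (?\<phi> d) \<in> nbh (fst (?\<phi> d))"
      using Y disj by (auto simp: darts_def nbh_def)
    from L[OF \<pi>(1) this] have "L \<le> card (orbit ?\<phi> (?\<phi> d))" by simp
    then show ?thesis using permutation_orbit_step[OF P, of d] by simp
  qed
  then have 1: "L * card (orbit ?\<phi> ` ?D) \<le> 2 * edges Y"
    using card_orbits_le[OF finite_darts perm] card_darts[OF Y] by simp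
  have "card (fst ` ?D) \<le> card (Y \<union> M)"
    using fin Y finite_subset by (intro card_mono) (auto simp: darts_def nbh_def)
  also have "\<dots> \<le> card Y + card M" by (rule card_Un_le)
  finally have 2: "card (fst ` ?D) \<le> card Y + card M" .
  have "int (card ?D div 2) \<le> 2 * int \<gamma> + int (card (fst ` ?D)) + int (card (orbit ?\<phi> ` ?D))"
    using edges_le[OF fin(1) _ \<pi>(1) darts_graph(1)] darts_graph(2) graph(3) \<pi>(2) by force
  then have "edges Y \<le> 2 * \<gamma> + card Y + card M + card (orbit ?\<phi> ` ?D)"
    using 2 card_darts[OF Y] by linarith
  then show ?thesis using 1 by blast
qed

lemma face_step:
  assumes rot: "rotation_system (darts Y) \<pi>" and Y: "Y \<subseteq> X"
  shows "x \<in> Y \<Longrightarrow> c \<in> nbh x \<Longrightarrow> \<exists>y. (\<pi> \<circ> flip (darts Y)) (x, c) = (c, y) \<and> \<pi> (c, x) = (c, y) \<and>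
      y \<in> Y \<and> c \<in> nbh y"
    and "x \<in> Y \<Longrightarrow> c \<in> nbh x \<Longrightarrow> \<exists>c'. (\<pi> \<circ> flip (darts Y)) (c, x) = (x, c') \<and> \<pi> (x, c) = (x, c') \<and>
      c' \<in> nbh x"
proof -
  assume xc: "x \<in> Y" "c \<in> nbh x"
  then have d: "(x, c) \<in> darts Y" "(c, x) \<in> darts Y" by (auto simp: darts_def)
  have cX: "c \<notin> X" "x \<in> X" using xc Y disj by (auto simp: nbh_def)
  have "\<pi> (c, x) \<in> darts Y" "fst (\<pi> (c, x)) = c" using rotation_system_D[OF rot d(2)] by auto
  then show "\<exists>y. (\<pi> \<circ> flip (darts Y)) (x, c) = (c, y) \<and> \<pi> (c, x) = (c, y) \<and> y \<in> Y \<and> c \<in> nbh y"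
    using d cX Y by (cases "\<pi> (c, x)") (auto simp: flip_def darts_def)
  have "\<pi> (x, c) \<in> darts Y" "fst (\<pi> (x, c)) = x" using rotation_system_D[OF rot d(1)] by auto
  then show "\<exists>c'. (\<pi> \<circ> flip (darts Y)) (c, x) = (x, c') \<and> \<pi> (x, c) = (x, c') \<and> c' \<in> nbh x"
    using d cX Y disj by (cases "\<pi> (x, c)") (auto simp: flip_def darts_def nbh_def)
qed

lemma rotation_moves:
  assumes rot: "rotation_system (darts Y) \<pi>" and "x \<in> Y" "c \<in> nbh x" "2 \<le> card (nbh x)"
  shows "\<pi> (x, c) \<noteq> (x, c)"
proof
  assume fixed: "\<pi> (x, c) = (x, c)"
  have "nbh x \<noteq> {c}" using assms(4) by auto
  then obtain c' where c': "c' \<in> nbh x" "c' \<noteq> c" using assms(3) by blast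
  have "(x, c) \<in> darts Y" "(x, c') \<in> darts Y" using assms c' by (auto simp: darts_def)
  then show False using rotation_system_fixed[OF rot _ fixed, of "(x, c')"] c' by simp
qed

text \<open>Going \<open>x\<close>, \<open>c\<close>, \<open>y\<close>, \<open>c1\<close> around the
  face, \<open>c1\<close> differs from \<open>c\<close> because the rotation at a vertex of degree
  at least 2 fixes no dart. This already separates four darts, even if \<open>y\<close> is
  \<open>x\<close>.\<close>

lemma face_ge_4:
  assumes rot: "rotation_system (darts Y) \<pi>" and Y: "Y \<subseteq> X" and xc: "x \<in> Y" "c \<in> nbh x"
    and deg: "\<And>x. x \<in> Y \<Longrightarrow> 2 \<le> card (nbh x)"
  shows "4 \<le> card (orbit (\<pi> \<circ> flip (darts Y)) (x, c))"
proof -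
  let ?\<phi> = "\<pi> \<circ> flip (darts Y)"
  have perm: "?\<phi> permutes darts Y" using face_permutes[OF rot darts_graph(1)] .
  then have P: "permutation ?\<phi>" using finite_darts permutation_permutes by blast
  obtain y where y: "?\<phi> (x, c) = (c, y)" "y \<in> Y" "c \<in> nbh y" using face_step(1)[OF rot Y xc] by blast
  obtain c1 where c1: "?\<phi> (c, y) = (y, c1)" "\<pi> (y, c) = (y, c1)" "c1 \<in> nbh y"
    using face_step(2)[OF rot Y y(2,3)] by blast
  obtain z where z: "?\<phi> (y, c1) = (c1, z)" "z \<in> Y" using face_step(1)[OF rot Y y(2) c1(3)] by blast
  have "c1 \<noteq> c" using rotation_moves[OF rot y(2,3) deg[OF y(2)]] c1(2) by auto
  then have "card {(x, c), (c, y), (y, c1), (c1, z)} = 4"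
    using xc y c1 z Y disj by (auto simp: nbh_def card_insert_if)
  moreover have "(x, c) \<in> orbit ?\<phi> (x, c)" by (rule permutation_self_in_orbit[OF P])
  then have "{(x, c), (c, y), (y, c1), (c1, z)} \<subseteq> orbit ?\<phi> (x, c)"
    using y(1) c1(1) z(1) orbit.intros by (metis empty_subsetI insert_subset)
  moreover have "finite (orbit ?\<phi> (x, c))"
    using finite_orbit permutation_self_in_orbit[OF P] by metis
  ultimately show ?thesis by (metis card_mono)
qed

text \<open>A shorter face would close after four darts. Then \<open>x\<close> and \<open>y\<close>
  have the same two neighbours and coincide by injectivity, so the face runs around a path with two
  edges whose ends have no other neighbour, which \<open>no_path\<close> excludes.\<close>

lemma face_ge_6:
  assumes rot: "rotation_system (darts Y) \<pi>" and Y: "Y \<subseteq> X" and xc: "x \<in> Y" "c \<in> nbh x"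
    and deg: "\<And>x. x \<in> Y \<Longrightarrow> card (nbh x) = 2" and inj: "inj_on nbh Y"
    and no_path: "\<And>x. x \<in> Y \<Longrightarrow> \<exists>c \<in> nbh x. \<exists>y \<in> Y. y \<noteq> x \<and> c \<in> nbh y"
  shows "6 \<le> card (orbit (\<pi> \<circ> flip (darts Y)) (x, c))"
proof -
  let ?\<phi> = "\<pi> \<circ> flip (darts Y)"
  have perm: "?\<phi> permutes darts Y" using face_permutes[OF rot darts_graph(1)] .
  then have P: "permutation ?\<phi>" using finite_darts permutation_permutes by blast
  obtain y where y: "?\<phi> (x, c) = (c, y)" "\<pi> (c, x) = (c, y)" "y \<in> Y" "c \<in> nbh y"
    using face_step(1)[OF rot Y xc] by blast
  obtain c1 where c1: "?\<phi> (c, y) = (y, c1)" "\<pi> (y, c) = (y, c1)" "c1 \<in> nbh y"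
    using face_step(2)[OF rot Y y(3,4)] by blast
  obtain z where z: "?\<phi> (y, c1) = (c1, z)" "\<pi> (c1, y) = (c1, z)" "z \<in> Y" "c1 \<in> nbh z"
    using face_step(1)[OF rot Y y(3) c1(3)] by blast
  obtain c2 where c2: "?\<phi> (c1, z) = (z, c2)" "\<pi> (z, c1) = (z, c2)" "c2 \<in> nbh z"
    using face_step(2)[OF rot Y z(3,4)] by blast
  obtain w where w: "?\<phi> (z, c2) = (c2, w)" "w \<in> Y" using face_step(1)[OF rot Y z(3) c2(3)] by blast
  have ne1: "c1 \<noteq> c" using rotation_moves[OF rot y(3,4)] deg[OF y(3)] c1(2) by auto
  have ne2: "c2 \<noteq> c1" using rotation_moves[OF rot z(3,4)] deg[OF z(3)] c2(2) by auto
  have ne3: "(z, c2) \<noteq> (x, c)"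
  proof
    assume eq: "(z, c2) = (x, c)"
    have nbh2: "nbh v = {c, c1}" if "v \<in> Y" "c \<in> nbh v" "c1 \<in> nbh v" for v
      using card_subset_eq[OF finite_nbh, of "{c, c1}" v] deg[OF that(1)] that ne1 by auto
    have "nbh x = {c, c1}" "nbh y = {c, c1}" using nbh2 xc y c1 z eq by auto
    then have xy: "x = y" using inj_onD[OF inj _ xc(1) y(3)] by simp
    have d: "(c, x) \<in> darts Y" "(c1, x) \<in> darts Y" using xc z eq by (auto simp: darts_def)
    obtain c' v where v: "c' \<in> nbh x" "v \<in> Y" "v \<noteq> x" "c' \<in> nbh v" using no_path[OF xc(1)] by blast
    then have dv: "(c', v) \<in> darts Y" by (auto simp: darts_def)
    have "\<pi> (c, x) = (c, x)" "\<pi> (c1, x) = (c1, x)" using y(2) z(2) xy eq by auto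
    then have "(c', v) = (c, x) \<or> (c', v) = (c1, x)"
      using rotation_system_fixed[OF rot d(1) _ dv] rotation_system_fixed[OF rot d(2) _ dv]
        \<open>nbh x = {c, c1}\<close> v(1) by auto
    then show False using v(3) by auto
  qed
  have ne4: "(c2, w) \<noteq> (c, y)"
  proof
    assume "(c2, w) = (c, y)"
    then have "?\<phi> (z, c2) = ?\<phi> (x, c)" using w y by simp
    then show False using ne3 permutes_inj[OF perm] by (metis injD)
  qed
  have "card {(x, c), (c, y), (y, c1), (c1, z), (z, c2), (c2, w)} = 6"
    using xc y c1 z c2 w Y disj ne1 ne2 ne3 ne4 by (auto simp: nbh_def card_insert_if)
  moreover have "(x, c) \<in> orbit ?\<phi> (x, c)" by (rule permutation_self_in_orbit[OF P])
  then have "{(x, c), (c, y), (y, c1), (c1, z), (z, c2), (c2, w)} \<subseteq> orbit ?\<phi> (x, c)"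
    using y(1) c1(1) z(1) c2(1) w(1) orbit.intros by (metis empty_subsetI insert_subset)
  moreover have "finite (orbit ?\<phi> (x, c))"
    using finite_orbit permutation_self_in_orbit[OF P] by metis
  ultimately show ?thesis by (metis card_mono)
qed

lemma edges_degree_3:
  assumes "Y \<subseteq> X" "\<And>x. x \<in> Y \<Longrightarrow> 3 \<le> card (nbh x)"
  shows "edges Y \<le> 12 * \<gamma> + 6 * card M"
proof -
  have "\<exists>F. edges Y \<le> 2 * \<gamma> + card Y + card M + F \<and> 4 * F \<le> 2 * edges Y"
    using assms by (intro edges_long_faces face_ge_4) force+
  then obtain F where F: "edges Y \<le> 2 * \<gamma> + card Y + card M + F" "4 * F \<le> 2 * edges Y" by blast
  have "(\<Sum>x\<in>Y. 3) \<le> edges Y" unfolding edges_def using assms(2) by (intro sum_mono) auto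
  then have "3 * card Y \<le> edges Y" by simp
  \<comment> \<open>With \<open>card Y\<close> at most a third of the edges and \<open>F\<close> at
    most half of them, a sixth of the edges is at most \<open>2 * \<gamma> + card M\<close>.\<close>
  then show ?thesis using F by linarith
qed

lemma edges_degree_2:
  assumes "Y \<subseteq> X" "\<And>x. x \<in> Y \<Longrightarrow> card (nbh x) = 2" "inj_on nbh Y"
  shows "edges Y \<le> 12 * \<gamma> + 8 * card M"
proof -
  \<comment> \<open>The faces around a path with two edges have length 4; these paths are counted separately.\<close>
  define Z where "Z = {x \<in> Y. \<forall>c \<in> nbh x. \<forall>y \<in> Y. c \<in> nbh y \<longrightarrow> y = x}"
  have finY: "finite Y" using assms(1) fin finite_subset by blast
  have sub: "Y - Z \<subseteq> X" using assms(1) by blast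
  \<comment> \<open>The other vertex \<open>y\<close> shares \<open>c\<close> with \<open>x\<close>
    and so lies outside \<open>Z\<close> too: the condition survives the removal of
    \<open>Z\<close>.\<close>
  have no_path: "\<exists>c \<in> nbh x. \<exists>y \<in> Y - Z. y \<noteq> x \<and> c \<in> nbh y" if x: "x \<in> Y - Z" for x
  proof -
    obtain c y where "c \<in> nbh x" "y \<in> Y" "c \<in> nbh y" "y \<noteq> x" using x unfolding Z_def by blast
    moreover from this have "y \<notin> Z" using x unfolding Z_def by blast
    ultimately show ?thesis by blast
  qed
  have "\<exists>F. edges (Y - Z) \<le> 2 * \<gamma> + card (Y - Z) + card M + F \<and> 6 * F \<le> 2 * edges (Y - Z)"
    using sub assms no_path
    by (intro edges_long_faces face_ge_6) (auto intro: inj_on_subset)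
  then obtain F where F: "edges (Y - Z) \<le> 2 * \<gamma> + card (Y - Z) + card M + F"
    "6 * F \<le> 2 * edges (Y - Z)" by blast
  have e: "edges W = 2 * card W" if "W \<subseteq> Y" for W
    unfolding edges_def using that assms(2) by (simp add: subset_iff)
  \<comment> \<open>Now \<open>card (Y - Z)\<close> is half of the edges and \<open>F\<close> at
    most a third, which again leaves a sixth.\<close>
  have 1: "edges (Y - Z) \<le> 12 * \<gamma> + 6 * card M" using F e[of "Y - Z"] by auto
  define f where "f x = (SOME c. c \<in> nbh x)" for x
  have f: "f x \<in> nbh x" if "x \<in> Y" for x
  proof -
    have "nbh x \<noteq> {}" using assms(2)[OF that] by auto
    then show ?thesis unfolding f_def by (simp add: some_in_eq)
  qed
  \<comment> \<open>The vertices of \<open>Z\<close> share no neighbour with others, so one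
    neighbour each tells them apart. With two edges per vertex, \<open>Z\<close> adds at most
    \<open>2 * card M\<close>, hence 8 instead of 6.\<close>
  have "inj_on f Z"
  proof (rule inj_onI)
    fix x y assume *: "x \<in> Z" "y \<in> Z" "f x = f y"
    then have "f x \<in> nbh x" "f x \<in> nbh y" using f[of x] f[of y] by (auto simp: Z_def)
    then show "x = y" using * by (auto simp: Z_def)
  qed
  moreover have "f ` Z \<subseteq> M" using f by (auto simp: Z_def nbh_def)
  ultimately have 2: "card Z \<le> card M" using fin by (metis card_image card_mono)
  have "edges Y = edges (Y - Z) + edges Z"
    unfolding edges_def using finY by (intro sum.subset_diff) (auto simp: Z_def)
  moreover have "Z \<subseteq> Y" by (auto simp: Z_def)
  ultimately show ?thesis using 1 2 e[of Z] by linarith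
qed

lemma edges_degree_1:
  assumes "Y \<subseteq> X" "\<And>x. x \<in> Y \<Longrightarrow> card (nbh x) = 1" "inj_on nbh Y"
  shows "edges Y \<le> card M"
proof -
  have "card Y = card (nbh ` Y)" using assms(3) by (simp add: card_image)
  also have "\<dots> \<le> card ((\<lambda>c. {c}) ` M)"
  proof (rule card_mono)
    show "nbh ` Y \<subseteq> (\<lambda>c. {c}) ` M"
    proof
      fix W assume "W \<in> nbh ` Y"
      then obtain x c where "x \<in> Y" "W = nbh x" "nbh x = {c}" using assms(2) card_1_singletonE by blast
      then show "W \<in> (\<lambda>c. {c}) ` M" by (auto simp: nbh_def)
    qed
  qed (use fin in simp)
  also have "\<dots> = card M" by (intro card_image) simp
  finally show ?thesis using assms(2) by (simp add: edges_def)
qed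

text \<open>The vertices of \<open>X\<close> are sorted by degree: degree 1 gives at most
  \<open>card M\<close> edges, degree 2 and the rest at most 8 and 6 times as many, plus
  \<open>12 * \<gamma>\<close> each. This is the origin of 15 and 24; if all degrees in
  \<open>M\<close> were larger, counting the edges from both sides would be contradictory.\<close>

theorem ex_low_degree:
  assumes "inj_on nbh X" "M \<noteq> {}"
  shows "\<exists>c \<in> M. card {x \<in> X. c \<in> nbh x} \<le> 15 + 24 * \<gamma>"
proof (rule ccontr)
  assume "\<not> ?thesis"
  then have big: "16 + 24 * \<gamma> \<le> card {x \<in> X. c \<in> nbh x}" if "c \<in> M" for c using that by force
  let ?X = "\<lambda>P. {x \<in> X. P (card (nbh x))}"
  have "edges X = edges (?X (\<lambda>d. d = 0)) + edges (?X (\<lambda>d. d = 1)) + edges (?X (\<lambda>d. d = 2)) +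
    edges (?X (\<lambda>d. 3 \<le> d))"
  proof -
    have "edges X = (\<Sum>x\<in>X. (if card (nbh x) = 0 then card (nbh x) else 0) +
      (if card (nbh x) = 1 then card (nbh x) else 0) + (if card (nbh x) = 2 then card (nbh x) else 0) +
      (if 3 \<le> card (nbh x) then card (nbh x) else 0))"
      unfolding edges_def by (intro sum.cong) auto
    then show ?thesis unfolding sum.distrib edges_def using fin(2) by (simp only: sum.inter_filter)
  qed
  moreover have "edges (?X (\<lambda>d. d = 0)) = 0" by (simp add: edges_def)
  moreover have "edges (?X (\<lambda>d. d = 1)) \<le> card M"
    by (rule edges_degree_1) (auto intro: inj_on_subset[OF assms(1)])
  moreover have "edges (?X (\<lambda>d. d = 2)) \<le> 12 * \<gamma> + 8 * card M"
    by (rule edges_degree_2) (auto intro: inj_on_subset[OF assms(1)])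
  moreover have "edges (?X (\<lambda>d. 3 \<le> d)) \<le> 12 * \<gamma> + 6 * card M"
    by (rule edges_degree_3) auto
  ultimately have "edges X \<le> 24 * \<gamma> + 15 * card M" by linarith
  moreover have "edges X = (\<Sum>c\<in>M. card {x \<in> X. c \<in> nbh x})"
  proof -
    have "edges X = (\<Sum>x\<in>X. \<Sum>c\<in>M. if (x, c) \<in> D then 1 else 0)"
      unfolding edges_def nbh_def using fin by (simp add: sum.If_cases Int_def)
    also have "\<dots> = (\<Sum>c\<in>M. \<Sum>x\<in>X. if (x, c) \<in> D then 1 else 0)" by (rule sum.swap)
    also have "\<dots> = (\<Sum>c\<in>M. card {x \<in> X. c \<in> nbh x})"
      unfolding nbh_def using fin by (intro sum.cong) (simp_all add: sum.If_cases Int_def)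
    finally show ?thesis .
  qed
  moreover have "(\<Sum>c\<in>M. 16 + 24 * \<gamma>) \<le> (\<Sum>c\<in>M. card {x \<in> X. c \<in> nbh x})"
    using big by (rule sum_mono)
  ultimately have "card M * (16 + 24 * \<gamma>) \<le> 24 * \<gamma> + 15 * card M" by simp
  moreover have "0 < card M" using assms(2) fin by (simp add: card_gt_0_iff)
  then have "24 * \<gamma> \<le> card M * (24 * \<gamma>)" by simp
  ultimately show False using \<open>0 < card M\<close> by (simp add: distrib_left)
qed

end

section \<open>Programming the machine\<close>

text \<open>
  The memory is divided into eight interleaved regions: region 0 holds the variables, region 7
  temporary values, regions 1 to 3 three lists, whose lengths are the first three temporaries, and
  region 6 the memory of a simulated program.
\<close>

definition cell :: "nat \<Rightarrow> nat \<Rightarrow> nat" where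
  "cell k i = 8 * i + k"

lemma cell_eq_iff [simp]: "k < 8 \<Longrightarrow> l < 8 \<Longrightarrow> cell k i = cell l j \<longleftrightarrow> k = l \<and> i = j"
  unfolding cell_def by presburger

abbreviation reg :: "nat \<Rightarrow> nat" where "reg \<equiv> cell 0"
abbreviation tmp :: "nat \<Rightarrow> nat" where "tmp \<equiv> cell 7"
abbreviation raw :: "nat \<Rightarrow> nat" where "raw \<equiv> cell 6"

datatype arr = A0 | A1 | A2

fun arr_index :: "arr \<Rightarrow> nat" where
  "arr_index A0 = 0" | "arr_index A1 = 1" | "arr_index A2 = 2"

lemma arr_index_less: "arr_index j < 3"
  by (cases j) simp_all

lemma arr_index_eq_iff [simp]: "arr_index j = arr_index l \<longleftrightarrow> j = l"
  by (cases j; cases l) simp_all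

definition off :: "arr \<Rightarrow> nat" where "off j = arr_index j + 1"

abbreviation slot :: "arr \<Rightarrow> nat \<Rightarrow> nat" where "slot j \<equiv> cell (off j)"

lemma off_simps [simp]:
  "off j < 8" "off j \<noteq> 0" "0 \<noteq> off j" "off j \<noteq> 6" "off j \<noteq> 7" "6 \<noteq> off j" "7 \<noteq> off j" "off j > 0"
  by (cases j; simp add: off_def)+

lemma off_eq_iff [simp]: "off j = off l \<longleftrightarrow> j = l"
  by (simp add: off_def)

lemma arr_index_neq [simp]: "3 \<le> t \<Longrightarrow> arr_index j \<noteq> t" "3 \<le> t \<Longrightarrow> t \<noteq> arr_index j"
  using arr_index_less[of j] by linarith+

fun eff :: "ram \<Rightarrow> ram_state \<Rightarrow> ram_state" where
  "eff (Const i c) s = s\<lparr>mem := (mem s)(i := c)\<rparr>"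
| "eff (Add i j l) s = s\<lparr>mem := (mem s)(i := mem s j + mem s l)\<rparr>"
| "eff (Sub i j l) s = s\<lparr>mem := (mem s)(i := mem s j - mem s l)\<rparr>"
| "eff (Load i j) s = s\<lparr>mem := (mem s)(i := mem s (mem s j))\<rparr>"
| "eff (Store i j) s = s\<lparr>mem := (mem s)(mem s i := mem s j)\<rparr>"
| "eff (Read i) s =
     s\<lparr>mem := (mem s)(i := (case inp s of [] \<Rightarrow> 0 | a # _ \<Rightarrow> a)), inp := tl (inp s)\<rparr>"
| "eff (Write i) s = s\<lparr>outp := outp s @ [mem s i]\<rparr>"
| "eff _ s = s"

fun basic :: "ram \<Rightarrow> bool" where
  "basic (Seq p q) = False"
| "basic (Cond i p q) = False"
| "basic (While i p) = False"
| "basic _ = True"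

fun block :: "ram list \<Rightarrow> ram" where
  "block [] = Const (tmp 3) 0"
| "block [p] = p"
| "block (p # q # ps) = Seq p (block (q # ps))"

lemma exec_basic: "basic p \<Longrightarrow> exec p s 1 (eff p s)"
  by (cases p) (auto intro: exec.intros[simplified])

lemma exec_block:
  "list_all basic ps \<Longrightarrow> ps \<noteq> [] \<Longrightarrow> exec (block ps) s (length ps) (fold eff ps s)"
proof (induction ps arbitrary: s rule: block.induct)
  case (3 p q ps)
  have "exec (Seq p (block (q # ps))) s (1 + length (q # ps)) (fold eff (q # ps) (eff p s))"
    using 3 by (intro exec.intros(8)[OF exec_basic]) auto
  then show ?case by simp
qed (use exec_basic in auto)

lemma exec_blockI:
  "list_all basic ps \<Longrightarrow> ps \<noteq> [] \<Longrightarrow> length ps = n \<Longrightarrow> fold eff ps s = s' \<Longrightarrow>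
    exec (block ps) s n s'"
  using exec_block by blast

record astate =
  av :: "nat \<Rightarrow> nat"
  aa :: "arr \<Rightarrow> nat list"
  araw :: "nat \<Rightarrow> nat"
  ain :: "nat list"
  aout :: "nat list"

text \<open>Cells beyond the ends of the lists and the temporaries from 3 on are left open: they
  hold garbage or scratch values.\<close>

definition rel :: "astate \<Rightarrow> ram_state \<Rightarrow> bool" where
  "rel a s \<longleftrightarrow> (\<forall>x. mem s (reg x) = av a x) \<and>
     (\<forall>j. mem s (tmp (arr_index j)) = length (aa a j)) \<and>
     (\<forall>j. \<forall>i < length (aa a j). mem s (slot j i) = aa a j ! i) \<and>
     (\<forall>i. mem s (raw i) = araw a i) \<and> inp s = ain a \<and> outp s = aout a"

lemma relD:
  assumes "rel a s"
  shows "mem s (reg x) = av a x" "mem s (tmp (arr_index j)) = length (aa a j)"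
    "i < length (aa a j) \<Longrightarrow> mem s (slot j i) = aa a j ! i"
    "mem s (raw i) = araw a i" "inp s = ain a" "outp s = aout a"
  using assms by (auto simp: rel_def)

text \<open>The temporaries from \<open>t\<close> on may be overwritten. Code for an expression gets
  such a \<open>t\<close> as its stack height and keeps everything below.\<close>

definition frame :: "nat \<Rightarrow> ram_state \<Rightarrow> ram_state \<Rightarrow> bool" where
  "frame t s s' \<longleftrightarrow> inp s' = inp s \<and> outp s' = outp s \<and>
     (\<forall>k i. k < 8 \<longrightarrow> (k = 7 \<longrightarrow> i < t) \<longrightarrow> mem s' (cell k i) = mem s (cell k i))"

lemma rel_frame: "rel a s \<Longrightarrow> frame t s s' \<Longrightarrow> 3 \<le> t \<Longrightarrow> rel a s'"
proof -
  assume rel: "rel a s" and fr: "frame t s s'" and "3 \<le> t"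
  have "mem s' (cell k i) = mem s (cell k i)" if "k < 8" "k = 7 \<longrightarrow> i < t" for k i
    using fr that by (auto simp: frame_def)
  moreover have "arr_index j < t" for j using less_le_trans[OF arr_index_less \<open>3 \<le> t\<close>] .
  ultimately show "rel a s'" using rel fr by (simp add: rel_def frame_def)
qed

lemma frame_tmp: "frame t s s' \<Longrightarrow> i < t \<Longrightarrow> mem s' (tmp i) = mem s (tmp i)"
  unfolding frame_def by auto

subsection \<open>Expressions\<close>

text \<open>Evaluation is total: reading beyond the end of a list gives 0, as on the input tape. The
  bounded sum covers multiplication, counting and bounded quantifiers, and keeps the running time
  polynomial.\<close>

datatype expr =
    Num nat
  | Var nat
  | Arr arr expr
  | Plus expr expr
  | Minus expr expr
  | Ite expr expr expr
  | Sum nat nat expr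

fun eval :: "expr \<Rightarrow> (nat \<Rightarrow> nat) \<Rightarrow> (arr \<Rightarrow> nat list) \<Rightarrow> nat" where
  "eval (Num n) \<sigma> \<rho> = n"
| "eval (Var x) \<sigma> \<rho> = \<sigma> x"
| "eval (Arr j e) \<sigma> \<rho> =
     (if eval e \<sigma> \<rho> < length (\<rho> j) then \<rho> j ! eval e \<sigma> \<rho> else 0)"
| "eval (Plus e e') \<sigma> \<rho> = eval e \<sigma> \<rho> + eval e' \<sigma> \<rho>"
| "eval (Minus e e') \<sigma> \<rho> = eval e \<sigma> \<rho> - eval e' \<sigma> \<rho>"
| "eval (Ite b e e') \<sigma> \<rho> = (if eval b \<sigma> \<rho> \<noteq> 0 then eval e \<sigma> \<rho> else eval e' \<sigma> \<rho>)"
| "eval (Sum x d e) \<sigma> \<rho> = (\<Sum>i < \<sigma> d. eval e (\<sigma>(x := i)) \<rho>)"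

text \<open>
  Variables below 20 serve as loop bounds and the others as loop counters, so that the running
  time is controlled by the largest of the former.
\<close>

fun wf_expr :: "expr \<Rightarrow> bool" where
  "wf_expr (Num n) = True"
| "wf_expr (Var x) = True"
| "wf_expr (Arr j e) = wf_expr e"
| "wf_expr (Plus e e') = (wf_expr e \<and> wf_expr e')"
| "wf_expr (Minus e e') = (wf_expr e \<and> wf_expr e')"
| "wf_expr (Ite b e e') = (wf_expr b \<and> wf_expr e \<and> wf_expr e')"
| "wf_expr (Sum x d e) = (20 \<le> x \<and> d < 20 \<and> wf_expr e)"

fun arrs_expr :: "expr \<Rightarrow> arr set" where
  "arrs_expr (Num n) = {}"
| "arrs_expr (Var x) = {}"
| "arrs_expr (Arr j e) = insert j (arrs_expr e)"
| "arrs_expr (Plus e e') = arrs_expr e \<union> arrs_expr e'"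
| "arrs_expr (Minus e e') = arrs_expr e \<union> arrs_expr e'"
| "arrs_expr (Ite b e e') = arrs_expr b \<union> arrs_expr e \<union> arrs_expr e'"
| "arrs_expr (Sum x d e) = arrs_expr e"

lemma eval_cong: "(\<And>j. j \<in> arrs_expr e \<Longrightarrow> \<rho> j = \<rho>' j) \<Longrightarrow> eval e \<sigma> \<rho> = eval e \<sigma> \<rho>'"
  by (induction e arbitrary: \<sigma>) auto

text \<open>A round of a sum costs its body, four steps of bookkeeping and the loop test; the 9 pays
  for setting up, for the last test and for restoring the variable.\<close>

fun expr_cost :: "expr \<Rightarrow> nat \<Rightarrow> nat" where
  "expr_cost (Num n) B = 1"
| "expr_cost (Var x) B = 2"
| "expr_cost (Arr j e) B = expr_cost e B + 8"
| "expr_cost (Plus e e') B = expr_cost e B + expr_cost e' B + 1"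
| "expr_cost (Minus e e') B = expr_cost e B + expr_cost e' B + 1"
| "expr_cost (Ite b e e') B = expr_cost b B + expr_cost e B + expr_cost e' B + 1"
| "expr_cost (Sum x d e) B = B * (expr_cost e B + 5) + 9"

definition copy :: "nat \<Rightarrow> nat \<Rightarrow> ram list" where
  "copy i j = [Const i 0, Add i i j]"

text \<open>Three doublings multiply by 8, the number of regions; the machine has no
  multiplication.\<close>

definition address :: "nat \<Rightarrow> nat \<Rightarrow> nat \<Rightarrow> ram list" where
  "address k i t = [Add (tmp t) i i, Add (tmp t) (tmp t) (tmp t), Add (tmp t) (tmp t) (tmp t),
     Const (tmp (t + 1)) k, Add (tmp t) (tmp t) (tmp (t + 1))]"

lemma list_all_copy [simp]: "list_all basic (copy i j)" "length (copy i j) = 2" "copy i j \<noteq> []"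
  by (simp_all add: copy_def)

lemma list_all_address [simp]: "list_all basic (address k i t)" "length (address k i t) = 5"
  by (simp_all add: address_def)

lemma eff_copy:
  "i \<noteq> j \<Longrightarrow> fold eff (copy i j) s = s\<lparr>mem := (mem s)(i := mem s j)\<rparr>"
  by (simp add: copy_def)

lemma eff_address:
  "i \<noteq> tmp (t + 1) \<Longrightarrow> fold eff (address k i t) s =
     s\<lparr>mem := (mem s)(tmp (t + 1) := k, tmp t := cell k (mem s i))\<rparr>"
  by (simp add: address_def fun_upd_twist) (simp add: cell_def fun_upd_twist mult.commute mult_2_right[symmetric])

abbreviation sum_step :: "nat \<Rightarrow> nat \<Rightarrow> ram" where
  "sum_step x t \<equiv> block [Add (tmp t) (tmp t) (tmp (t + 3)), Const (tmp (t + 3)) 1,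
     Add (reg x) (reg x) (tmp (t + 3)), Sub (tmp (t + 2)) (tmp (t + 2)) (tmp (t + 3))]"

abbreviation sum_loop :: "nat \<Rightarrow> nat \<Rightarrow> ram \<Rightarrow> ram" where
  "sum_loop x t p \<equiv> While (tmp (t + 2)) (Seq p (sum_step x t))"

text \<open>The value ends up in \<open>tmp t\<close>. A sum keeps the old value of its variable in
  \<open>tmp (t + 1)\<close> and the number of rounds left in \<open>tmp (t + 2)\<close>, so its
  body is compiled at height \<open>t + 3\<close>.\<close>

fun compile_expr :: "expr \<Rightarrow> nat \<Rightarrow> ram" where
  "compile_expr (Num n) t = Const (tmp t) n"
| "compile_expr (Var x) t = block (copy (tmp t) (reg x))"
| "compile_expr (Arr j e) t =
     Seq (compile_expr e t)
       (Seq (Sub (tmp (t + 1)) (tmp (arr_index j)) (tmp t))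
         (Cond (tmp (t + 1))
           (block (address (off j) (tmp t) t @ [Load (tmp t) (tmp t)]))
           (Const (tmp t) 0)))"
| "compile_expr (Plus e e') t =
     Seq (compile_expr e t) (Seq (compile_expr e' (t + 1)) (Add (tmp t) (tmp t) (tmp (t + 1))))"
| "compile_expr (Minus e e') t =
     Seq (compile_expr e t) (Seq (compile_expr e' (t + 1)) (Sub (tmp t) (tmp t) (tmp (t + 1))))"
| "compile_expr (Ite b e e') t =
     Seq (compile_expr b t) (Cond (tmp t) (compile_expr e t) (compile_expr e' t))"
| "compile_expr (Sum x d e) t =
     Seq (block (copy (tmp (t + 1)) (reg x) @ copy (tmp (t + 2)) (reg d) @
            [Const (tmp t) 0, Const (reg x) 0]))
       (Seq
         (sum_loop x t (compile_expr e (t + 3)))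
         (block (copy (reg x) (tmp (t + 1)))))"

abbreviation dims_le :: "(nat \<Rightarrow> nat) \<Rightarrow> nat \<Rightarrow> bool" where
  "dims_le \<sigma> B \<equiv> \<forall>d < 20. \<sigma> d \<le> B"

definition computes_expr :: "expr \<Rightarrow> nat \<Rightarrow> nat \<Rightarrow> nat \<Rightarrow> astate \<Rightarrow> bool" where
  "computes_expr e t n v a \<longleftrightarrow> (\<forall>s. rel a s \<longrightarrow> (\<exists>m s'. m \<le> n \<and>
     exec (compile_expr e t) s m s' \<and> frame t s s' \<and> mem s' (tmp t) = v))"

lemma rel_setv:
  "rel a s \<Longrightarrow> rel (a\<lparr>av := (av a)(x := v)\<rparr>) (s\<lparr>mem := (mem s)(reg x := v)\<rparr>)"
  by (auto simp: rel_def)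

lemma compile_expr_loop:
  assumes "3 \<le> t"
    and body: "\<And>i s. i < r \<Longrightarrow> rel (a\<lparr>av := (av a)(x := i)\<rparr>) s \<Longrightarrow> \<exists>n s'. n \<le> c \<and>
      exec (compile_expr e (t + 3)) s n s' \<and> frame (t + 3) s s' \<and> mem s' (tmp (t + 3)) = v i"
  shows "i \<le> r \<Longrightarrow> rel (a\<lparr>av := (av a)(x := i)\<rparr>) s \<Longrightarrow> mem s (tmp (t + 2)) = r - i \<Longrightarrow>
    \<exists>n s'. n \<le> (r - i) * (c + 5) + 1 \<and> exec (sum_loop x t (compile_expr e (t + 3))) s n s' \<and>
      rel (a\<lparr>av := (av a)(x := r)\<rparr>) s' \<and> mem s' (tmp (t + 1)) = mem s (tmp (t + 1)) \<and>
      (\<forall>k i. 0 < k \<longrightarrow> k < 8 \<longrightarrow> (k = 7 \<longrightarrow> i < t) \<longrightarrow> mem s' (cell k i) = mem s (cell k i)) \<and>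
      mem s' (tmp t) = mem s (tmp t) + (\<Sum>k = i..<r. v k)"
proof (induction "r - i" arbitrary: i s)
  case 0
  then show ?case by (intro exI[of _ 1] exI[of _ s]) (auto intro!: exec.intros(11)[unfolded One_nat_def])
next
  case (Suc k)
  then have "i < r" by simp
  from body[OF this Suc.prems(2)] obtain n s1 where
    1: "n \<le> c" "exec (compile_expr e (t + 3)) s n s1" "frame (t + 3) s s1"
       "mem s1 (tmp (t + 3)) = v i" by auto
  define s2 where "s2 = s1\<lparr>mem := (mem s1)(tmp t := mem s1 (tmp t) + v i, tmp (t + 3) := 1,
      reg x := Suc i, tmp (t + 2) := mem s1 (tmp (t + 2)) - 1)\<rparr>"
  have rel1: "rel (a\<lparr>av := (av a)(x := i)\<rparr>) s1"
    using rel_frame[OF Suc.prems(2) 1(3)] by simp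
  have regx: "mem s1 (reg x) = i" using relD(1)[OF rel1, of x] by simp
  have 2: "exec (sum_step x t) s1 4 s2"
    by (intro exec_blockI) (simp_all add: s2_def regx 1(4))
  have rel2: "rel (a\<lparr>av := (av a)(x := Suc i)\<rparr>) s2"
    using rel1 \<open>3 \<le> t\<close> by (auto simp: rel_def s2_def)
  have t2: "mem s2 (tmp (t + 2)) = r - Suc i"
    using frame_tmp[OF 1(3), of "t + 2"] Suc.prems(3) by (simp add: s2_def)
  obtain m s3 where 3: "m \<le> (r - Suc i) * (c + 5) + 1"
    "exec (sum_loop x t (compile_expr e (t + 3))) s2 m s3"
    "rel (a\<lparr>av := (av a)(x := r)\<rparr>) s3" "mem s3 (tmp (t + 1)) = mem s2 (tmp (t + 1))"
    "\<forall>k i. 0 < k \<longrightarrow> k < 8 \<longrightarrow> (k = 7 \<longrightarrow> i < t) \<longrightarrow> mem s3 (cell k i) = mem s2 (cell k i)"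
    "mem s3 (tmp t) = mem s2 (tmp t) + (\<Sum>k = Suc i..<r. v k)"
    using Suc.hyps(1)[of "Suc i", OF _ _ rel2 t2] Suc.hyps(2) \<open>i < r\<close> by force
  have "(r - i) * (c + 5) = (r - Suc i) * (c + 5) + (c + 5)"
    using \<open>i < r\<close> by (simp add: Suc_diff_Suc[symmetric])
  then have time: "(n + 4) + m + 1 \<le> (r - i) * (c + 5) + 1" using 1(1) 3(1) by linarith
  have "exec (sum_loop x t (compile_expr e (t + 3))) s ((n + 4) + m + 1) s3"
    using exec.intros(12)[OF _ exec.intros(8)[OF 1(2) 2] 3(2)] Suc.prems(3) \<open>i < r\<close> by simp
  moreover have "mem s3 (tmp (t + 1)) = mem s (tmp (t + 1))"
    using 3(4) frame_tmp[OF 1(3), of "t + 1"] by (simp add: s2_def)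
  moreover have "\<forall>k i. 0 < k \<longrightarrow> k < 8 \<longrightarrow> (k = 7 \<longrightarrow> i < t) \<longrightarrow> mem s3 (cell k i) = mem s (cell k i)"
    using 3(5) 1(3) by (auto simp: s2_def frame_def)
  moreover have "mem s3 (tmp t) = mem s (tmp t) + (\<Sum>k = i..<r. v k)"
    using 3(6) frame_tmp[OF 1(3), of t] \<open>i < r\<close> by (simp add: s2_def sum.atLeast_Suc_lessThan)
  ultimately show ?case using time 3(3) by blast
qed

lemma computes_binary:
  assumes "3 \<le> t" and e: "computes_expr e t n v a" and e': "computes_expr e' (t + 1) m v' a"
    and "compile_expr d t = Seq (compile_expr e t) (Seq (compile_expr e' (t + 1)) p)" and "basic p"
    and eff: "\<And>s. eff p s = s\<lparr>mem := (mem s)(tmp t := f (mem s (tmp t)) (mem s (tmp (t + 1))))\<rparr>"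
  shows "computes_expr d t (n + m + 1) (f v v') a"
  unfolding computes_expr_def
proof (intro allI impI)
  fix s assume rel: "rel a s"
  obtain i s1 where 1: "i \<le> n" "exec (compile_expr e t) s i s1" "frame t s s1" "mem s1 (tmp t) = v"
    using e rel by (auto simp: computes_expr_def)
  have rel1: "rel a s1" using rel_frame[OF rel 1(3) assms(1)] .
  obtain j s2 where 2: "j \<le> m" "exec (compile_expr e' (t + 1)) s1 j s2" "frame (t + 1) s1 s2"
    "mem s2 (tmp (t + 1)) = v'"
    using e' rel1 by (auto simp: computes_expr_def)
  have 3: "exec (compile_expr d t) s (i + (j + 1)) (eff p s2)"
    unfolding assms(4) by (intro exec.intros(8)[OF 1(2)] exec.intros(8)[OF 2(2)] exec_basic assms(5))
  have "frame t s (eff p s2)" using 1(3) 2(3) by (auto simp: frame_def eff)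
  moreover have "mem (eff p s2) (tmp t) = f v v'"
    using frame_tmp[OF 2(3), of t] 1(4) 2(4) by (simp add: eff)
  ultimately show "\<exists>i s'. i \<le> n + m + 1 \<and> exec (compile_expr d t) s i s' \<and> frame t s s' \<and>
      mem s' (tmp t) = f v v'"
    using 3 1(1) 2(1) by (intro exI[of _ "i + (j + 1)"] exI[of _ "eff p s2"]) auto
qed

lemma compile_expr_correct:
  assumes "3 \<le> t" "wf_expr e" "dims_le (av a) B"
  shows "computes_expr e t (expr_cost e B) (eval e (av a) (aa a)) a"
  using assms
proof (induction e arbitrary: t a)
  case (Num n)
  show ?case unfolding computes_expr_def
  proof (intro allI impI)
    fix s
    show "\<exists>m s'. m \<le> expr_cost (Num n) B \<and> exec (compile_expr (Num n) t) s m s' \<and>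
        frame t s s' \<and> mem s' (tmp t) = eval (Num n) (av a) (aa a)"
      using exec_basic[of "Const (tmp t) n" s]
      by (intro exI[of _ 1] exI[of _ "eff (Const (tmp t) n) s"]) (auto simp: frame_def)
  qed
next
  case (Var x)
  show ?case unfolding computes_expr_def
  proof (intro allI impI)
    fix s assume "rel a s"
    then show "\<exists>m s'. m \<le> expr_cost (Var x) B \<and> exec (compile_expr (Var x) t) s m s' \<and>
        frame t s s' \<and> mem s' (tmp t) = eval (Var x) (av a) (aa a)"
      using exec_block[of "copy (tmp t) (reg x)" s, simplified]
      by (intro exI[of _ 2] exI[of _ "fold eff (copy (tmp t) (reg x)) s"])
        (auto simp: eff_copy frame_def relD(1) simp del: One_nat_def)
  qed
next
  case (Arr j e)
  show ?case unfolding computes_expr_def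
  proof (intro allI impI)
    fix s assume rel: "rel a s"
    let ?v = "eval e (av a) (aa a)"
    obtain n s1 where 1: "n \<le> expr_cost e B" "exec (compile_expr e t) s n s1" "frame t s s1"
      "mem s1 (tmp t) = ?v"
      using Arr.IH[of t a] Arr.prems rel by (auto simp: computes_expr_def)
    have rel1: "rel a s1" using rel_frame[OF rel 1(3)] Arr.prems by simp
    define s2 where "s2 = s1\<lparr>mem := (mem s1)(tmp (t + 1) := length (aa a j) - ?v)\<rparr>"
    have 2: "exec (Sub (tmp (t + 1)) (tmp (arr_index j)) (tmp t)) s1 1 s2"
      using exec_basic[of "Sub (tmp (t + 1)) (tmp (arr_index j)) (tmp t)" s1] 1(4)
      by (simp add: s2_def relD(2)[OF rel1])
    show "\<exists>m s'. m \<le> expr_cost (Arr j e) B \<and> exec (compile_expr (Arr j e) t) s m s' \<and>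
        frame t s s' \<and> mem s' (tmp t) = eval (Arr j e) (av a) (aa a)"
    proof (cases "?v < length (aa a j)")
      case True
      define s3 where "s3 = s2\<lparr>mem := (mem s2)(tmp (t + 1) := off j,
          tmp t := aa a j ! ?v)\<rparr>"
      let ?p = "address (off j) (tmp t) t @ [Load (tmp t) (tmp t)]"
      have "fold eff ?p s2 = s3"
        using relD(3)[OF rel1 True] 1(4)
        by (simp add: eff_address s3_def s2_def fun_upd_twist)
      then have 3: "exec (block ?p) s2 6 s3" using exec_block[of ?p s2] by simp
      have 4: "exec (Cond (tmp (t + 1)) (block ?p) (Const (tmp t) 0)) s2 (6 + 1) s3"
        using True by (intro exec.intros(9) 3) (simp add: s2_def)
      show ?thesis
      proof (intro exI conjI)
        show "exec (compile_expr (Arr j e) t) s (n + (1 + (6 + 1))) s3"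
          unfolding compile_expr.simps by (intro exec.intros(8)[OF 1(2)] exec.intros(8)[OF 2] 4)
        show "frame t s s3" using 1(3) by (auto simp: frame_def s3_def s2_def)
        show "mem s3 (tmp t) = eval (Arr j e) (av a) (aa a)" using True by (simp add: s3_def)
        show "n + (1 + (6 + 1)) \<le> expr_cost (Arr j e) B" using 1(1) by simp
      qed
    next
      case False
      define s3 where "s3 = s2\<lparr>mem := (mem s2)(tmp t := 0)\<rparr>"
      let ?p = "address (off j) (tmp t) t @ [Load (tmp t) (tmp t)]"
      have 3: "exec (Const (tmp t) 0) s2 1 s3"
        using exec_basic[of "Const (tmp t) 0" s2] by (simp add: s3_def)
      have 4: "exec (Cond (tmp (t + 1)) (block ?p) (Const (tmp t) 0)) s2 (1 + 1) s3"
        using False by (intro exec.intros(10) 3) (simp add: s2_def)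
      show ?thesis
      proof (intro exI conjI)
        show "exec (compile_expr (Arr j e) t) s (n + (1 + (1 + 1))) s3"
          unfolding compile_expr.simps by (intro exec.intros(8)[OF 1(2)] exec.intros(8)[OF 2] 4)
        show "frame t s s3" using 1(3) by (auto simp: frame_def s3_def s2_def)
        show "mem s3 (tmp t) = eval (Arr j e) (av a) (aa a)" using False by (simp add: s3_def)
        show "n + (1 + (1 + 1)) \<le> expr_cost (Arr j e) B" using 1(1) by simp
      qed
    qed
  qed
next
  case (Plus e e')
  show ?case
    using computes_binary[where d = "Plus e e'" and p = "Add (tmp t) (tmp t) (tmp (t + 1))" and f = "(+)"]
      Plus.IH(1)[of t a] Plus.IH(2)[of "t + 1" a] Plus.prems by simp
next
  case (Minus e e')
  show ?case
    using computes_binary[where d = "Minus e e'" and p = "Sub (tmp t) (tmp t) (tmp (t + 1))" and f = "(-)"]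
      Minus.IH(1)[of t a] Minus.IH(2)[of "t + 1" a] Minus.prems by simp
next
  case (Ite b e e')
  show ?case unfolding computes_expr_def
  proof (intro allI impI)
    fix s assume rel: "rel a s"
    obtain n s1 where 1: "n \<le> expr_cost b B" "exec (compile_expr b t) s n s1" "frame t s s1"
      "mem s1 (tmp t) = eval b (av a) (aa a)"
      using Ite.IH(1)[of t a] Ite.prems rel by (auto simp: computes_expr_def)
    have rel1: "rel a s1" using rel_frame[OF rel 1(3)] Ite.prems by simp
    obtain m s2 where 2: "m \<le> expr_cost e B" "exec (compile_expr e t) s1 m s2"
      "frame t s1 s2" "mem s2 (tmp t) = eval e (av a) (aa a)"
      using Ite.IH(2)[of t a] Ite.prems rel1 by (auto simp: computes_expr_def)
    obtain l s3 where 3: "l \<le> expr_cost e' B" "exec (compile_expr e' t) s1 l s3"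
      "frame t s1 s3" "mem s3 (tmp t) = eval e' (av a) (aa a)"
      using Ite.IH(3)[of t a] Ite.prems rel1 by (auto simp: computes_expr_def)
    show "\<exists>m s'. m \<le> expr_cost (Ite b e e') B \<and> exec (compile_expr (Ite b e e') t) s m s' \<and>
        frame t s s' \<and> mem s' (tmp t) = eval (Ite b e e') (av a) (aa a)"
    proof (cases "eval b (av a) (aa a) = 0")
      case False
      show ?thesis
      proof (intro exI conjI)
        show "exec (compile_expr (Ite b e e') t) s (n + (m + 1)) s2"
          unfolding compile_expr.simps using False 1(4)
          by (intro exec.intros(8)[OF 1(2)] exec.intros(9) 2(2)) simp
        show "frame t s s2" using 1(3) 2(3) by (auto simp: frame_def)
        show "mem s2 (tmp t) = eval (Ite b e e') (av a) (aa a)" using False 2(4) by simp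
        show "n + (m + 1) \<le> expr_cost (Ite b e e') B" using 1(1) 2(1) by simp
      qed
    next
      case True
      show ?thesis
      proof (intro exI conjI)
        show "exec (compile_expr (Ite b e e') t) s (n + (l + 1)) s3"
          unfolding compile_expr.simps using True 1(4)
          by (intro exec.intros(8)[OF 1(2)] exec.intros(10) 3(2)) simp
        show "frame t s s3" using 1(3) 3(3) by (auto simp: frame_def)
        show "mem s3 (tmp t) = eval (Ite b e e') (av a) (aa a)" using True 3(4) by simp
        show "n + (l + 1) \<le> expr_cost (Ite b e e') B" using 1(1) 3(1) by simp
      qed
    qed
  qed
next
  case (Sum x d e)
  show ?case unfolding computes_expr_def
  proof (intro allI impI)
    fix s assume rel: "rel a s"
    let ?v = "\<lambda>i. eval e ((av a)(x := i)) (aa a)" and ?r = "av a d"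
    have body: "\<exists>n s'. n \<le> expr_cost e B \<and> exec (compile_expr e (t + 3)) s n s' \<and>
        frame (t + 3) s s' \<and> mem s' (tmp (t + 3)) = ?v i"
      if "rel (a\<lparr>av := (av a)(x := i)\<rparr>) s" for i s
    proof -
      have "computes_expr e (t + 3) (expr_cost e B) (?v i) (a\<lparr>av := (av a)(x := i)\<rparr>)"
        using Sum.IH[of "t + 3" "a\<lparr>av := (av a)(x := i)\<rparr>"] Sum.prems
        by (simp del: fun_upd_apply) (simp add: fun_upd_def)
      then show ?thesis using that by (simp add: computes_expr_def)
    qed
    define s1 where "s1 = s\<lparr>mem := (mem s)(tmp (t + 1) := av a x, tmp (t + 2) := ?r,
        tmp t := 0, reg x := 0)\<rparr>"
    let ?p = "copy (tmp (t + 1)) (reg x) @ copy (tmp (t + 2)) (reg d) @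
            [Const (tmp t) 0, Const (reg x) 0]"
    have "fold eff ?p s = s1" by (simp add: eff_copy s1_def relD(1)[OF rel])
    then have 1: "exec (block ?p) s 6 s1" by (intro exec_blockI) (simp_all add: copy_def)
    have rel1: "rel (a\<lparr>av := (av a)(x := 0)\<rparr>) s1"
      using rel Sum.prems by (auto simp: rel_def s1_def)
    obtain n s2 where 2: "n \<le> ?r * (expr_cost e B + 5) + 1" "exec (sum_loop x t (compile_expr e (t + 3))) s1 n s2"
      "rel (a\<lparr>av := (av a)(x := ?r)\<rparr>) s2" "mem s2 (tmp (t + 1)) = mem s1 (tmp (t + 1))"
      "\<forall>k i. 0 < k \<longrightarrow> k < 8 \<longrightarrow> (k = 7 \<longrightarrow> i < t) \<longrightarrow> mem s2 (cell k i) = mem s1 (cell k i)"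
      "mem s2 (tmp t) = mem s1 (tmp t) + (\<Sum>k = 0..<?r. ?v k)"
      using compile_expr_loop[of t ?r a x "expr_cost e B" e ?v 0 s1] body rel1 Sum.prems
      by (auto simp: s1_def)
    define s3 where "s3 = s2\<lparr>mem := (mem s2)(reg x := av a x)\<rparr>"
    have "fold eff (copy (reg x) (tmp (t + 1))) s2 = s3"
      using 2(4) by (simp add: eff_copy s3_def s1_def)
    then have 3: "exec (block (copy (reg x) (tmp (t + 1)))) s2 2 s3"
      by (intro exec_blockI) (simp_all add: copy_def)
    have rel3: "rel a s3" using rel_setv[OF 2(3), of x "av a x"] by (simp add: s3_def)
    have cells: "mem s3 (cell k i) = mem s (cell k i)" if "k < 8" "k = 7 \<longrightarrow> i < t" for k i
    proof (cases "k = 0")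
      case True
      then show ?thesis using relD(1)[OF rel3] relD(1)[OF rel] by simp
    next
      case False
      then show ?thesis using 2(5) that by (auto simp: s3_def s1_def)
    qed
    show "\<exists>m s'. m \<le> expr_cost (Sum x d e) B \<and> exec (compile_expr (Sum x d e) t) s m s' \<and>
        frame t s s' \<and> mem s' (tmp t) = eval (Sum x d e) (av a) (aa a)"
    proof (intro exI conjI)
      show "exec (compile_expr (Sum x d e) t) s (6 + (n + 2)) s3"
        unfolding compile_expr.simps by (intro exec.intros(8)[OF 1] exec.intros(8)[OF 2(2)] 3)
      show "frame t s s3" unfolding frame_def
        using relD(5,6)[OF rel3] relD(5,6)[OF rel] cells by simp
      show "mem s3 (tmp t) = eval (Sum x d e) (av a) (aa a)"
        using 2(6) by (simp add: s3_def s1_def atLeast0LessThan)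
      have "?r * (expr_cost e B + 5) \<le> B * (expr_cost e B + 5)"
        using Sum.prems by (intro mult_right_mono) auto
      then have "n \<le> B * (expr_cost e B + 5) + 1" using 2(1) by linarith
      then show "6 + (n + 2) \<le> expr_cost (Sum x d e) B" by simp
    qed
  qed
qed

subsection \<open>Emitting lists\<close>

text \<open>Programs that print a list. The same language serves the output tape and the lists in
  memory, which are told apart only by \<open>target\<close>.\<close>

datatype emit =
    Emit expr
  | ESeq emit emit
  | EIf expr emit
  | EFor nat nat emit

fun den :: "emit \<Rightarrow> (nat \<Rightarrow> nat) \<Rightarrow> (arr \<Rightarrow> nat list) \<Rightarrow> nat list" where
  "den (Emit e) \<sigma> \<rho> = [eval e \<sigma> \<rho>]"
| "den (ESeq m m') \<sigma> \<rho> = den m \<sigma> \<rho> @ den m' \<sigma> \<rho>"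
| "den (EIf e m) \<sigma> \<rho> = (if eval e \<sigma> \<rho> \<noteq> 0 then den m \<sigma> \<rho> else [])"
| "den (EFor x d m) \<sigma> \<rho> = concat (map (\<lambda>i. den m (\<sigma>(x := i)) \<rho>) [0..<\<sigma> d])"

fun wf_emit :: "emit \<Rightarrow> bool" where
  "wf_emit (Emit e) = wf_expr e"
| "wf_emit (ESeq m m') = (wf_emit m \<and> wf_emit m')"
| "wf_emit (EIf e m) = (wf_expr e \<and> wf_emit m)"
| "wf_emit (EFor x d m) = (20 \<le> x \<and> d < 20 \<and> wf_emit m)"

fun arrs_emit :: "emit \<Rightarrow> arr set" where
  "arrs_emit (Emit e) = arrs_expr e"
| "arrs_emit (ESeq m m') = arrs_emit m \<union> arrs_emit m'"
| "arrs_emit (EIf e m) = arrs_expr e \<union> arrs_emit m"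
| "arrs_emit (EFor x d m) = arrs_emit m"

lemma den_cong: "(\<And>j. j \<in> arrs_emit m \<Longrightarrow> \<rho> j = \<rho>' j) \<Longrightarrow> den m \<sigma> \<rho> = den m \<sigma> \<rho>'"
proof (induction m arbitrary: \<sigma>)
  case (EIf e m)
  then show ?case using eval_cong[of e \<rho> \<rho>' \<sigma>] by auto
next
  case (Emit e)
  then show ?case using eval_cong[of e \<rho> \<rho>' \<sigma>] by auto
next
  case (EFor x d m)
  then have "den m \<tau> \<rho> = den m \<tau> \<rho>'" for \<tau> by simp
  then show ?case by simp
qed auto

fun emit_cost :: "emit \<Rightarrow> nat \<Rightarrow> nat" where
  "emit_cost (Emit e) B = expr_cost e B + 8"
| "emit_cost (ESeq m m') B = emit_cost m B + emit_cost m' B"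
| "emit_cost (EIf e m) B = expr_cost e B + emit_cost m B + 2"
| "emit_cost (EFor x d m) B = B * (emit_cost m B + 4) + 8"

datatype target = Tape | To arr

fun push :: "target \<Rightarrow> nat list \<Rightarrow> astate \<Rightarrow> astate" where
  "push Tape vs a = a\<lparr>aout := aout a @ vs\<rparr>"
| "push (To j) vs a = a\<lparr>aa := (aa a)(j := aa a j @ vs)\<rparr>"

lemma push_simps [simp]:
  "av (push g vs a) = av a" "ain (push g vs a) = ain a" "araw (push g vs a) = araw a"
  "push g vs (push g us a) = push g (us @ vs) a" "push g [] a = a"
  "g \<noteq> To j \<Longrightarrow> aa (push g vs a) j = aa a j"
  "(push g vs a)\<lparr>av := f\<rparr> = push g vs (a\<lparr>av := f\<rparr>)"
  by (cases g; auto)+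

fun compile_push :: "target \<Rightarrow> nat \<Rightarrow> ram list" where
  "compile_push Tape t = [Write (tmp t)]"
| "compile_push (To j) t =
     address (off j) (tmp (arr_index j)) (t + 1) @
     [Store (tmp (t + 1)) (tmp t), Const (tmp (t + 1)) 1,
      Add (tmp (arr_index j)) (tmp (arr_index j)) (tmp (t + 1))]"

abbreviation emit_step :: "nat \<Rightarrow> nat \<Rightarrow> ram" where
  "emit_step x t \<equiv> block [Const (tmp (t + 2)) 1, Add (reg x) (reg x) (tmp (t + 2)),
     Sub (tmp (t + 1)) (tmp (t + 1)) (tmp (t + 2))]"

abbreviation emit_loop :: "nat \<Rightarrow> nat \<Rightarrow> ram \<Rightarrow> ram" where
  "emit_loop x t p \<equiv> While (tmp (t + 1)) (Seq p (emit_step x t))"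

fun compile_emit :: "target \<Rightarrow> emit \<Rightarrow> nat \<Rightarrow> ram" where
  "compile_emit g (Emit e) t = Seq (compile_expr e t) (block (compile_push g t))"
| "compile_emit g (ESeq m m') t = Seq (compile_emit g m t) (compile_emit g m' t)"
| "compile_emit g (EIf e m) t =
     Seq (compile_expr e t) (Cond (tmp t) (compile_emit g m t) (Const (tmp t) 0))"
| "compile_emit g (EFor x d m) t =
     Seq (block (copy (tmp t) (reg x) @ copy (tmp (t + 1)) (reg d) @ [Const (reg x) 0]))
       (Seq
         (emit_loop x t (compile_emit g m (t + 2)))
         (block (copy (reg x) (tmp t))))"

text \<open>The temporaries below 3 are the list lengths; they change when something is pushed and
  are covered by \<open>rel\<close>.\<close>

definition emits :: "ram \<Rightarrow> target \<Rightarrow> nat \<Rightarrow> nat \<Rightarrow> nat list \<Rightarrow> astate \<Rightarrow> bool" where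
  "emits p g t n vs a \<longleftrightarrow> (\<forall>s. rel a s \<longrightarrow> (\<exists>k s'. k \<le> n \<and> exec p s k s' \<and>
     rel (push g vs a) s' \<and> (\<forall>u. 3 \<le> u \<longrightarrow> u < t \<longrightarrow> mem s' (tmp u) = mem s (tmp u))))"

lemma compile_push_correct:
  assumes "rel a s" "3 \<le> t" "mem s (tmp t) = v"
  shows "\<exists>k s'. k \<le> 8 \<and> exec (block (compile_push g t)) s k s' \<and> rel (push g [v] a) s' \<and>
    (\<forall>u. 3 \<le> u \<longrightarrow> u < t \<longrightarrow> mem s' (tmp u) = mem s (tmp u))"
proof (cases g)
  case Tape
  then show ?thesis using assms exec_basic[of "Write (tmp t)" s]
    by (intro exI[of _ 1] exI[of _ "eff (Write (tmp t)) s"]) (auto simp: rel_def)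
next
  case (To j)
  define s' where "s' = s\<lparr>mem := (mem s)(tmp (t + 2) := off j,
      slot j (length (aa a j)) := v, tmp (t + 1) := 1,
      tmp (arr_index j) := length (aa a j) + 1)\<rparr>"
  have "fold eff (compile_push g t) s = s'"
    using assms relD(2)[OF assms(1), of j] by (auto simp: To eff_address s'_def fun_eq_iff)
  then have "exec (block (compile_push g t)) s 8 s'"
    by (intro exec_blockI) (simp_all add: To)
  moreover have "rel (push g [v] a) s'"
    using assms unfolding rel_def s'_def To by (auto simp: nth_append less_Suc_eq)
  ultimately show ?thesis using assms by (intro exI[of _ 8] exI[of _ s']) (auto simp: s'_def)
qed

lemma compile_emit_loop:
  assumes "3 \<le> t"
    and body: "\<And>i us. i < r \<Longrightarrow>
      emits (compile_emit g m (t + 2)) g (t + 2) c (v i) (push g us (a\<lparr>av := (av a)(x := i)\<rparr>))"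
  shows "i \<le> r \<Longrightarrow> rel (push g us (a\<lparr>av := (av a)(x := i)\<rparr>)) s \<Longrightarrow> mem s (tmp (t + 1)) = r - i \<Longrightarrow>
    \<exists>n s'. n \<le> (r - i) * (c + 4) + 1 \<and> exec (emit_loop x t (compile_emit g m (t + 2))) s n s' \<and>
      rel (push g (us @ concat (map v [i..<r])) (a\<lparr>av := (av a)(x := r)\<rparr>)) s' \<and>
      (\<forall>u. 3 \<le> u \<longrightarrow> u \<le> t \<longrightarrow> mem s' (tmp u) = mem s (tmp u))"
proof (induction "r - i" arbitrary: i s us)
  case 0
  then show ?case
    by (intro exI[of _ 1] exI[of _ s]) (auto intro!: exec.intros(11)[unfolded One_nat_def])
next
  case (Suc k)
  then have "i < r" by simp
  from body[OF this] Suc.prems(2) obtain n s1 where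
    1: "n \<le> c" "exec (compile_emit g m (t + 2)) s n s1"
       "rel (push g (us @ v i) (a\<lparr>av := (av a)(x := i)\<rparr>)) s1"
       "\<And>u. 3 \<le> u \<Longrightarrow> u < t + 2 \<Longrightarrow> mem s1 (tmp u) = mem s (tmp u)"
    unfolding emits_def by force
  define s2 where "s2 = s1\<lparr>mem := (mem s1)(tmp (t + 2) := 1,
      reg x := Suc i, tmp (t + 1) := mem s1 (tmp (t + 1)) - 1)\<rparr>"
  have regx: "mem s1 (reg x) = i" using relD(1)[OF 1(3), of x] by simp
  have 2: "exec (emit_step x t) s1 3 s2"
    by (intro exec_blockI) (simp_all add: s2_def regx)
  have rel2: "rel (push g (us @ v i) (a\<lparr>av := (av a)(x := Suc i)\<rparr>)) s2"
    using 1(3) \<open>3 \<le> t\<close> by (cases g) (auto simp: rel_def s2_def)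
  have t2: "mem s2 (tmp (t + 1)) = r - Suc i"
    using 1(4)[of "t + 1"] Suc.prems(3) \<open>3 \<le> t\<close> by (simp add: s2_def)
  obtain l s3 where 3: "l \<le> (r - Suc i) * (c + 4) + 1"
    "exec (emit_loop x t (compile_emit g m (t + 2))) s2 l s3"
    "rel (push g ((us @ v i) @ concat (map v [Suc i..<r])) (a\<lparr>av := (av a)(x := r)\<rparr>)) s3"
    "\<forall>u. 3 \<le> u \<longrightarrow> u \<le> t \<longrightarrow> mem s3 (tmp u) = mem s2 (tmp u)"
    using Suc.hyps(1)[of "Suc i", OF _ _ rel2 t2] Suc.hyps(2) \<open>i < r\<close> by force
  have "(r - i) * (c + 4) = (r - Suc i) * (c + 4) + (c + 4)"
    using \<open>i < r\<close> by (simp add: Suc_diff_Suc[symmetric])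
  then have time: "(n + 3) + l + 1 \<le> (r - i) * (c + 4) + 1" using 1(1) 3(1) by linarith
  have "exec (emit_loop x t (compile_emit g m (t + 2))) s ((n + 3) + l + 1) s3"
    using exec.intros(12)[OF _ exec.intros(8)[OF 1(2) 2] 3(2)] Suc.prems(3) \<open>i < r\<close> by simp
  moreover have "\<forall>u. 3 \<le> u \<longrightarrow> u \<le> t \<longrightarrow> mem s3 (tmp u) = mem s (tmp u)"
    using 3(4) 1(4) by (simp add: s2_def)
  moreover have "rel (push g (us @ concat (map v [i..<r])) (a\<lparr>av := (av a)(x := r)\<rparr>)) s3"
    using 3(3) \<open>i < r\<close> by (simp add: upt_conv_Cons)
  ultimately show ?case using time by blast
qed

text \<open>The list grows while it is computed, so the expressions must not read the list being
  extended. Then \<open>den_cong\<close> allows evaluating all parts in the lists as they were at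
  the start.\<close>

lemma compile_emit_correct:
  assumes "3 \<le> t" "wf_emit m" "dims_le (av a) B" "\<And>j. g = To j \<Longrightarrow> j \<notin> arrs_emit m"
  shows "emits (compile_emit g m t) g t (emit_cost m B) (den m (av a) (aa a)) a"
  using assms
proof (induction m arbitrary: t a)
  case (Emit e)
  show ?case unfolding emits_def
  proof (intro allI impI)
    fix s assume rel: "rel a s"
    obtain n s1 where 1: "n \<le> expr_cost e B" "exec (compile_expr e t) s n s1" "frame t s s1"
      "mem s1 (tmp t) = eval e (av a) (aa a)"
      using compile_expr_correct[of t e a B] Emit.prems rel by (auto simp: computes_expr_def)
    have rel1: "rel a s1" using rel_frame[OF rel 1(3)] Emit.prems by simp
    obtain k s2 where 2: "k \<le> 8" "exec (block (compile_push g t)) s1 k s2"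
      "rel (push g [eval e (av a) (aa a)] a) s2"
      "\<forall>u. 3 \<le> u \<longrightarrow> u < t \<longrightarrow> mem s2 (tmp u) = mem s1 (tmp u)"
      using compile_push_correct[OF rel1 Emit.prems(1) 1(4)] by blast
    show "\<exists>k s'. k \<le> emit_cost (Emit e) B \<and> exec (compile_emit g (Emit e) t) s k s' \<and>
       rel (push g (den (Emit e) (av a) (aa a)) a) s' \<and>
       (\<forall>u\<ge>3. u < t \<longrightarrow> mem s' (tmp u) = mem s (tmp u))"
      using exec.intros(8)[OF 1(2) 2(2)] 1 2 frame_tmp[OF 1(3)]
      by (intro exI[of _ "n + k"] exI[of _ s2]) auto
  qed
next
  case (ESeq m m')
  show ?case unfolding emits_def
  proof (intro allI impI)
    fix s assume rel: "rel a s"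
    let ?a = "push g (den m (av a) (aa a)) a"
    have "den m' (av a) (aa ?a) = den m' (av a) (aa a)"
      using ESeq.prems by (intro den_cong) (force intro: push_simps(6))
    then have IH2: "emits (compile_emit g m' t) g t (emit_cost m' B) (den m' (av a) (aa a)) ?a"
      using ESeq.IH(2)[of t ?a] ESeq.prems by auto
    have IH1: "emits (compile_emit g m t) g t (emit_cost m B) (den m (av a) (aa a)) a"
      using ESeq.IH(1)[of t a] ESeq.prems by auto
    from IH1 rel obtain k s1 where 1: "k \<le> emit_cost m B" "exec (compile_emit g m t) s k s1"
      "rel ?a s1" "\<forall>u. 3 \<le> u \<longrightarrow> u < t \<longrightarrow> mem s1 (tmp u) = mem s (tmp u)"
      unfolding emits_def by blast
    from IH2 1(3) obtain l s2 where 2: "l \<le> emit_cost m' B" "exec (compile_emit g m' t) s1 l s2"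
      "rel (push g (den m' (av a) (aa a)) ?a) s2"
      "\<forall>u. 3 \<le> u \<longrightarrow> u < t \<longrightarrow> mem s2 (tmp u) = mem s1 (tmp u)"
      unfolding emits_def by blast
    show "\<exists>k s'. k \<le> emit_cost (ESeq m m') B \<and> exec (compile_emit g (ESeq m m') t) s k s' \<and>
       rel (push g (den (ESeq m m') (av a) (aa a)) a) s' \<and>
       (\<forall>u\<ge>3. u < t \<longrightarrow> mem s' (tmp u) = mem s (tmp u))"
      using exec.intros(8)[OF 1(2) 2(2)] 1 2
      by (intro exI[of _ "k + l"] exI[of _ s2]) auto
  qed
next
  case (EIf e m)
  show ?case unfolding emits_def
  proof (intro allI impI)
    fix s assume rel: "rel a s"
    obtain n s1 where 1: "n \<le> expr_cost e B" "exec (compile_expr e t) s n s1" "frame t s s1"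
      "mem s1 (tmp t) = eval e (av a) (aa a)"
      using compile_expr_correct[of t e a B] EIf.prems rel by (auto simp: computes_expr_def)
    have rel1: "rel a s1" using rel_frame[OF rel 1(3)] EIf.prems by simp
    show "\<exists>k s'. k \<le> emit_cost (EIf e m) B \<and> exec (compile_emit g (EIf e m) t) s k s' \<and>
       rel (push g (den (EIf e m) (av a) (aa a)) a) s' \<and>
       (\<forall>u\<ge>3. u < t \<longrightarrow> mem s' (tmp u) = mem s (tmp u))"
    proof (cases "eval e (av a) (aa a) = 0")
      case False
      have "emits (compile_emit g m t) g t (emit_cost m B) (den m (av a) (aa a)) a"
        using EIf.IH[of t a] EIf.prems by auto
      then obtain k s2 where 2: "k \<le> emit_cost m B" "exec (compile_emit g m t) s1 k s2"
        "rel (push g (den m (av a) (aa a)) a) s2"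
        "\<forall>u. 3 \<le> u \<longrightarrow> u < t \<longrightarrow> mem s2 (tmp u) = mem s1 (tmp u)"
        using rel1 unfolding emits_def by blast
      have "exec (compile_emit g (EIf e m) t) s (n + (k + 1)) s2"
        using False 1(4) unfolding compile_emit.simps
        by (intro exec.intros(8)[OF 1(2)] exec.intros(9)[OF _ 2(2)]) simp
      then show ?thesis using 1 2 False frame_tmp[OF 1(3)]
        by (intro exI[of _ "n + (k + 1)"] exI[of _ s2]) auto
    next
      case True
      define s2 where "s2 = eff (Const (tmp t) 0) s1"
      have 2: "exec (Const (tmp t) 0) s1 1 s2" unfolding s2_def by (rule exec_basic) simp
      have "exec (compile_emit g (EIf e m) t) s (n + (1 + 1)) s2"
        using True 1(4) unfolding compile_emit.simps
        by (intro exec.intros(8)[OF 1(2)] exec.intros(10)[OF _ 2]) simp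
      moreover have "rel a s2"
        by (rule rel_frame[OF rel1, of t]) (use EIf.prems in \<open>auto simp: frame_def s2_def\<close>)
      ultimately show ?thesis using 1 True frame_tmp[OF 1(3)]
        by (intro exI[of _ "n + (1 + 1)"] exI[of _ s2]) (auto simp: s2_def)
    qed
  qed
next
  case (EFor x d m)
  show ?case unfolding emits_def
  proof (intro allI impI)
    fix s assume rel: "rel a s"
    let ?v = "\<lambda>i. den m ((av a)(x := i)) (aa a)" and ?r = "av a d"
    have body: "emits (compile_emit g m (t + 2)) g (t + 2) (emit_cost m B) (?v i)
        (push g us (a\<lparr>av := (av a)(x := i)\<rparr>))" for i us
    proof -
      have "den m ((av a)(x := i)) (aa (push g us (a\<lparr>av := (av a)(x := i)\<rparr>))) = ?v i"
      proof (rule den_cong)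
        fix j assume "j \<in> arrs_emit m"
        then have "g \<noteq> To j" using EFor.prems by auto
        then show "aa (push g us (a\<lparr>av := (av a)(x := i)\<rparr>)) j = aa a j"
          by (simp del: push_simps(7))
      qed
      moreover have "emits (compile_emit g m (t + 2)) g (t + 2) (emit_cost m B)
          (den m (av (push g us (a\<lparr>av := (av a)(x := i)\<rparr>))) (aa (push g us (a\<lparr>av := (av a)(x := i)\<rparr>))))
          (push g us (a\<lparr>av := (av a)(x := i)\<rparr>))"
        using EFor.prems by (intro EFor.IH) auto
      ultimately show ?thesis by simp
    qed
    define s1 where "s1 = s\<lparr>mem := (mem s)(tmp t := av a x, tmp (t + 1) := ?r, reg x := 0)\<rparr>"
    let ?p = "copy (tmp t) (reg x) @ copy (tmp (t + 1)) (reg d) @ [Const (reg x) 0]"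
    have "fold eff ?p s = s1" by (simp add: eff_copy s1_def relD(1)[OF rel])
    then have 1: "exec (block ?p) s 5 s1" by (intro exec_blockI) (simp_all add: copy_def)
    have rel1: "rel (push g [] (a\<lparr>av := (av a)(x := 0)\<rparr>)) s1"
      using rel EFor.prems by (auto simp: rel_def s1_def)
    have t1: "mem s1 (tmp (t + 1)) = ?r - 0" by (simp add: s1_def)
    from compile_emit_loop[OF EFor.prems(1) body _ rel1 t1] obtain n s2 where
      2: "n \<le> ?r * (emit_cost m B + 4) + 1" "exec (emit_loop x t (compile_emit g m (t + 2))) s1 n s2"
        "rel (push g (concat (map ?v [0..<?r])) (a\<lparr>av := (av a)(x := ?r)\<rparr>)) s2"
        "\<forall>u. 3 \<le> u \<longrightarrow> u \<le> t \<longrightarrow> mem s2 (tmp u) = mem s1 (tmp u)" by auto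
    define s3 where "s3 = s2\<lparr>mem := (mem s2)(reg x := av a x)\<rparr>"
    have "mem s2 (tmp t) = av a x" using 2(4) EFor.prems(1) by (simp add: s1_def)
    then have "fold eff (copy (reg x) (tmp t)) s2 = s3" by (simp add: eff_copy s3_def)
    then have 3: "exec (block (copy (reg x) (tmp t))) s2 2 s3"
      by (intro exec_blockI) (simp_all add: copy_def)
    have rel3: "rel (push g (concat (map ?v [0..<?r])) a) s3"
      using rel_setv[OF 2(3), of x "av a x"] by (simp add: s3_def)
    have "?r * (emit_cost m B + 4) \<le> B * (emit_cost m B + 4)"
      using EFor.prems by (intro mult_right_mono) auto
    then have "n \<le> B * (emit_cost m B + 4) + 1" using 2(1) by linarith
    then have time: "5 + (n + 2) \<le> emit_cost (EFor x d m) B" by simp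
    have "exec (compile_emit g (EFor x d m) t) s (5 + (n + 2)) s3"
      unfolding compile_emit.simps by (intro exec.intros(8)[OF 1] exec.intros(8)[OF 2(2)] 3)
    moreover have "\<forall>u. 3 \<le> u \<longrightarrow> u < t \<longrightarrow> mem s3 (tmp u) = mem s (tmp u)"
      using 2(4) by (auto simp: s3_def s1_def)
    ultimately show "\<exists>k s'. k \<le> emit_cost (EFor x d m) B \<and>
       exec (compile_emit g (EFor x d m) t) s k s' \<and>
       rel (push g (den (EFor x d m) (av a) (aa a)) a) s' \<and>
       (\<forall>u\<ge>3. u < t \<longrightarrow> mem s' (tmp u) = mem s (tmp u))"
      using time rel3 by (metis den.simps(4))
  qed
qed

subsection \<open>Commands\<close>

text \<open>A Hoare triple with a time bound. It speaks of every machine state that represents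
  \<open>a\<close>, so that the garbage left by one program cannot disturb the next one.\<close>

definition does :: "ram \<Rightarrow> astate \<Rightarrow> nat \<Rightarrow> astate \<Rightarrow> bool" where
  "does p a n a' \<longleftrightarrow> (\<forall>s. rel a s \<longrightarrow> (\<exists>k s'. k \<le> n \<and> exec p s k s' \<and> rel a' s'))"

lemma does_mono: "does p a n a' \<Longrightarrow> n \<le> m \<Longrightarrow> does p a m a'"
  unfolding does_def by (meson order_trans)

lemma does_Seq:
  assumes "does p a n a'" "does q a' m a''"
  shows "does (Seq p q) a (n + m) a''"
  unfolding does_def
proof (intro allI impI)
  fix s assume "rel a s"
  then obtain k s' where 1: "k \<le> n" "exec p s k s'" "rel a' s'"
    using assms(1) by (auto simp: does_def)
  then obtain l s'' where 2: "l \<le> m" "exec q s' l s''" "rel a'' s''"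
    using assms(2) by (auto simp: does_def)
  show "\<exists>k s'. k \<le> n + m \<and> exec (Seq p q) s k s' \<and> rel a'' s'"
    using exec.intros(8)[OF 1(2) 2(2)] 1(1) 2 add_mono by blast
qed

lemma does_While_exit: "av a x = 0 \<Longrightarrow> does (While (reg x) p) a 1 a"
  unfolding does_def using exec.intros(11) relD(1) by (metis order_refl)

lemma does_While_raw_exit: "araw a i = 0 \<Longrightarrow> does (While (raw i) p) a 1 a"
  unfolding does_def using exec.intros(11) relD(4) by (metis order_refl)

lemma does_While:
  assumes "\<And>i. i < r \<Longrightarrow> av (A i) x \<noteq> 0" "\<And>i. i < r \<Longrightarrow> does p (A i) n (A (Suc i))"
    and "av (A r) x = 0"
  shows "does (While (reg x) p) (A 0) (r * (n + 1) + 1) (A r)"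
proof -
  have "does (While (reg x) p) (A i) ((r - i) * (n + 1) + 1) (A r)" if "i \<le> r" for i
    using that
  proof (induction "r - i" arbitrary: i)
    case 0
    then have "i = r" by simp
    then show ?case using does_While_exit[of "A r" x p] assms(3) by simp
  next
    case (Suc k)
    then have "i < r" by simp
    show ?case unfolding does_def
    proof (intro allI impI)
      fix s assume rel: "rel (A i) s"
      obtain l s1 where 1: "l \<le> n" "exec p s l s1" "rel (A (Suc i)) s1"
        using assms(2)[OF \<open>i < r\<close>] rel by (auto simp: does_def)
      obtain m s2 where 2: "m \<le> (r - Suc i) * (n + 1) + 1" "exec (While (reg x) p) s1 m s2"
        "rel (A r) s2"
        using Suc.hyps(1)[of "Suc i"] Suc.hyps(2) \<open>i < r\<close> 1(3) unfolding does_def by force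
      have "exec (While (reg x) p) s (l + m + 1) s2"
        using assms(1)[OF \<open>i < r\<close>] relD(1)[OF rel, of x]
        by (intro exec.intros(12)[OF _ 1(2) 2(2)]) simp
      moreover have "(r - i) * (n + 1) = (r - Suc i) * (n + 1) + (n + 1)"
        using \<open>i < r\<close> by (simp add: Suc_diff_Suc[symmetric])
      then have "l + m + 1 \<le> (r - i) * (n + 1) + 1" using 1(1) 2(1) by linarith
      ultimately show "\<exists>k s'. k \<le> (r - i) * (n + 1) + 1 \<and> exec (While (reg x) p) s k s' \<and>
          rel (A r) s'" using 2(3) by blast
    qed
  qed
  from this[of 0] show ?thesis by simp
qed

definition assign :: "nat \<Rightarrow> expr \<Rightarrow> ram" where
  "assign x e = Seq (compile_expr e 3) (block (copy (reg x) (tmp 3)))"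

lemma does_assign:
  assumes "wf_expr e" "dims_le (av a) B"
  shows "does (assign x e) a (expr_cost e B + 2) (a\<lparr>av := (av a)(x := eval e (av a) (aa a))\<rparr>)"
  unfolding does_def
proof (intro allI impI)
  fix s assume rel: "rel a s"
  let ?v = "eval e (av a) (aa a)"
  obtain n s1 where 1: "n \<le> expr_cost e B" "exec (compile_expr e 3) s n s1" "frame 3 s s1"
    "mem s1 (tmp 3) = ?v"
    using compile_expr_correct[of 3 e a B] assms rel by (auto simp: computes_expr_def)
  have rel1: "rel a s1" using rel_frame[OF rel 1(3)] by simp
  define s2 where "s2 = s1\<lparr>mem := (mem s1)(reg x := ?v)\<rparr>"
  have "fold eff (copy (reg x) (tmp 3)) s1 = s2" by (simp add: eff_copy s2_def 1(4))
  then have 2: "exec (block (copy (reg x) (tmp 3))) s1 2 s2"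
    by (intro exec_blockI) (simp_all add: copy_def)
  show "\<exists>k s'. k \<le> expr_cost e B + 2 \<and> exec (assign x e) s k s' \<and>
      rel (a\<lparr>av := (av a)(x := ?v)\<rparr>) s'"
    unfolding assign_def using exec.intros(8)[OF 1(2) 2] 1(1) rel_setv[OF rel1, of x ?v]
    by (intro exI[of _ "n + 2"] exI[of _ s2]) (auto simp: s2_def)
qed

lemma does_emit:
  assumes "wf_emit m" "dims_le (av a) B" "\<And>j. g = To j \<Longrightarrow> j \<notin> arrs_emit m"
  shows "does (compile_emit g m 3) a (emit_cost m B) (push g (den m (av a) (aa a)) a)"
  using compile_emit_correct[OF _ assms, of 3] unfolding does_def emits_def by fastforce

lemma does_clear:
  "does (Const (tmp (arr_index j)) 0) a 1 (a\<lparr>aa := (aa a)(j := [])\<rparr>)"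
  unfolding does_def
proof (intro allI impI)
  fix s assume "rel a s"
  then show "\<exists>k s'. k \<le> 1 \<and> exec (Const (tmp (arr_index j)) 0) s k s' \<and>
      rel (a\<lparr>aa := (aa a)(j := [])\<rparr>) s'"
    using exec_basic[of "Const (tmp (arr_index j)) 0" s]
    by (intro exI[of _ 1] exI[of _ "eff (Const (tmp (arr_index j)) 0) s"]) (auto simp: rel_def)
qed

lemma does_Read:
  "does (Read (reg x)) a 1
     (a\<lparr>av := (av a)(x := (case ain a of [] \<Rightarrow> 0 | v # _ \<Rightarrow> v)), ain := tl (ain a)\<rparr>)"
  unfolding does_def
proof (intro allI impI)
  fix s assume "rel a s"
  then show "\<exists>k s'. k \<le> 1 \<and> exec (Read (reg x)) s k s' \<and> rel
     (a\<lparr>av := (av a)(x := (case ain a of [] \<Rightarrow> 0 | v # _ \<Rightarrow> v)), ain := tl (ain a)\<rparr>) s'"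
    using exec_basic[of "Read (reg x)" s]
    by (intro exI[of _ 1] exI[of _ "eff (Read (reg x)) s"]) (auto simp: rel_def)
qed

subsection \<open>Subroutines\<close>

text \<open>
  The simulated program keeps its memory in the cells of the form \<open>raw i\<close>, takes its
  input from \<open>A0\<close>, from the position in variable 30 on, and appends its output to
  \<open>A1\<close>. Variable 31 bounds the addresses of the nonzero cells, so that its memory can be
  cleared afterwards.
\<close>

fun hosted :: "ram \<Rightarrow> ram" where
  "hosted (Const i c) = Const (raw i) c"
| "hosted (Add i j l) = Add (raw i) (raw j) (raw l)"
| "hosted (Sub i j l) = Sub (raw i) (raw j) (raw l)"
| "hosted (Load i j) = block (address 6 (raw j) 3 @ [Load (raw i) (tmp 3)])"
| "hosted (Store i j) = block (address 6 (raw i) 3 @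
     [Sub (tmp 4) (raw i) (reg 31), Add (reg 31) (reg 31) (tmp 4), Store (tmp 3) (raw j)])"
| "hosted (Read i) = Seq (compile_expr (Arr A0 (Var 30)) 3)
     (block (copy (raw i) (tmp 3) @ [Const (tmp 3) 1, Add (reg 30) (reg 30) (tmp 3)]))"
| "hosted (Write i) = Seq (block (copy (tmp 3) (raw i))) (block (compile_push (To A1) 3))"
| "hosted (Seq p q) = Seq (hosted p) (hosted q)"
| "hosted (Cond i p q) = Cond (raw i) (hosted p) (hosted q)"
| "hosted (While i p) = While (raw i) (hosted p)"

text \<open>Cells addressed directly never exceed this number, so it is a start value for the bound
  in variable 31; only \<open>Store\<close> can go beyond it.\<close>

fun max_reg :: "ram \<Rightarrow> nat" where
  "max_reg (Const i c) = i"
| "max_reg (Add i j l) = max i (max j l)"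
| "max_reg (Sub i j l) = max i (max j l)"
| "max_reg (Load i j) = max i j"
| "max_reg (Store i j) = max i j"
| "max_reg (Read i) = i"
| "max_reg (Write i) = i"
| "max_reg (Seq p q) = max (max_reg p) (max_reg q)"
| "max_reg (Cond i p q) = max i (max (max_reg p) (max_reg q))"
| "max_reg (While i p) = max i (max_reg p)"

definition sim_state :: "astate \<Rightarrow> ram_state \<Rightarrow> nat \<Rightarrow> nat \<Rightarrow> nat list \<Rightarrow> astate" where
  "sim_state a s p m vs = a\<lparr>av := (av a)(30 := p, 31 := m), araw := mem s,
     aa := (aa a)(A1 := aa a A1 @ vs)\<rparr>"

text \<open>\<open>p\<close> is the position in the input and \<open>m\<close> the address bound;
  they are quantified inside, so that consecutive simulations can be chained. A step of the
  simulated program costs at most 20, the dearest instruction being \<open>Read\<close> with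
  14.\<close>

definition simulates :: "astate \<Rightarrow> nat \<Rightarrow> ram_state \<Rightarrow> ram \<Rightarrow> nat \<Rightarrow> nat list \<Rightarrow> ram_state \<Rightarrow> bool" where
  "simulates a c s q n us s' \<longleftrightarrow> (\<forall>p m. inp s = drop p (aa a A0) \<longrightarrow> c \<le> m \<longrightarrow>
     (\<forall>i > m. mem s i = 0) \<longrightarrow>
     (\<exists>p' m' vs. inp s' = drop p' (aa a A0) \<and> m \<le> m' \<and> (\<forall>i > m'. mem s' i = 0) \<and>
        outp s' = outp s @ vs \<and>
        does q (sim_state a s p m us) (20 * n) (sim_state a s' p' m' (us @ vs))))"

lemma does_block:
  assumes "\<And>s. rel a s \<Longrightarrow> rel a' (fold eff ps s)" "list_all basic ps" "ps \<noteq> []" "length ps \<le> n"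
  shows "does (block ps) a n a'"
  unfolding does_def using exec_block[OF assms(2,3)] assms(1,4) by blast

lemma does_Cond:
  assumes "araw a i \<noteq> 0 \<Longrightarrow> does p a n a'" "araw a i = 0 \<Longrightarrow> does q a n a'"
  shows "does (Cond (raw i) p q) a (n + 1) a'"
  unfolding does_def
proof (intro allI impI)
  fix s assume rel: "rel a s"
  show "\<exists>k s'. k \<le> n + 1 \<and> exec (Cond (raw i) p q) s k s' \<and> rel a' s'"
  proof (cases "araw a i = 0")
    case True
    then obtain k s' where "k \<le> n" "exec q s k s'" "rel a' s'"
      using assms(2) rel by (auto simp: does_def)
    then show ?thesis using exec.intros(10)[of s "raw i" q k s' p] relD(4)[OF rel, of i] True
      by (intro exI[of _ "k + 1"] exI[of _ s']) auto
  next
    case False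
    then obtain k s' where "k \<le> n" "exec p s k s'" "rel a' s'"
      using assms(1) rel by (auto simp: does_def)
    then show ?thesis using exec.intros(9)[of s "raw i" p k s' q] relD(4)[OF rel, of i] False
      by (intro exI[of _ "k + 1"] exI[of _ s']) auto
  qed
qed

lemma does_While_raw:
  assumes "araw a i \<noteq> 0" "does p a n a'" "does (While (raw i) p) a' m a''"
  shows "does (While (raw i) p) a (n + m + 1) a''"
  unfolding does_def
proof (intro allI impI)
  fix s assume rel: "rel a s"
  obtain k s1 where 1: "k \<le> n" "exec p s k s1" "rel a' s1"
    using assms(2) rel by (auto simp: does_def)
  obtain l s2 where 2: "l \<le> m" "exec (While (raw i) p) s1 l s2" "rel a'' s2"
    using assms(3) 1(3) by (auto simp: does_def)
  show "\<exists>k s'. k \<le> n + m + 1 \<and> exec (While (raw i) p) s k s' \<and> rel a'' s'"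
    using exec.intros(12)[OF _ 1(2) 2(2)] assms(1) relD(4)[OF rel, of i] 1 2
    by (intro exI[of _ "k + l + 1"] exI[of _ s2]) auto
qed

lemma simulatesI:
  assumes "\<And>p m. inp s = drop p (aa a A0) \<Longrightarrow> c \<le> m \<Longrightarrow> \<forall>i > m. mem s i = 0 \<Longrightarrow>
    \<exists>p' m' vs. inp s' = drop p' (aa a A0) \<and> m \<le> m' \<and> (\<forall>i > m'. mem s' i = 0) \<and>
        outp s' = outp s @ vs \<and>
        does q (sim_state a s p m us) (20 * n) (sim_state a s' p' m' (us @ vs))"
  shows "simulates a c s q n us s'"
  using assms unfolding simulates_def by blast

lemma simulatesE:
  assumes "simulates a c s q n us s'" "inp s = drop p (aa a A0)" "c \<le> m" "\<forall>i > m. mem s i = 0"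
  obtains p' m' vs where "inp s' = drop p' (aa a A0)" "m \<le> m'" "\<forall>i > m'. mem s' i = 0"
    "outp s' = outp s @ vs"
    "does q (sim_state a s p m us) (20 * n) (sim_state a s' p' m' (us @ vs))"
  using assms unfolding simulates_def by blast

lemma simulates_basic:
  assumes "inp s' = inp s" "outp s' = outp s" "\<And>m. c \<le> m \<Longrightarrow> \<forall>i > m. mem s i = 0 \<Longrightarrow> \<forall>i > m. mem s' i = 0"
    and "\<And>p m. does q (sim_state a s p m us) 20 (sim_state a s' p m us)"
  shows "simulates a c s q 1 us s'"
proof (rule simulatesI)
  fix p m assume "inp s = drop p (aa a A0)" "c \<le> m" "\<forall>i>m. mem s i = 0"
  then show "\<exists>p' m' vs. inp s' = drop p' (aa a A0) \<and> m \<le> m' \<and> (\<forall>i > m'. mem s' i = 0) \<and>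
        outp s' = outp s @ vs \<and>
        does q (sim_state a s p m us) (20 * 1) (sim_state a s' p' m' (us @ vs))"
    using assms by (intro exI[of _ p] exI[of _ m] exI[of _ "[]"]) simp
qed

lemma hosted_correct:
  "exec q s n s' \<Longrightarrow> max_reg q \<le> c \<Longrightarrow> simulates a c s (hosted q) n us s'"
proof (induction arbitrary: us rule: exec.induct)
  case (1 i c s)
  show ?case
    by (rule simulates_basic) (use 1 in \<open>auto intro!: does_block[of _ _ "[Const (raw i) c]", simplified]
      simp: rel_def sim_state_def\<close>)
next
  case (2 i j l s)
  show ?case
    by (rule simulates_basic) (use 2 in \<open>auto intro!: does_block[of _ _ "[Add (raw i) (raw j) (raw l)]", simplified]
      simp: rel_def sim_state_def\<close>)
next
  case (3 i j l s)
  show ?case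
    by (rule simulates_basic) (use 3 in \<open>auto intro!: does_block[of _ _ "[Sub (raw i) (raw j) (raw l)]", simplified]
      simp: rel_def sim_state_def\<close>)
next
  case (4 i j s)
  show ?case unfolding hosted.simps
    by (rule simulates_basic) (use 4 in \<open>auto intro!: does_block
      simp: eff_address rel_def sim_state_def\<close>)
next
  case (5 i j s)
  show ?case
  proof (rule simulatesI)
    fix p m assume *: "inp s = drop p (aa a A0)" "c \<le> m" "\<forall>i>m. mem s i = 0"
    \<comment> \<open>Truncated subtraction makes \<open>?m\<close> the maximum of \<open>m\<close>
      and the address written to.\<close>
    let ?s' = "s\<lparr>mem := (mem s)(mem s i := mem s j)\<rparr>" and ?m = "m + (mem s i - m)"
    have "does (hosted (Store i j)) (sim_state a s p m us) (20 * 1) (sim_state a ?s' p ?m us)"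
      unfolding hosted.simps
      by (rule does_block) (auto simp: eff_address rel_def sim_state_def)
    then show "\<exists>p' m' vs. inp ?s' = drop p' (aa a A0) \<and> m \<le> m' \<and> (\<forall>i > m'. mem ?s' i = 0) \<and>
        outp ?s' = outp s @ vs \<and>
        does (hosted (Store i j)) (sim_state a s p m us) (20 * 1) (sim_state a ?s' p' m' (us @ vs))"
      using * by (intro exI[of _ p] exI[of _ ?m] exI[of _ "[]"]) auto
  qed
next
  case (6 i s)
  show ?case
  proof (rule simulatesI)
    fix p m assume *: "inp s = drop p (aa a A0)" "c \<le> m" "\<forall>i>m. mem s i = 0"
    let ?v = "case inp s of [] \<Rightarrow> 0 | a # _ \<Rightarrow> a"
    let ?s' = "s\<lparr>mem := (mem s)(i := ?v), inp := tl (inp s)\<rparr>"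
    let ?p = "copy (raw i) (tmp 3) @ [Const (tmp 3) 1, Add (reg 30) (reg 30) (tmp 3)]"
    have v: "eval (Arr A0 (Var 30)) (av (sim_state a s p m us)) (aa (sim_state a s p m us)) = ?v"
      using *(1) by (auto simp: sim_state_def hd_drop_conv_nth split: list.split)
        (metis hd_drop_conv_nth list.sel(1))
    have "does (hosted (Read i)) (sim_state a s p m us) (20 * 1) (sim_state a ?s' (Suc p) m us)"
      unfolding does_def
    proof (intro allI impI)
      fix z assume rel: "rel (sim_state a s p m us) z"
      obtain n z1 where 1: "n \<le> 10" "exec (compile_expr (Arr A0 (Var 30)) 3) z n z1" "frame 3 z z1"
        "mem z1 (tmp 3) = ?v"
        using compile_expr_correct[of 3 "Arr A0 (Var 30)" "sim_state a s p m us"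
            "Max (av (sim_state a s p m us) ` {..<20})"] rel
        unfolding computes_expr_def v by (auto intro!: Max_ge)
      have rel1: "rel (sim_state a s p m us) z1" using rel_frame[OF rel 1(3)] by simp
      show "\<exists>k s''. k \<le> 20 * 1 \<and> exec (hosted (Read i)) z k s'' \<and> rel (sim_state a ?s' (Suc p) m us) s''"
      proof (intro exI conjI)
        show "exec (hosted (Read i)) z (n + 4) (fold eff ?p z1)"
          unfolding hosted.simps by (intro exec.intros(8)[OF 1(2)] exec_blockI) (simp_all add: copy_def)
        show "n + 4 \<le> 20 * 1" using 1(1) by simp
        show "rel (sim_state a ?s' (Suc p) m us) (fold eff ?p z1)"
          using rel1 1(4) by (auto simp: eff_copy rel_def sim_state_def)
      qed
    qed
    moreover have "inp ?s' = drop (Suc p) (aa a A0)" using *(1) by (simp add: drop_Suc drop_tl)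
    ultimately show "\<exists>p' m' vs. inp ?s' = drop p' (aa a A0) \<and> m \<le> m' \<and> (\<forall>i > m'. mem ?s' i = 0) \<and>
        outp ?s' = outp s @ vs \<and>
        does (hosted (Read i)) (sim_state a s p m us) (20 * 1) (sim_state a ?s' p' m' (us @ vs))"
      using * 6 by (intro exI[of _ "Suc p"] exI[of _ m] exI[of _ "[]"]) auto
  qed
next
  case (7 i s)
  show ?case
  proof (rule simulatesI)
    fix p m assume *: "inp s = drop p (aa a A0)" "c \<le> m" "\<forall>i>m. mem s i = 0"
    let ?s' = "s\<lparr>outp := outp s @ [mem s i]\<rparr>"
    have "does (hosted (Write i)) (sim_state a s p m us) (20 * 1) (sim_state a ?s' p m (us @ [mem s i]))"
      unfolding does_def
    proof (intro allI impI)
      fix z assume rel: "rel (sim_state a s p m us) z"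
      define z1 where "z1 = fold eff (copy (tmp 3) (raw i)) z"
      have 1: "exec (block (copy (tmp 3) (raw i))) z 2 z1"
        by (intro exec_blockI) (simp_all add: copy_def z1_def)
      have rel1: "rel (sim_state a s p m us) z1" "mem z1 (tmp 3) = mem s i"
        using rel by (auto simp: z1_def eff_copy rel_def sim_state_def)
      obtain k z2 where 2: "k \<le> 8" "exec (block (compile_push (To A1) 3)) z1 k z2"
        "rel (push (To A1) [mem s i] (sim_state a s p m us)) z2"
        using compile_push_correct[OF rel1(1) _ rel1(2), of "To A1"] by auto
      show "\<exists>k s''. k \<le> 20 * 1 \<and> exec (hosted (Write i)) z k s'' \<and>
          rel (sim_state a ?s' p m (us @ [mem s i])) s''"
        using exec.intros(8)[OF 1 2(2)] 2
        by (intro exI[of _ "2 + k"] exI[of _ z2]) (auto simp: sim_state_def)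
    qed
    then show "\<exists>p' m' vs. inp ?s' = drop p' (aa a A0) \<and> m \<le> m' \<and> (\<forall>i > m'. mem ?s' i = 0) \<and>
        outp ?s' = outp s @ vs \<and>
        does (hosted (Write i)) (sim_state a s p m us) (20 * 1) (sim_state a ?s' p' m' (us @ vs))"
      using * by (intro exI[of _ p] exI[of _ m] exI[of _ "[mem s i]"]) auto
  qed
next
  case (8 p1 s t s' p2 t' s'')
  show ?case
  proof (rule simulatesI)
    fix p m assume *: "inp s = drop p (aa a A0)" "c \<le> m" "\<forall>i>m. mem s i = 0"
    obtain p' m' vs where 1: "inp s' = drop p' (aa a A0)" "m \<le> m'" "\<forall>i > m'. mem s' i = 0"
      "outp s' = outp s @ vs"
      "does (hosted p1) (sim_state a s p m us) (20 * t) (sim_state a s' p' m' (us @ vs))"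
      by (rule simulatesE[OF 8(3)[of us] *]) (use 8(5) in auto)
    have cm: "c \<le> m'" using 1(2) *(2) by simp
    obtain p'' m'' ws where 2: "inp s'' = drop p'' (aa a A0)" "m' \<le> m''" "\<forall>i > m''. mem s'' i = 0"
      "outp s'' = outp s' @ ws"
      "does (hosted p2) (sim_state a s' p' m' (us @ vs)) (20 * t') (sim_state a s'' p'' m'' ((us @ vs) @ ws))"
      by (rule simulatesE[OF 8(4)[of "us @ vs"] 1(1) cm 1(3)]) (use 8(5) in auto)
    show "\<exists>p' m' vs. inp s'' = drop p' (aa a A0) \<and> m \<le> m' \<and> (\<forall>i > m'. mem s'' i = 0) \<and>
        outp s'' = outp s @ vs \<and>
        does (hosted (Seq p1 p2)) (sim_state a s p m us) (20 * (t + t')) (sim_state a s'' p' m' (us @ vs))"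
      using does_Seq[OF 1(5) 2(5)] 1 2
      by (intro exI[of _ p''] exI[of _ m''] exI[of _ "vs @ ws"]) (auto simp: algebra_simps)
  qed
next
  case (9 s i p1 t s' p2)
  show ?case
  proof (rule simulatesI)
    fix p m assume *: "inp s = drop p (aa a A0)" "c \<le> m" "\<forall>i>m. mem s i = 0"
    obtain p' m' vs where 1: "inp s' = drop p' (aa a A0)" "m \<le> m'" "\<forall>i > m'. mem s' i = 0"
      "outp s' = outp s @ vs"
      "does (hosted p1) (sim_state a s p m us) (20 * t) (sim_state a s' p' m' (us @ vs))"
      by (rule simulatesE[OF 9(3)[of us] *]) (use 9(4) in auto)
    have "does (hosted (Cond i p1 p2)) (sim_state a s p m us) (20 * t + 1) (sim_state a s' p' m' (us @ vs))"
      unfolding hosted.simps by (rule does_Cond) (use 1(5) 9(1) in \<open>auto simp: sim_state_def\<close>)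
    then have "does (hosted (Cond i p1 p2)) (sim_state a s p m us) (20 * (t + 1)) (sim_state a s' p' m' (us @ vs))"
      by (rule does_mono) simp
    then show "\<exists>p' m' vs. inp s' = drop p' (aa a A0) \<and> m \<le> m' \<and> (\<forall>i > m'. mem s' i = 0) \<and>
        outp s' = outp s @ vs \<and>
        does (hosted (Cond i p1 p2)) (sim_state a s p m us) (20 * (t + 1)) (sim_state a s' p' m' (us @ vs))"
      using 1 by blast
  qed
next
  case (10 s i p2 t s' p1)
  show ?case
  proof (rule simulatesI)
    fix p m assume *: "inp s = drop p (aa a A0)" "c \<le> m" "\<forall>i>m. mem s i = 0"
    obtain p' m' vs where 1: "inp s' = drop p' (aa a A0)" "m \<le> m'" "\<forall>i > m'. mem s' i = 0"
      "outp s' = outp s @ vs"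
      "does (hosted p2) (sim_state a s p m us) (20 * t) (sim_state a s' p' m' (us @ vs))"
      by (rule simulatesE[OF 10(3)[of us] *]) (use 10(4) in auto)
    have "does (hosted (Cond i p1 p2)) (sim_state a s p m us) (20 * t + 1) (sim_state a s' p' m' (us @ vs))"
      unfolding hosted.simps by (rule does_Cond) (use 1(5) 10(1) in \<open>auto simp: sim_state_def\<close>)
    then have "does (hosted (Cond i p1 p2)) (sim_state a s p m us) (20 * (t + 1)) (sim_state a s' p' m' (us @ vs))"
      by (rule does_mono) simp
    then show "\<exists>p' m' vs. inp s' = drop p' (aa a A0) \<and> m \<le> m' \<and> (\<forall>i > m'. mem s' i = 0) \<and>
        outp s' = outp s @ vs \<and>
        does (hosted (Cond i p1 p2)) (sim_state a s p m us) (20 * (t + 1)) (sim_state a s' p' m' (us @ vs))"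
      using 1 by blast
  qed
next
  case (11 s i p)
  show ?case
    by (rule simulates_basic) (use 11 in \<open>auto intro!: does_While_raw_exit[THEN does_mono]
      simp: sim_state_def\<close>)
next
  case (12 s i p1 t s' t' s'')
  show ?case
  proof (rule simulatesI)
    fix p m assume *: "inp s = drop p (aa a A0)" "c \<le> m" "\<forall>i>m. mem s i = 0"
    obtain p' m' vs where 1: "inp s' = drop p' (aa a A0)" "m \<le> m'" "\<forall>i > m'. mem s' i = 0"
      "outp s' = outp s @ vs"
      "does (hosted p1) (sim_state a s p m us) (20 * t) (sim_state a s' p' m' (us @ vs))"
      by (rule simulatesE[OF 12(4)[of us] *]) (use 12(6) in auto)
    have cm: "c \<le> m'" using 1(2) *(2) by simp
    obtain p'' m'' ws where 2: "inp s'' = drop p'' (aa a A0)" "m' \<le> m''" "\<forall>i > m''. mem s'' i = 0"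
      "outp s'' = outp s' @ ws"
      "does (hosted (While i p1)) (sim_state a s' p' m' (us @ vs)) (20 * t') (sim_state a s'' p'' m'' ((us @ vs) @ ws))"
      by (rule simulatesE[OF 12(5)[of "us @ vs"] 1(1) cm 1(3)]) (use 12(6) in auto)
    have "does (hosted (While i p1)) (sim_state a s p m us) (20 * t + 20 * t' + 1)
        (sim_state a s'' p'' m'' ((us @ vs) @ ws))"
      unfolding hosted.simps
      by (rule does_While_raw[OF _ 1(5)]) (use 2(5) 12(1) in \<open>auto simp: sim_state_def\<close>)
    then have "does (hosted (While i p1)) (sim_state a s p m us) (20 * (t + t' + 1))
        (sim_state a s'' p'' m'' ((us @ vs) @ ws))"
      by (rule does_mono) simp
    then show "\<exists>p' m' vs. inp s'' = drop p' (aa a A0) \<and> m \<le> m' \<and> (\<forall>i > m'. mem s'' i = 0) \<and>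
        outp s'' = outp s @ vs \<and>
        does (hosted (While i p1)) (sim_state a s p m us) (20 * (t + t' + 1)) (sim_state a s'' p' m' (us @ vs))"
      using 1 2 by (intro exI[of _ p''] exI[of _ m''] exI[of _ "vs @ ws"]) auto
  qed
qed

lemma does_While_step:
  assumes "av a x \<noteq> 0" "does p a n a'" "does (While (reg x) p) a' m a''"
  shows "does (While (reg x) p) a (n + m + 1) a''"
  unfolding does_def
proof (intro allI impI)
  fix s assume rel: "rel a s"
  obtain k s1 where 1: "k \<le> n" "exec p s k s1" "rel a' s1"
    using assms(2) rel by (auto simp: does_def)
  obtain l s2 where 2: "l \<le> m" "exec (While (reg x) p) s1 l s2" "rel a'' s2"
    using assms(3) 1(3) by (auto simp: does_def)
  show "\<exists>k s'. k \<le> n + m + 1 \<and> exec (While (reg x) p) s k s' \<and> rel a'' s'"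
    using exec.intros(12)[OF _ 1(2) 2(2)] assms(1) relD(1)[OF rel, of x] 1 2
    by (intro exI[of _ "k + l + 1"] exI[of _ s2]) auto
qed

text \<open>Unlike in \<open>does_While\<close>, the intermediate states are known only through an
  invariant, which suits states with unspecified variables.\<close>

lemma does_While_inv:
  assumes step: "\<And>i a. i < r \<Longrightarrow> I i a \<Longrightarrow> av a x \<noteq> 0 \<and> (\<exists>a'. does p a n a' \<and> I (Suc i) a')"
    and exit: "\<And>a. I r a \<Longrightarrow> av a x = 0" and "I 0 a"
  shows "\<exists>a'. does (While (reg x) p) a (r * (n + 1) + 1) a' \<and> I r a'"
proof -
  have "\<exists>a'. does (While (reg x) p) a ((r - i) * (n + 1) + 1) a' \<and> I r a'"
    if "i \<le> r" "I i a" for i a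
    using that
  proof (induction "r - i" arbitrary: i a)
    case 0
    then have "I r a" by simp
    then show ?case using does_While_exit[OF exit] 0 by auto
  next
    case (Suc k)
    then have "i < r" by simp
    with step Suc.prems obtain a1 where 1: "av a x \<noteq> 0" "does p a n a1" "I (Suc i) a1" by blast
    have "k = r - Suc i" "Suc i \<le> r" using Suc.hyps(2) \<open>i < r\<close> by linarith+
    from Suc.hyps(1)[OF this 1(3)] obtain a2 where
      2: "does (While (reg x) p) a1 ((r - Suc i) * (n + 1) + 1) a2" "I r a2" by blast
    have "(r - i) * (n + 1) = (r - Suc i) * (n + 1) + (n + 1)"
      using \<open>i < r\<close> by (simp add: Suc_diff_Suc[symmetric])
    then show ?case using does_While_step[OF 1(1,2) 2(1)] 2(2)
      by (auto intro!: exI[of _ a2] elim!: does_mono)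
  qed
  from this[of 0 a] assms(3) show ?thesis by simp
qed

definition init :: "nat list \<Rightarrow> astate" where
  "init xs = \<lparr>av = \<lambda>_. 0, aa = \<lambda>_. [], araw = \<lambda>_. 0, ain = xs, aout = []\<rparr>"

lemma runs_does:
  assumes "does p (init xs) n a"
  shows "\<exists>t \<le> n. runs p xs t (aout a)"
proof -
  have "rel (init xs) \<lparr>mem = \<lambda>_. 0, inp = xs, outp = []\<rparr>" by (simp add: rel_def init_def)
  then show ?thesis using assms relD(6) unfolding does_def runs_def by blast
qed

section \<open>Computable functions\<close>

text \<open>Computability asks for no time bound, so the number of steps is dropped.\<close>

definition leads :: "ram \<Rightarrow> astate \<Rightarrow> astate \<Rightarrow> bool" where
  "leads p a a' \<longleftrightarrow> (\<exists>n. does p a n a')"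

lemma leads_Seq: "leads p a a' \<Longrightarrow> leads q a' a'' \<Longrightarrow> leads (Seq p q) a a''"
  unfolding leads_def using does_Seq by blast

lemma leads_While_inv:
  assumes step: "\<And>i a. i < r \<Longrightarrow> I i a \<Longrightarrow> av a x \<noteq> 0 \<and> (\<exists>a'. leads p a a' \<and> I (Suc i) a')"
    and exit: "\<And>a. I r a \<Longrightarrow> av a x = 0" and "I 0 a"
  shows "\<exists>a'. leads (While (reg x) p) a a' \<and> I r a'"
proof -
  have "\<exists>a'. leads (While (reg x) p) a a' \<and> I r a'" if "i \<le> r" "I i a" for i a
    using that
  proof (induction "r - i" arbitrary: i a)
    case 0
    then have "I r a" by simp
    then show ?case using does_While_exit[OF exit] 0 by (auto simp: leads_def)
  next
    case (Suc k)
    then have "i < r" by simp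
    with step Suc.prems obtain a1 where 1: "av a x \<noteq> 0" "leads p a a1" "I (Suc i) a1" by blast
    have "k = r - Suc i" "Suc i \<le> r" using Suc.hyps(2) \<open>i < r\<close> by linarith+
    from Suc.hyps(1)[OF this 1(3)] obtain a2 where
      2: "leads (While (reg x) p) a1 a2" "I r a2" by blast
    then show ?case using 1 does_While_step unfolding leads_def by blast
  qed
  from this[of 0 a] assms(3) show ?thesis by simp
qed

lemma ex_dims_le: "\<exists>B. dims_le \<sigma> B"
  by (intro exI[of _ "Max (\<sigma> ` {..<20})"]) (auto intro!: Max_ge)

lemma leads_assign:
  "wf_expr e \<Longrightarrow> leads (assign x e) a (a\<lparr>av := (av a)(x := eval e (av a) (aa a))\<rparr>)"
  unfolding leads_def using does_assign ex_dims_le by blast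

lemma leads_emit:
  assumes "wf_emit m" "\<And>j. g = To j \<Longrightarrow> j \<notin> arrs_emit m"
  shows "leads (compile_emit g m 3) a (push g (den m (av a) (aa a)) a)"
  unfolding leads_def using does_emit[OF assms(1) _ assms(2)] ex_dims_le[of "av a"] by blast

lemma leads_clear: "leads (Const (tmp (arr_index j)) 0) a (a\<lparr>aa := (aa a)(j := [])\<rparr>)"
  unfolding leads_def using does_clear by blast

lemma leads_Read:
  "ain a = [v] \<Longrightarrow> leads (Read (reg x)) a (a\<lparr>av := (av a)(x := v), ain := []\<rparr>)"
  unfolding leads_def using does_Read[of x a] by auto

text \<open>A hosted program has to start from memory that is all 0, also when it is called again.
  The loop stops when variable 31 reaches 0, so cell 0 is cleared separately.\<close>

definition clear_raw :: ram where
  "clear_raw = Seq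
     (While (reg 31) (block (address 6 (reg 31) 3 @
        [Const (tmp 4) 0, Store (tmp 3) (tmp 4), Const (tmp 4) 1, Sub (reg 31) (reg 31) (tmp 4)])))
     (Const (raw 0) 0)"

lemma leads_clear_raw:
  assumes "\<forall>i > av a 31. araw a i = 0"
  shows "leads clear_raw a (a\<lparr>av := (av a)(31 := 0), araw := \<lambda>_. 0\<rparr>)"
proof -
  define A where "A i = a\<lparr>av := (av a)(31 := av a 31 - i),
    araw := \<lambda>j. if av a 31 - i < j then 0 else araw a j\<rparr>" for i
  have w: "does (While (reg 31) (block (address 6 (reg 31) 3 @
        [Const (tmp 4) 0, Store (tmp 3) (tmp 4), Const (tmp 4) 1, Sub (reg 31) (reg 31) (tmp 4)])))
      (A 0) (av a 31 * (9 + 1) + 1) (A (av a 31))"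
  proof (rule does_While)
    fix i assume "i < av a 31"
    then show "does (block (address 6 (reg 31) 3 @ [Const (tmp 4) 0, Store (tmp 3) (tmp 4),
        Const (tmp 4) 1, Sub (reg 31) (reg 31) (tmp 4)])) (A i) 9 (A (Suc i))"
      by (intro does_block) (auto simp: eff_address rel_def A_def)
  qed (auto simp: A_def)
  have A0: "A 0 = a" using assms by (auto simp: A_def fun_eq_iff)
  have c: "does (Const (raw 0) 0) (A (av a 31)) 1 (a\<lparr>av := (av a)(31 := 0), araw := \<lambda>_. 0\<rparr>)"
    by (rule does_block[of _ _ "[Const (raw 0) 0]", simplified]) (auto simp: rel_def A_def)
  show ?thesis unfolding clear_raw_def leads_def using does_Seq[OF w[unfolded A0] c] by blast
qed

text \<open>The result is appended to \<open>A1\<close> instead of replacing it, so that the values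
  of several calls can be collected.\<close>

definition call :: "ram \<Rightarrow> nat \<Rightarrow> ram" where
  "call p x = Seq (Const (tmp (arr_index A0)) 0) (Seq (compile_emit (To A0) (Emit (Var x)) 3)
     (Seq (assign 30 (Num 0)) (Seq (assign 31 (Num (max_reg p))) (Seq (hosted p) clear_raw))))"

lemma leads_hosted:
  assumes "runs p (drop (av a 30) (aa a A0)) t vs" "max_reg p \<le> av a 31" "araw a = (\<lambda>_. 0)"
  shows "\<exists>m m' raw. does (hosted p) a (20 * t) (a\<lparr>av := (av a)(30 := m, 31 := m'),
    aa := (aa a)(A1 := aa a A1 @ vs), araw := raw\<rparr>) \<and> (\<forall>i > m'. raw i = 0)"
proof -
  let ?s = "\<lparr>mem = \<lambda>_. 0, inp = drop (av a 30) (aa a A0), outp = []\<rparr>"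
  obtain s where s: "exec p ?s t s" "outp s = vs" using assms(1) by (auto simp: runs_def)
  obtain p' m' us where 1: "\<forall>i > m'. mem s i = 0" "outp s = outp ?s @ us"
    "does (hosted p) (sim_state a ?s (av a 30) (av a 31) []) (20 * t) (sim_state a s p' m' ([] @ us))"
    by (rule simulatesE[OF hosted_correct[OF s(1) assms(2), where a = a and us = "[]"]]) auto
  moreover have "sim_state a ?s (av a 30) (av a 31) [] = a"
    using assms(3) by (simp add: sim_state_def)
  moreover have "sim_state a s p' m' us = a\<lparr>av := (av a)(30 := p', 31 := m'),
    aa := (aa a)(A1 := aa a A1 @ us), araw := mem s\<rparr>" by (simp add: sim_state_def)
  ultimately show ?thesis using s(2) by auto
qed

lemma leads_call:
  assumes "runs p [av a x] t [v]" "araw a = (\<lambda>_. 0)" "x \<noteq> 30" "x \<noteq> 31"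
  shows "\<exists>m. leads (call p x) a (a\<lparr>av := (av a)(30 := m, 31 := 0),
    aa := (aa a)(A0 := [av a x], A1 := aa a A1 @ [v])\<rparr>)"
proof -
  let ?a1 = "a\<lparr>aa := (aa a)(A0 := [])\<rparr>" and ?a2 = "a\<lparr>aa := (aa a)(A0 := [av a x])\<rparr>"
  let ?a3 = "?a2\<lparr>av := (av a)(30 := 0)\<rparr>"
  let ?a4 = "?a2\<lparr>av := (av a)(30 := 0, 31 := max_reg p)\<rparr>"
  have 1: "leads (Const (tmp (arr_index A0)) 0) a ?a1" by (rule leads_clear)
  have 2: "leads (compile_emit (To A0) (Emit (Var x)) 3) ?a1 ?a2"
    using leads_emit[of "Emit (Var x)" "To A0" ?a1] by simp
  have 3: "leads (assign 30 (Num 0)) ?a2 ?a3" using leads_assign[of "Num 0" 30 ?a2] by simp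
  have 4: "leads (assign 31 (Num (max_reg p))) ?a3 ?a4"
    using leads_assign[of "Num (max_reg p)" 31 ?a3] by simp
  obtain m m' w where 5: "does (hosted p) ?a4 (20 * t) (?a4\<lparr>av := (av ?a4)(30 := m, 31 := m'),
      aa := (aa ?a4)(A1 := aa ?a4 A1 @ [v]), araw := w\<rparr>)" "\<forall>i > m'. w i = 0"
    using leads_hosted[of p ?a4 t "[v]"] assms by auto
  let ?a5 = "?a4\<lparr>av := (av ?a4)(30 := m, 31 := m'),
      aa := (aa ?a4)(A1 := aa ?a4 A1 @ [v]), araw := w\<rparr>"
  have 6: "leads clear_raw ?a5 (?a5\<lparr>av := (av ?a5)(31 := 0), araw := \<lambda>_. 0\<rparr>)"
    by (rule leads_clear_raw) (use 5(2) in simp)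
  have 7: "?a5\<lparr>av := (av ?a5)(31 := 0), araw := \<lambda>_. 0\<rparr> = a\<lparr>av := (av a)(30 := m, 31 := 0),
    aa := (aa a)(A0 := [av a x], A1 := aa a A1 @ [v])\<rparr>"
    using assms(2) by (simp add: fun_upd_twist)
  have 8: "leads (hosted p) ?a4 ?a5" using 5(1) by (auto simp: leads_def)
  show ?thesis unfolding call_def
    using leads_Seq[OF 1 leads_Seq[OF 2 leads_Seq[OF 3 leads_Seq[OF 4 leads_Seq[OF 8 6]]]]] 7 by auto
qed

lemma computableI:
  assumes "\<And>n. \<exists>a. leads p (init [n]) a \<and> aout a = [f n]"
  shows "computable f"
  unfolding computable_def using assms runs_does unfolding leads_def by metis

section \<open>Closure properties of the computable functions\<close>

lemma computable_id: "computable (\<lambda>n. n)"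
  unfolding computable_def
proof (intro exI allI)
  fix n
  have "exec (block [Read 0, Write 0]) \<lparr>mem = \<lambda>_. 0, inp = [n], outp = []\<rparr> 2
      \<lparr>mem = (\<lambda>_. 0)(0 := n), inp = [], outp = [n]\<rparr>"
    by (rule exec_blockI) auto
  then show "runs (block [Read 0, Write 0]) [n] 2 [n]" unfolding runs_def by force
qed

text \<open>The programs for \<open>f\<close> and \<open>g\<close> are called one after the other;
  their results, collected in \<open>A1\<close>, go to variables 2 and 3, from which
  \<open>e\<close> computes the value.\<close>

lemma computable_expr:
  assumes "computable f" "computable g" "wf_expr e"
    and e: "\<And>n \<sigma> \<rho>. \<sigma> 2 = f n \<Longrightarrow> \<sigma> 3 = g n \<Longrightarrow> eval e \<sigma> \<rho> = h n"
  shows "computable h"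
proof -
  obtain p q where p: "\<And>n. \<exists>t. runs p [n] t [f n]" and q: "\<And>n. \<exists>t. runs q [n] t [g n]"
    using assms(1,2) unfolding computable_def by metis
  show ?thesis
  proof (rule computableI)
    fix n
    obtain t u where t: "runs p [n] t [f n]" and u: "runs q [n] u [g n]" using p q by blast
    let ?a1 = "(init [n])\<lparr>av := (av (init [n]))(1 := n), ain := []\<rparr>"
    have 1: "leads (Read (reg 1)) (init [n]) ?a1" by (rule leads_Read) (simp add: init_def)
    obtain m where 2: "leads (call p 1) ?a1 (?a1\<lparr>av := (av ?a1)(30 := m, 31 := 0),
        aa := (aa ?a1)(A0 := [av ?a1 1], A1 := aa ?a1 A1 @ [f n])\<rparr>)"
      using leads_call[of p ?a1 1 t "f n"] t by (auto simp: init_def)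
    let ?a2 = "?a1\<lparr>av := (av ?a1)(30 := m, 31 := 0),
        aa := (aa ?a1)(A0 := [av ?a1 1], A1 := aa ?a1 A1 @ [f n])\<rparr>"
    obtain l where 3: "leads (call q 1) ?a2 (?a2\<lparr>av := (av ?a2)(30 := l, 31 := 0),
        aa := (aa ?a2)(A0 := [av ?a2 1], A1 := aa ?a2 A1 @ [g n])\<rparr>)"
      using leads_call[of q ?a2 1 u "g n"] u by (auto simp: init_def)
    let ?a3 = "?a2\<lparr>av := (av ?a2)(30 := l, 31 := 0),
        aa := (aa ?a2)(A0 := [av ?a2 1], A1 := aa ?a2 A1 @ [g n])\<rparr>"
    have A1: "aa ?a3 A1 = [f n, g n]" by (simp add: init_def)
    let ?a4 = "?a3\<lparr>av := (av ?a3)(2 := eval (Arr A1 (Num 0)) (av ?a3) (aa ?a3))\<rparr>"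
    have 4: "leads (assign 2 (Arr A1 (Num 0))) ?a3 ?a4" by (rule leads_assign) simp
    let ?a5 = "?a4\<lparr>av := (av ?a4)(3 := eval (Arr A1 (Num 1)) (av ?a4) (aa ?a4))\<rparr>"
    have 5: "leads (assign 3 (Arr A1 (Num 1))) ?a4 ?a5" by (rule leads_assign) simp
    have 6: "leads (compile_emit Tape (Emit e) 3) ?a5 (push Tape (den (Emit e) (av ?a5) (aa ?a5)) ?a5)"
      using assms(3) by (intro leads_emit) auto
    have "av ?a5 2 = f n" "av ?a5 3 = g n" using A1 by (simp_all add: init_def)
    then have "den (Emit e) (av ?a5) (aa ?a5) = [h n]" using e[of "av ?a5" n "aa ?a5"] by simp
    then have "aout (push Tape (den (Emit e) (av ?a5) (aa ?a5)) ?a5) = [h n]"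
      by (simp add: init_def)
    then show "\<exists>a. leads (Seq (Read (reg 1)) (Seq (call p 1) (Seq (call q 1)
        (Seq (assign 2 (Arr A1 (Num 0))) (Seq (assign 3 (Arr A1 (Num 1)))
          (compile_emit Tape (Emit e) 3)))))) (init [n]) a \<and> aout a = [h n]"
      using leads_Seq[OF 1 leads_Seq[OF 2 leads_Seq[OF 3 leads_Seq[OF 4 leads_Seq[OF 5 6]]]]] by blast
  qed
qed

lemma computable_const: "computable (\<lambda>_. c)"
  by (rule computable_expr[OF computable_id computable_id, of "Num c"]) auto

lemma computable_add: "computable f \<Longrightarrow> computable g \<Longrightarrow> computable (\<lambda>n. f n + g n)"
  by (rule computable_expr[of f g "Plus (Var 2) (Var 3)"]) auto

lemma computable_mult: "computable f \<Longrightarrow> computable g \<Longrightarrow> computable (\<lambda>n. f n * g n)"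
  by (rule computable_expr[of f g "Sum 20 2 (Var 3)"]) auto

lemma computable_power: "computable f \<Longrightarrow> computable (\<lambda>n. f n ^ c)"
  by (induction c) (auto intro: computable_const[of 1, unfolded One_nat_def] computable_mult)

text \<open>Expressions grow only polynomially in their variables, so this needs a loop of
  \<open>f n\<close> doublings.\<close>

lemma computable_exp2:
  assumes "computable f"
  shows "computable (\<lambda>n. 2 ^ f n)"
proof -
  obtain p where p: "\<And>n. \<exists>t. runs p [n] t [f n]"
    using assms unfolding computable_def by metis
  let ?b = "Seq (assign 3 (Plus (Var 3) (Var 3))) (assign 2 (Minus (Var 2) (Num 1)))"
  show ?thesis
  proof (rule computableI)
    fix n
    obtain t where t: "runs p [n] t [f n]" using p by blast
    let ?a1 = "(init [n])\<lparr>av := (av (init [n]))(1 := n), ain := []\<rparr>"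
    have 1: "leads (Read (reg 1)) (init [n]) ?a1" by (rule leads_Read) (simp add: init_def)
    obtain m where 2: "leads (call p 1) ?a1 (?a1\<lparr>av := (av ?a1)(30 := m, 31 := 0),
        aa := (aa ?a1)(A0 := [av ?a1 1], A1 := aa ?a1 A1 @ [f n])\<rparr>)"
      using leads_call[of p ?a1 1 t "f n"] t by (auto simp: init_def)
    let ?a2 = "?a1\<lparr>av := (av ?a1)(30 := m, 31 := 0),
        aa := (aa ?a1)(A0 := [av ?a1 1], A1 := aa ?a1 A1 @ [f n])\<rparr>"
    let ?a3 = "?a2\<lparr>av := (av ?a2)(2 := eval (Arr A1 (Num 0)) (av ?a2) (aa ?a2))\<rparr>"
    have 3: "leads (assign 2 (Arr A1 (Num 0))) ?a2 ?a3" by (rule leads_assign) simp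
    let ?a4 = "?a3\<lparr>av := (av ?a3)(3 := eval (Num 1) (av ?a3) (aa ?a3))\<rparr>"
    have 4: "leads (assign 3 (Num 1)) ?a3 ?a4" by (rule leads_assign) simp
    let ?I = "\<lambda>i (a :: astate). av a 2 = f n - i \<and> av a 3 = 2 ^ i \<and> aout a = []"
    have "\<exists>a'. leads (While (reg 2) ?b) ?a4 a' \<and> ?I (f n) a'"
    proof (rule leads_While_inv[where I = ?I and r = "f n"])
      fix i a assume i: "i < f n" and a: "?I i a"
      let ?b1 = "a\<lparr>av := (av a)(3 := eval (Plus (Var 3) (Var 3)) (av a) (aa a))\<rparr>"
      have "leads ?b a (?b1\<lparr>av := (av ?b1)(2 := eval (Minus (Var 2) (Num 1)) (av ?b1) (aa ?b1))\<rparr>)"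
        by (intro leads_Seq[of _ _ ?b1] leads_assign) simp_all
      then show "av a 2 \<noteq> 0 \<and> (\<exists>a'. leads ?b a a' \<and> ?I (Suc i) a')"
        using i a by (auto intro!: exI)
    qed (auto simp: init_def)
    then obtain a5 where 5: "leads (While (reg 2) ?b) ?a4 a5" "?I (f n) a5" by blast
    have 6: "leads (compile_emit Tape (Emit (Var 3)) 3) a5 (push Tape (den (Emit (Var 3)) (av a5) (aa a5)) a5)"
      by (intro leads_emit) auto
    have "aout (push Tape (den (Emit (Var 3)) (av a5) (aa a5)) a5) = [2 ^ f n]"
      using 5(2) by simp
    then show "\<exists>a. leads (Seq (Read (reg 1)) (Seq (call p 1)
        (Seq (assign 2 (Arr A1 (Num 0))) (Seq (assign 3 (Num 1)) (Seq (While (reg 2) ?b)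
          (compile_emit Tape (Emit (Var 3)) 3)))))) (init [n]) a \<and> aout a = [2 ^ f n]"
      using leads_Seq[OF 1 leads_Seq[OF 2 leads_Seq[OF 3 leads_Seq[OF 4 leads_Seq[OF 5(1) 6]]]]] by blast
  qed
qed

text \<open>Unbounded search. The flag in variable 3 is 1 as long as \<mu> is below
  \<open>k\<close>, and adding it to the counter makes the counter stop at the first success. This
  turns the effective \<mu> of the growth rate into a computable threshold for \<open>n\<close> in
  terms of \<open>k\<close>.\<close>

lemma computable_Least:
  assumes "computable \<mu>" and ex: "\<And>k. \<exists>n. k \<le> \<mu> n"
  shows "computable (\<lambda>k. LEAST n. k \<le> \<mu> n)"
proof -
  obtain p where p: "\<And>n. \<exists>t. runs p [n] t [\<mu> n]"
    using assms unfolding computable_def by metis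
  let ?e = "Minus (Num 1) (Minus (Num 1) (Minus (Var 1) (Arr A1 (Num 0))))"
  let ?b = "Seq (Const (tmp (arr_index A1)) 0) (Seq (call p 2) (Seq (assign 3 ?e)
    (assign 2 (Plus (Var 2) (Var 3)))))"
  show ?thesis
  proof (rule computableI)
    fix k
    define L where "L = (LEAST n. k \<le> \<mu> n)"
    have L: "k \<le> \<mu> L" unfolding L_def using ex by (rule LeastI_ex)
    have less: "\<mu> i < k" if "i < L" for i using not_less_Least[of i "\<lambda>n. k \<le> \<mu> n"] that L_def by auto
    let ?a1 = "(init [k])\<lparr>av := (av (init [k]))(1 := k), ain := []\<rparr>"
    have 1: "leads (Read (reg 1)) (init [k]) ?a1" by (rule leads_Read) (simp add: init_def)
    let ?a2 = "?a1\<lparr>av := (av ?a1)(3 := eval (Num 1) (av ?a1) (aa ?a1))\<rparr>"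
    have 2: "leads (assign 3 (Num 1)) ?a1 ?a2" by (rule leads_assign) simp
    \<comment> \<open>Round \<open>L\<close> finds the success and only clears the flag, hence
      \<open>Suc L\<close> rounds in all.\<close>
    let ?I = "\<lambda>i (a :: astate). av a 1 = k \<and> (if i \<le> L then av a 2 = i \<and> av a 3 = 1 else av a 2 = L \<and> av a 3 = 0) \<and>
      araw a = (\<lambda>_. 0) \<and> aout a = []"
    have "\<exists>a'. leads (While (reg 3) ?b) ?a2 a' \<and> ?I (Suc L) a'"
    proof (rule leads_While_inv[where I = ?I and r = "Suc L"])
      fix i a assume i: "i < Suc L" and a: "?I i a"
      let ?b1 = "a\<lparr>aa := (aa a)(A1 := [])\<rparr>"
      have b1: "leads (Const (tmp (arr_index A1)) 0) a ?b1" by (rule leads_clear)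
      obtain t where "runs p [av ?b1 2] t [\<mu> i]" using p a i by auto
      from leads_call[OF this] obtain m where b2: "leads (call p 2) ?b1 (?b1\<lparr>av := (av ?b1)(30 := m, 31 := 0),
        aa := (aa ?b1)(A0 := [av ?b1 2], A1 := aa ?b1 A1 @ [\<mu> i])\<rparr>)" using a by auto
      let ?b2 = "?b1\<lparr>av := (av ?b1)(30 := m, 31 := 0),
        aa := (aa ?b1)(A0 := [av ?b1 2], A1 := aa ?b1 A1 @ [\<mu> i])\<rparr>"
      let ?b3 = "?b2\<lparr>av := (av ?b2)(3 := eval ?e (av ?b2) (aa ?b2))\<rparr>"
      have b3: "leads (assign 3 ?e) ?b2 ?b3" by (rule leads_assign) simp
      let ?b4 = "?b3\<lparr>av := (av ?b3)(2 := eval (Plus (Var 2) (Var 3)) (av ?b3) (aa ?b3))\<rparr>"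
      have b4: "leads (assign 2 (Plus (Var 2) (Var 3))) ?b3 ?b4" by (rule leads_assign) simp
      have "leads ?b a ?b4" by (rule leads_Seq[OF b1 leads_Seq[OF b2 leads_Seq[OF b3 b4]]])
      moreover have "?I (Suc i) ?b4"
      proof (cases "i < L")
        case True
        then show ?thesis using less[OF True] a i by auto
      next
        case False
        then have "i = L" using i by simp
        then show ?thesis using L a by auto
      qed
      moreover have "av a 3 \<noteq> 0" using a i by auto
      ultimately show "av a 3 \<noteq> 0 \<and> (\<exists>a'. leads ?b a a' \<and> ?I (Suc i) a')" by blast
    qed (auto simp: init_def)
    then obtain a3 where 3: "leads (While (reg 3) ?b) ?a2 a3" "?I (Suc L) a3" by blast
    have 4: "leads (compile_emit Tape (Emit (Var 2)) 3) a3 (push Tape (den (Emit (Var 2)) (av a3) (aa a3)) a3)"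
      by (intro leads_emit) auto
    have "aout (push Tape (den (Emit (Var 2)) (av a3) (aa a3)) a3) = [L]"
      using 3(2) by simp
    then show "\<exists>a. leads (Seq (Read (reg 1)) (Seq (assign 3 (Num 1)) (Seq (While (reg 3) ?b)
          (compile_emit Tape (Emit (Var 2)) 3)))) (init [k]) a \<and> aout a = [LEAST n. k \<le> \<mu> n]"
      using leads_Seq[OF 1 leads_Seq[OF 2 leads_Seq[OF 3(1) 4]]] unfolding L_def by blast
  qed
qed

section \<open>Polynomial bounds\<close>

text \<open>The bound holds for all \<open>B\<close>, and the base \<open>B + 1\<close> is at least
  1, so that exponents can be raised freely.\<close>

definition poly_bounded :: "(nat \<Rightarrow> nat) \<Rightarrow> bool" where
  "poly_bounded f \<longleftrightarrow> (\<exists>C n. \<forall>B. f B \<le> C * (B + 1) ^ n)"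

lemma poly_bounded_const: "poly_bounded (\<lambda>_. c)"
  unfolding poly_bounded_def by (intro exI[of _ c] exI[of _ 0]) simp

lemma poly_bounded_id: "poly_bounded (\<lambda>B. B)"
  unfolding poly_bounded_def by (intro exI[of _ 1]) simp

lemma poly_bounded_add:
  assumes "poly_bounded f" "poly_bounded g"
  shows "poly_bounded (\<lambda>B. f B + g B)"
proof -
  obtain C n C' n' where *: "\<And>B. f B \<le> C * (B + 1) ^ n" "\<And>B. g B \<le> C' * (B + 1) ^ n'"
    using assms by (auto simp: poly_bounded_def)
  have "f B + g B \<le> (C + C') * (B + 1) ^ (n + n')" for B
  proof -
    have "(B + 1) ^ n \<le> (B + 1) ^ (n + n')" "(B + 1) ^ n' \<le> (B + 1) ^ (n + n')"
      by (intro power_increasing; simp)+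
    then have "C * (B + 1) ^ n \<le> C * (B + 1) ^ (n + n')" "C' * (B + 1) ^ n' \<le> C' * (B + 1) ^ (n + n')"
      by (intro mult_left_mono; simp)+
    then show ?thesis unfolding distrib_right using *[of B] by linarith
  qed
  then show ?thesis unfolding poly_bounded_def by blast
qed

lemma poly_bounded_mult:
  assumes "poly_bounded f" "poly_bounded g"
  shows "poly_bounded (\<lambda>B. f B * g B)"
proof -
  obtain C n C' n' where *: "\<And>B. f B \<le> C * (B + 1) ^ n" "\<And>B. g B \<le> C' * (B + 1) ^ n'"
    using assms by (auto simp: poly_bounded_def)
  have "f B * g B \<le> (C * C') * (B + 1) ^ (n + n')" for B
  proof -
    have "f B * g B \<le> (C * (B + 1) ^ n) * (C' * (B + 1) ^ n')" using * by (intro mult_mono) auto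
    then show ?thesis by (simp add: power_add mult_ac)
  qed
  then show ?thesis unfolding poly_bounded_def by blast
qed

lemma poly_bounded_Suc: "poly_bounded f \<Longrightarrow> poly_bounded (\<lambda>B. Suc (f B))"
  using poly_bounded_add[OF _ poly_bounded_const[of 1], of f] by simp

lemma poly_bounded_power: "poly_bounded f \<Longrightarrow> poly_bounded (\<lambda>B. f B ^ c)"
  by (induction c) (auto intro: poly_bounded_mult poly_bounded_const[of 1, unfolded One_nat_def])

lemma poly_bounded_comp:
  assumes "poly_bounded f" "poly_bounded g"
  shows "poly_bounded (\<lambda>B. f (g B))"
proof -
  obtain C n where f: "\<And>B. f B \<le> C * (B + 1) ^ n" using assms by (auto simp: poly_bounded_def)
  have "poly_bounded (\<lambda>B. C * (g B + 1) ^ n)"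
    by (intro poly_bounded_mult poly_bounded_power poly_bounded_add poly_bounded_const assms)
  then show ?thesis unfolding poly_bounded_def using f by (meson order_trans)
qed

lemma poly_bounded_expr_cost: "poly_bounded (expr_cost e)"
  by (induction e) (auto intro!: poly_bounded_mult poly_bounded_Suc poly_bounded_add poly_bounded_id
    poly_bounded_const simp: expr_cost.simps[abs_def])

lemma poly_bounded_emit_cost: "poly_bounded (emit_cost m)"
  by (induction m) (auto intro!: poly_bounded_mult poly_bounded_Suc poly_bounded_add poly_bounded_id
    poly_bounded_const poly_bounded_expr_cost simp: emit_cost.simps[abs_def])

lemmas poly_bounded_intros = poly_bounded_const poly_bounded_id poly_bounded_add poly_bounded_mult
  poly_bounded_Suc poly_bounded_power poly_bounded_expr_cost poly_bounded_emit_cost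

text \<open>Monotonicity is taken from the polynomial bound, into which an estimate of the input
  size can be substituted.\<close>

lemma poly_bounded_mono_bound:
  assumes "poly_bounded f"
  shows "\<exists>C n. \<forall>B B'. B \<le> B' \<longrightarrow> f B \<le> C * (B' + 1) ^ n"
proof -
  obtain C n where f: "\<And>B. f B \<le> C * (B + 1) ^ n" using assms by (auto simp: poly_bounded_def)
  have "f B \<le> C * (B' + 1) ^ n" if "B \<le> B'" for B B'
  proof -
    have "C * (B + 1) ^ n \<le> C * (B' + 1) ^ n" using that by (intro mult_left_mono power_mono) auto
    then show ?thesis using f[of B] by linarith
  qed
  then show ?thesis by blast
qed

section \<open>Reading the input\<close>

text \<open>The two leading numbers are stored as well, so \<open>A0\<close> has the format of a
  tape and can be passed on to a hosted program. The last assignment resets the variable used for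
  reading.\<close>

definition read_input :: ram where
  "read_input = Seq (Read (reg 1)) (Seq (compile_emit (To A0) (Emit (Var 1)) 3)
     (Seq (Read (reg 2)) (Seq (compile_emit (To A0) (Emit (Var 2)) 3)
       (Seq (While (reg 2) (Seq (Read (reg 21)) (Seq (compile_emit (To A0) (Emit (Var 21)) 3)
          (assign 2 (Minus (Var 2) (Num 1))))))
         (assign 21 (Num 0))))))"

definition loaded_state :: "nat list \<Rightarrow> nat \<Rightarrow> astate" where
  "loaded_state w k = (init [])\<lparr>av := (\<lambda>_. 0)(1 := k), aa := (\<lambda>_. [])(A0 := k # length w # w)\<rparr>"

lemma does_emit_var:
  "does (compile_emit (To A0) (Emit (Var x)) 3) a 10 (push (To A0) [av a x] a)"
proof -
  obtain B where "dims_le (av a) B" using ex_dims_le by blast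
  then show ?thesis using does_emit[of "Emit (Var x)" a B "To A0"] by simp
qed

lemma does_read_input: "does read_input (init (tape (w, k))) (30 * (length w + 2)) (loaded_state w k)"
proof -
  let ?a1 = "(init (length w # w))\<lparr>av := (\<lambda>_. 0)(1 := k)\<rparr>"
  let ?a2 = "(init (length w # w))\<lparr>av := (\<lambda>_. 0)(1 := k), aa := (\<lambda>_. [])(A0 := [k])\<rparr>"
  let ?a3 = "(init w)\<lparr>av := (\<lambda>_. 0)(1 := k, 2 := length w), aa := (\<lambda>_. [])(A0 := [k])\<rparr>"
  define A where "A i = (init (drop i w))\<lparr>av := (\<lambda>_. 0)(1 := k, 2 := length w - i,
      21 := if i = 0 then 0 else w ! (i - 1)),
      aa := (\<lambda>_. [])(A0 := k # length w # take i w)\<rparr>" for i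
  have 1: "does (Read (reg 1)) (init (tape (w, k))) 1 ?a1"
    using does_Read[of 1 "init (tape (w, k))"] by (simp add: init_def)
  have 2: "does (compile_emit (To A0) (Emit (Var 1)) 3) ?a1 10 ?a2"
    using does_emit_var[of 1 ?a1] by (simp add: init_def)
  have 3: "does (Read (reg 2)) ?a2 1 ?a3"
    using does_Read[of 2 ?a2] by (simp add: init_def)
  have 4: "does (compile_emit (To A0) (Emit (Var 2)) 3) ?a3 10 (A 0)"
    using does_emit_var[of 2 ?a3] by (simp add: init_def A_def fun_upd_idem)
  have 5: "does (While (reg 2) (Seq (Read (reg 21)) (Seq (compile_emit (To A0) (Emit (Var 21)) 3)
          (assign 2 (Minus (Var 2) (Num 1)))))) (A 0) (length w * ((1 + (10 + 6)) + 1) + 1) (A (length w))"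
  proof (rule does_While)
    fix i assume i: "i < length w"
    show "av (A i) 2 \<noteq> 0" using i by (simp add: A_def)
    let ?v = "(\<lambda>_. 0)(1 := k, 2 := length w - i, 21 := w ! i)"
    let ?b1 = "(init (drop (Suc i) w))\<lparr>av := ?v,
      aa := (\<lambda>_. [])(A0 := k # length w # take i w)\<rparr>"
    let ?b2 = "(init (drop (Suc i) w))\<lparr>av := ?v,
      aa := (\<lambda>_. [])(A0 := k # length w # take (Suc i) w)\<rparr>"
    have b1: "does (Read (reg 21)) (A i) 1 ?b1"
      using does_Read[of 21 "A i"] i by (simp add: A_def init_def Cons_nth_drop_Suc[symmetric])
    have b2: "does (compile_emit (To A0) (Emit (Var 21)) 3) ?b1 10 ?b2"
      using does_emit_var[of 21 ?b1] i by (simp add: take_Suc_conv_app_nth init_def)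
    obtain B where "dims_le (av ?b2) B" using ex_dims_le by blast
    then have b3: "does (assign 2 (Minus (Var 2) (Num 1))) ?b2 6 (A (Suc i))"
      using does_assign[of "Minus (Var 2) (Num 1)" ?b2 B 2] i
      by (simp add: A_def init_def fun_upd_twist)
    show "does (Seq (Read (reg 21)) (Seq (compile_emit (To A0) (Emit (Var 21)) 3)
          (assign 2 (Minus (Var 2) (Num 1))))) (A i) (1 + (10 + 6)) (A (Suc i))"
      by (rule does_Seq[OF b1 does_Seq[OF b2 b3]])
  qed (simp add: A_def)
  obtain B where "dims_le (av (A (length w))) B" using ex_dims_le by blast
  then have "does (assign 21 (Num 0)) (A (length w)) 3 ((A (length w))\<lparr>av := (av (A (length w)))(21 := 0)\<rparr>)"
    by (intro does_mono[OF does_assign[of "Num 0" "A (length w)" B 21, simplified]]) simp_all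
  moreover have "(A (length w))\<lparr>av := (av (A (length w)))(21 := 0)\<rparr> = loaded_state w k"
    by (simp add: A_def init_def loaded_state_def fun_upd_idem fun_upd_twist)
  ultimately have 6: "does (assign 21 (Num 0)) (A (length w)) 3 (loaded_state w k)" by simp
  have "does read_input (init (tape (w, k)))
    (1 + (10 + (1 + (10 + ((length w * ((1 + (10 + 6)) + 1) + 1) + 3))))) (loaded_state w k)"
    unfolding read_input_def
    by (rule does_Seq[OF 1 does_Seq[OF 2 does_Seq[OF 3 does_Seq[OF 4 does_Seq[OF 5 6]]]]])
  then show ?thesis by (rule does_mono) simp
qed

section \<open>Formulas\<close>

definition tr :: "expr \<Rightarrow> (nat \<Rightarrow> nat) \<Rightarrow> (arr \<Rightarrow> nat list) \<Rightarrow> bool" where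
  "tr e \<sigma> \<rho> \<longleftrightarrow> eval e \<sigma> \<rho> \<noteq> 0"

text \<open>Truth is being nonzero. Truncated subtraction gives negation and comparison, addition
  gives disjunction and a sum an existential quantifier; for counting, as in \<open>CardE\<close>, a
  condition is first normalized to 0 or 1.\<close>

definition NotE :: "expr \<Rightarrow> expr" where "NotE e = Minus (Num 1) e"
definition LeE :: "expr \<Rightarrow> expr \<Rightarrow> expr" where "LeE e e' = NotE (Minus e e')"
definition OrE :: "expr \<Rightarrow> expr \<Rightarrow> expr" where "OrE e e' = Plus e e'"
definition AndE :: "expr \<Rightarrow> expr \<Rightarrow> expr" where "AndE e e' = NotE (OrE (NotE e) (NotE e'))"
definition EqE :: "expr \<Rightarrow> expr \<Rightarrow> expr" where "EqE e e' = AndE (LeE e e') (LeE e' e)"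
definition LessE :: "expr \<Rightarrow> expr \<Rightarrow> expr" where "LessE e e' = NotE (LeE e' e)"
definition ExE :: "nat \<Rightarrow> nat \<Rightarrow> expr \<Rightarrow> expr" where "ExE x d e = Sum x d e"
definition AllE :: "nat \<Rightarrow> nat \<Rightarrow> expr \<Rightarrow> expr" where "AllE x d e = NotE (ExE x d (NotE e))"
definition CardE :: "nat \<Rightarrow> nat \<Rightarrow> expr \<Rightarrow> expr" where
  "CardE x d e = Sum x d (Ite e (Num 1) (Num 0))"

lemma tr_simps [simp]:
  "tr (NotE e) \<sigma> \<rho> \<longleftrightarrow> \<not> tr e \<sigma> \<rho>"
  "tr (LeE e e') \<sigma> \<rho> \<longleftrightarrow> eval e \<sigma> \<rho> \<le> eval e' \<sigma> \<rho>"
  "tr (OrE e e') \<sigma> \<rho> \<longleftrightarrow> tr e \<sigma> \<rho> \<or> tr e' \<sigma> \<rho>"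
  "tr (AndE e e') \<sigma> \<rho> \<longleftrightarrow> tr e \<sigma> \<rho> \<and> tr e' \<sigma> \<rho>"
  "tr (EqE e e') \<sigma> \<rho> \<longleftrightarrow> eval e \<sigma> \<rho> = eval e' \<sigma> \<rho>"
  "tr (LessE e e') \<sigma> \<rho> \<longleftrightarrow> eval e \<sigma> \<rho> < eval e' \<sigma> \<rho>"
  "tr (ExE x d e) \<sigma> \<rho> \<longleftrightarrow> (\<exists>i < \<sigma> d. tr e (\<sigma>(x := i)) \<rho>)"
  by (auto simp: tr_def NotE_def LeE_def OrE_def AndE_def EqE_def LessE_def ExE_def)

lemma tr_AllE [simp]: "tr (AllE x d e) \<sigma> \<rho> \<longleftrightarrow> (\<forall>i < \<sigma> d. tr e (\<sigma>(x := i)) \<rho>)"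
  by (simp add: AllE_def)

lemma eval_Ite_tr: "eval (Ite b e e') \<sigma> \<rho> = (if tr b \<sigma> \<rho> then eval e \<sigma> \<rho> else eval e' \<sigma> \<rho>)"
  by (simp add: tr_def)

lemma den_EIf_tr: "den (EIf e m) \<sigma> \<rho> = (if tr e \<sigma> \<rho> then den m \<sigma> \<rho> else [])"
  by (simp add: tr_def)

lemma eval_CardE: "eval (CardE x d e) \<sigma> \<rho> = card {i. i < \<sigma> d \<and> tr e (\<sigma>(x := i)) \<rho>}"
proof -
  have "eval (CardE x d e) \<sigma> \<rho> = (\<Sum>i < \<sigma> d. if tr e (\<sigma>(x := i)) \<rho> then 1 else 0)"
    by (simp add: CardE_def tr_def cong: if_cong)
  also have "\<dots> = card ({..<\<sigma> d} \<inter> {i. tr e (\<sigma>(x := i)) \<rho>})" by (simp add: sum.If_cases)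
  also have "{..<\<sigma> d} \<inter> {i. tr e (\<sigma>(x := i)) \<rho>} = {i. i < \<sigma> d \<and> tr e (\<sigma>(x := i)) \<rho>}" by auto
  finally show ?thesis .
qed

lemmas formula_defs = NotE_def LeE_def OrE_def AndE_def EqE_def LessE_def ExE_def AllE_def CardE_def

section \<open>Encoded circuits\<close>

text \<open>
  Variables 1 to 4 hold the parameter, the output gate, the number of vertices and the number of
  wires.
\<close>

definition loaded :: "arr \<Rightarrow> circuit \<Rightarrow> nat \<Rightarrow> (nat \<Rightarrow> nat) \<Rightarrow> (arr \<Rightarrow> nat list) \<Rightarrow> bool" where
  "loaded j C k \<sigma> \<rho> \<longleftrightarrow> \<rho> j = tape (enc_circuit C, k) \<and> \<sigma> 1 = k \<and> \<sigma> 2 = outgate C \<and>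
     \<sigma> 3 = length (labels C) \<and> \<sigma> 4 = length (wires C)"

lemma loaded_upd [simp]: "5 \<le> x \<Longrightarrow> loaded j C k (\<sigma>(x := i)) \<rho> = loaded j C k \<sigma> \<rho>"
  by (auto simp: loaded_def)

definition double :: "nat \<Rightarrow> expr" where "double x = Plus (Var x) (Var x)"
text \<open>The tape starts with the parameter, the length of the word, the output gate and the
  number of vertices, hence the offset 4. After two numbers per vertex comes the number of wires, so
  the wires start at 5 plus twice variable 3.\<close>

definition tagE :: "arr \<Rightarrow> nat \<Rightarrow> expr" where "tagE j v = Arr j (Plus (Num 4) (double v))"
definition argE :: "arr \<Rightarrow> nat \<Rightarrow> expr" where "argE j v = Arr j (Plus (Num 5) (double v))"
definition srcE :: "arr \<Rightarrow> nat \<Rightarrow> expr" where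
  "srcE j e = Arr j (Plus (Num 5) (Plus (double 3) (double e)))"
definition dstE :: "arr \<Rightarrow> nat \<Rightarrow> expr" where
  "dstE j e = Arr j (Plus (Num 6) (Plus (double 3) (double e)))"
text \<open>Bound variables have fixed numbers, here 90, and are never renamed; later conditions
  such as \<open>u \<noteq> 90\<close> exclude capture.\<close>

definition wireE :: "arr \<Rightarrow> nat \<Rightarrow> nat \<Rightarrow> expr" where
  "wireE j u v = ExE 90 4 (AndE (EqE (srcE j 90) (Var u)) (EqE (dstE j 90) (Var v)))"
definition litE :: "arr \<Rightarrow> nat \<Rightarrow> expr" where "litE j v = LeE (Num 2) (tagE j v)"

lemmas circuit_expr_defs = double_def tagE_def argE_def srcE_def dstE_def wireE_def litE_def

lemma eval_double [simp]: "eval (double x) \<sigma> \<rho> = 2 * \<sigma> x"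
  by (simp add: double_def)

lemma nth_concat_pairs:
  assumes "\<And>x. x \<in> set xs \<Longrightarrow> length (f x) = 2" "i < length xs"
  shows "concat (map f xs) ! (2 * i) = f (xs ! i) ! 0" "concat (map f xs) ! (2 * i + 1) = f (xs ! i) ! 1"
  using assms
proof (induction xs arbitrary: i)
  case (Cons x xs)
  {
    case 1
    then show ?case using Cons.IH by (cases i) (auto simp: nth_append)
  next
    case 2
    then show ?case using Cons.IH by (cases i) (auto simp: nth_append)
  }
qed auto

lemma length_concat_pairs: "(\<And>x. x \<in> set xs \<Longrightarrow> length (f x) = 2) \<Longrightarrow> length (concat (map f xs)) = 2 * length xs"
  by (induction xs) auto

fun arg_of :: "vlabel \<Rightarrow> nat" where
  "arg_of (Lit x b) = x" | "arg_of _ = 0"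

lemma length_enc_circuit:
  "length (enc_circuit C) = 3 + 2 * length (labels C) + 2 * length (wires C)"
  unfolding enc_circuit_def by (simp add: length_concat_pairs length_enc_label split_def)

lemma tape_nth:
  fixes C :: circuit
  defines "n \<equiv> length (labels C)"
  shows "tape (enc_circuit C, k) ! 0 = k" "tape (enc_circuit C, k) ! 2 = outgate C"
    "tape (enc_circuit C, k) ! 3 = n" "tape (enc_circuit C, k) ! (4 + 2 * n) = length (wires C)"
    "v < n \<Longrightarrow> tape (enc_circuit C, k) ! (4 + 2 * v) = enc_label (labels C ! v) ! 0"
    "v < n \<Longrightarrow> tape (enc_circuit C, k) ! (5 + 2 * v) = enc_label (labels C ! v) ! 1"
    "e < length (wires C) \<Longrightarrow> tape (enc_circuit C, k) ! (5 + 2 * n + 2 * e) = fst (wires C ! e)"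
    "e < length (wires C) \<Longrightarrow> tape (enc_circuit C, k) ! (6 + 2 * n + 2 * e) = snd (wires C ! e)"
proof -
  let ?L = "concat (map enc_label (labels C))" and ?W = "concat (map (\<lambda>(u, v). [u, v]) (wires C))"
  have t: "tape (enc_circuit C, k) = [k, length (enc_circuit C), outgate C, n] @ ?L @ [length (wires C)] @ ?W"
    by (simp add: enc_circuit_def n_def)
  have L: "length ?L = 2 * n" unfolding n_def by (simp add: length_concat_pairs length_enc_label)
  have W: "length ?W = 2 * length (wires C)" by (simp add: length_concat_pairs split_def)
  show "tape (enc_circuit C, k) ! 0 = k" "tape (enc_circuit C, k) ! 2 = outgate C"
    "tape (enc_circuit C, k) ! 3 = n" unfolding t by simp_all
  have 4: "length ([k, length (enc_circuit C), outgate C, n] :: nat list) = 4" by simp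
  show "tape (enc_circuit C, k) ! (4 + 2 * n) = length (wires C)" unfolding t
    by (simp only: nth_append 4 L) simp
  show "tape (enc_circuit C, k) ! (4 + 2 * v) = enc_label (labels C ! v) ! 0" if "v < n"
    using that nth_concat_pairs(1)[of "labels C" enc_label v] unfolding t
    by (simp only: nth_append 4 L) (simp add: length_enc_label n_def)
  show "tape (enc_circuit C, k) ! (5 + 2 * v) = enc_label (labels C ! v) ! 1" if "v < n"
    using that nth_concat_pairs(2)[of "labels C" enc_label v] unfolding t
    by (simp only: nth_append 4 L) (simp add: length_enc_label n_def)
  show "tape (enc_circuit C, k) ! (5 + 2 * n + 2 * e) = fst (wires C ! e)" if "e < length (wires C)"
    using that nth_concat_pairs(1)[of "wires C" "\<lambda>(u, v). [u, v]" e] unfolding t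
    by (simp only: nth_append 4 L) (simp add: split_def)
  show "tape (enc_circuit C, k) ! (6 + 2 * n + 2 * e) = snd (wires C ! e)" if "e < length (wires C)"
    using that nth_concat_pairs(2)[of "wires C" "\<lambda>(u, v). [u, v]" e] unfolding t
    by (simp only: nth_append 4 L) (simp add: split_def)
qed

lemma length_tape: "length (tape (enc_circuit C, k)) = 5 + 2 * length (labels C) + 2 * length (wires C)"
  by (simp add: length_enc_circuit)

lemma enc_label_nth:
  "enc_label l ! 0 = (case l of AndG \<Rightarrow> 0 | OrG \<Rightarrow> 1 | Lit x b \<Rightarrow> if b then 2 else 3)"
  "enc_label l ! 1 = arg_of l"
  by (cases l rule: enc_label.cases; simp)+

context
  fixes j C k \<sigma> \<rho>
  assumes ld: "loaded j C k \<sigma> \<rho>"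
begin

lemma eval_tagE: "\<sigma> v < length (labels C) \<Longrightarrow> eval (tagE j v) \<sigma> \<rho> = enc_label (labels C ! \<sigma> v) ! 0"
  using ld tape_nth(5)[where v = "\<sigma> v" and C = C and k = k] length_tape[of C k]
  unfolding loaded_def tagE_def by (simp del: tape.simps)

lemma eval_argE: "\<sigma> v < length (labels C) \<Longrightarrow> eval (argE j v) \<sigma> \<rho> = arg_of (labels C ! \<sigma> v)"
  using ld tape_nth(6)[where v = "\<sigma> v" and C = C and k = k] length_tape[of C k]
  unfolding loaded_def argE_def by (simp add: enc_label_nth(2)[simplified] del: tape.simps)

lemma tr_litE: "\<sigma> v < length (labels C) \<Longrightarrow> tr (litE j v) \<sigma> \<rho> \<longleftrightarrow> is_lit (labels C ! \<sigma> v)"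
  by (simp add: litE_def eval_tagE enc_label_nth(1) split: vlabel.split)

lemma tr_posE: "\<sigma> v < length (labels C) \<Longrightarrow>
    tr (EqE (tagE j v) (Num 2)) \<sigma> \<rho> \<longleftrightarrow> (\<exists>x. labels C ! \<sigma> v = Lit x True)"
  by (simp add: eval_tagE enc_label_nth(1) split: vlabel.split)

lemma tr_wireE:
  assumes "u \<noteq> 90" "v \<noteq> 90"
  shows "tr (wireE j u v) \<sigma> \<rho> \<longleftrightarrow> (\<sigma> u, \<sigma> v) \<in> set (wires C)"
proof -
  have "eval (srcE j 90) (\<sigma>(90 := e)) \<rho> = fst (wires C ! e)"
    "eval (dstE j 90) (\<sigma>(90 := e)) \<rho> = snd (wires C ! e)" if "e < length (wires C)" for e
    using ld that tape_nth(7,8)[where e = e and C = C and k = k] length_tape[of C k]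
    unfolding loaded_def srcE_def dstE_def by (simp_all add: add.assoc del: tape.simps)
  moreover have "\<sigma> 4 = length (wires C)" using ld by (simp add: loaded_def)
  ultimately have "tr (wireE j u v) \<sigma> \<rho> \<longleftrightarrow>
      (\<exists>e < length (wires C). fst (wires C ! e) = \<sigma> u \<and> snd (wires C ! e) = \<sigma> v)"
    using assms by (auto simp: wireE_def)
  also have "\<dots> \<longleftrightarrow> (\<sigma> u, \<sigma> v) \<in> set (wires C)" by (auto simp: in_set_conv_nth) (metis prod.collapse)
  finally show ?thesis .
qed

end

definition load_circuit :: "arr \<Rightarrow> ram" where
  "load_circuit j = Seq (assign 1 (Arr j (Num 0))) (Seq (assign 2 (Arr j (Num 2)))
     (Seq (assign 3 (Arr j (Num 3))) (assign 4 (Arr j (Plus (Num 4) (double 3))))))"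

lemma does_load_circuit:
  assumes "aa a j = tape (enc_circuit C, k)"
  shows "does (load_circuit j) a 60 (a\<lparr>av := (av a)(1 := k, 2 := outgate C, 3 := length (labels C),
    4 := length (wires C))\<rparr>)"
proof -
  note l = length_tape[of C k, folded assms]
  note t = tape_nth[where C = C and k = k, folded assms]
  let ?a1 = "a\<lparr>av := (av a)(1 := k)\<rparr>"
  let ?a2 = "a\<lparr>av := (av a)(1 := k, 2 := outgate C)\<rparr>"
  let ?a3 = "a\<lparr>av := (av a)(1 := k, 2 := outgate C, 3 := length (labels C))\<rparr>"
  let ?a4 = "a\<lparr>av := (av a)(1 := k, 2 := outgate C, 3 := length (labels C), 4 := length (wires C))\<rparr>"
  obtain B where "dims_le (av a) B" using ex_dims_le by blast
  then have 1: "does (assign 1 (Arr j (Num 0))) a 11 ?a1"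
    using does_assign[of "Arr j (Num 0)" a B 1] l t by (simp del: tape.simps)
  obtain B where "dims_le (av ?a1) B" using ex_dims_le by blast
  then have 2: "does (assign 2 (Arr j (Num 2))) ?a1 11 ?a2"
    using does_assign[of "Arr j (Num 2)" ?a1 B 2] l t by (simp del: tape.simps)
  obtain B where "dims_le (av ?a2) B" using ex_dims_le by blast
  then have 3: "does (assign 3 (Arr j (Num 3))) ?a2 11 ?a3"
    using does_assign[of "Arr j (Num 3)" ?a2 B 3] l t by (simp del: tape.simps)
  obtain B where "dims_le (av ?a3) B" using ex_dims_le by blast
  then have 4: "does (assign 4 (Arr j (Plus (Num 4) (double 3)))) ?a3 17 ?a4"
    using does_assign[of "Arr j (Plus (Num 4) (double 3))" ?a3 B 4] l t
    by (simp del: tape.simps) (simp add: double_def)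
  have "does (load_circuit j) a (11 + (11 + (11 + 17))) ?a4"
    unfolding load_circuit_def by (rule does_Seq[OF 1 does_Seq[OF 2 does_Seq[OF 3 4]]])
  then show ?thesis by (rule does_mono) simp
qed

section \<open>Circuits of depth two\<close>

text \<open>The depth condition of \<open>Pi_circuit\<close> concerns only paths that start at
  inputs. As the wires are acyclic, every path can be prolonged backwards to an input, so the
  condition bounds all paths to the output.\<close>

lemma reach_input:
  assumes "wf_circuit C" "v \<in> verts C"
  shows "\<exists>u \<in> inputs C. \<exists>d. (u, v) \<in> set (wires C) ^^ d"
proof -
  have "wf (set (wires C))" using assms(1) by (intro finite_acyclic_wf) (auto simp: wf_circuit_def)
  then show ?thesis using assms(2)
  proof (induction v rule: wf_induct_rule)
    case (less v)
    show ?case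
    proof (cases "v \<in> inputs C")
      case True
      then show ?thesis by (intro bexI[of _ v] exI[of _ 0]) auto
    next
      case False
      then obtain w where w: "(w, v) \<in> set (wires C)" using assms(1) less.prems by (auto simp: wf_circuit_def)
      then have "w \<in> verts C" using assms(1) by (auto simp: wf_circuit_def)
      then obtain u d where "u \<in> inputs C" "(u, w) \<in> set (wires C) ^^ d" using less.IH[OF w] by blast
      then show ?thesis using w by (intro bexI[of _ u] exI[of _ "Suc d"]) auto
    qed
  qed
qed

definition lit_true :: "circuit \<Rightarrow> nat set \<Rightarrow> nat \<Rightarrow> bool" where
  "lit_true C A u \<longleftrightarrow> (\<exists>x b. labels C ! u = Lit x b \<and> (x \<in> A) = b)"

lemma holds_input: "v \<in> inputs C \<Longrightarrow> holds C A v \<longleftrightarrow> lit_true C A v"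
  by (auto simp: inputs_def lit_true_def elim: holds.cases intro: holds.intros)

text \<open>The gates alternate, so a gate below the output is an \<open>OrG\<close>. A gate below
  that one would itself be reached from an input, giving a path of length at least 3 to the
  output.\<close>

lemma Pi2_gate:
  assumes "Pi_circuit 2 C" "(c, outgate C) \<in> set (wires C)" "c \<notin> inputs C"
  shows "labels C ! c = OrG" "\<And>u. (u, c) \<in> set (wires C) \<Longrightarrow> u \<in> inputs C"
proof -
  have wf: "wf_circuit C" using assms(1) by (simp add: Pi_circuit_def)
  have c: "c \<in> verts C" using wf assms(2) by (auto simp: wf_circuit_def)
  have "labels C ! c \<noteq> AndG" using assms by (auto simp: Pi_circuit_def)
  then show "labels C ! c = OrG" using c assms(3) by (cases "labels C ! c") (auto simp: inputs_def)
  fix u assume u: "(u, c) \<in> set (wires C)"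
  show "u \<in> inputs C"
  proof (rule ccontr)
    assume nu: "u \<notin> inputs C"
    have "u \<in> verts C" using wf u by (auto simp: wf_circuit_def)
    then obtain w d where w: "w \<in> inputs C" "(w, u) \<in> set (wires C) ^^ d" using reach_input[OF wf] by blast
    then have "d \<noteq> 0" using nu by (cases d) auto
    have "(w, outgate C) \<in> set (wires C) ^^ Suc (Suc d)"
      using w(2) u assms(2) by (auto intro!: relcompI)
    then have "Suc (Suc d) \<le> 2" using assms(1) w(1) unfolding Pi_circuit_def by blast
    then show False using \<open>d \<noteq> 0\<close> by simp
  qed
qed

text \<open>The output is a conjunction of clauses. An input wired directly to the output is a
  clause with one literal, which the alternative \<open>u = c\<close> covers.\<close>

lemma Pi2_holds:
  assumes "Pi_circuit 2 C"
  shows "holds C A (outgate C) \<longleftrightarrow> (\<forall>c. (c, outgate C) \<in> set (wires C) \<longrightarrow>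
    (\<exists>u \<in> inputs C. ((u, c) \<in> set (wires C) \<or> u = c) \<and> lit_true C A u))"
proof -
  have wf: "wf_circuit C" using assms by (simp add: Pi_circuit_def)
  have out: "outgate C \<in> verts C" "labels C ! outgate C = AndG"
    using assms by (auto simp: Pi_circuit_def wf_circuit_def)
  have "holds C A (outgate C) \<longleftrightarrow> (\<forall>c. (c, outgate C) \<in> set (wires C) \<longrightarrow> holds C A c)"
    using out by (auto elim: holds.cases intro: holds.intros)
  also have "\<dots> \<longleftrightarrow> (\<forall>c. (c, outgate C) \<in> set (wires C) \<longrightarrow>
    (\<exists>u \<in> inputs C. ((u, c) \<in> set (wires C) \<or> u = c) \<and> lit_true C A u))"
  proof (intro all_cong)
    fix c assume c: "(c, outgate C) \<in> set (wires C)"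
    show "holds C A c \<longleftrightarrow> (\<exists>u \<in> inputs C. ((u, c) \<in> set (wires C) \<or> u = c) \<and> lit_true C A u)"
    proof (cases "c \<in> inputs C")
      case True
      then have "(u, c) \<notin> set (wires C)" for u using wf by (force simp: wf_circuit_def)
      then show ?thesis using holds_input[OF True] True by blast
    next
      case False
      note g = Pi2_gate[OF assms c False]
      have "c \<in> verts C" using wf c by (auto simp: wf_circuit_def)
      then have "holds C A c \<longleftrightarrow> (\<exists>u. (u, c) \<in> set (wires C) \<and> holds C A u)"
        using g(1) by (auto elim: holds.cases intro: holds.intros)
      then show ?thesis using g(2) holds_input False by blast
    qed
  qed
  finally show ?thesis .
qed

section \<open>Monotone formulas as circuits\<close>

text \<open>Only the first \<open>G\<close> of the \<open>N\<close> variables occur in clauses. The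
  others raise the number of variables without adding edges.\<close>

definition cnf_circuit :: "nat \<Rightarrow> nat \<Rightarrow> nat \<Rightarrow> (nat \<Rightarrow> nat \<Rightarrow> bool) \<Rightarrow> circuit" where
  "cnf_circuit N G m R = \<lparr>labels = map (\<lambda>v. Lit v True) [0..<N] @ replicate m OrG @ [AndG],
     wires = map (\<lambda>(v, j). (v, N + j)) (filter (\<lambda>(v, j). R v j) (List.product [0..<G] [0..<m])) @
       map (\<lambda>j. (N + j, N + m)) [0..<m],
     outgate = N + m\<rparr>"

text \<open>In a well-formed circuit every vertex without an incoming wire is an input; therefore
  there has to be a clause, and every clause needs a variable.\<close>

locale cnf =
  fixes N G m :: nat and R :: "nat \<Rightarrow> nat \<Rightarrow> bool"
  assumes GN: "G \<le> N" and m_pos: "0 < m" and nonempty: "\<And>j. j < m \<Longrightarrow> \<exists>v < G. R v j"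
begin

abbreviation "CC \<equiv> cnf_circuit N G m R"

lemma labels_nth: "v < N \<Longrightarrow> labels CC ! v = Lit v True" "j < m \<Longrightarrow> labels CC ! (N + j) = OrG"
  "labels CC ! (N + m) = AndG"
  by (simp_all add: cnf_circuit_def nth_append)

lemma verts_CC: "verts CC = {..<N + m + 1}"
  by (simp add: verts_def cnf_circuit_def)

lemma wires_CC: "set (wires CC) = {(v, N + j) |v j. v < G \<and> j < m \<and> R v j} \<union> {(N + j, N + m) |j. j < m}"
  by (auto simp: cnf_circuit_def)

lemma out_CC: "outgate CC = N + m"
  by (simp add: cnf_circuit_def)

lemma inputs_CC: "inputs CC = {..<N}"
proof -
  have "is_lit (labels CC ! v) \<longleftrightarrow> v < N" if "v < N + m + 1" for v
  proof (cases "v < N")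
    case False
    then obtain j where "v = N + j" using le_Suc_ex not_less by blast
    then show ?thesis using labels_nth(2)[of j] labels_nth(3) that by (cases "j = m") auto
  qed (use labels_nth(1) in auto)
  then show ?thesis unfolding inputs_def verts_CC by auto
qed

lemma wf_CC: "wf_circuit CC"
proof -
  have "distinct (map (\<lambda>(v, j). (v, N + j)) (filter (\<lambda>(v, j). R v j) (List.product [0..<G] [0..<m])))"
    by (auto simp: distinct_map inj_on_def intro!: distinct_filter distinct_product)
  then have "distinct (wires CC)" using GN unfolding cnf_circuit_def by (auto simp: distinct_map inj_on_def)
  moreover have "set (wires CC) \<subseteq> verts CC \<times> verts CC" using GN unfolding wires_CC verts_CC by auto
  moreover have "acyclic (set (wires CC))"
  proof (rule acyclicI_order[of _ "\<lambda>v. - int v"])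
    fix a b assume "(a, b) \<in> set (wires CC)"
    then show "- int b < - int a" using GN unfolding wires_CC by auto
  qed
  moreover have "inputs CC = verts CC - snd ` set (wires CC)"
  proof -
    have "snd ` set (wires CC) = {N..N + m}"
    proof
      show "snd ` set (wires CC) \<subseteq> {N..N + m}" unfolding wires_CC by auto
      show "{N..N + m} \<subseteq> snd ` set (wires CC)"
      proof
        fix x assume x: "x \<in> {N..N + m}"
        then obtain j where j: "x = N + j" "j \<le> m" by (metis atLeastAtMost_iff le_Suc_ex nat_add_left_cancel_le)
        show "x \<in> snd ` set (wires CC)"
        proof (cases "j = m")
          case True
          then have "(N + 0, x) \<in> set (wires CC)" using j m_pos unfolding wires_CC by blast
          then show ?thesis by force
        next
          case False
          then obtain v where "v < G" "R v j" using nonempty[of j] j by auto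
          then have "(v, x) \<in> set (wires CC)" using j False unfolding wires_CC by auto
          then show ?thesis by force
        qed
      qed
    qed
    then show ?thesis unfolding inputs_CC verts_CC by auto
  qed
  moreover have "inj_on ((!) (labels CC)) (inputs CC)"
    unfolding inputs_CC using labels_nth(1) by (auto intro!: inj_onI)
  moreover have "outgate CC \<notin> fst ` set (wires CC)" using GN unfolding wires_CC out_CC by auto
  moreover have "outgate CC \<in> verts CC - inputs CC" unfolding verts_CC inputs_CC out_CC by simp
  ultimately show ?thesis unfolding wf_circuit_def by blast
qed

lemma Pi_CC: "Pi_circuit 2 CC"
  unfolding Pi_circuit_def
proof (intro conjI ballI)
  show "wf_circuit CC" by (rule wf_CC)
  show "labels CC ! outgate CC = AndG" unfolding out_CC by (rule labels_nth)
next
  fix v assume "v \<in> verts CC - inputs CC"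
  then have "{u. (v, u) \<in> set (wires CC)} \<subseteq> {N + m}" unfolding inputs_CC wires_CC using GN by auto
  then have "card {u. (v, u) \<in> set (wires CC)} \<le> card {N + m}" by (intro card_mono) auto
  then show "card {u. (v, u) \<in> set (wires CC)} \<le> 1" by simp
next
  fix e assume "e \<in> set (wires CC)"
  then show "case e of (u, v) \<Rightarrow> u \<notin> inputs CC \<longrightarrow> labels CC ! u \<noteq> labels CC ! v"
    unfolding inputs_CC wires_CC using GN labels_nth(2,3) by auto
next
  fix v assume "v \<in> inputs CC"
  show "\<forall>d. (v, outgate CC) \<in> set (wires CC) ^^ d \<longrightarrow> d \<le> 2"
  proof (intro allI impI)
    fix d assume d: "(v, outgate CC) \<in> set (wires CC) ^^ d"
    \<comment> \<open>Every wire climbs exactly one of the levels 0 (inputs), 1 (clauses) and 2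
      (output), so the length of a path is the difference of levels.\<close>
    have level: "(if x < N then 0 else if x < N + m then 1 else 2) + d = (if y < N then 0 else if y < N + m then 1 else 2 :: nat)"
      if "(x, y) \<in> set (wires CC) ^^ d" for x y d
      using that
    proof (induction d arbitrary: y)
      case (Suc d)
      then obtain z where z: "(x, z) \<in> set (wires CC) ^^ d" "(z, y) \<in> set (wires CC)" by auto
      from z(2) have "(if y < N then 0 else if y < N + m then 1 else 2 :: nat) =
          Suc (if z < N then 0 else if z < N + m then 1 else 2)"
        using GN unfolding wires_CC by auto
      then show ?case using Suc.IH[OF z(1)] by linarith
    qed auto
    from level[OF d] show "d \<le> 2" by (simp split: if_splits)
  qed
qed

lemma monotone_CC: "monotone_circuit CC"
  unfolding monotone_circuit_def by (auto simp: cnf_circuit_def)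

lemma vars_CC: "vars CC = {..<N}"
  unfolding vars_def by (auto simp: cnf_circuit_def image_iff)

lemma holds_CC: "holds CC A (outgate CC) \<longleftrightarrow> (\<forall>j < m. \<exists>v \<in> A. v < G \<and> R v j)"
proof -
  have lit: "lit_true CC A u \<longleftrightarrow> u \<in> A" if "u < N" for u using labels_nth(1)[OF that] by (auto simp: lit_true_def)
  have "holds CC A (outgate CC) \<longleftrightarrow> (\<forall>j < m. \<exists>u < N. (u, N + j) \<in> set (wires CC) \<and> lit_true CC A u)"
  proof -
    have "(c, N + m) \<in> set (wires CC) \<longleftrightarrow> (\<exists>j < m. c = N + j)" for c
      using GN unfolding wires_CC by auto
    then show ?thesis using Pi2_holds[OF Pi_CC, of A] unfolding out_CC inputs_CC by auto
  qed
  also have "\<dots> \<longleftrightarrow> (\<forall>j < m. \<exists>v \<in> A. v < G \<and> R v j)"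
  proof -
    have "(u, N + j) \<in> set (wires CC) \<longleftrightarrow> u < G \<and> R u j" if "j < m" "u < N" for u j
      using that unfolding wires_CC by auto
    then show ?thesis using GN lit by (metis order_less_le_trans)
  qed
  finally show ?thesis .
qed

text \<open>Without the output gate only edges between variables and clauses remain, at most
  \<open>G * m\<close>, and the genus is at most the number of darts.\<close>

lemma genus_CC: "circuit_genus CC \<le> 2 * (G * m)"
proof -
  let ?V = "verts CC - {outgate CC}" and ?W = "set (wires CC)"
  let ?D = "(?W \<union> ?W\<inverse>) \<inter> ?V \<times> ?V"
  let ?E = "(\<lambda>(v, j). (v, N + j)) ` ({..<G} \<times> {..<m})"
  have "sym ?D" "irrefl ?D" using GN by (auto simp: sym_def irrefl_def wires_CC)
  then have "graph_genus ?V ?D \<le> card ?D" by (intro graph_genus_excess(2)) (auto simp: verts_def)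
  also have "\<dots> \<le> card (?E \<union> ?E\<inverse>)"
  proof (rule card_mono)
    show "?D \<subseteq> ?E \<union> ?E\<inverse>" unfolding wires_CC out_CC by auto
    show "finite (?E \<union> ?E\<inverse>)" by simp
  qed
  also have "\<dots> \<le> card ?E + card (?E\<inverse>)" by (rule card_Un_le)
  also have "card (?E\<inverse>) = card ?E" by (rule card_inverse)
  also have "card ?E \<le> card ({..<G} \<times> {..<m})" by (rule card_image_le) simp
  finally show ?thesis unfolding circuit_genus_def Let_def by (simp add: card_cartesian_product)
qed

end

section \<open>Gap variables\<close>

text \<open>
  A choice of \<open>K\<close> variables is a chain of positions from 0 to \<open>n + 1\<close>; the triple
  \<open>(i, a, b)\<close> says that \<open>a\<close> and \<open>b\<close> are the positions number \<open>i\<close> and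
  \<open>i + 1\<close> of the chain. That a position is not chosen then becomes a positive statement: it
  lies strictly inside a gap. A variable has the position after its first literal.
\<close>

definition first_lit :: "circuit \<Rightarrow> nat \<Rightarrow> bool" where
  "first_lit C p \<longleftrightarrow> p < length (labels C) \<and> is_lit (labels C ! p) \<and>
     (\<forall>u < p. is_lit (labels C ! u) \<longrightarrow> arg_of (labels C ! u) \<noteq> arg_of (labels C ! p))"

definition position :: "circuit \<Rightarrow> nat \<Rightarrow> bool" where
  "position C q \<longleftrightarrow> (\<exists>p. q = Suc p \<and> first_lit C p)"

text \<open>The positions of variables are successors of vertices, which keeps 0 and
  \<open>Suc (length (labels C))\<close> free as ends of the chain. The two equivalences let exactly
  the first triple start and exactly the last one end there.\<close>

definition valid_gap :: "circuit \<Rightarrow> nat \<Rightarrow> nat \<Rightarrow> nat \<Rightarrow> nat \<Rightarrow> bool" where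
  "valid_gap C K i a b \<longleftrightarrow> a < b \<and> (i = 0 \<longleftrightarrow> a = 0) \<and> (i = K \<longleftrightarrow> b = Suc (length (labels C))) \<and>
     (a = 0 \<or> position C a) \<and> (b = Suc (length (labels C)) \<or> position C b)"

text \<open>The clause for \<open>(i, a, b)\<close> expresses: if this triple is chosen, it is valid
  and the next one starts at \<open>b\<close>. To avoid a negation, the triple not being chosen is
  replaced by another triple with the same \<open>i\<close> being chosen.\<close>

definition chain_gate :: "circuit \<Rightarrow> nat \<Rightarrow> nat \<Rightarrow> nat \<Rightarrow> nat \<Rightarrow> nat \<Rightarrow> nat \<Rightarrow> nat \<Rightarrow> bool" where
  "chain_gate C K i a b i' a' b' \<longleftrightarrow> i' = i \<and> \<not> (a' = a \<and> b' = b) \<or>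
     valid_gap C K i a b \<and> (i = K \<and> i' = i \<or> i' = Suc i \<and> a' = b)"

definition supports :: "circuit \<Rightarrow> nat \<Rightarrow> nat \<Rightarrow> nat \<Rightarrow> bool" where
  "supports C u a b \<longleftrightarrow> (\<exists>p. first_lit C p \<and> arg_of (labels C ! p) = arg_of (labels C ! u) \<and>
     (if \<exists>x. labels C ! u = Lit x True then b = Suc p else a < Suc p \<and> Suc p < b))"

text \<open>For a vertex that is no clause of \<open>C\<close> every triple will do. This gives each
  vertex its gate and keeps the numbering simple.\<close>

definition clause_gate :: "circuit \<Rightarrow> nat \<Rightarrow> nat \<Rightarrow> nat \<Rightarrow> bool" where
  "clause_gate C c a b \<longleftrightarrow> ((c, outgate C) \<in> set (wires C) \<longrightarrow>
     (\<exists>u < length (labels C). is_lit (labels C ! u) \<and> ((u, c) \<in> set (wires C) \<or> u = c) \<and> supports C u a b))"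

definition gap_index :: "circuit \<Rightarrow> nat \<Rightarrow> nat \<Rightarrow> nat \<Rightarrow> nat" where
  "gap_index C i a b = (length (labels C) + 2) * ((length (labels C) + 2) * i + a) + b"

definition num_gaps :: "circuit \<Rightarrow> nat \<Rightarrow> nat" where
  "num_gaps C K = (K + 1) * ((length (labels C) + 2) * (length (labels C) + 2))"

text \<open>The clauses numbered below \<open>num_gaps C K\<close> are the chain conditions, indexed
  by their triples; one clause for each vertex of \<open>C\<close> follows.\<close>

definition gap_rel :: "circuit \<Rightarrow> nat \<Rightarrow> nat \<Rightarrow> nat \<Rightarrow> bool" where
  "gap_rel C K v j \<longleftrightarrow> (\<exists>i < K + 1. \<exists>a < length (labels C) + 2. \<exists>b < length (labels C) + 2.
     v = gap_index C i a b \<and>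
     ((\<exists>i' < K + 1. \<exists>a' < length (labels C) + 2. \<exists>b' < length (labels C) + 2.
         j = gap_index C i' a' b' \<and> chain_gate C K i' a' b' i a b) \<or>
      (\<exists>c < length (labels C). j = num_gaps C K + c \<and> clause_gate C c a b)))"

section \<open>Numbering of the triples and nonemptiness of the clauses\<close>

lemma radix_inj:
  fixes a b U :: nat
  assumes "a < U" "b < U" "U * x + a = U * y + b"
  shows "x = y \<and> a = b"
proof -
  have "(U * x + a) div U = x" "(U * y + b) div U = y" "(U * x + a) mod U = a" "(U * y + b) mod U = b"
    using assms(1,2) by simp_all
  then show ?thesis using assms(3) by metis
qed

lemma gap_index_inj:
  assumes "a < length (labels C) + 2" "b < length (labels C) + 2"
    "a' < length (labels C) + 2" "b' < length (labels C) + 2"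
  shows "gap_index C i a b = gap_index C i' a' b' \<longleftrightarrow> i = i' \<and> a = a' \<and> b = b'"
proof
  assume "gap_index C i a b = gap_index C i' a' b'"
  then show "i = i' \<and> a = a' \<and> b = b'"
    unfolding gap_index_def using radix_inj[OF assms(1,3)] radix_inj[OF assms(2,4)] by blast
qed simp

lemma gap_index_less:
  assumes "i < K + 1" "a < length (labels C) + 2" "b < length (labels C) + 2"
  shows "gap_index C i a b < num_gaps C K"
proof -
  let ?U = "length (labels C) + 2"
  have "?U * i + a < ?U * (K + 1)"
  proof -
    have "?U * i + a < ?U * (i + 1)" using assms by simp
    also have "\<dots> \<le> ?U * (K + 1)" using assms by (intro mult_le_mono2) simp
    finally show ?thesis .
  qed
  then have "?U * i + a + 1 \<le> ?U * (K + 1)" by simp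
  then have "?U * (?U * i + a + 1) \<le> ?U * (?U * (K + 1))" by (rule mult_le_mono2)
  moreover have "gap_index C i a b < ?U * (?U * i + a + 1)" using assms unfolding gap_index_def by simp
  moreover have "num_gaps C K = ?U * (?U * (K + 1))" unfolding num_gaps_def by (simp only: mult_ac)
  ultimately show ?thesis by linarith
qed

text \<open>Chain clauses and vertex clauses have disjoint ranges of numbers, so one alternative of
  \<open>gap_rel\<close> drops out.\<close>

lemma gap_rel_chain:
  assumes "i' < K + 1" "a' < length (labels C) + 2" "b' < length (labels C) + 2"
  shows "gap_rel C K v (gap_index C i' a' b') \<longleftrightarrow> (\<exists>i < K + 1. \<exists>a < length (labels C) + 2.
    \<exists>b < length (labels C) + 2. v = gap_index C i a b \<and> chain_gate C K i' a' b' i a b)"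
  using gap_index_less[OF assms] gap_index_inj[OF assms(2,3)] assms unfolding gap_rel_def by fastforce

lemma gap_rel_clause:
  assumes "c < length (labels C)"
  shows "gap_rel C K v (num_gaps C K + c) \<longleftrightarrow> (\<exists>i < K + 1. \<exists>a < length (labels C) + 2.
    \<exists>b < length (labels C) + 2. v = gap_index C i a b \<and> clause_gate C c a b)"
proof -
  have "num_gaps C K + c \<noteq> gap_index C i a b"
    if "i < K + 1" "a < length (labels C) + 2" "b < length (labels C) + 2" for i a b
    using gap_index_less[OF that] by simp
  then have "(\<exists>i' < K + 1. \<exists>a' < length (labels C) + 2. \<exists>b' < length (labels C) + 2.
         num_gaps C K + c = gap_index C i' a' b' \<and> chain_gate C K i' a' b' i a b) \<longleftrightarrow> False" for i a b
    by blast
  moreover have "(\<exists>c' < length (labels C). num_gaps C K + c = num_gaps C K + c' \<and> clause_gate C c' a b) \<longleftrightarrow>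
      clause_gate C c a b" for a b using assms by auto
  ultimately show ?thesis unfolding gap_rel_def by (simp only: simp_thms)
qed

lemma gap_index_surj:
  assumes "v < num_gaps C K"
  shows "\<exists>i < K + 1. \<exists>a < length (labels C) + 2. \<exists>b < length (labels C) + 2. v = gap_index C i a b"
proof -
  let ?U = "length (labels C) + 2"
  have "v div ?U div ?U < K + 1"
  proof -
    have "v < (K + 1) * ?U * ?U" using assms unfolding num_gaps_def by (simp only: mult_ac)
    then show ?thesis by (simp only: less_mult_imp_div_less)
  qed
  moreover have "v = ?U * (?U * (v div ?U div ?U) + v div ?U mod ?U) + v mod ?U"
    by (simp only: mult_div_mod_eq)
  moreover have "v div ?U mod ?U < ?U" "v mod ?U < ?U" by simp_all
  ultimately show ?thesis unfolding gap_index_def by blast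
qed

lemma first_lit_ex:
  assumes "u < length (labels C)" "is_lit (labels C ! u)"
  shows "\<exists>p. first_lit C p \<and> arg_of (labels C ! p) = arg_of (labels C ! u)"
proof -
  let ?P = "\<lambda>p. p < length (labels C) \<and> is_lit (labels C ! p) \<and> arg_of (labels C ! p) = arg_of (labels C ! u)"
  define p where "p = (LEAST p. ?P p)"
  have P: "?P p" unfolding p_def by (rule LeastI[of ?P u]) (use assms in auto)
  have "\<not> ?P v" if "v < p" for v using that not_less_Least[of v ?P] unfolding p_def by blast
  then show ?thesis using P unfolding first_lit_def by (intro exI[of _ p]) auto
qed

lemma first_lit_inj:
  assumes "first_lit C p" "first_lit C q" "arg_of (labels C ! p) = arg_of (labels C ! q)"
  shows "p = q"
  using assms unfolding first_lit_def by (metis linorder_neqE_nat)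

text \<open>Required by the locale \<open>cnf\<close>. A chain clause contains the other triples of
  its block; a clause of \<open>C\<close> contains a triple of block 0 that starts at 0 and ends at,
  or passes over, one of its variables.\<close>

lemma gap_nonempty:
  assumes wf: "Pi_circuit 2 C" and "j < num_gaps C K + length (labels C)"
  shows "\<exists>v < num_gaps C K. gap_rel C K v j"
proof (cases "j < num_gaps C K")
  case True
  then obtain i a b where *: "i < K + 1" "a < length (labels C) + 2" "b < length (labels C) + 2"
    "j = gap_index C i a b" using gap_index_surj by blast
  let ?b = "if b = 0 then 1 else 0"
  have "gap_rel C K (gap_index C i a ?b) j"
    unfolding *(4) gap_rel_chain[OF *(1-3)] using *
    by (intro exI[of _ i] exI[of _ a] exI[of _ ?b]) (auto simp: chain_gate_def)
  moreover have "gap_index C i a ?b < num_gaps C K" using * by (intro gap_index_less) auto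
  ultimately show ?thesis by blast
next
  case False
  then obtain c where c: "j = num_gaps C K + c" "c < length (labels C)"
    using assms(2) by (metis le_Suc_ex not_less nat_add_left_cancel_less)
  have "\<exists>a < length (labels C) + 2. \<exists>b < length (labels C) + 2. clause_gate C c a b"
  proof (cases "(c, outgate C) \<in> set (wires C)")
    case False
    then show ?thesis unfolding clause_gate_def by (intro exI[of _ 0]) auto
  next
    case True
    have wfc: "wf_circuit C" using wf by (simp add: Pi_circuit_def)
    have "\<exists>u \<in> inputs C. (u, c) \<in> set (wires C) \<or> u = c"
    proof (cases "c \<in> inputs C")
      case False
      then obtain u where "(u, c) \<in> set (wires C)" using wfc True by (auto simp: wf_circuit_def)
      then show ?thesis using Pi2_gate(2)[OF wf True False] by blast
    qed blast
    then obtain u where u: "u < length (labels C)" "is_lit (labels C ! u)" "(u, c) \<in> set (wires C) \<or> u = c"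
      by (auto simp: inputs_def verts_def)
    obtain p where p: "first_lit C p" "arg_of (labels C ! p) = arg_of (labels C ! u)"
      using first_lit_ex[OF u(1,2)] by blast
    then have "p < length (labels C)" by (simp add: first_lit_def)
    let ?b = "if \<exists>x. labels C ! u = Lit x True then Suc p else Suc (length (labels C))"
    have "supports C u 0 ?b" unfolding supports_def using p \<open>p < _\<close> by (intro exI[of _ p]) auto
    then have "clause_gate C c 0 ?b" unfolding clause_gate_def using u by blast
    moreover have "?b < length (labels C) + 2" using \<open>p < _\<close> by simp
    ultimately show ?thesis by (metis add_gr_0 zero_less_numeral)
  qed
  then obtain a b where ab: "a < length (labels C) + 2" "b < length (labels C) + 2" "clause_gate C c a b" by blast
  then have "gap_rel C K (gap_index C 0 a b) j" unfolding c(1) gap_rel_clause[OF c(2)]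
    by (intro exI[of _ 0]) auto
  then show ?thesis using gap_index_less[of 0 K a C b] ab by auto
qed

section \<open>Gap solutions and satisfying assignments\<close>

definition gap_solution :: "circuit \<Rightarrow> nat \<Rightarrow> (nat \<times> nat \<times> nat) set \<Rightarrow> bool" where
  "gap_solution C K T \<longleftrightarrow> T \<subseteq> {..<K + 1} \<times> {..<length (labels C) + 2} \<times> {..<length (labels C) + 2} \<and>
     card T = K + 1 \<and>
     (\<forall>i < K + 1. \<forall>a < length (labels C) + 2. \<forall>b < length (labels C) + 2.
        \<exists>(i', a', b') \<in> T. chain_gate C K i a b i' a' b') \<and>
     (\<forall>c < length (labels C). \<exists>(i, a, b) \<in> T. clause_gate C c a b)"

lemma gap_solution_of_chain:
  assumes C: "Pi_circuit 2 C" and q: "\<And>i. i \<le> K \<Longrightarrow> q i < q (Suc i)" "q 0 = 0" "q (Suc K) = Suc (length (labels C))"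
    and pos: "\<And>i. 0 < i \<Longrightarrow> i \<le> K \<Longrightarrow> position C (q i)"
    and A: "\<And>p. first_lit C p \<Longrightarrow> arg_of (labels C ! p) \<in> A \<longleftrightarrow> (\<exists>i. 0 < i \<and> i \<le> K \<and> q i = Suc p)"
    and sat: "holds C A (outgate C)"
  shows "gap_solution C K ((\<lambda>i. (i, q i, q (Suc i))) ` {..<K + 1})"
proof -
  let ?T = "(\<lambda>i. (i, q i, q (Suc i))) ` {..<K + 1}" and ?n = "length (labels C)"
  have mono: "q i < q j" if "i < j" "j \<le> Suc K" for i j
    using that
  proof (induction j)
    case (Suc j)
    then show ?case using q(1)[of j] by (cases "i = j") force+
  qed simp
  have ub: "q i < ?n + 2" if "i \<le> Suc K" for i
    using mono[of i "Suc K"] that q(3) by (cases "i = Suc K") auto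
  have valid: "valid_gap C K i (q i) (q (Suc i))" if "i \<le> K" for i
  proof -
    have "i = 0 \<longleftrightarrow> q i = 0" using mono[of 0 i] q(2) that by (cases "i = 0") auto
    moreover have "i = K \<longleftrightarrow> q (Suc i) = Suc ?n" using mono[of "Suc i" "Suc K"] q(3) that by (cases "i = K") auto
    ultimately show ?thesis unfolding valid_gap_def using q(1)[OF that] pos[of i] pos[of "Suc i"] that
      by (cases "i = 0"; cases "i = K") auto
  qed
  show ?thesis unfolding gap_solution_def
  proof (intro conjI allI impI)
    show "?T \<subseteq> {..<K + 1} \<times> {..<?n + 2} \<times> {..<?n + 2}" using ub by auto
    show "card ?T = K + 1" by (subst card_image) (auto simp: inj_on_def)
  next
    fix i a b assume i: "i < K + 1"
    show "\<exists>(i', a', b') \<in> ?T. chain_gate C K i a b i' a' b'"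
    proof (cases "a = q i \<and> b = q (Suc i)")
      case False
      then show ?thesis using i by (intro bexI[of _ "(i, q i, q (Suc i))"]) (auto simp: chain_gate_def)
    next
      case True
      show ?thesis
      proof (cases "i = K")
        case True
        then show ?thesis using valid[of i] \<open>a = _ \<and> b = _\<close>
          by (intro bexI[of _ "(i, q i, q (Suc i))"]) (auto simp: chain_gate_def)
      next
        case False
        then show ?thesis using valid[of i] \<open>a = _ \<and> b = _\<close> i
          by (intro bexI[of _ "(Suc i, q (Suc i), q (Suc (Suc i)))"]) (auto simp: chain_gate_def)
      qed
    qed
  next
    fix c assume "c < ?n"
    show "\<exists>(i, a, b) \<in> ?T. clause_gate C c a b"
    proof (cases "(c, outgate C) \<in> set (wires C)")
      case False
      then show ?thesis by (intro bexI[of _ "(0, q 0, q (Suc 0))"]) (auto simp: clause_gate_def)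
    next
      case True
      then obtain u where u: "u \<in> inputs C" "(u, c) \<in> set (wires C) \<or> u = c" "lit_true C A u"
        using sat unfolding Pi2_holds[OF C] by blast
      then have u': "u < ?n" "is_lit (labels C ! u)" by (auto simp: inputs_def verts_def)
      obtain x s where xs: "labels C ! u = Lit x s" "(x \<in> A) = s" using u(3) by (auto simp: lit_true_def)
      obtain p where p: "first_lit C p" "arg_of (labels C ! p) = arg_of (labels C ! u)"
        using first_lit_ex[OF u'] by blast
      have pn: "p < ?n" using p by (simp add: first_lit_def)
      have pA: "s \<longleftrightarrow> (\<exists>i. 0 < i \<and> i \<le> K \<and> q i = Suc p)" using A[OF p(1)] p(2) xs by simp
      have "\<exists>i \<le> K. supports C u (q i) (q (Suc i))"
      proof (cases s)
        case True
        then obtain i where i: "0 < i" "i \<le> K" "q i = Suc p" using pA by blast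
        then obtain i' where "i = Suc i'" by (cases i) auto
        then show ?thesis unfolding supports_def using i p xs True by (intro exI[of _ i'] conjI exI[of _ p]) auto
      next
        case False
        \<comment> \<open>The last chain point before the position of \<open>p\<close>. The next one
          cannot be before it by maximality, nor at it since the variable is false; so the position
          lies inside the gap.\<close>
        define i where "i = Max {i. i \<le> K \<and> q i < Suc p}"
        have fin: "finite {i. i \<le> K \<and> q i < Suc p}" by simp
        have "0 \<in> {i. i \<le> K \<and> q i < Suc p}" using q(2) by simp
        then have "i \<in> {i. i \<le> K \<and> q i < Suc p}" unfolding i_def by (intro Max_in[OF fin]) blast
        then have i: "i \<le> K" "q i < Suc p" by auto
        have "Suc p < q (Suc i)"
        proof (cases "i = K")
          case True
          then show ?thesis using q(3) pn by simp
        next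
          case iK: False
          then have "\<not> q (Suc i) < Suc p" using Max_ge[OF fin, of "Suc i"] i(1) unfolding i_def[symmetric] by auto
          moreover have "Suc i \<le> K" using iK i(1) by simp
          then have "q (Suc i) \<noteq> Suc p" using pA False by blast
          ultimately show ?thesis by simp
        qed
        then show ?thesis unfolding supports_def using i p xs False by (intro exI[of _ i] conjI exI[of _ p]) auto
      qed
      then obtain i where "i \<le> K" "clause_gate C c (q i) (q (Suc i))"
        unfolding clause_gate_def using u u' by blast
      then show ?thesis by (intro bexI[of _ "(i, q i, q (Suc i))"]) auto
    qed
  qed
qed

text \<open>There are \<open>K + 1\<close> triples and no block is empty, so each block has exactly
  one. The chain clauses can then only be met as intended, which makes the triples valid and
  consecutive; the assignment consists of the variables at the ends of all gaps but the
  last.\<close>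

lemma chain_of_gap_solution:
  assumes C: "Pi_circuit 2 C" and T: "gap_solution C K T"
  shows "weight_sat C K"
proof -
  let ?n = "length (labels C)"
  have T_sub: "T \<subseteq> {..<K + 1} \<times> {..<?n + 2} \<times> {..<?n + 2}" and T_card: "card T = K + 1"
    and T_chain: "\<And>i a b. i < K + 1 \<Longrightarrow> a < ?n + 2 \<Longrightarrow> b < ?n + 2 \<Longrightarrow> \<exists>(i', a', b') \<in> T. chain_gate C K i a b i' a' b'"
    and T_clause: "\<And>c. c < ?n \<Longrightarrow> \<exists>(i, a, b) \<in> T. clause_gate C c a b"
    using T unfolding gap_solution_def by blast+
  have finT: "finite T" using T_sub finite_subset by blast
  \<comment> \<open>The gates of the invalid triples \<open>(i, 0, 0)\<close> force every block to be nonempty.\<close>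
  have "fst ` T = {..<K + 1}"
  proof
    show "fst ` T \<subseteq> {..<K + 1}" using T_sub by auto
    show "{..<K + 1} \<subseteq> fst ` T"
    proof
      fix i assume "i \<in> {..<K + 1}"
      then obtain i' a' b' where t: "(i', a', b') \<in> T" "chain_gate C K i 0 0 i' a' b'" using T_chain[of i 0 0] by auto
      then have "i' = i" by (auto simp: chain_gate_def valid_gap_def)
      then show "i \<in> fst ` T" using t by force
    qed
  qed
  then have inj: "inj_on fst T" using T_card finT by (metis card_lessThan eq_card_imp_inj_on)
  have "\<exists>a b. (i, a, b) \<in> T" if "i \<le> K" for i
  proof -
    have "i \<in> fst ` T" using that \<open>fst ` T = _\<close> by simp
    then show ?thesis by force
  qed
  then obtain s e where se: "\<And>i. i \<le> K \<Longrightarrow> (i, s i, e i) \<in> T" by metis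
  have uniq: "a = s i \<and> b = e i \<and> i \<le> K" if "(i, a, b) \<in> T" for i a b
  proof -
    have "i \<le> K" using that T_sub by auto
    then show ?thesis using inj_onD[OF inj _ that se[OF \<open>i \<le> K\<close>]] by simp
  qed
  have sub: "s i < ?n + 2" "e i < ?n + 2" if "i \<le> K" for i using se[OF that] T_sub by auto
  have gate: "valid_gap C K i (s i) (e i) \<and> (i = K \<or> s (Suc i) = e i)" if i: "i \<le> K" for i
  proof -
    obtain i' a' b' where t: "(i', a', b') \<in> T" "chain_gate C K i (s i) (e i) i' a' b'"
      using T_chain[of i "s i" "e i"] sub[OF i] i by auto
    then show ?thesis using uniq[OF t(1)] unfolding chain_gate_def by auto
  qed
  have valid: "valid_gap C K i (s i) (e i)" if "i \<le> K" for i using gate[OF that] by blast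
  have link: "s (Suc i) = e i" if "i < K" for i using gate[of i] that by auto
  have step: "s i < e i" if "i \<le> K" for i using valid[OF that] by (simp add: valid_gap_def)
  have mono: "e i < e j" if "i < j" "j \<le> K" for i j
    using that
  proof (induction j)
    case (Suc j)
    then have "e j < e (Suc j)" using step[of "Suc j"] link[of j] by simp
    then show ?case using Suc by (cases "i = j") force+
  qed simp
  have posE: "position C (e i)" if "i < K" for i
    using valid[of i] that unfolding valid_gap_def by auto
  define P where "P = (\<lambda>i. e i - 1) ` {..<K}"
  have firstP: "first_lit C p" if "p \<in> P" for p using that posE unfolding P_def position_def by force
  have eP: "Suc (e i - 1) = e i" if "i < K" for i using posE[OF that] unfolding position_def by auto
  define A where "A = (\<lambda>p. arg_of (labels C ! p)) ` P"
  have "inj_on (\<lambda>i. e i - 1) {..<K}"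
  proof (rule inj_onI)
    fix i j assume ij: "i \<in> {..<K}" "j \<in> {..<K}" "e i - 1 = e j - 1"
    then have "e i = e j" using eP[of i] eP[of j] by simp
    then show "i = j" using mono[of i j] mono[of j i] ij by (metis lessThan_iff less_irrefl linorder_neqE_nat less_imp_le)
  qed
  then have "card P = K" unfolding P_def by (simp add: card_image)
  moreover have "inj_on (\<lambda>p. arg_of (labels C ! p)) P" using first_lit_inj[OF firstP firstP] by (intro inj_onI)
  ultimately have cardA: "card A = K" unfolding A_def by (simp add: card_image)
  have "A \<subseteq> vars C"
  proof
    fix x assume "x \<in> A"
    then obtain p where "p \<in> P" "x = arg_of (labels C ! p)" by (auto simp: A_def)
    then have "p < ?n" "is_lit (labels C ! p)" "x = arg_of (labels C ! p)" using firstP by (auto simp: first_lit_def)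
    then show "x \<in> vars C" unfolding vars_def by (auto simp: in_set_conv_nth) metis
  qed
  moreover have "holds C A (outgate C)" unfolding Pi2_holds[OF C]
  proof (intro allI impI)
    fix c assume c: "(c, outgate C) \<in> set (wires C)"
    then have "c < ?n" using C by (auto simp: Pi_circuit_def wf_circuit_def verts_def)
    then obtain i a b where t: "(i, a, b) \<in> T" "clause_gate C c a b" using T_clause by blast
    then obtain u where u: "u < ?n" "is_lit (labels C ! u)" "(u, c) \<in> set (wires C) \<or> u = c" "supports C u a b"
      using c unfolding clause_gate_def by blast
    obtain p where p: "first_lit C p" "arg_of (labels C ! p) = arg_of (labels C ! u)"
      "if \<exists>x. labels C ! u = Lit x True then b = Suc p else a < Suc p \<and> Suc p < b"
      using u(4) unfolding supports_def by blast
    have pn: "p < ?n" using p(1) by (simp add: first_lit_def)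
    have ab: "a = s i" "b = e i" "i \<le> K" using uniq[OF t(1)] by auto
    obtain x r where xr: "labels C ! u = Lit x r" using u(2) by blast
    have "lit_true C A u"
    proof (cases r)
      case True
      then have "e i = Suc p" using p(3) xr ab by simp
      then have "i < K" using valid[OF ab(3)] pn ab(3) unfolding valid_gap_def by (cases "i = K") auto
      then have "p \<in> P" using \<open>e i = Suc p\<close> unfolding P_def by force
      then have "arg_of (labels C ! p) \<in> A" unfolding A_def by blast
      then show ?thesis using xr True p(2) by (simp add: lit_true_def)
    next
      case False
      then have gap: "s i < Suc p" "Suc p < e i" using p(3) xr ab by auto
      \<comment> \<open>If the position of \<open>p\<close> were the end of gap \<open>j\<close>,
        monotonicity would put \<open>j\<close> before \<open>i\<close>. Then gap \<open>i\<close>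
        starts at or behind that end, whereas it has to start before it.\<close>
      have "p \<notin> P"
      proof
        assume "p \<in> P"
        then obtain j where j: "j < K" "e j = Suc p" using eP unfolding P_def by auto
        have "j < i" using gap j mono[of i j] by (metis less_irrefl linorder_neqE_nat less_imp_le order_less_trans)
        then obtain i' where i': "i = Suc i'" by (cases i) auto
        then have "s i = e i'" using link[of i'] ab(3) by simp
        then have "e i' < e j" using gap j by simp
        then show False using mono[of j i'] \<open>j < i\<close> i' ab(3) by (cases "j = i'") auto
      qed
      have "x \<notin> A"
      proof
        assume "x \<in> A"
        then obtain p' where "p' \<in> P" "arg_of (labels C ! p') = x" unfolding A_def by blast
        then have "p' = p" using first_lit_inj[OF firstP p(1)] p(2) xr by simp
        then show False using \<open>p \<notin> P\<close> \<open>p' \<in> P\<close> by simp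
      qed
      then show ?thesis using xr False by (simp add: lit_true_def)
    qed
    then show "\<exists>u \<in> inputs C. ((u, c) \<in> set (wires C) \<or> u = c) \<and> lit_true C A u"
      using u by (intro bexI[of _ u]) (auto simp: inputs_def verts_def)
  qed
  ultimately show ?thesis unfolding weight_sat_def using cardA by blast
qed

text \<open>The chain lists the first literals of the true variables in increasing order. First
  literals correspond one to one to the variables, even if both signs occur.\<close>

lemma gap_solution_of_sat:
  assumes C: "Pi_circuit 2 C" and "weight_sat C K"
  shows "\<exists>T. gap_solution C K T"
proof -
  let ?n = "length (labels C)"
  obtain A where A: "A \<subseteq> vars C" "card A = K" "holds C A (outgate C)"
    using assms(2) unfolding weight_sat_def by blast
  define S where "S = {p. first_lit C p \<and> arg_of (labels C ! p) \<in> A}"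
  have finS: "finite S" unfolding S_def first_lit_def by simp
  have "inj_on (\<lambda>p. arg_of (labels C ! p)) S" using first_lit_inj unfolding S_def by (auto intro!: inj_onI)
  moreover have "(\<lambda>p. arg_of (labels C ! p)) ` S = A"
  proof
    show "(\<lambda>p. arg_of (labels C ! p)) ` S \<subseteq> A" unfolding S_def by auto
    show "A \<subseteq> (\<lambda>p. arg_of (labels C ! p)) ` S"
    proof
      fix x assume x: "x \<in> A"
      then obtain b where "Lit x b \<in> set (labels C)" using A(1) by (auto simp: vars_def)
      then obtain u where "u < ?n" "labels C ! u = Lit x b" by (auto simp: in_set_conv_nth)
      then obtain p where "first_lit C p" "arg_of (labels C ! p) = x" using first_lit_ex[of u C] by auto
      then show "x \<in> (\<lambda>p. arg_of (labels C ! p)) ` S" using x unfolding S_def by blast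
    qed
  qed
  ultimately have cardS: "card S = K" using A(2) by (metis card_image)
  define l where "l = sorted_list_of_set S"
  have l: "set l = S" "length l = K" "sorted_wrt (<) l"
    unfolding l_def using finS cardS by (simp_all add: strict_sorted_list_of_set)
  define q where "q i = (if i = 0 then 0 else if i \<le> K then Suc (l ! (i - 1)) else Suc ?n)" for i
  have lS: "l ! i \<in> S" if "i < K" for i using l that nth_mem by blast
  have ln: "l ! i < ?n" if "i < K" for i using lS[OF that] unfolding S_def first_lit_def by auto
  have "gap_solution C K ((\<lambda>i. (i, q i, q (Suc i))) ` {..<K + 1})"
  proof (rule gap_solution_of_chain[OF C _ _ _ _ _ A(3)])
    show "q i < q (Suc i)" if "i \<le> K" for i
    proof (cases "i = 0 \<or> i = K")
      case True
      then show ?thesis using ln[of "i - 1"] by (auto simp: q_def)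
    next
      case False
      then show ?thesis using that sorted_wrt_nth_less[OF l(3), of "i - 1" i] l(2) by (simp add: q_def)
    qed
    show "q 0 = 0" "q (Suc K) = Suc ?n" by (simp_all add: q_def)
    show "position C (q i)" if "0 < i" "i \<le> K" for i
      using lS[of "i - 1"] that by (auto simp: q_def position_def S_def)
    show "arg_of (labels C ! p) \<in> A \<longleftrightarrow> (\<exists>i. 0 < i \<and> i \<le> K \<and> q i = Suc p)" if "first_lit C p" for p
    proof
      assume "arg_of (labels C ! p) \<in> A"
      then have "p \<in> set l" using that l(1) unfolding S_def by simp
      then obtain i where "i < K" "l ! i = p" using l(2) by (auto simp: in_set_conv_nth)
      then show "\<exists>i. 0 < i \<and> i \<le> K \<and> q i = Suc p" by (intro exI[of _ "Suc i"]) (auto simp: q_def)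
    next
      assume "\<exists>i. 0 < i \<and> i \<le> K \<and> q i = Suc p"
      then obtain i where "0 < i" "i \<le> K" "l ! (i - 1) = p" by (auto simp: q_def)
      then have "p \<in> S" using lS[of "i - 1"] by auto
      then show "arg_of (labels C ! p) \<in> A" unfolding S_def by simp
    qed
  qed
  then show ?thesis by blast
qed

definition gap_circuit :: "nat \<Rightarrow> circuit \<Rightarrow> nat \<Rightarrow> circuit" where
  "gap_circuit P C K = cnf_circuit (num_gaps C K + P) (num_gaps C K)
     (num_gaps C K + length (labels C)) (gap_rel C K)"

lemma cnf_gap: "Pi_circuit 2 C \<Longrightarrow> cnf (num_gaps C K + P) (num_gaps C K)
     (num_gaps C K + length (labels C)) (gap_rel C K)"
  using gap_nonempty by unfold_locales (auto simp: num_gaps_def)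

text \<open>The parameter becomes \<open>K + 1\<close>, the number of gaps between \<open>K\<close>
  chosen positions and the two ends. In the backward direction each block needs a triple, so the
  whole weight is used up by triples and none is left for padding variables.\<close>

lemma weight_sat_gap_circuit:
  assumes C: "Pi_circuit 2 C"
  shows "weight_sat (gap_circuit P C K) (K + 1) \<longleftrightarrow> weight_sat C K"
proof -
  interpret cnf "num_gaps C K + P" "num_gaps C K" "num_gaps C K + length (labels C)" "gap_rel C K"
    using cnf_gap[OF C] .
  let ?n = "length (labels C)" and ?G = "num_gaps C K"
  let ?X = "{..<K + 1} \<times> {..<?n + 2} \<times> {..<?n + 2}" and ?f = "\<lambda>(i, a, b). gap_index C i a b"
  have inj: "inj_on ?f ?X" using gap_index_inj by (force intro!: inj_onI)
  have fX: "?f x < ?G" if "x \<in> ?X" for x using that gap_index_less by auto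
  have sat: "weight_sat (gap_circuit P C K) (K + 1) \<longleftrightarrow>
    (\<exists>B \<subseteq> {..<?G + P}. card B = K + 1 \<and> (\<forall>j < ?G + ?n. \<exists>v \<in> B. v < ?G \<and> gap_rel C K v j))"
    unfolding weight_sat_def gap_circuit_def vars_CC holds_CC ..
  show ?thesis
  proof
    assume "weight_sat C K"
    then obtain T where T: "gap_solution C K T" using gap_solution_of_sat[OF C] by blast
    then have TX: "T \<subseteq> ?X" "card T = K + 1" by (auto simp: gap_solution_def)
    have "card (?f ` T) = K + 1" using inj_on_subset[OF inj TX(1)] TX(2) by (simp add: card_image)
    moreover have "?f ` T \<subseteq> {..<?G + P}" using TX(1) fX by fastforce
    moreover have "\<exists>v \<in> ?f ` T. v < ?G \<and> gap_rel C K v j" if j: "j < ?G + ?n" for j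
    proof (cases "j < ?G")
      case True
      then obtain i a b where *: "i < K + 1" "a < ?n + 2" "b < ?n + 2" "j = gap_index C i a b"
        using gap_index_surj by blast
      then obtain i' a' b' where t: "(i', a', b') \<in> T" "chain_gate C K i a b i' a' b'"
        using T unfolding gap_solution_def by blast
      then have "i' < K + 1" "a' < ?n + 2" "b' < ?n + 2" using TX(1) by auto
      then have "gap_rel C K (gap_index C i' a' b') j" unfolding *(4) gap_rel_chain[OF *(1-3)] using t(2) by blast
      moreover have "gap_index C i' a' b' < ?G" using gap_index_less \<open>i' < _\<close> \<open>a' < _\<close> \<open>b' < _\<close> by blast
      moreover have "gap_index C i' a' b' \<in> ?f ` T" using t(1) by (rule rev_image_eqI) simp
      ultimately show ?thesis by blast
    next
      case False
      then obtain c where c: "j = ?G + c" "c < ?n" using j by (metis le_Suc_ex not_less nat_add_left_cancel_less)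
      then obtain i a b where t: "(i, a, b) \<in> T" "clause_gate C c a b" using T unfolding gap_solution_def by blast
      then have "i < K + 1" "a < ?n + 2" "b < ?n + 2" using TX(1) by auto
      then have "gap_rel C K (gap_index C i a b) j" unfolding c(1) gap_rel_clause[OF c(2)] using t(2) by blast
      moreover have "gap_index C i a b < ?G" using gap_index_less \<open>i < _\<close> \<open>a < _\<close> \<open>b < _\<close> by blast
      moreover have "gap_index C i a b \<in> ?f ` T" using t(1) by (rule rev_image_eqI) simp
      ultimately show ?thesis by blast
    qed
    ultimately show "weight_sat (gap_circuit P C K) (K + 1)" unfolding sat by blast
  next
    assume "weight_sat (gap_circuit P C K) (K + 1)"
    then obtain B where B: "B \<subseteq> {..<?G + P}" "card B = K + 1"
      "\<And>j. j < ?G + ?n \<Longrightarrow> \<exists>v \<in> B. v < ?G \<and> gap_rel C K v j" unfolding sat by blast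
    have finB: "finite B" using B(1) finite_subset by blast
    define T where "T = {x \<in> ?X. ?f x \<in> B}"
    have finT: "finite T" unfolding T_def by simp
    have chain: "\<exists>(i', a', b') \<in> T. chain_gate C K i a b i' a' b'"
      if "i < K + 1" "a < ?n + 2" "b < ?n + 2" for i a b
    proof -
      have "gap_index C i a b < ?G + ?n" using gap_index_less[OF that] by simp
      then obtain v where "v \<in> B" "gap_rel C K v (gap_index C i a b)" using B(3) by blast
      then show ?thesis unfolding gap_rel_chain[OF that] T_def by fastforce
    qed
    have clause: "\<exists>(i, a, b) \<in> T. clause_gate C c a b" if c: "c < ?n" for c
    proof -
      obtain v where "v \<in> B" "gap_rel C K v (?G + c)" using B(3)[of "?G + c"] c by auto
      then show ?thesis unfolding gap_rel_clause[OF c] T_def by fastforce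
    qed
    have "card T \<le> card B"
    proof -
      have "card T = card (?f ` T)" using inj_on_subset[OF inj, of T] by (simp add: card_image T_def)
      also have "\<dots> \<le> card B" using finB by (intro card_mono) (auto simp: T_def)
      finally show ?thesis .
    qed
    moreover have "K + 1 \<le> card T"
    proof -
      have "{..<K + 1} \<subseteq> fst ` T"
      proof
        fix i assume "i \<in> {..<K + 1}"
        then obtain i' a' b' where t: "(i', a', b') \<in> T" "chain_gate C K i 0 0 i' a' b'" using chain[of i 0 0] by auto
        then have "i' = i" by (auto simp: chain_gate_def valid_gap_def)
        then show "i \<in> fst ` T" using t by force
      qed
      then have "card {..<K + 1} \<le> card (fst ` T)" using finT by (intro card_mono) auto
      also have "\<dots> \<le> card T" using finT by (rule card_image_le)
      finally show ?thesis by simp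
    qed
    ultimately have "card T = K + 1" using B(2) by simp
    then have "gap_solution C K T" unfolding gap_solution_def using chain clause by (auto simp: T_def)
    then show "weight_sat C K" by (rule chain_of_gap_solution[OF C])
  qed
qed

section \<open>The gap formula as a machine expression\<close>

definition IffE :: "expr \<Rightarrow> expr \<Rightarrow> expr" where "IffE e e' = OrE (AndE e e') (NotE (OrE e e'))"

lemma tr_IffE [simp]: "tr (IffE e e') \<sigma> \<rho> \<longleftrightarrow> (tr e \<sigma> \<rho> \<longleftrightarrow> tr e' \<sigma> \<rho>)"
  by (auto simp: IffE_def)

lemma tr_Ite [simp]: "tr (Ite b e e') \<sigma> \<rho> \<longleftrightarrow> (if tr b \<sigma> \<rho> then tr e \<sigma> \<rho> else tr e' \<sigma> \<rho>)"
  by (simp add: tr_def)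

text \<open>The nested formulas bind variables with different numbers (20 to 28, 50 to 53 and 90 to
  92), so that none is captured.\<close>

definition firstE :: "nat \<Rightarrow> expr" where
  "firstE p = AndE (litE A1 p) (AllE 50 3 (OrE (NotE (AndE (LessE (Var 50) (Var p)) (litE A1 50)))
     (NotE (EqE (argE A1 50) (argE A1 p)))))"

definition positionE :: "nat \<Rightarrow> expr" where
  "positionE q = ExE 51 3 (AndE (EqE (Var q) (Plus (Var 51) (Num 1))) (firstE 51))"

definition valid_gapE :: "nat \<Rightarrow> nat \<Rightarrow> nat \<Rightarrow> expr" where
  "valid_gapE i a b = AndE (LessE (Var a) (Var b))
     (AndE (IffE (EqE (Var i) (Num 0)) (EqE (Var a) (Num 0)))
       (AndE (IffE (EqE (Var i) (Var 1)) (EqE (Var b) (Plus (Var 3) (Num 1))))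
         (AndE (OrE (EqE (Var a) (Num 0)) (positionE a))
           (OrE (EqE (Var b) (Plus (Var 3) (Num 1))) (positionE b)))))"

definition chain_gateE :: "nat \<Rightarrow> nat \<Rightarrow> nat \<Rightarrow> nat \<Rightarrow> nat \<Rightarrow> nat \<Rightarrow> expr" where
  "chain_gateE i a b i' a' b' =
     OrE (AndE (EqE (Var i') (Var i)) (NotE (AndE (EqE (Var a') (Var a)) (EqE (Var b') (Var b)))))
       (AndE (valid_gapE i a b)
         (OrE (AndE (EqE (Var i) (Var 1)) (EqE (Var i') (Var i)))
           (AndE (EqE (Var i') (Plus (Var i) (Num 1))) (EqE (Var a') (Var b)))))"

definition supportsE :: "nat \<Rightarrow> nat \<Rightarrow> nat \<Rightarrow> expr" where
  "supportsE u a b = ExE 52 3 (AndE (firstE 52) (AndE (EqE (argE A1 52) (argE A1 u))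
     (Ite (EqE (tagE A1 u) (Num 2)) (EqE (Var b) (Plus (Var 52) (Num 1)))
       (AndE (LessE (Var a) (Plus (Var 52) (Num 1))) (LessE (Plus (Var 52) (Num 1)) (Var b))))))"

definition clause_gateE :: "nat \<Rightarrow> nat \<Rightarrow> nat \<Rightarrow> expr" where
  "clause_gateE c a b = OrE (NotE (wireE A1 c 2)) (ExE 53 3 (AndE (litE A1 53)
     (AndE (OrE (wireE A1 53 c) (EqE (Var 53) (Var c))) (supportsE 53 a b))))"

text \<open>Variable 5 holds the radix; a sum of constant terms is multiplication by it.\<close>

definition gap_indexE :: "nat \<Rightarrow> nat \<Rightarrow> nat \<Rightarrow> expr" where
  "gap_indexE i a b = Plus (Sum 91 5 (Plus (Sum 92 5 (Var i)) (Var a))) (Var b)"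

definition gap_relE :: "nat \<Rightarrow> nat \<Rightarrow> expr" where
  "gap_relE v j = ExE 22 6 (ExE 23 5 (ExE 24 5 (AndE (EqE (Var v) (gap_indexE 22 23 24))
     (OrE
       (ExE 25 6 (ExE 26 5 (ExE 27 5 (AndE (EqE (Var j) (gap_indexE 25 26 27))
         (chain_gateE 25 26 27 22 23 24)))))
       (ExE 28 3 (AndE (EqE (Var j) (Plus (Var 7) (Var 28))) (clause_gateE 28 23 24)))))))"

definition gap_ok :: "circuit \<Rightarrow> nat \<Rightarrow> (nat \<Rightarrow> nat) \<Rightarrow> (arr \<Rightarrow> nat list) \<Rightarrow> bool" where
  "gap_ok C K \<sigma> \<rho> \<longleftrightarrow> loaded A1 C K \<sigma> \<rho> \<and> \<sigma> 5 = length (labels C) + 2 \<and> \<sigma> 6 = K + 1 \<and>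
     \<sigma> 7 = num_gaps C K"

lemma gap_ok_upd [simp]: "20 \<le> x \<Longrightarrow> gap_ok C K (\<sigma>(x := i)) \<rho> = gap_ok C K \<sigma> \<rho>"
  by (auto simp: gap_ok_def)

lemma gap_okD:
  assumes "gap_ok C K \<sigma> \<rho>"
  shows "loaded A1 C K \<sigma> \<rho>" "\<sigma> 1 = K" "\<sigma> 2 = outgate C" "\<sigma> 3 = length (labels C)"
    "\<sigma> 5 = length (labels C) + 2" "\<sigma> 6 = K + 1" "\<sigma> 7 = num_gaps C K"
  using assms by (auto simp: gap_ok_def loaded_def)

lemma gap_ok_loaded: "gap_ok C K \<sigma> \<rho> \<Longrightarrow> 5 \<le> x \<Longrightarrow> loaded A1 C K (\<sigma>(x := i)) \<rho>"
  by (simp add: gap_ok_def)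

lemma tr_firstE:
  assumes "gap_ok C K \<sigma> \<rho>" "\<sigma> p < length (labels C)" "p \<noteq> 50"
  shows "tr (firstE p) \<sigma> \<rho> \<longleftrightarrow> first_lit C (\<sigma> p)"
proof -
  note l = gap_okD(1)[OF assms(1)]
  have "tr (litE A1 50) (\<sigma>(50 := u)) \<rho> \<longleftrightarrow> is_lit (labels C ! u)"
    "eval (argE A1 50) (\<sigma>(50 := u)) \<rho> = arg_of (labels C ! u)"
    "eval (argE A1 p) (\<sigma>(50 := u)) \<rho> = arg_of (labels C ! \<sigma> p)"
    if "u < length (labels C)" for u
    using tr_litE[OF gap_ok_loaded[OF assms(1)], of 50 u 50]
      eval_argE[OF gap_ok_loaded[OF assms(1)], of 50 u 50]
      eval_argE[OF gap_ok_loaded[OF assms(1)], of 50 u p] that assms(2,3) by simp_all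
  then have "tr (firstE p) \<sigma> \<rho> \<longleftrightarrow> is_lit (labels C ! \<sigma> p) \<and> (\<forall>u < length (labels C).
      \<not> (u < \<sigma> p \<and> is_lit (labels C ! u)) \<or> arg_of (labels C ! u) \<noteq> arg_of (labels C ! \<sigma> p))"
    unfolding firstE_def using tr_litE[OF l assms(2)] gap_okD(4)[OF assms(1)] assms(3) by simp
  then show ?thesis unfolding first_lit_def using assms(2) by (auto dest: less_trans)
qed

lemma first_lit_less: "first_lit C p \<Longrightarrow> p < length (labels C)"
  by (simp add: first_lit_def)

lemma tr_positionE:
  assumes "gap_ok C K \<sigma> \<rho>" "q \<noteq> 51"
  shows "tr (positionE q) \<sigma> \<rho> \<longleftrightarrow> position C (\<sigma> q)"
proof -
  have "tr (firstE 51) (\<sigma>(51 := p)) \<rho> \<longleftrightarrow> first_lit C p" if "p < length (labels C)" for p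
    using tr_firstE[of C K "\<sigma>(51 := p)" \<rho> 51] assms that by simp
  then show ?thesis unfolding positionE_def position_def
    using gap_okD(4)[OF assms(1)] assms(2) first_lit_less by (auto simp: Suc_eq_plus1[symmetric] simp del: Suc_eq_plus1)
qed

lemma tr_valid_gapE:
  assumes "gap_ok C K \<sigma> \<rho>" "a \<noteq> 51" "b \<noteq> 51"
  shows "tr (valid_gapE i a b) \<sigma> \<rho> \<longleftrightarrow> valid_gap C K (\<sigma> i) (\<sigma> a) (\<sigma> b)"
  using tr_positionE[OF assms(1)] assms gap_okD[OF assms(1)] unfolding valid_gapE_def valid_gap_def by simp

lemma tr_chain_gateE:
  assumes "gap_ok C K \<sigma> \<rho>" "a \<noteq> 51" "b \<noteq> 51"
  shows "tr (chain_gateE i a b i' a' b') \<sigma> \<rho> \<longleftrightarrow> chain_gate C K (\<sigma> i) (\<sigma> a) (\<sigma> b) (\<sigma> i') (\<sigma> a') (\<sigma> b')"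
  using tr_valid_gapE[OF assms] gap_okD(2)[OF assms(1)] unfolding chain_gateE_def chain_gate_def by auto

lemma tr_supportsE:
  assumes "gap_ok C K \<sigma> \<rho>" "\<sigma> u < length (labels C)" "u \<noteq> 52" "a \<noteq> 52" "b \<noteq> 52"
  shows "tr (supportsE u a b) \<sigma> \<rho> \<longleftrightarrow> supports C (\<sigma> u) (\<sigma> a) (\<sigma> b)"
proof -
  have "tr (firstE 52) (\<sigma>(52 := p)) \<rho> \<longleftrightarrow> first_lit C p"
    "eval (argE A1 52) (\<sigma>(52 := p)) \<rho> = arg_of (labels C ! p)"
    "eval (argE A1 u) (\<sigma>(52 := p)) \<rho> = arg_of (labels C ! \<sigma> u)"
    "tr (EqE (tagE A1 u) (Num 2)) (\<sigma>(52 := p)) \<rho> \<longleftrightarrow> (\<exists>x. labels C ! \<sigma> u = Lit x True)"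
    if "p < length (labels C)" for p
    using tr_firstE[of C K "\<sigma>(52 := p)" \<rho> 52] eval_argE[OF gap_ok_loaded[OF assms(1)], of 52 p 52]
      eval_argE[OF gap_ok_loaded[OF assms(1)], of 52 p u]
      tr_posE[OF gap_ok_loaded[OF assms(1)], of 52 p u] that assms by (simp_all del: tr_simps(5))
  then have "tr (AndE (firstE 52) (AndE (EqE (argE A1 52) (argE A1 u))
     (Ite (EqE (tagE A1 u) (Num 2)) (EqE (Var b) (Plus (Var 52) (Num 1)))
       (AndE (LessE (Var a) (Plus (Var 52) (Num 1))) (LessE (Plus (Var 52) (Num 1)) (Var b)))))) (\<sigma>(52 := p)) \<rho> \<longleftrightarrow>
    first_lit C p \<and> arg_of (labels C ! p) = arg_of (labels C ! \<sigma> u) \<and>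
     (if \<exists>x. labels C ! \<sigma> u = Lit x True then \<sigma> b = Suc p else \<sigma> a < Suc p \<and> Suc p < \<sigma> b)"
    if "p < length (labels C)" for p using that assms(3-) by simp
  then show ?thesis unfolding supportsE_def supports_def tr_simps(7)
    using gap_okD(4)[OF assms(1)] first_lit_less by metis
qed

lemma tr_clause_gateE:
  assumes "gap_ok C K \<sigma> \<rho>" "c \<noteq> 53" "a \<noteq> 53" "b \<noteq> 53" "c \<noteq> 90" "a \<noteq> 52" "b \<noteq> 52"
  shows "tr (clause_gateE c a b) \<sigma> \<rho> \<longleftrightarrow> clause_gate C (\<sigma> c) (\<sigma> a) (\<sigma> b)"
proof -
  have "tr (litE A1 53) (\<sigma>(53 := u)) \<rho> \<longleftrightarrow> is_lit (labels C ! u)"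
    "tr (wireE A1 53 c) (\<sigma>(53 := u)) \<rho> \<longleftrightarrow> (u, \<sigma> c) \<in> set (wires C)"
    "tr (supportsE 53 a b) (\<sigma>(53 := u)) \<rho> \<longleftrightarrow> supports C u (\<sigma> a) (\<sigma> b)"
    if "u < length (labels C)" for u
    using tr_litE[OF gap_ok_loaded[OF assms(1)], of 53 u 53]
      tr_wireE[OF gap_ok_loaded[OF assms(1)], of 53 53 c u]
      tr_supportsE[of C K "\<sigma>(53 := u)" \<rho> 53 a b] that assms by simp_all
  then show ?thesis unfolding clause_gateE_def clause_gate_def
    using gap_okD(3,4)[OF assms(1)] tr_wireE[OF gap_okD(1)[OF assms(1)], of c 2] assms(2-) by auto
qed

lemma eval_gap_indexE:
  assumes "gap_ok C K \<sigma> \<rho>" "i \<notin> {91, 92}" "a \<notin> {91, 92}" "b \<notin> {91, 92}"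
  shows "eval (gap_indexE i a b) \<sigma> \<rho> = gap_index C (\<sigma> i) (\<sigma> a) (\<sigma> b)"
  using gap_okD(5)[OF assms(1)] assms(2-) unfolding gap_indexE_def gap_index_def by simp

lemma tr_gap_relE:
  assumes "gap_ok C K \<sigma> \<rho>" "v < 22 \<or> 200 < v" "j < 22 \<or> 200 < j"
  shows "tr (gap_relE v j) \<sigma> \<rho> \<longleftrightarrow> gap_rel C K (\<sigma> v) (\<sigma> j)"
proof -
  note d = gap_okD[OF assms(1)]
  have v: "v \<notin> {22, 23, 24, 25, 26, 27, 28}" "j \<notin> {22, 23, 24, 25, 26, 27, 28}" using assms(2,3) by auto
  have i1: "eval (gap_indexE 22 23 24) (\<sigma>(22 := i, 23 := a, 24 := b)) \<rho> = gap_index C i a b" for i a b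
    using eval_gap_indexE[of C K "\<sigma>(22 := i, 23 := a, 24 := b)" \<rho> 22 23 24] assms(1) by simp
  have i2: "eval (gap_indexE 25 26 27) (\<sigma>(22 := i, 23 := a, 24 := b, 25 := i', 26 := a', 27 := b')) \<rho> = gap_index C i' a' b'"
    for i a b i' a' b'
    using eval_gap_indexE[of C K "\<sigma>(22 := i, 23 := a, 24 := b, 25 := i', 26 := a', 27 := b')" \<rho> 25 26 27] assms(1) by simp
  have c1: "tr (chain_gateE 25 26 27 22 23 24) (\<sigma>(22 := i, 23 := a, 24 := b, 25 := i', 26 := a', 27 := b')) \<rho> \<longleftrightarrow>
    chain_gate C K i' a' b' i a b" for i a b i' a' b'
    using tr_chain_gateE[of C K "\<sigma>(22 := i, 23 := a, 24 := b, 25 := i', 26 := a', 27 := b')" \<rho> 26 27 25 22 23 24] assms(1)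
    by simp
  have c2: "tr (clause_gateE 28 23 24) (\<sigma>(22 := i, 23 := a, 24 := b, 28 := c)) \<rho> \<longleftrightarrow> clause_gate C c a b" for i a b c
    using tr_clause_gateE[of C K "\<sigma>(22 := i, 23 := a, 24 := b, 28 := c)" \<rho> 28 23 24] assms(1) by simp
  show ?thesis unfolding gap_relE_def gap_rel_def using v
    by (simp add: i1 i2 c1 c2 d cong: conj_cong del: One_nat_def)
qed

lemmas gap_expr_defs = IffE_def firstE_def positionE_def valid_gapE_def chain_gateE_def supportsE_def
  clause_gateE_def gap_indexE_def gap_relE_def

text \<open>The encoding states the number of wires before listing them, so they are counted in a
  separate pass.\<close>

definition wire_countE :: expr where
  "wire_countE = Plus (Sum 20 7 (CardE 21 8 (gap_relE 20 21))) (Var 8)"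

text \<open>Variables 7, 8, 11 and 12 hold the numbers of triples, of clauses, of variables with
  padding, and of wires. The 5 in the word length is 3 for the output gate and the two counters, and
  2 for the label of the output gate.\<close>

definition gap_emit :: emit where
  "gap_emit = ESeq (Emit (Var 6))
    (ESeq (Emit (Plus (Num 5) (Plus (double 11) (Plus (double 8) (double 12)))))
    (ESeq (Emit (Plus (Var 11) (Var 8)))
    (ESeq (Emit (Plus (Plus (Var 11) (Var 8)) (Num 1)))
    (ESeq (EFor 20 11 (ESeq (Emit (Num 2)) (Emit (Var 20))))
    (ESeq (EFor 20 8 (ESeq (Emit (Num 1)) (Emit (Num 0))))
    (ESeq (ESeq (Emit (Num 0)) (Emit (Num 0)))
    (ESeq (Emit (Var 12))
    (ESeq (EFor 20 7 (EFor 21 8 (EIf (gap_relE 20 21)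
        (ESeq (Emit (Var 20)) (Emit (Plus (Var 11) (Var 21)))))))
      (EFor 20 8 (ESeq (Emit (Plus (Var 11) (Var 20))) (Emit (Plus (Var 11) (Var 8)))))))))))))"

lemma wf_gap_exprs: "wf_expr wire_countE" "wf_emit gap_emit"
  by (simp_all add: wire_countE_def gap_emit_def gap_expr_defs formula_defs circuit_expr_defs)

text \<open>Turns the list of wires, a filtered product, into the nested loops that
  \<open>gap_emit\<close> runs.\<close>

lemma concat_product_filter:
  "concat (map (\<lambda>(u, v). [u, v]) (map (\<lambda>(v, j). (v, N + j)) (filter (\<lambda>(v, j). R v j) (List.product xs ys)))) =
   concat (map (\<lambda>v. concat (map (\<lambda>j. if R v j then [v, N + j] else []) ys)) xs)"
proof (induction xs)
  case (Cons x xs)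
  have "concat (map (\<lambda>(u, v). [u, v]) (map (\<lambda>(v, j). (v, N + j)) (filter (\<lambda>(v, j). R v j) (map (Pair x) ys)))) =
    concat (map (\<lambda>j. if R x j then [x, N + j] else []) ys)" by (induction ys) auto
  then show ?case using Cons by simp
qed simp

lemma length_product_filter:
  "length (filter (\<lambda>(v, j). R v j) (List.product [0..<G] [0..<m])) = (\<Sum>v < G. card {j. j < m \<and> R v j})"
proof -
  have "length (filter (\<lambda>(v, j). R v j) (List.product xs ys)) = (\<Sum>v\<leftarrow>xs. length (filter (R v) ys))" for xs ys
  proof (induction xs)
    case (Cons x xs)
    have "length (filter (\<lambda>(v, j). R v j) (map (Pair x) ys)) = length (filter (R x) ys)" by (induction ys) auto
    then show ?case using Cons by simp
  qed simp
  moreover have "length (filter (R v) [0..<m]) = card {j. j < m \<and> R v j}" for v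
  proof -
    have "length (filter (R v) [0..<m]) = card (set (filter (R v) [0..<m]))" by (rule distinct_card[symmetric]) simp
    also have "set (filter (R v) [0..<m]) = {j. j < m \<and> R v j}" by auto
    finally show ?thesis .
  qed
  ultimately show ?thesis by (simp add: interv_sum_list_conv_sum_set_nat atLeast0LessThan)
qed

lemma eval_wire_countE:
  assumes "gap_ok C K \<sigma> \<rho>" "\<sigma> 8 = num_gaps C K + length (labels C)"
  shows "eval wire_countE \<sigma> \<rho> = length (wires (gap_circuit P C K))"
proof -
  have "tr (gap_relE 20 21) (\<sigma>(20 := v, 21 := j)) \<rho> \<longleftrightarrow> gap_rel C K v j" for v j
    using tr_gap_relE[of C K "\<sigma>(20 := v, 21 := j)" \<rho> 20 21] assms(1) by simp
  then show ?thesis unfolding wire_countE_def gap_circuit_def cnf_circuit_def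
    using assms(2) gap_okD(7)[OF assms(1)] by (simp add: eval_CardE length_product_filter)
qed

lemma den_gap_emit:
  assumes "gap_ok C K \<sigma> \<rho>" "\<sigma> 8 = num_gaps C K + length (labels C)" "\<sigma> 11 = num_gaps C K + P"
    "\<sigma> 12 = length (wires (gap_circuit P C K))"
  shows "den gap_emit \<sigma> \<rho> = tape (enc_circuit (gap_circuit P C K), K + 1)"
proof -
  let ?D = "gap_circuit P C K" and ?G = "num_gaps C K" and ?m = "num_gaps C K + length (labels C)"
  have r: "tr (gap_relE 20 21) (\<sigma>(20 := v, 21 := j)) \<rho> \<longleftrightarrow> gap_rel C K v j" for v j
    using tr_gap_relE[of C K "\<sigma>(20 := v, 21 := j)" \<rho> 20 21] assms(1) by simp
  note d = gap_okD[OF assms(1)]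
  have lab: "labels ?D = map (\<lambda>v. Lit v True) [0..<?G + P] @ replicate ?m OrG @ [AndG]"
    and wir: "wires ?D = map (\<lambda>(v, j). (v, ?G + P + j)) (filter (\<lambda>(v, j). gap_rel C K v j) (List.product [0..<?G] [0..<?m])) @
       map (\<lambda>j. (?G + P + j, ?G + P + ?m)) [0..<?m]" and out: "outgate ?D = ?G + P + ?m"
    by (simp_all add: gap_circuit_def cnf_circuit_def)
  have llab: "length (labels ?D) = ?G + P + ?m + 1" unfolding lab by simp
  have lw: "length (enc_circuit ?D) = 5 + 2 * (?G + P) + 2 * ?m + 2 * length (wires ?D)"
    unfolding length_enc_circuit llab by simp
  have 1: "concat (map enc_label (labels ?D)) =
      concat (map (\<lambda>v. [2, v]) [0..<?G + P]) @ concat (map (\<lambda>_. [1, 0]) [0..<?m]) @ [0, 0]"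
    unfolding lab by (simp add: comp_def map_replicate_const del: upt_Suc)
  have 2: "concat (map (\<lambda>(u, v). [u, v]) (wires ?D)) =
      concat (map (\<lambda>v. concat (map (\<lambda>j. if gap_rel C K v j then [v, ?G + P + j] else []) [0..<?m])) [0..<?G]) @
      concat (map (\<lambda>j. [?G + P + j, ?G + P + ?m]) [0..<?m])"
    unfolding wir map_append concat_append concat_product_filter by (simp add: comp_def)
  have t: "tape (enc_circuit ?D, K + 1) = [K + 1, length (enc_circuit ?D), outgate ?D, length (labels ?D)] @
      concat (map enc_label (labels ?D)) @ [length (wires ?D)] @ concat (map (\<lambda>(u, v). [u, v]) (wires ?D))"
    by (simp add: enc_circuit_def)
  show ?thesis unfolding t gap_emit_def 1 2 llab lw out
    using assms(2-4) d by (simp add: den_EIf_tr r del: den.simps(3) upt_Suc cong: if_cong)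
qed

text \<open>The exponent depends on \<open>g\<close> and not on the instance, so the multiplications
  are unrolled in the program.\<close>

fun power_program :: "nat \<Rightarrow> ram" where
  "power_program 0 = assign 10 (Num 1)"
| "power_program (Suc q) = Seq (power_program q) (assign 10 (Sum 20 9 (Var 10)))"

lemma does_assign_eq:
  assumes "wf_expr e" "dims_le (av a) B" "eval e (av a) (aa a) = v"
  shows "does (assign x e) a (expr_cost e B + 2) (a\<lparr>av := (av a)(x := v)\<rparr>)"
  using does_assign[OF assms(1,2)] assms(3) by simp

text \<open>Smaller powers of a positive base stay below the last one, so all intermediate values
  respect \<open>B\<close>.\<close>

lemma does_power_program:
  assumes "dims_le (av a) B" "av a 9 ^ q \<le> B" "0 < av a 9"
  shows "does (power_program q) a ((expr_cost (Num 1) B + 2) + q * (expr_cost (Sum 20 9 (Var 10)) B + 2))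
    (a\<lparr>av := (av a)(10 := av a 9 ^ q)\<rparr>)"
  using assms
proof (induction q)
  case 0
  then show ?case unfolding power_program.simps power_0 mult_0 add_0_right by (intro does_assign_eq) auto
next
  case (Suc q)
  let ?b = "a\<lparr>av := (av a)(10 := av a 9 ^ q)\<rparr>"
  have "av a 9 ^ q \<le> av a 9 ^ Suc q" using Suc.prems(3) by (intro power_increasing) auto
  then have le: "av a 9 ^ q \<le> B" using Suc.prems(2) by linarith
  have "does (assign 10 (Sum 20 9 (Var 10))) ?b (expr_cost (Sum 20 9 (Var 10)) B + 2)
      (?b\<lparr>av := (av ?b)(10 := av a 9 ^ Suc q)\<rparr>)"
    using Suc.prems(1) le by (intro does_assign_eq) auto
  then have "does (assign 10 (Sum 20 9 (Var 10))) ?b (expr_cost (Sum 20 9 (Var 10)) B + 2)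
      (a\<lparr>av := (av a)(10 := av a 9 ^ Suc q)\<rparr>)" by simp
  from does_Seq[OF Suc.IH[OF Suc.prems(1) le Suc.prems(3)] this]
  show ?case unfolding power_program.simps by (rule does_mono) simp
qed

text \<open>Twice the number of possible edges bounds the genus by \<open>genus_CC\<close>;
  \<open>N0\<close> brings the number of variables into the range where \<open>g\<close> is large,
  and 1 makes the base positive.\<close>

definition padding :: "nat \<Rightarrow> circuit \<Rightarrow> nat \<Rightarrow> nat" where
  "padding N0 C K = N0 + 1 + num_gaps C K * (2 * (num_gaps C K + length (labels C)))"

definition gap_program :: "nat \<Rightarrow> nat \<Rightarrow> ram" where
  "gap_program q N0 = Seq (load_circuit A1) (Seq (assign 5 (Plus (Var 3) (Num 2)))
    (Seq (assign 6 (Plus (Var 1) (Num 1))) (Seq (assign 7 (Sum 20 6 (Sum 21 5 (Var 5))))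
    (Seq (assign 8 (Plus (Var 7) (Var 3))) (Seq (assign 9 (Plus (Num (N0 + 1)) (Sum 20 7 (double 8))))
    (Seq (power_program q) (Seq (assign 11 (Plus (Var 7) (Var 10)))
    (Seq (assign 12 wire_countE) (compile_emit Tape gap_emit 3)))))))))"

text \<open>A common bound for all variables that serve as loop bounds in the reduction, in terms of
  the parameter plus the size of the circuit. It only has to be polynomial.\<close>

definition gap_bound :: "nat \<Rightarrow> nat \<Rightarrow> nat \<Rightarrow> nat" where
  "gap_bound q N0 B = (let G = (B + 1) * ((B + 2) * (B + 2)); m = G + B; M = N0 + 1 + G * (2 * m)
     in M ^ q + M + G + m + B + 2 + G * m)"

lemma poly_bounded_gap_bound: "poly_bounded (gap_bound q N0)"
  unfolding gap_bound_def[abs_def] Let_def by (intro poly_bounded_intros)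

lemma gap_bounds:
  fixes C :: circuit
  assumes "K + length (labels C) + length (wires C) \<le> B"
  shows "num_gaps C K \<le> gap_bound q N0 B" "num_gaps C K + length (labels C) \<le> gap_bound q N0 B"
    "padding N0 C K \<le> gap_bound q N0 B" "padding N0 C K ^ q \<le> gap_bound q N0 B"
    "num_gaps C K + padding N0 C K ^ q \<le> gap_bound q N0 B"
    "length (wires (gap_circuit P C K)) \<le> gap_bound q N0 B" "B + 2 \<le> gap_bound q N0 B"
proof -
  define G where "G = (B + 1) * ((B + 2) * (B + 2))"
  define m where "m = G + B"
  define M where "M = N0 + 1 + G * (2 * m)"
  have Z: "gap_bound q N0 B = M ^ q + M + G + m + B + 2 + G * m" unfolding gap_bound_def Let_def G_def m_def M_def ..
  have leG: "num_gaps C K \<le> G" unfolding num_gaps_def G_def using assms by (intro mult_le_mono) auto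
  have lem: "num_gaps C K + length (labels C) \<le> m" unfolding m_def using leG assms by linarith
  have "num_gaps C K * (2 * (num_gaps C K + length (labels C))) \<le> G * (2 * m)"
    using leG lem by (intro mult_le_mono) auto
  then have leM: "padding N0 C K \<le> M" unfolding padding_def M_def by linarith
  then have Mq: "padding N0 C K ^ q \<le> M ^ q" by (intro power_mono) auto
  have "length (filter (\<lambda>(v, j). gap_rel C K v j)
      (List.product [0..<num_gaps C K] [0..<num_gaps C K + length (labels C)])) \<le>
      num_gaps C K * (num_gaps C K + length (labels C))"
    by (rule order_trans[OF length_filter_le]) (simp add: length_product)
  also have "\<dots> \<le> G * m" using leG lem by (rule mult_le_mono)
  finally have "length (wires (gap_circuit P C K)) \<le> G * m + m"
    unfolding gap_circuit_def cnf_circuit_def using lem by simp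
  then show "length (wires (gap_circuit P C K)) \<le> gap_bound q N0 B" unfolding Z by linarith
  show "num_gaps C K \<le> gap_bound q N0 B" "num_gaps C K + length (labels C) \<le> gap_bound q N0 B"
    "padding N0 C K \<le> gap_bound q N0 B" "padding N0 C K ^ q \<le> gap_bound q N0 B"
    "num_gaps C K + padding N0 C K ^ q \<le> gap_bound q N0 B" "B + 2 \<le> gap_bound q N0 B"
    unfolding Z using leG lem leM Mq by linarith+
qed

text \<open>Nested in the same way as the program, so that \<open>does_Seq\<close> produces this sum
  literally.\<close>

definition gap_time :: "nat \<Rightarrow> nat \<Rightarrow> nat \<Rightarrow> nat" where
  "gap_time q N0 B0 = (let B = gap_bound q N0 B0 in 60 + ((expr_cost (Plus (Var 3) (Num 2)) B + 2) +
    ((expr_cost (Plus (Var 1) (Num 1)) B + 2) + ((expr_cost (Sum 20 6 (Sum 21 5 (Var 5))) B + 2) +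
    ((expr_cost (Plus (Var 7) (Var 3)) B + 2) +
    ((expr_cost (Plus (Num (N0 + 1)) (Sum 20 7 (double 8))) B + 2) +
    (((expr_cost (Num 1) B + 2) + q * (expr_cost (Sum 20 9 (Var 10)) B + 2)) +
    ((expr_cost (Plus (Var 7) (Var 10)) B + 2) + ((expr_cost wire_countE B + 2) + emit_cost gap_emit B)))))))))"

lemma poly_bounded_gap_time: "poly_bounded (gap_time q N0)"
  unfolding gap_time_def[abs_def] Let_def
  by (intro poly_bounded_add poly_bounded_mult poly_bounded_const
      poly_bounded_comp[OF poly_bounded_expr_cost poly_bounded_gap_bound]
      poly_bounded_comp[OF poly_bounded_emit_cost poly_bounded_gap_bound])

lemma does_gap_program:
  fixes C :: circuit
  assumes A1: "aa a A1 = tape (enc_circuit C, K)" and out: "outgate C < length (labels C)"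
    and av0: "\<And>d. d < 20 \<Longrightarrow> d \<noteq> 1 \<Longrightarrow> av a d = 0" and B0: "B0 = K + length (labels C) + length (wires C)"
  shows "\<exists>a'. does (gap_program q N0) a (gap_time q N0 B0) a' \<and>
    aout a' = aout a @ tape (enc_circuit (gap_circuit (padding N0 C K ^ q) C K), K + 1)"
proof -
  let ?n = "length (labels C)" and ?G = "num_gaps C K" and ?P = "padding N0 C K ^ q"
  define B where "B = gap_bound q N0 B0"
  note b = gap_bounds[where K = K and C = C and B = B0 and q = q and ?N0.0 = N0, folded B_def]
  have B0': "K + ?n + length (wires C) \<le> B0" using B0 by simp
  note b = b[OF B0']
  have bK: "K \<le> B" "?n \<le> B" "length (wires C) \<le> B" "outgate C \<le> B" "?n + 2 \<le> B" "K + 1 \<le> B"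
    using b(7) B0 out by auto
  define \<sigma>0 where "\<sigma>0 = (av a)(1 := K, 2 := outgate C, 3 := ?n, 4 := length (wires C))"
  define \<sigma>1 where "\<sigma>1 = \<sigma>0(5 := ?n + 2)"
  define \<sigma>2 where "\<sigma>2 = \<sigma>1(6 := K + 1)"
  define \<sigma>3 where "\<sigma>3 = \<sigma>2(7 := ?G)"
  define \<sigma>4 where "\<sigma>4 = \<sigma>3(8 := ?G + ?n)"
  define \<sigma>5 where "\<sigma>5 = \<sigma>4(9 := padding N0 C K)"
  define \<sigma>6 where "\<sigma>6 = \<sigma>5(10 := ?P)"
  define \<sigma>7 where "\<sigma>7 = \<sigma>6(11 := ?G + ?P)"
  define \<sigma>8 where "\<sigma>8 = \<sigma>7(12 := length (wires (gap_circuit ?P C K)))"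
  note defs = \<sigma>0_def \<sigma>1_def \<sigma>2_def \<sigma>3_def \<sigma>4_def \<sigma>5_def \<sigma>6_def \<sigma>7_def \<sigma>8_def
  have d0: "dims_le \<sigma>0 B" using bK av0 by (auto simp: \<sigma>0_def)
  have d1: "dims_le \<sigma>1 B" using bK d0 by (auto simp: \<sigma>1_def)
  have d2: "dims_le \<sigma>2 B" using bK d1 by (auto simp: \<sigma>2_def)
  have d3: "dims_le \<sigma>3 B" using b d2 by (auto simp: \<sigma>3_def)
  have d4: "dims_le \<sigma>4 B" using b d3 by (auto simp: \<sigma>4_def)
  have d5: "dims_le \<sigma>5 B" using b d4 by (auto simp: \<sigma>5_def)
  have d6: "dims_le \<sigma>6 B" using b d5 by (auto simp: \<sigma>6_def)
  have d7: "dims_le \<sigma>7 B" using b d6 by (auto simp: \<sigma>7_def)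
  have d8: "dims_le \<sigma>8 B" using b d7 by (auto simp: \<sigma>8_def)
  have 0: "does (load_circuit A1) a 60 (a\<lparr>av := \<sigma>0\<rparr>)" unfolding \<sigma>0_def by (rule does_load_circuit[OF A1])
  have step: "does (assign x e) (a\<lparr>av := \<sigma>\<rparr>) (expr_cost e B + 2) (a\<lparr>av := \<sigma>(x := v)\<rparr>)"
    if "wf_expr e" "dims_le \<sigma> B" "eval e \<sigma> (aa a) = v" for x e \<sigma> v
    using does_assign_eq[of e "a\<lparr>av := \<sigma>\<rparr>" B v x] that by simp
  have 1: "does (assign 5 (Plus (Var 3) (Num 2))) (a\<lparr>av := \<sigma>0\<rparr>) (expr_cost (Plus (Var 3) (Num 2)) B + 2) (a\<lparr>av := \<sigma>1\<rparr>)"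
    unfolding \<sigma>1_def by (rule step[OF _ d0]) (simp_all add: \<sigma>0_def)
  have 2: "does (assign 6 (Plus (Var 1) (Num 1))) (a\<lparr>av := \<sigma>1\<rparr>) (expr_cost (Plus (Var 1) (Num 1)) B + 2) (a\<lparr>av := \<sigma>2\<rparr>)"
    unfolding \<sigma>2_def by (rule step[OF _ d1]) (simp_all add: \<sigma>0_def \<sigma>1_def)
  have 3: "does (assign 7 (Sum 20 6 (Sum 21 5 (Var 5)))) (a\<lparr>av := \<sigma>2\<rparr>)
      (expr_cost (Sum 20 6 (Sum 21 5 (Var 5))) B + 2) (a\<lparr>av := \<sigma>3\<rparr>)"
    unfolding \<sigma>3_def by (rule step[OF _ d2]) (simp_all add: \<sigma>0_def \<sigma>1_def \<sigma>2_def num_gaps_def)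
  have 4: "does (assign 8 (Plus (Var 7) (Var 3))) (a\<lparr>av := \<sigma>3\<rparr>) (expr_cost (Plus (Var 7) (Var 3)) B + 2) (a\<lparr>av := \<sigma>4\<rparr>)"
    unfolding \<sigma>4_def by (rule step[OF _ d3]) (simp_all add: \<sigma>0_def \<sigma>1_def \<sigma>2_def \<sigma>3_def)
  have 5: "does (assign 9 (Plus (Num (N0 + 1)) (Sum 20 7 (double 8)))) (a\<lparr>av := \<sigma>4\<rparr>)
      (expr_cost (Plus (Num (N0 + 1)) (Sum 20 7 (double 8))) B + 2) (a\<lparr>av := \<sigma>5\<rparr>)"
    unfolding \<sigma>5_def by (rule step[OF _ d4])
      (simp_all add: double_def, simp_all add: \<sigma>0_def \<sigma>1_def \<sigma>2_def \<sigma>3_def \<sigma>4_def padding_def)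
  have 6: "does (power_program q) (a\<lparr>av := \<sigma>5\<rparr>)
      ((expr_cost (Num 1) B + 2) + q * (expr_cost (Sum 20 9 (Var 10)) B + 2)) (a\<lparr>av := \<sigma>6\<rparr>)"
  proof -
    have "\<sigma>5 9 = padding N0 C K" by (simp add: \<sigma>5_def)
    moreover from this have "dims_le (av (a\<lparr>av := \<sigma>5\<rparr>)) B" "av (a\<lparr>av := \<sigma>5\<rparr>) 9 ^ q \<le> B" "0 < av (a\<lparr>av := \<sigma>5\<rparr>) 9"
      using d5 b(4) by (auto simp: padding_def)
    ultimately show ?thesis using does_power_program[of "a\<lparr>av := \<sigma>5\<rparr>" B q] by (simp add: \<sigma>6_def)
  qed
  have 7: "does (assign 11 (Plus (Var 7) (Var 10))) (a\<lparr>av := \<sigma>6\<rparr>) (expr_cost (Plus (Var 7) (Var 10)) B + 2) (a\<lparr>av := \<sigma>7\<rparr>)"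
    unfolding \<sigma>7_def by (rule step[OF _ d6]) (simp_all add: \<sigma>3_def \<sigma>4_def \<sigma>5_def \<sigma>6_def)
  have ok: "gap_ok C K \<sigma>7 (aa a)" "\<sigma>7 8 = ?G + ?n" "\<sigma>7 11 = ?G + ?P"
    using A1 by (simp_all add: gap_ok_def loaded_def defs del: tape.simps)
  have 8: "does (assign 12 wire_countE) (a\<lparr>av := \<sigma>7\<rparr>) (expr_cost wire_countE B + 2) (a\<lparr>av := \<sigma>8\<rparr>)"
    unfolding \<sigma>8_def by (rule step[OF wf_gap_exprs(1) d7 eval_wire_countE[OF ok(1,2)]])
  have ok': "gap_ok C K \<sigma>8 (aa a)" "\<sigma>8 8 = ?G + ?n" "\<sigma>8 11 = ?G + ?P"
      "\<sigma>8 12 = length (wires (gap_circuit ?P C K))"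
    using A1 by (simp_all add: gap_ok_def loaded_def defs del: tape.simps)
  have 9: "does (compile_emit Tape gap_emit 3) (a\<lparr>av := \<sigma>8\<rparr>) (emit_cost gap_emit B)
     (push Tape (tape (enc_circuit (gap_circuit ?P C K), K + 1)) (a\<lparr>av := \<sigma>8\<rparr>))"
    using does_emit[OF wf_gap_exprs(2), of "a\<lparr>av := \<sigma>8\<rparr>" B Tape] d8 den_gap_emit[OF ok'] by (simp del: tape.simps)
  note all = does_Seq[OF 0 does_Seq[OF 1 does_Seq[OF 2 does_Seq[OF 3 does_Seq[OF 4 does_Seq[OF 5
    does_Seq[OF 6 does_Seq[OF 7 does_Seq[OF 8 9]]]]]]]]]
  show ?thesis
  proof (intro exI conjI)
    show "does (gap_program q N0) a (gap_time q N0 B0)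
      (push Tape (tape (enc_circuit (gap_circuit ?P C K), K + 1)) (a\<lparr>av := \<sigma>8\<rparr>))"
      using all unfolding gap_program_def gap_time_def Let_def B_def[symmetric] .
  qed simp
qed

section \<open>Completeness\<close>

lemma length_word_size: "length w + 1 \<le> word_size w"
proof -
  have "(\<Sum>a\<leftarrow>w. 1) \<le> (\<Sum>a\<leftarrow>w. 1 + floorlog 2 a)" by (rule sum_list_mono) simp
  then show ?thesis by (simp add: word_size_def sum_list_triv)
qed

text \<open>A step writes at most one number. Hence the circuit produced by a reduction is no longer
  than its running time.\<close>

lemma length_outp: "exec p s t s' \<Longrightarrow> length (outp s') \<le> length (outp s) + t"
  by (induction rule: exec.induct) auto

lemma runs_length: "runs p xs t ys \<Longrightarrow> length ys \<le> t"
  unfolding runs_def using length_outp by fastforce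

definition copy_program :: ram where
  "copy_program = Seq read_input (Seq (assign 2 (Plus (Arr A0 (Num 1)) (Num 2)))
     (compile_emit Tape (EFor 20 2 (Emit (Arr A0 (Var 20)))) 3))"

lemma runs_copy_program: "\<exists>t \<le> 200 * (k + 1) * word_size w ^ 1. runs copy_program (tape (w, k)) t (tape (w, k))"
proof -
  let ?a = "loaded_state w k" and ?B = "k + length w + 2" and ?e = "Plus (Arr A0 (Num 1)) (Num 2)"
  let ?m = "EFor 20 2 (Emit (Arr A0 (Var 20)))"
  let ?a1 = "?a\<lparr>av := (av ?a)(2 := length w + 2)\<rparr>"
  have 1: "does (assign 2 ?e) ?a (expr_cost ?e ?B + 2) ?a1"
    by (rule does_assign_eq) (auto simp: loaded_state_def)
  have 2: "does (compile_emit Tape ?m 3) ?a1 (emit_cost ?m ?B) (push Tape (den ?m (av ?a1) (aa ?a1)) ?a1)"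
    by (rule does_emit) (auto simp: loaded_state_def)
  have "den ?m (av ?a1) (aa ?a1) = concat (map (\<lambda>i. [(k # length w # w) ! i]) [0..<length w + 2])"
    unfolding den.simps by (rule arg_cong[where f = concat], rule map_cong)
      (auto simp: loaded_state_def)
  also have "\<dots> = map (\<lambda>i. (k # length w # w) ! i) [0..<length (k # length w # w)]" by (simp del: upt_Suc)
  also have "\<dots> = k # length w # w" by (rule map_nth)
  finally have "aout (push Tape (den ?m (av ?a1) (aa ?a1)) ?a1) = tape (w, k)"
    by (simp add: loaded_state_def init_def)
  then obtain t where t: "t \<le> 30 * (length w + 2) + ((expr_cost ?e ?B + 2) + emit_cost ?m ?B)"
    "runs copy_program (tape (w, k)) t (tape (w, k))"
    using runs_does[OF does_Seq[OF does_read_input does_Seq[OF 1 2]]] unfolding copy_program_def by auto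
  have "30 * (length w + 2) + ((expr_cost ?e ?B + 2) + emit_cost ?m ?B) = 52 * length w + 22 * k + 125"
    by simp
  also have "\<dots> \<le> 200 * (k + 1) * (length w + 1)" by (simp add: algebra_simps)
  also have "\<dots> \<le> 200 * (k + 1) * word_size w" using length_word_size by (intro mult_left_mono) auto
  finally show ?thesis using t(2) order_trans[OF t(1)] unfolding power_one_right by blast
qed

text \<open>These circuits are instances of \<open>Pi_circuit 2\<close> already, so the reduction
  copies its input.\<close>

lemma wsat_pos_genus_in_W2: "wsat_pos_genus g \<in> W 2"
  unfolding W_def mem_Collect_eq fpt_reducible_def
proof (rule exI[of _ copy_program], rule exI[of _ "\<lambda>k. 200 * (k + 1)"], rule exI[of _ "\<lambda>k. k"],
    rule exI[of _ 1], intro conjI allI impI)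
  show "computable (\<lambda>k. 200 * (k + 1))"
    by (intro computable_mult computable_add computable_const computable_id)
  show "computable (\<lambda>k. k)" by (rule computable_id)
  fix w k assume "(w, k) \<in> yes (wsat_pos_genus g) \<union> no (wsat_pos_genus g)"
  obtain t where "t \<le> 200 * (k + 1) * word_size w ^ 1" "runs copy_program (tape (w, k)) t (tape (w, k))"
    using runs_copy_program by blast
  then show "\<exists>t w' k'. t \<le> 200 * (k + 1) * word_size w ^ 1 \<and>
      runs copy_program (tape (w, k)) t (tape (w', k')) \<and> k' \<le> k \<and>
      ((w, k) \<in> yes (wsat_pos_genus g) \<longrightarrow> (w', k') \<in> yes (wsat_on (Pi_circuit 2))) \<and>
      ((w, k) \<in> no (wsat_pos_genus g) \<longrightarrow> (w', k') \<in> no (wsat_on (Pi_circuit 2)))"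
    unfolding wsat_pos_genus_def wsat_on_def by (intro exI[of _ t] exI[of _ w] exI[of _ k]) auto
qed

text \<open>With \<open>M\<close> for the padding, the genus is at most \<open>M\<close> and there
  are at least \<open>M ^ q\<close> variables. As \<open>q * a\<close> is at least 1,
  \<open>g\<close> is at least \<open>M\<close> there.\<close>

lemma genus_gap_circuit:
  assumes C: "Pi_circuit 2 C" and "0 < a" and g: "\<And>n. N0 \<le> n \<Longrightarrow> real n powr a \<le> real (g n)"
    and q: "1 \<le> real q * a" "0 < q"
  shows "circuit_genus (gap_circuit (padding N0 C K ^ q) C K) \<le>
    g (card (vars (gap_circuit (padding N0 C K ^ q) C K)))"
proof -
  let ?M = "padding N0 C K" and ?G = "num_gaps C K"
  interpret cnf "?G + ?M ^ q" ?G "?G + length (labels C)" "gap_rel C K" using cnf_gap[OF C] .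
  let ?N = "?G + ?M ^ q"
  have M: "1 \<le> ?M" "N0 \<le> ?M" by (simp_all add: padding_def)
  have "?M ^ 1 \<le> ?M ^ q" using q M by (intro power_increasing) auto
  then have "N0 \<le> ?N" using M by simp
  have "circuit_genus (gap_circuit (?M ^ q) C K) \<le> ?M"
    using genus_CC unfolding gap_circuit_def
    by (rule order_trans) (simp add: padding_def algebra_simps)
  then have "real (circuit_genus (gap_circuit (?M ^ q) C K)) \<le> real ?M powr 1" using M by simp
  also have "\<dots> \<le> real ?M powr (real q * a)" using q M by (intro powr_mono) auto
  also have "\<dots> = real (?M ^ q) powr a" using M by (simp add: powr_powr[symmetric] powr_realpow)
  also have "\<dots> \<le> real ?N powr a" using \<open>0 < a\<close> by (intro powr_mono2) auto
  also have "\<dots> \<le> real (g ?N)" using g[OF \<open>N0 \<le> ?N\<close>] .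
  finally show ?thesis unfolding gap_circuit_def vars_CC by simp
qed

text \<open>The given reduction to circuits of depth 2 is run as a hosted program, and its output,
  left in \<open>A1\<close> in tape format, is the input of \<open>gap_program\<close>.\<close>

lemma W2_reducible:
  assumes "R \<in> W 2" "polynomial_growth g"
  shows "fpt_reducible R (wsat_pos_genus g)"
proof -
  obtain p f h c where comp: "computable f" "computable h"
    and red: "\<And>w k. (w, k) \<in> yes R \<union> no R \<Longrightarrow>
        \<exists>t w' k'. t \<le> f k * word_size w ^ c \<and> runs p (tape (w, k)) t (tape (w', k')) \<and>
           k' \<le> h k \<and>
           ((w, k) \<in> yes R \<longrightarrow> (w', k') \<in> yes (wsat_on (Pi_circuit 2))) \<and>
           ((w, k) \<in> no R \<longrightarrow> (w', k') \<in> no (wsat_on (Pi_circuit 2)))"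
    using assms(1) unfolding W_def fpt_reducible_def by blast
  obtain a b where a: "0 < a" "\<forall>\<^sub>F n in sequentially. real n powr a \<le> real (g n) \<and> real (g n) \<le> real n powr b"
    using assms(2) unfolding polynomial_growth_def by blast
  then obtain N0 where N0: "\<And>n. N0 \<le> n \<Longrightarrow> real n powr a \<le> real (g n)"
    unfolding eventually_sequentially by blast
  \<comment> \<open>Just large enough that \<open>M ^ q\<close> variables raise \<open>g\<close> to
    at least \<open>M\<close>.\<close>
  define q where "q = nat \<lceil>1 / a\<rceil>"
  have "1 / a \<le> real q" unfolding q_def by linarith
  then have q: "1 \<le> real q * a" using a(1) by (simp add: field_simps)
  then have q0: "0 < q" by (cases "q = 0") auto
  obtain Ct nt where gt: "\<And>B B'. B \<le> B' \<Longrightarrow> gap_time q N0 B \<le> Ct * (B' + 1) ^ nt"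
    using poly_bounded_mono_bound[OF poly_bounded_gap_time] by blast
  define F where "F k = 96 + 20 * f k + Ct * (h k + f k + 1) ^ nt" for k
  let ?c = "1 + c + c * nt"
  let ?prog = "Seq read_input (Seq (assign 30 (Num 0)) (Seq (assign 31 (Num (max_reg p)))
    (Seq (hosted p) (gap_program q N0))))"
  have compF: "computable F" unfolding F_def
    by (intro computable_add computable_mult computable_const computable_power comp)
  have comph: "computable (\<lambda>k. h k + 1)" by (intro computable_add computable_const comp)
  show ?thesis unfolding fpt_reducible_def
  proof (rule exI[of _ ?prog], rule exI[of _ F], rule exI[of _ "\<lambda>k. h k + 1"], rule exI[of _ ?c],
      intro conjI allI impI)
    show "computable F" "computable (\<lambda>k. h k + 1)" using compF comph by blast+
    fix w k assume wk: "(w, k) \<in> yes R \<union> no R"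
    let ?ws = "word_size w"
    obtain t w' K where t: "t \<le> f k * ?ws ^ c" "runs p (tape (w, k)) t (tape (w', K))" "K \<le> h k"
      "(w, k) \<in> yes R \<Longrightarrow> (w', K) \<in> yes (wsat_on (Pi_circuit 2))"
      "(w, k) \<in> no R \<Longrightarrow> (w', K) \<in> no (wsat_on (Pi_circuit 2))"
      using red[OF wk] by blast
    then obtain C where C: "Pi_circuit 2 C" "w' = enc_circuit C"
      using wk unfolding wsat_on_def by auto
    let ?P = "padding N0 C K ^ q" and ?B0 = "K + length (labels C) + length (wires C)"
    let ?D = "gap_circuit ?P C K"
    let ?a1 = "loaded_state w k"
    let ?a2 = "?a1\<lparr>av := (av ?a1)(30 := 0)\<rparr>"
    let ?a3 = "?a2\<lparr>av := (av ?a2)(31 := max_reg p)\<rparr>"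
    obtain B where B: "dims_le (av ?a1) B" using ex_dims_le by blast
    have 2: "does (assign 30 (Num 0)) ?a1 (expr_cost (Num 0) B + 2) ?a2" using B by (intro does_assign_eq) auto
    have 3: "does (assign 31 (Num (max_reg p))) ?a2 (expr_cost (Num (max_reg p)) B + 2) ?a3"
      using B by (intro does_assign_eq) auto
    have A0: "drop (av ?a3 30) (aa ?a3 A0) = tape (w, k)" by (simp add: loaded_state_def)
    have "\<exists>m m' raw. does (hosted p) ?a3 (20 * t) (?a3\<lparr>av := (av ?a3)(30 := m, 31 := m'),
      aa := (aa ?a3)(A1 := aa ?a3 A1 @ tape (w', K)), araw := raw\<rparr>) \<and> (\<forall>i > m'. raw i = 0)"
      by (rule leads_hosted) (use t(2) A0 in \<open>auto simp: loaded_state_def init_def\<close>)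
    then obtain m m' raw where 4: "does (hosted p) ?a3 (20 * t) (?a3\<lparr>av := (av ?a3)(30 := m, 31 := m'),
      aa := (aa ?a3)(A1 := aa ?a3 A1 @ tape (w', K)), araw := raw\<rparr>)" by blast
    let ?a4 = "?a3\<lparr>av := (av ?a3)(30 := m, 31 := m'),
      aa := (aa ?a3)(A1 := aa ?a3 A1 @ tape (w', K)), araw := raw\<rparr>"
    have "\<exists>a'. does (gap_program q N0) ?a4 (gap_time q N0 ?B0) a' \<and>
      aout a' = aout ?a4 @ tape (enc_circuit ?D, K + 1)"
      by (rule does_gap_program) (use C in \<open>auto simp: loaded_state_def init_def Pi_circuit_def wf_circuit_def verts_def\<close>)
    then obtain a' where 5: "does (gap_program q N0) ?a4 (gap_time q N0 ?B0) a'"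
      "aout a' = tape (enc_circuit ?D, K + 1)" by (auto simp: loaded_state_def init_def)
    obtain t' where t': "runs ?prog (tape (w, k)) t' (tape (enc_circuit ?D, K + 1))"
      "t' \<le> 30 * (length w + 2) + ((expr_cost (Num 0) B + 2) + ((expr_cost (Num (max_reg p)) B + 2) +
        (20 * t + gap_time q N0 ?B0)))"
      using runs_does[OF does_Seq[OF does_read_input does_Seq[OF 2 does_Seq[OF 3 does_Seq[OF 4 5(1)]]]]]
      unfolding 5(2) by blast
    have ws: "1 \<le> ?ws" "length w + 1 \<le> ?ws" using length_word_size[of w] by auto
    have pw: "1 \<le> ?ws ^ i" for i using ws(1) by simp
    have "length (tape (w', K)) \<le> t" using runs_length[OF t(2)] .
    then have "length (labels C) + length (wires C) \<le> t"
      unfolding C(2) length_tape by linarith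
    then have "?B0 \<le> h k + f k * ?ws ^ c" using t(1,3) by linarith
    also have "\<dots> \<le> (h k + f k) * ?ws ^ c" using pw[of c] by (simp add: distrib_right)
    finally have B0: "?B0 \<le> (h k + f k) * ?ws ^ c" .
    have "(h k + f k) * ?ws ^ c + 1 \<le> (h k + f k + 1) * ?ws ^ c" using pw[of c] by simp
    then have "((h k + f k) * ?ws ^ c + 1) ^ nt \<le> ((h k + f k + 1) * ?ws ^ c) ^ nt" by (rule power_mono) simp
    also have "\<dots> = (h k + f k + 1) ^ nt * ?ws ^ (c * nt)" by (simp only: power_mult_distrib power_mult)
    finally have "Ct * ((h k + f k) * ?ws ^ c + 1) ^ nt \<le> Ct * ((h k + f k + 1) ^ nt * ?ws ^ (c * nt))"
      by (rule mult_left_mono) simp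
    then have time3: "gap_time q N0 ?B0 \<le> Ct * (h k + f k + 1) ^ nt * ?ws ^ (c * nt)"
      using gt[OF B0] unfolding mult.assoc by linarith
    have mono: "x * ?ws ^ i \<le> x * ?ws ^ ?c" if "i \<le> ?c" for i x
      using that ws(1) by (intro mult_left_mono power_increasing) auto
    have "t' \<le> 96 * ?ws ^ 1 + 20 * f k * ?ws ^ c + Ct * (h k + f k + 1) ^ nt * ?ws ^ (c * nt)"
      using t'(2) t(1) time3 ws(2) by simp
    also have "\<dots> \<le> 96 * ?ws ^ ?c + 20 * f k * ?ws ^ ?c + Ct * (h k + f k + 1) ^ nt * ?ws ^ ?c"
      by (intro add_mono mono) auto
    also have "\<dots> = F k * ?ws ^ ?c" unfolding F_def by (simp only: distrib_right)
    finally have time: "t' \<le> F k * ?ws ^ ?c" .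
    interpret cnf "num_gaps C K + ?P" "num_gaps C K" "num_gaps C K + length (labels C)" "gap_rel C K"
      using cnf_gap[OF C(1)] .
    have in_class: "Pi_circuit 2 ?D \<and> monotone_circuit ?D \<and> circuit_genus ?D \<le> g (card (vars ?D))"
      using Pi_CC monotone_CC genus_gap_circuit[OF C(1) a(1) N0 q q0] unfolding gap_circuit_def by blast
    have "(w, k) \<in> yes R \<longrightarrow> (enc_circuit ?D, K + 1) \<in> yes (wsat_pos_genus g)"
    proof
      assume "(w, k) \<in> yes R"
      then have "weight_sat C K" using t(4) C(2) injD[OF inj_enc_circuit] by (auto simp: wsat_on_def)
      then have "weight_sat ?D (K + 1)" using weight_sat_gap_circuit[OF C(1)] by blast
      then show "(enc_circuit ?D, K + 1) \<in> yes (wsat_pos_genus g)"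
        using in_class unfolding wsat_pos_genus_def wsat_on_def by auto
    qed
    moreover have "(w, k) \<in> no R \<longrightarrow> (enc_circuit ?D, K + 1) \<in> no (wsat_pos_genus g)"
    proof
      assume "(w, k) \<in> no R"
      then have "\<not> weight_sat C K" using t(5) C(2) injD[OF inj_enc_circuit] by (auto simp: wsat_on_def)
      then have "\<not> weight_sat ?D (K + 1)" using weight_sat_gap_circuit[OF C(1)] by blast
      then show "(enc_circuit ?D, K + 1) \<in> no (wsat_pos_genus g)"
        using in_class unfolding wsat_pos_genus_def wsat_on_def by auto
    qed
    ultimately show "\<exists>t w' k'. t \<le> F k * ?ws ^ ?c \<and> runs ?prog (tape (w, k)) t (tape (w', k')) \<and>
      k' \<le> h k + 1 \<and> ((w, k) \<in> yes R \<longrightarrow> (w', k') \<in> yes (wsat_pos_genus g)) \<and>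
      ((w, k) \<in> no R \<longrightarrow> (w', k') \<in> no (wsat_pos_genus g))"
      using time t'(1) t(3) by (intro exI[of _ t'] exI[of _ "enc_circuit ?D"] exI[of _ "K + 1"]) auto
  qed
qed

theorem W2_complete: "polynomial_growth g \<Longrightarrow> W_complete 2 (wsat_pos_genus g)"
  unfolding W_complete_def using wsat_pos_genus_in_W2 W2_reducible by blast

section \<open>The search tree\<close>

text \<open>
  A partial solution is a list of vertices; entries that are not inputs are unused. The search
  branches on the variables of an active clause of least degree, where variables that occur in the
  same active clauses are identified.
\<close>

definition adj :: "circuit \<Rightarrow> nat \<Rightarrow> nat \<Rightarrow> bool" where
  "adj C x c \<longleftrightarrow> x \<in> inputs C \<and> ((x, c) \<in> set (wires C) \<or> x = c)"

definition active :: "circuit \<Rightarrow> nat list \<Rightarrow> nat \<Rightarrow> bool" where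
  "active C r c \<longleftrightarrow> (c, outgate C) \<in> set (wires C) \<and> \<not> (\<exists>y \<in> set r. adj C y c)"

definition same :: "circuit \<Rightarrow> nat list \<Rightarrow> nat \<Rightarrow> nat \<Rightarrow> bool" where
  "same C r x y \<longleftrightarrow> (\<forall>c. active C r c \<longrightarrow> (adj C x c \<longleftrightarrow> adj C y c))"

definition rep :: "circuit \<Rightarrow> nat list \<Rightarrow> nat \<Rightarrow> bool" where
  "rep C r x \<longleftrightarrow> x \<in> inputs C \<and> (\<forall>y < x. y \<in> inputs C \<longrightarrow> \<not> same C r y x)"

definition deg :: "circuit \<Rightarrow> nat list \<Rightarrow> nat \<Rightarrow> nat" where
  "deg C r c = card {x. rep C r x \<and> adj C x c}"

text \<open>The strict inequality for smaller numbers breaks ties, so there is at most one such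
  clause and all children of a row branch on the same one.\<close>

definition best :: "circuit \<Rightarrow> nat list \<Rightarrow> nat \<Rightarrow> bool" where
  "best C r c \<longleftrightarrow> active C r c \<and> (\<forall>c'. active C r c' \<longrightarrow>
     (if c' < c then deg C r c < deg C r c' else deg C r c \<le> deg C r c'))"

text \<open>\<open>length (labels C)\<close> is no vertex and serves as a blank. Once everything is
  hit a row gets exactly one child, by a blank, and so survives to the last level.\<close>

definition chosen :: "circuit \<Rightarrow> nat list \<Rightarrow> nat \<Rightarrow> bool" where
  "chosen C r x \<longleftrightarrow> x = length (labels C) \<and> (\<forall>c. \<not> active C r c) \<or>
     rep C r x \<and> (\<exists>c. best C r c \<and> adj C x c)"

definition children :: "circuit \<Rightarrow> nat \<Rightarrow> nat list \<Rightarrow> nat list list" where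
  "children C i r = map (\<lambda>x. r[i := x]) (filter (chosen C r) [0..<length (labels C) + 1])"

text \<open>Breadth-first: all rows have equal length and can be stored one after another, without
  recursion on the machine.\<close>

fun level :: "circuit \<Rightarrow> nat \<Rightarrow> nat \<Rightarrow> nat list list" where
  "level C k 0 = [replicate k (length (labels C))]"
| "level C k (Suc i) = concat (map (children C i) (level C k i))"

lemma inputs_less: "x \<in> inputs C \<Longrightarrow> x < length (labels C)"
  by (simp add: inputs_def verts_def)

lemma finite_inputs: "finite (inputs C)"
  by (simp add: inputs_def verts_def)

lemma rep_input: "rep C r x \<Longrightarrow> x \<in> inputs C"
  by (simp add: rep_def)

lemma level_rows:
  "r \<in> set (level C k i) \<Longrightarrow> length r = k \<and> (\<forall>j. i \<le> j \<longrightarrow> j < k \<longrightarrow> r ! j = length (labels C))"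
proof (induction i arbitrary: r)
  case (Suc i)
  then obtain r' x where "r' \<in> set (level C k i)" "r = r'[i := x]" by (auto simp: children_def)
  then show ?case using Suc.IH[of r'] by auto
qed auto

lemma active_clause_less:
  assumes "wf_circuit C" "active C r c"
  shows "c < length (labels C)"
  using assms by (auto simp: active_def wf_circuit_def verts_def)

lemma finite_active: "wf_circuit C \<Longrightarrow> finite {c. active C r c}"
  using active_clause_less by (metis (no_types, lifting) finite_nat_set_iff_bounded mem_Collect_eq)

text \<open>First the degree is minimized, then the number of the clause among those of that
  degree.\<close>

lemma best_ex:
  assumes "wf_circuit C" "active C r c0"
  shows "\<exists>c. best C r c"
proof -
  define m where "m = (LEAST m. \<exists>c. active C r c \<and> deg C r c = m)"
  have ex: "\<exists>m c. active C r c \<and> deg C r c = m" using assms by blast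
  have m: "\<exists>c. active C r c \<and> deg C r c = m" unfolding m_def by (rule LeastI_ex[OF ex])
  have least: "m \<le> deg C r c" if "active C r c" for c unfolding m_def using that by (intro Least_le) blast
  define c where "c = (LEAST c. active C r c \<and> deg C r c = m)"
  have c: "active C r c \<and> deg C r c = m" unfolding c_def by (rule LeastI_ex[OF m])
  have "deg C r c' \<noteq> m" if "c' < c" "active C r c'" for c'
    using not_less_Least[of c' "\<lambda>c. active C r c \<and> deg C r c = m"] that unfolding c_def by blast
  then have "best C r c" unfolding best_def using c least by (metis order_le_less)
  then show ?thesis by blast
qed

lemma best_unique: "best C r c \<Longrightarrow> best C r c' \<Longrightarrow> c = c'"
  unfolding best_def by (cases c c' rule: linorder_cases) (force dest: spec)+

lemma rep_ex:
  assumes "x \<in> inputs C"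
  shows "\<exists>y. rep C r y \<and> same C r y x"
proof -
  define y where "y = (LEAST y. y \<in> inputs C \<and> same C r y x)"
  have y: "y \<in> inputs C \<and> same C r y x" unfolding y_def
    by (rule LeastI[of _ x]) (use assms in \<open>auto simp: same_def\<close>)
  have "\<not> same C r z y" if "z < y" "z \<in> inputs C" for z
  proof
    assume "same C r z y"
    then have "z \<in> inputs C \<and> same C r z x" using that y by (auto simp: same_def)
    then show False using not_less_Least[of z "\<lambda>y. y \<in> inputs C \<and> same C r y x"] that unfolding y_def by blast
  qed
  then show ?thesis using y by (auto simp: rep_def)
qed

text \<open>Position \<open>i\<close> still held a blank, which hits nothing; so overwriting it
  makes no clause active again.\<close>

lemma active_update:
  assumes "i < length r" "r ! i = length (labels C)"
  shows "active C (r[i := x]) c \<longleftrightarrow> active C r c \<and> \<not> adj C x c"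
proof -
  have un: "\<not> adj C (length (labels C)) c" using inputs_less by (auto simp: adj_def)
  have "(\<exists>y \<in> set (r[i := x]). adj C y c) \<longleftrightarrow> adj C x c \<or> (\<exists>y \<in> set r. adj C y c)"
  proof
    assume "\<exists>y \<in> set (r[i := x]). adj C y c"
    then show "adj C x c \<or> (\<exists>y \<in> set r. adj C y c)" using set_update_subset_insert by fast
  next
    assume "adj C x c \<or> (\<exists>y \<in> set r. adj C y c)"
    then show "\<exists>y \<in> set (r[i := x]). adj C y c"
    proof
      assume "adj C x c"
      then show ?thesis using assms(1) set_update_memI by fast
    next
      assume "\<exists>y \<in> set r. adj C y c"
      then obtain j where j: "j < length r" "adj C (r ! j) c" by (auto simp: in_set_conv_nth)
      then have "j \<noteq> i" using un assms(2) by auto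
      then have "r[i := x] ! j = r ! j" by simp
      then show ?thesis using j by (metis length_list_update nth_mem)
    qed
  qed
  then show ?thesis by (auto simp: active_def)
qed

text \<open>Some row remains completable by at most \<open>k - i\<close> further inputs. These hit
  the clause branched on by some \<open>x\<close>; the representative \<open>y\<close> of
  \<open>x\<close> hits the same active clauses and can take its place.\<close>

lemma level_complete:
  assumes wf: "wf_circuit C" and H: "H \<subseteq> inputs C" "card H \<le> k"
    "\<And>c. (c, outgate C) \<in> set (wires C) \<Longrightarrow> \<exists>x \<in> H. adj C x c"
  shows "i \<le> k \<Longrightarrow> \<exists>r \<in> set (level C k i). \<exists>H' \<subseteq> inputs C. card H' \<le> k - i \<and>
    (\<forall>c. active C r c \<longrightarrow> (\<exists>x \<in> H'. adj C x c))"
proof (induction i)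
  case 0
  then show ?case using H by (auto intro!: exI[of _ H] simp: active_def)
next
  case (Suc i)
  then obtain r H' where r: "r \<in> set (level C k i)" "H' \<subseteq> inputs C" "card H' \<le> k - i"
    "\<And>c. active C r c \<Longrightarrow> \<exists>x \<in> H'. adj C x c" by auto
  have row: "length r = k" "r ! i = length (labels C)" using level_rows[OF r(1)] Suc.prems by auto
  have upd: "active C (r[i := x]) c \<longleftrightarrow> active C r c \<and> \<not> adj C x c" for x c
    using active_update[of i r C x c] row Suc.prems by simp
  have child: "r[i := x] \<in> set (level C k (Suc i))" if "chosen C r x" "x \<le> length (labels C)" for x
  proof -
    have "x \<in> set (filter (chosen C r) [0..<length (labels C) + 1])" using that by (simp del: upt_Suc)
    then have "r[i := x] \<in> set (children C i r)" unfolding children_def set_map by blast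
    then show ?thesis using r(1) by auto
  qed
  show ?case
  proof (cases "\<exists>c. active C r c")
    case False
    have "chosen C r (length (labels C))" using False by (auto simp: chosen_def)
    then have "r[i := length (labels C)] \<in> set (level C k (Suc i))" using child by simp
    then show ?thesis using False upd by (intro bexI[of _ "r[i := length (labels C)]"] exI[of _ "{}"]) auto
  next
    case True
    then obtain c where c: "best C r c" using best_ex[OF wf] by blast
    then have "active C r c" by (simp add: best_def)
    then obtain x where x: "x \<in> H'" "adj C x c" using r(4) by blast
    then obtain y where y: "rep C r y" "same C r y x" using rep_ex r(2) by blast
    have yc: "adj C y c'" if "active C r c'" "adj C x c'" for c' using y(2) that by (auto simp: same_def)
    have "chosen C r y" using y(1) c yc[OF \<open>active C r c\<close> x(2)] by (auto simp: chosen_def)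
    moreover have "y \<le> length (labels C)" using inputs_less[OF rep_input[OF y(1)]] by simp
    ultimately have mem: "r[i := y] \<in> set (level C k (Suc i))" by (rule child)
    have fin: "finite H'" using r(2) finite_inputs finite_subset by blast
    have "card (H' - {x}) \<le> k - Suc i" using r(3) x(1) fin by simp
    moreover have "\<exists>z \<in> H' - {x}. adj C z c'" if "active C (r[i := y]) c'" for c'
    proof -
      have "active C r c'" "\<not> adj C y c'" using that upd by auto
      then obtain z where "z \<in> H'" "adj C z c'" using r(4) by blast
      moreover have "z \<noteq> x" using yc \<open>active C r c'\<close> \<open>\<not> adj C y c'\<close> \<open>adj C z c'\<close> by blast
      ultimately show ?thesis by blast
    qed
    ultimately show ?thesis using mem r(2) by (intro bexI[OF _ mem] exI[of _ "H' - {x}"]) auto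
  qed
qed

text \<open>In a monotone circuit a variable has one literal, and that literal labels one input, so
  sets of variables and sets of inputs correspond.\<close>

lemma weight_sat_inputs:
  assumes C: "Pi_circuit 2 C" "monotone_circuit C"
  shows "weight_sat C k \<longleftrightarrow> (\<exists>H \<subseteq> inputs C. card H = k \<and>
    (\<forall>c. (c, outgate C) \<in> set (wires C) \<longrightarrow> (\<exists>x \<in> H. adj C x c)))"
    and "card (vars C) = card (inputs C)"
proof -
  have wf: "wf_circuit C" using C by (simp add: Pi_circuit_def)
  let ?f = "\<lambda>v. arg_of (labels C ! v)"
  have lit: "labels C ! v = Lit (?f v) True" if v: "v \<in> inputs C" for v
  proof -
    obtain x b where xb: "labels C ! v = Lit x b" using v by (auto simp: inputs_def)
    then have "Lit x b \<in> set (labels C)" using inputs_less[OF v] by (metis nth_mem)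
    then show ?thesis using C(2) xb by (auto simp: monotone_circuit_def)
  qed
  have inj: "inj_on ?f (inputs C)"
  proof (rule inj_onI)
    fix u v assume "u \<in> inputs C" "v \<in> inputs C" "?f u = ?f v"
    then have "labels C ! u = labels C ! v" using lit[of u] lit[of v] by metis
    moreover have "inj_on ((!) (labels C)) (inputs C)" using wf unfolding wf_circuit_def by blast
    ultimately show "u = v" using \<open>u \<in> inputs C\<close> \<open>v \<in> inputs C\<close> by (metis inj_onD)
  qed
  have img: "?f ` inputs C = vars C"
  proof
    show "?f ` inputs C \<subseteq> vars C"
    proof
      fix x assume "x \<in> ?f ` inputs C"
      then obtain v where v: "v \<in> inputs C" "x = ?f v" by blast
      then have "Lit x True \<in> set (labels C)" using lit[OF v(1)] inputs_less[OF v(1)] by (metis nth_mem)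
      then show "x \<in> vars C" by (auto simp: vars_def)
    qed
    show "vars C \<subseteq> ?f ` inputs C"
    proof
      fix x assume "x \<in> vars C"
      then obtain b v where "v < length (labels C)" "labels C ! v = Lit x b" by (auto simp: vars_def in_set_conv_nth)
      then show "x \<in> ?f ` inputs C" by (intro image_eqI[of _ _ v]) (auto simp: inputs_def verts_def)
    qed
  qed
  show "card (vars C) = card (inputs C)" using inj img by (metis card_image)
  have holds: "holds C (?f ` H) (outgate C) \<longleftrightarrow>
      (\<forall>c. (c, outgate C) \<in> set (wires C) \<longrightarrow> (\<exists>x \<in> H. adj C x c))" if H: "H \<subseteq> inputs C" for H
  proof -
    have "lit_true C (?f ` H) u \<longleftrightarrow> u \<in> H" if "u \<in> inputs C" for u
    proof -
      have "lit_true C (?f ` H) u \<longleftrightarrow> ?f u \<in> ?f ` H"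
        unfolding lit_true_def using lit[OF that] by (metis (no_types, lifting) vlabel.inject(1))
      also have "\<dots> \<longleftrightarrow> u \<in> H" by (rule inj_on_image_mem_iff[OF inj that H])
      finally show ?thesis .
    qed
    then show ?thesis unfolding Pi2_holds[OF C(1)] adj_def using H by blast
  qed
  show "weight_sat C k \<longleftrightarrow> (\<exists>H \<subseteq> inputs C. card H = k \<and>
    (\<forall>c. (c, outgate C) \<in> set (wires C) \<longrightarrow> (\<exists>x \<in> H. adj C x c)))"
  proof
    assume "weight_sat C k"
    then obtain A where A: "A \<subseteq> ?f ` inputs C" "card A = k" "holds C A (outgate C)"
      unfolding weight_sat_def img by blast
    then obtain H where H: "H \<subseteq> inputs C" "A = ?f ` H" by (metis subset_imageE)
    then have "card H = k" using A(2) inj_on_subset[OF inj] by (metis card_image)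
    then show "\<exists>H \<subseteq> inputs C. card H = k \<and>
      (\<forall>c. (c, outgate C) \<in> set (wires C) \<longrightarrow> (\<exists>x \<in> H. adj C x c))" using H A(3) holds by blast
  next
    assume "\<exists>H \<subseteq> inputs C. card H = k \<and>
      (\<forall>c. (c, outgate C) \<in> set (wires C) \<longrightarrow> (\<exists>x \<in> H. adj C x c))"
    then obtain H where H: "H \<subseteq> inputs C" "card H = k" "holds C (?f ` H) (outgate C)" using holds by blast
    have "card (?f ` H) = k" using H(1,2) inj_on_subset[OF inj] by (metis card_image)
    moreover have "?f ` H \<subseteq> vars C" using H(1) img by blast
    ultimately show "weight_sat C k" unfolding weight_sat_def using H(3) by blast
  qed
qed

text \<open>A row that hits everything uses at most \<open>k\<close> inputs. By monotonicity further
  inputs do no harm, so it can be filled up to exactly \<open>k\<close> if there are enough.\<close>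

theorem weight_sat_level:
  assumes C: "Pi_circuit 2 C" "monotone_circuit C"
  shows "weight_sat C k \<longleftrightarrow> k \<le> card (inputs C) \<and> (\<exists>r \<in> set (level C k k). \<forall>c. \<not> active C r c)"
proof
  have wf: "wf_circuit C" using C by (simp add: Pi_circuit_def)
  assume "weight_sat C k"
  then obtain H where H: "H \<subseteq> inputs C" "card H = k"
    "\<And>c. (c, outgate C) \<in> set (wires C) \<Longrightarrow> \<exists>x \<in> H. adj C x c" unfolding weight_sat_inputs(1)[OF C] by blast
  then obtain r H' where r: "r \<in> set (level C k k)" "H' \<subseteq> inputs C" "card H' \<le> k - k"
    "\<forall>c. active C r c \<longrightarrow> (\<exists>x \<in> H'. adj C x c)" using level_complete[OF wf H(1) _ H(3), of k k] by blast
  have "finite H'" using r(2) finite_inputs finite_subset by blast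
  then have "H' = {}" using r(3) by simp
  then show "k \<le> card (inputs C) \<and> (\<exists>r \<in> set (level C k k). \<forall>c. \<not> active C r c)"
    using r card_mono[OF finite_inputs H(1)] H(2) by blast
next
  assume "k \<le> card (inputs C) \<and> (\<exists>r \<in> set (level C k k). \<forall>c. \<not> active C r c)"
  then obtain r where r: "k \<le> card (inputs C)" "r \<in> set (level C k k)" "\<And>c. \<not> active C r c" by blast
  let ?S = "set r \<inter> inputs C"
  have "card ?S \<le> card (set r)" by (intro card_mono) auto
  also have "\<dots> \<le> k" using level_rows[OF r(2)] card_length[of r] by simp
  finally have "card ?S \<le> k" .
  then obtain H where H: "?S \<subseteq> H" "H \<subseteq> inputs C" "card H = k"
    using exists_subset_between[of ?S k "inputs C"] r(1) finite_inputs by auto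
  have "\<exists>x \<in> H. adj C x c" if c: "(c, outgate C) \<in> set (wires C)" for c
  proof -
    obtain y where "y \<in> set r" "adj C y c" using r(3)[of c] c by (auto simp: active_def)
    then have "y \<in> ?S" by (simp add: adj_def)
    then show ?thesis using H(1) \<open>adj C y c\<close> by blast
  qed
  then show "weight_sat C k" unfolding weight_sat_inputs(1)[OF C] using H by blast
qed

section \<open>The branching degree\<close>

lemma input_no_wire:
  assumes "wf_circuit C" "x \<in> inputs C"
  shows "(u, x) \<notin> set (wires C)"
proof
  assume "(u, x) \<in> set (wires C)"
  then have "x \<in> snd ` set (wires C)" by (rule rev_image_eqI) simp
  moreover have "inputs C = verts C - snd ` set (wires C)" using assms(1) by (simp add: wf_circuit_def)
  ultimately show False using assms(2) by blast
qed

text \<open>A clause that is itself an input has only that variable. Otherwise variables and active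
  clauses are disjoint and \<open>ex_low_degree\<close> applies to the representatives: two of them
  with the same active clauses would have been identified. No edge between them is lost with the
  output gate.\<close>

lemma ex_active_low_degree:
  assumes C: "Pi_circuit 2 C" and "active C r c0"
  shows "\<exists>c. active C r c \<and> deg C r c \<le> 15 + 24 * circuit_genus C"
proof (cases "\<exists>c. active C r c \<and> c \<in> inputs C")
  case True
  then obtain c where c: "active C r c" "c \<in> inputs C" by blast
  have "(x, c) \<notin> set (wires C)" for x using input_no_wire c(2) C by (auto simp: Pi_circuit_def)
  then have "{x. rep C r x \<and> adj C x c} \<subseteq> {c}" by (auto simp: adj_def)
  then have "deg C r c \<le> card {c}" unfolding deg_def by (intro card_mono) auto
  then show ?thesis using c(1) by (intro exI[of _ c]) simp
next
  case False
  let ?V = "verts C - {outgate C}" and ?W = "set (wires C)"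
  let ?D = "(?W \<union> ?W\<inverse>) \<inter> ?V \<times> ?V"
  let ?X = "{x. rep C r x}" and ?M = "{c. active C r c}"
  have wf: "wf_circuit C" using C by (simp add: Pi_circuit_def)
  have XI: "?X \<subseteq> inputs C" using rep_input by blast
  interpret bipartite_genus ?V ?D ?X ?M
  proof
    show "finite ?V" by (simp add: verts_def)
    show "finite ?X" using XI finite_inputs finite_subset by blast
    show "finite ?M" using finite_active[OF wf] .
    show "sym ?D" by (auto simp: sym_def)
    have "(v, v) \<notin> ?W" for v using wf by (auto simp: wf_circuit_def acyclic_def)
    then show "irrefl ?D" by (auto simp: irrefl_def)
    show "?X \<inter> ?M = {}" using False XI by blast
  qed blast
  have nbh: "nbh x = {c. active C r c \<and> adj C x c}" if "rep C r x" for x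
  proof -
    have x: "x \<in> inputs C" using rep_input[OF that] .
    have "(c, x) \<notin> ?W" for c using input_no_wire[OF wf x] .
    moreover have "x \<in> ?V" using x wf by (auto simp: inputs_def wf_circuit_def)
    moreover have "c \<in> ?V" if "active C r c" for c
    proof -
      have w: "(c, outgate C) \<in> ?W" using that by (simp add: active_def)
      then have "c \<in> fst ` ?W" by (rule rev_image_eqI) simp
      moreover have "outgate C \<notin> fst ` ?W" "?W \<subseteq> verts C \<times> verts C" using wf by (simp_all add: wf_circuit_def)
      ultimately show ?thesis using w by blast
    qed
    moreover have "x \<noteq> c" if "active C r c" for c using False x that by blast
    ultimately show ?thesis unfolding nbh_def adj_def using x by blast
  qed
  have "inj_on nbh ?X"
  proof (rule inj_onI)
    fix x y assume xy: "x \<in> ?X" "y \<in> ?X" "nbh x = nbh y"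
    then have s: "same C r x y" "same C r y x" using nbh by (auto simp: same_def)
    show "x = y" using xy s by (metis linorder_neqE_nat mem_Collect_eq rep_def)
  qed
  then obtain c where c: "c \<in> ?M" "card {x \<in> ?X. c \<in> nbh x} \<le> 15 + 24 * graph_genus ?V ?D"
    using ex_low_degree assms(2) by blast
  have "{x \<in> ?X. c \<in> nbh x} = {x. rep C r x \<and> adj C x c}" using c(1) nbh by auto
  then have "deg C r c \<le> 15 + 24 * circuit_genus C"
    using c(2) unfolding deg_def circuit_genus_def Let_def by simp
  then show ?thesis using c(1) by blast
qed

text \<open>Minimality passes the bound from a clause of low degree to the one branched on. The
  second bound serves when the number of variables is bounded in terms of \<open>k\<close>; its 1
  covers the blank.\<close>

lemma length_children:
  assumes C: "Pi_circuit 2 C"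
  shows "length (children C i r) \<le> 15 + 24 * circuit_genus C"
    and "length (children C i r) \<le> card (inputs C) + 1"
proof -
  have wf: "wf_circuit C" using C by (simp add: Pi_circuit_def)
  let ?l = "filter (chosen C r) [0..<length (labels C) + 1]"
  have len: "length (children C i r) = card (set ?l)"
    unfolding children_def length_map by (rule distinct_card[symmetric]) simp
  have "length (children C i r) \<le> 15 + 24 * circuit_genus C \<and> length (children C i r) \<le> card (inputs C) + 1"
  proof (cases "\<exists>c. active C r c")
    case False
    then have "\<not> best C r c" for c by (auto simp: best_def)
    then have "set ?l \<subseteq> {length (labels C)}" by (auto simp: chosen_def)
    then have "card (set ?l) \<le> card {length (labels C)}" by (intro card_mono) auto
    then show ?thesis using len by simp
  next
    case True
    then obtain c where c: "active C r c" "deg C r c \<le> 15 + 24 * circuit_genus C"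
      using ex_active_low_degree[OF C] by blast
    obtain b where b: "best C r b" using best_ex[OF wf] True by blast
    have "deg C r b \<le> deg C r c" using b c(1) unfolding best_def by (metis less_imp_le)
    have sub: "set ?l \<subseteq> {x. rep C r x \<and> adj C x b}"
      using True b best_unique by (auto simp: chosen_def)
    have subI: "{x. rep C r x \<and> adj C x b} \<subseteq> inputs C" using rep_input by blast
    then have fin: "finite {x. rep C r x \<and> adj C x b}" using finite_inputs finite_subset by blast
    have "card (set ?l) \<le> deg C r b" unfolding deg_def using card_mono[OF fin sub] .
    moreover have "deg C r b \<le> card (inputs C)" unfolding deg_def using card_mono[OF finite_inputs subI] .
    ultimately show ?thesis using len c(2) \<open>deg C r b \<le> deg C r c\<close> by linarith
  qed
  then show "length (children C i r) \<le> 15 + 24 * circuit_genus C"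
    "length (children C i r) \<le> card (inputs C) + 1" by auto
qed

lemma length_level:
  assumes "\<And>i r. length (children C i r) \<le> D"
  shows "length (level C k i) \<le> D ^ i"
proof (induction i)
  case (Suc i)
  have "length (level C k (Suc i)) = (\<Sum>r\<leftarrow>level C k i. length (children C i r))"
    by (simp add: length_concat comp_def)
  also have "\<dots> \<le> (\<Sum>r\<leftarrow>level C k i. D)" using assms by (intro sum_list_mono) auto
  also have "\<dots> = length (level C k i) * D" by (simp add: sum_list_triv)
  also have "\<dots> \<le> D ^ i * D" using Suc by (rule mult_right_mono) simp
  finally show ?case by (simp add: mult.commute)
qed simp

section \<open>Search on the machine\<close>

text \<open>Row \<open>h\<close> starts at \<open>k * h\<close>, as all rows have length
  \<open>k\<close>; the product is a sum bounded by variable 1.\<close>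

definition rowE :: "nat \<Rightarrow> nat \<Rightarrow> expr" where
  "rowE h j = Arr A1 (Plus (Sum 91 1 (Var h)) (Var j))"

definition adjE :: "nat \<Rightarrow> nat \<Rightarrow> expr" where
  "adjE x c = AndE (litE A0 x) (OrE (wireE A0 x c) (EqE (Var x) (Var c)))"

text \<open>\<open>adjE\<close> takes variable numbers, so the entry of the row is given a name by
  quantifying over 41. A blank equals no vertex and drops out.\<close>

definition activeE :: "nat \<Rightarrow> nat \<Rightarrow> expr" where
  "activeE h c = AndE (wireE A0 c 2)
     (NotE (ExE 40 1 (ExE 41 3 (AndE (EqE (Var 41) (rowE h 40)) (adjE 41 c)))))"

definition sameE :: "nat \<Rightarrow> nat \<Rightarrow> nat \<Rightarrow> expr" where
  "sameE h x y = AllE 42 3 (OrE (NotE (activeE h 42)) (IffE (adjE x 42) (adjE y 42)))"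

definition repE :: "nat \<Rightarrow> nat \<Rightarrow> expr" where
  "repE h x = AndE (litE A0 x) (AllE 43 3 (OrE (NotE (AndE (LessE (Var 43) (Var x)) (litE A0 43)))
     (NotE (sameE h 43 x))))"

definition degE :: "nat \<Rightarrow> nat \<Rightarrow> expr" where
  "degE h c = CardE 44 3 (AndE (repE h 44) (adjE 44 c))"

definition bestE :: "nat \<Rightarrow> nat \<Rightarrow> expr" where
  "bestE h c = AndE (activeE h c) (AllE 45 3 (OrE (NotE (activeE h 45))
     (Ite (LessE (Var 45) (Var c)) (LessE (degE h c) (degE h 45)) (LeE (degE h c) (degE h 45)))))"

text \<open>The guard makes the second case false for the blank, at which the formulas for vertices
  would read past the labels.\<close>

definition chosenE :: "nat \<Rightarrow> nat \<Rightarrow> expr" where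
  "chosenE h x = OrE (AndE (EqE (Var x) (Var 3)) (AllE 46 3 (NotE (activeE h 46))))
     (AndE (LessE (Var x) (Var 3))
       (AndE (repE h x) (ExE 47 3 (AndE (bestE h 47) (adjE x 47)))))"

lemmas search_expr_defs = rowE_def adjE_def activeE_def sameE_def repE_def degE_def bestE_def chosenE_def

definition search_ok :: "circuit \<Rightarrow> nat \<Rightarrow> nat list list \<Rightarrow> (nat \<Rightarrow> nat) \<Rightarrow> (arr \<Rightarrow> nat list) \<Rightarrow> bool" where
  "search_ok C k L \<sigma> \<rho> \<longleftrightarrow> wf_circuit C \<and> loaded A0 C k \<sigma> \<rho> \<and> \<rho> A1 = concat L \<and> (\<forall>r \<in> set L. length r = k)"

lemma search_ok_upd [simp]: "5 \<le> x \<Longrightarrow> search_ok C k L (\<sigma>(x := i)) \<rho> = search_ok C k L \<sigma> \<rho>"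
  by (simp add: search_ok_def)

lemma search_okD:
  assumes "search_ok C k L \<sigma> \<rho>"
  shows "wf_circuit C" "loaded A0 C k \<sigma> \<rho>" "\<rho> A1 = concat L" "\<And>r. r \<in> set L \<Longrightarrow> length r = k"
    "\<sigma> 1 = k" "\<sigma> 2 = outgate C" "\<sigma> 3 = length (labels C)"
  using assms by (auto simp: search_ok_def loaded_def)

lemma nth_concat_rows:
  assumes "\<And>r. r \<in> set L \<Longrightarrow> length r = k" "h < length L" "j < k"
  shows "k * h + j < length (concat L)" "concat L ! (k * h + j) = L ! h ! j"
  using assms
proof (induction L arbitrary: h)
  case (Cons r L)
  {
    case 1
    then show ?case using Cons.IH(1) by (cases h) auto
  next
    case 2
    then show ?case using Cons.IH(2) by (cases h) (auto simp: nth_append)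
  }
qed auto

lemma eval_rowE:
  assumes "search_ok C k L \<sigma> \<rho>" "\<sigma> h < length L" "\<sigma> j < k" "h \<noteq> 91"
  shows "eval (rowE h j) \<sigma> \<rho> = L ! \<sigma> h ! \<sigma> j"
  using nth_concat_rows[of L k "\<sigma> h" "\<sigma> j"] search_okD[OF assms(1)] assms(2-) unfolding rowE_def by simp

lemma tr_adjE:
  assumes "search_ok C k L \<sigma> \<rho>" "\<sigma> x < length (labels C)" "x \<noteq> 90" "c \<noteq> 90"
  shows "tr (adjE x c) \<sigma> \<rho> \<longleftrightarrow> adj C (\<sigma> x) (\<sigma> c)"
  using tr_litE[OF search_okD(2)[OF assms(1)] assms(2)] tr_wireE[OF search_okD(2)[OF assms(1)] assms(3,4)] assms(2)
  unfolding adjE_def adj_def by (simp add: inputs_def verts_def)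

lemma tr_activeE:
  assumes ok: "search_ok C k L \<sigma> \<rho>" and h: "\<sigma> h < length L" and names: "h \<notin> {40, 41, 91}" "c \<notin> {40, 41, 90}"
  shows "tr (activeE h c) \<sigma> \<rho> \<longleftrightarrow> active C (L ! \<sigma> h) (\<sigma> c)"
proof -
  let ?r = "L ! \<sigma> h"
  note d = search_okD[OF ok]
  have len: "length ?r = k" using d(4) h by simp
  have 1: "eval (rowE h 40) (\<sigma>(40 := j, 41 := y)) \<rho> = ?r ! j" if "j < k" for j y
    using eval_rowE[of C k L "\<sigma>(40 := j, 41 := y)" \<rho> h 40] ok h names that by simp
  have 2: "tr (adjE 41 c) (\<sigma>(40 := j, 41 := y)) \<rho> \<longleftrightarrow> adj C y (\<sigma> c)" if "y < length (labels C)" for j y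
    using tr_adjE[of C k L "\<sigma>(40 := j, 41 := y)" \<rho> 41 c] ok names that by simp
  have "tr (activeE h c) \<sigma> \<rho> \<longleftrightarrow> (\<sigma> c, outgate C) \<in> set (wires C) \<and>
      \<not> (\<exists>j < k. \<exists>y < length (labels C). y = ?r ! j \<and> adj C y (\<sigma> c))"
    unfolding activeE_def using tr_wireE[OF d(2), of c 2] names d 1 2 by auto
  also have "(\<exists>j < k. \<exists>y < length (labels C). y = ?r ! j \<and> adj C y (\<sigma> c)) \<longleftrightarrow> (\<exists>y \<in> set ?r. adj C y (\<sigma> c))"
  proof -
    have "y < length (labels C)" if "adj C y (\<sigma> c)" for y using that inputs_less by (auto simp: adj_def)
    then show ?thesis by (auto simp: set_conv_nth len)
  qed
  finally show ?thesis unfolding active_def .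
qed

lemma tr_sameE:
  assumes ok: "search_ok C k L \<sigma> \<rho>" and h: "\<sigma> h < length L"
    and xy: "\<sigma> x < length (labels C)" "\<sigma> y < length (labels C)"
    and names: "h \<notin> {40, 41, 42, 91}" "x \<notin> {42, 90}" "y \<notin> {42, 90}"
  shows "tr (sameE h x y) \<sigma> \<rho> \<longleftrightarrow> same C (L ! \<sigma> h) (\<sigma> x) (\<sigma> y)"
proof -
  have "tr (activeE h 42) (\<sigma>(42 := c)) \<rho> \<longleftrightarrow> active C (L ! \<sigma> h) c"
    "tr (adjE x 42) (\<sigma>(42 := c)) \<rho> \<longleftrightarrow> adj C (\<sigma> x) c" "tr (adjE y 42) (\<sigma>(42 := c)) \<rho> \<longleftrightarrow> adj C (\<sigma> y) c" for c
    using tr_activeE[of C k L "\<sigma>(42 := c)" \<rho> h 42] tr_adjE[of C k L "\<sigma>(42 := c)" \<rho> x 42]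
      tr_adjE[of C k L "\<sigma>(42 := c)" \<rho> y 42] ok h xy names by simp_all
  then show ?thesis unfolding sameE_def same_def
    using search_okD(7)[OF ok] active_clause_less[OF search_okD(1)[OF ok]] by auto
qed

lemma tr_litE_input:
  assumes "search_ok C k L \<sigma> \<rho>" "\<sigma> x < length (labels C)"
  shows "tr (litE A0 x) \<sigma> \<rho> \<longleftrightarrow> \<sigma> x \<in> inputs C"
  using tr_litE[OF search_okD(2)[OF assms(1)] assms(2)] assms(2) by (simp add: inputs_def verts_def)

lemma tr_repE:
  assumes ok: "search_ok C k L \<sigma> \<rho>" and h: "\<sigma> h < length L" and x: "\<sigma> x < length (labels C)"
    and names: "h \<notin> {40, 41, 42, 43, 91}" "x \<notin> {42, 43, 90}"
  shows "tr (repE h x) \<sigma> \<rho> \<longleftrightarrow> rep C (L ! \<sigma> h) (\<sigma> x)"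
proof -
  have "tr (litE A0 43) (\<sigma>(43 := y)) \<rho> \<longleftrightarrow> y \<in> inputs C"
    "tr (sameE h 43 x) (\<sigma>(43 := y)) \<rho> \<longleftrightarrow> same C (L ! \<sigma> h) y (\<sigma> x)" if "y < length (labels C)" for y
    using tr_litE_input[of C k L "\<sigma>(43 := y)" \<rho> 43] tr_sameE[of C k L "\<sigma>(43 := y)" \<rho> h 43 x]
      ok h x names that by simp_all
  then have "tr (repE h x) \<sigma> \<rho> \<longleftrightarrow> \<sigma> x \<in> inputs C \<and> (\<forall>y < length (labels C). \<not> (y < \<sigma> x \<and> y \<in> inputs C) \<or>
      \<not> same C (L ! \<sigma> h) y (\<sigma> x))"
    unfolding repE_def using tr_litE_input[OF ok x] search_okD(7)[OF ok] names by simp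
  then show ?thesis unfolding rep_def using x by (auto dest: less_trans)
qed

lemma eval_degE:
  assumes ok: "search_ok C k L \<sigma> \<rho>" and h: "\<sigma> h < length L"
    and names: "h \<notin> {40, 41, 42, 43, 44, 91}" "c \<notin> {44, 90}"
  shows "eval (degE h c) \<sigma> \<rho> = deg C (L ! \<sigma> h) (\<sigma> c)"
proof -
  have "tr (repE h 44) (\<sigma>(44 := x)) \<rho> \<longleftrightarrow> rep C (L ! \<sigma> h) x"
    "tr (adjE 44 c) (\<sigma>(44 := x)) \<rho> \<longleftrightarrow> adj C x (\<sigma> c)" if "x < length (labels C)" for x
    using tr_repE[of C k L "\<sigma>(44 := x)" \<rho> h 44] tr_adjE[of C k L "\<sigma>(44 := x)" \<rho> 44 c] ok h names that by simp_all
  then have "{x. x < \<sigma> 3 \<and> tr (AndE (repE h 44) (adjE 44 c)) (\<sigma>(44 := x)) \<rho>} = {x. rep C (L ! \<sigma> h) x \<and> adj C x (\<sigma> c)}"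
    using search_okD(7)[OF ok] inputs_less rep_input by auto
  then show ?thesis unfolding degE_def eval_CardE deg_def by simp
qed

lemma tr_bestE:
  assumes ok: "search_ok C k L \<sigma> \<rho>" and h: "\<sigma> h < length L"
    and names: "h \<notin> {40, 41, 42, 43, 44, 45, 91}" "c \<notin> {40, 41, 44, 45, 90}"
  shows "tr (bestE h c) \<sigma> \<rho> \<longleftrightarrow> best C (L ! \<sigma> h) (\<sigma> c)"
proof -
  have "tr (activeE h 45) (\<sigma>(45 := c')) \<rho> \<longleftrightarrow> active C (L ! \<sigma> h) c'"
    "eval (degE h 45) (\<sigma>(45 := c')) \<rho> = deg C (L ! \<sigma> h) c'"
    "eval (degE h c) (\<sigma>(45 := c')) \<rho> = deg C (L ! \<sigma> h) (\<sigma> c)" for c'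
    using tr_activeE[of C k L "\<sigma>(45 := c')" \<rho> h 45] eval_degE[of C k L "\<sigma>(45 := c')" \<rho> h 45]
      eval_degE[of C k L "\<sigma>(45 := c')" \<rho> h c] ok h names by simp_all
  moreover have "tr (activeE h c) \<sigma> \<rho> \<longleftrightarrow> active C (L ! \<sigma> h) (\<sigma> c)" using tr_activeE[OF ok h] names by simp
  ultimately have "tr (bestE h c) \<sigma> \<rho> \<longleftrightarrow> active C (L ! \<sigma> h) (\<sigma> c) \<and> (\<forall>c' < length (labels C).
    active C (L ! \<sigma> h) c' \<longrightarrow> (if c' < \<sigma> c then deg C (L ! \<sigma> h) (\<sigma> c) < deg C (L ! \<sigma> h) c'
      else deg C (L ! \<sigma> h) (\<sigma> c) \<le> deg C (L ! \<sigma> h) c'))"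
    unfolding bestE_def using search_okD(7)[OF ok] names by auto
  then show ?thesis unfolding best_def using active_clause_less[OF search_okD(1)[OF ok]] by blast
qed

lemma tr_chosenE:
  assumes ok: "search_ok C k L \<sigma> \<rho>" and h: "\<sigma> h < length L"
    and names: "h < 40 \<and> 4 < h" "x < 40 \<and> 4 < x"
  shows "tr (chosenE h x) \<sigma> \<rho> \<longleftrightarrow> chosen C (L ! \<sigma> h) (\<sigma> x)"
proof -
  let ?n = "length (labels C)" and ?r = "L ! \<sigma> h"
  have 1: "tr (activeE h 46) (\<sigma>(46 := c)) \<rho> \<longleftrightarrow> active C ?r c" for c
    using tr_activeE[of C k L "\<sigma>(46 := c)" \<rho> h 46] ok h names by simp
  have 2: "tr (bestE h 47) (\<sigma>(47 := c)) \<rho> \<longleftrightarrow> best C ?r c" for c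
    using tr_bestE[of C k L "\<sigma>(47 := c)" \<rho> h 47] ok h names by simp
  have 3: "tr (adjE x 47) (\<sigma>(47 := c)) \<rho> \<longleftrightarrow> adj C (\<sigma> x) c" if "\<sigma> x < ?n" for c
    using tr_adjE[of C k L "\<sigma>(47 := c)" \<rho> x 47] ok names that by simp
  have 4: "tr (repE h x) \<sigma> \<rho> \<longleftrightarrow> rep C ?r (\<sigma> x)" if "\<sigma> x < ?n" using tr_repE[OF ok h that] names by simp
  have "tr (chosenE h x) \<sigma> \<rho> \<longleftrightarrow> \<sigma> x = ?n \<and> (\<forall>c < ?n. \<not> active C ?r c) \<or>
    \<sigma> x < ?n \<and> rep C ?r (\<sigma> x) \<and> (\<exists>c < ?n. best C ?r c \<and> adj C (\<sigma> x) c)"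
    unfolding chosenE_def using 1 2 3 4 search_okD(7)[OF ok] names by (auto cong: conj_cong)
  moreover have "c < ?n" if "active C ?r c" for c using active_clause_less[OF search_okD(1)[OF ok] that] .
  moreover have "c < ?n" if "best C ?r c" for c
    using that active_clause_less[OF search_okD(1)[OF ok]] by (auto simp: best_def)
  moreover have "\<sigma> x < ?n" if "rep C ?r (\<sigma> x)" using inputs_less[OF rep_input[OF that]] .
  ultimately show ?thesis unfolding chosen_def by blast
qed

text \<open>
  Variable 5 is the number of candidates for an entry, 6 the number of rows, 7 the level, 8 the
  number of levels left; \<open>A1\<close> holds the rows of the current level.
\<close>

definition child_countE :: expr where
  "child_countE = Sum 20 6 (CardE 21 5 (chosenE 20 21))"

definition child_emit :: emit where
  "child_emit = EFor 20 6 (EFor 21 5 (EIf (chosenE 20 21)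
     (EFor 22 1 (Emit (Ite (EqE (Var 22) (Var 7)) (Var 21) (rowE 20 22))))))"

definition copy_emit :: emit where
  "copy_emit = EFor 20 10 (Emit (Arr A2 (Var 20)))"

definition verdictE :: expr where
  "verdictE = AndE (LeE (Var 1) (CardE 20 3 (litE A0 20)))
     (ExE 20 6 (AllE 21 3 (NotE (activeE 20 21))))"

lemma wf_search:
  "wf_expr child_countE" "wf_emit child_emit" "wf_emit copy_emit" "wf_expr verdictE"
  "A2 \<notin> arrs_emit child_emit" "A1 \<notin> arrs_emit copy_emit"
  by (simp_all add: child_countE_def child_emit_def copy_emit_def verdictE_def search_expr_defs
      formula_defs circuit_expr_defs IffE_def)

lemma tr_chosenE_row:
  assumes "search_ok C k L \<sigma> \<rho>" "h < length L"
  shows "tr (chosenE 20 21) (\<sigma>(20 := h, 21 := x)) \<rho> \<longleftrightarrow> chosen C (L ! h) x"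
  using tr_chosenE[of C k L "\<sigma>(20 := h, 21 := x)" \<rho> 20 21] assms by simp

lemma length_children_card: "length (children C i r) = card {x. x < length (labels C) + 1 \<and> chosen C r x}"
proof -
  have "length (children C i r) = card (set (filter (chosen C r) [0..<length (labels C) + 1]))"
    unfolding children_def length_map by (rule distinct_card[symmetric]) simp
  also have "set (filter (chosen C r) [0..<length (labels C) + 1]) = {x. x < length (labels C) + 1 \<and> chosen C r x}"
    by (auto simp del: upt_Suc)
  finally show ?thesis .
qed

lemma eval_child_countE:
  assumes ok: "search_ok C k L \<sigma> \<rho>" and "\<sigma> 5 = length (labels C) + 1" "\<sigma> 6 = length L"
  shows "eval child_countE \<sigma> \<rho> = length (concat (map (children C i) L))"
proof -
  have "eval child_countE \<sigma> \<rho> = (\<Sum>h < length L. length (children C i (L ! h)))"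
    unfolding child_countE_def eval.simps assms(3)
    using assms(2) by (intro sum.cong) (simp_all add: eval_CardE length_children_card tr_chosenE_row[OF ok])
  also have "\<dots> = (\<Sum>r\<leftarrow>L. length (children C i r))" by (simp add: sum_list_sum_nth atLeast0LessThan)
  also have "\<dots> = length (concat (map (children C i) L))" by (simp add: length_concat comp_def)
  finally show ?thesis .
qed

lemma concat_map_filter: "concat (map (\<lambda>x. if P x then f x else []) xs) = concat (map f (filter P xs))"
  by (induction xs) auto

lemma concat_map_concat_map: "concat (map (\<lambda>x. concat (f x)) xs) = concat (concat (map f xs))"
  by (induction xs) auto

lemma list_update_map: "r[i := x] = map (\<lambda>j. if j = i then x else r ! j) [0..<length r]"
  by (rule nth_equalityI) (auto simp: nth_list_update)

lemma den_child_emit: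
  assumes ok: "search_ok C k L \<sigma> \<rho>" and "\<sigma> 5 = length (labels C) + 1" "\<sigma> 6 = length L" "\<sigma> 7 = i"
  shows "den child_emit \<sigma> \<rho> = concat (concat (map (children C i) L))"
proof -
  have d: "\<sigma> 1 = k" using search_okD(5)[OF ok] .
  have row: "den (EFor 22 1 (Emit (Ite (EqE (Var 22) (Var 7)) (Var 21) (rowE 20 22)))) (\<sigma>(20 := h, 21 := x)) \<rho> =
      (L ! h)[i := x]" if h: "h < length L" for h x
  proof -
    have len: "length (L ! h) = k" using search_okD(4)[OF ok] h by simp
    have "eval (Ite (EqE (Var 22) (Var 7)) (Var 21) (rowE 20 22)) (\<sigma>(20 := h, 21 := x, 22 := j)) \<rho> =
        (if j = i then x else L ! h ! j)" if "j < k" for j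
      using eval_rowE[of C k L "\<sigma>(20 := h, 21 := x, 22 := j)" \<rho> 20 22] ok h that assms(4)
      unfolding eval_Ite_tr by simp
    then have "map (\<lambda>j. den (Emit (Ite (EqE (Var 22) (Var 7)) (Var 21) (rowE 20 22)))
        (\<sigma>(20 := h, 21 := x, 22 := j)) \<rho>) [0..<k] = map (\<lambda>j. [if j = i then x else L ! h ! j]) [0..<k]"
      by (intro map_cong) (auto simp del: eval.simps)
    then show ?thesis unfolding list_update_map len den.simps(4) using d by (simp add: concat_map_singleton)
  qed
  have "den child_emit \<sigma> \<rho> = concat (map (\<lambda>h. concat (map (\<lambda>x. if chosen C (L ! h) x then (L ! h)[i := x] else [])
      [0..<length (labels C) + 1])) [0..<length L])"
    unfolding child_emit_def den.simps(4)[of 20] assms(3)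
  proof (intro arg_cong[where f = concat] map_cong refl)
    fix h assume "h \<in> set [0..<length L]"
    then have h: "h < length L" by simp
    show "den (EFor 21 5 (EIf (chosenE 20 21) (EFor 22 1 (Emit (Ite (EqE (Var 22) (Var 7)) (Var 21) (rowE 20 22))))))
        (\<sigma>(20 := h)) \<rho> = concat (map (\<lambda>x. if chosen C (L ! h) x then (L ! h)[i := x] else []) [0..<length (labels C) + 1])"
      unfolding den.simps(4)[of 21] using assms(2)
      by (intro arg_cong[where f = concat] map_cong)
        (simp_all add: den_EIf_tr tr_chosenE_row[OF ok h] row[OF h] del: den.simps upt_Suc One_nat_def)
  qed
  also have "\<dots> = concat (map (\<lambda>h. concat (children C i (L ! h))) [0..<length L])"
    unfolding concat_map_filter children_def by simp
  also have "\<dots> = concat (concat (map (\<lambda>h. children C i (L ! h)) [0..<length L]))" by (rule concat_map_concat_map)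
  also have "map (\<lambda>h. children C i (L ! h)) [0..<length L] = map (children C i) L"
    by (rule nth_equalityI) simp_all
  finally show ?thesis .
qed

lemma eval_verdictE:
  assumes ok: "search_ok C k L \<sigma> \<rho>" and "\<sigma> 6 = length L"
  shows "eval verdictE \<sigma> \<rho> = (if k \<le> card (inputs C) \<and> (\<exists>r \<in> set L. \<forall>c. \<not> active C r c) then 1 else 0)"
proof -
  have "{x. x < \<sigma> 3 \<and> tr (litE A0 20) (\<sigma>(20 := x)) \<rho>} = inputs C"
    using tr_litE_input[of C k L "\<sigma>(20 := x)" \<rho> 20 for x] ok search_okD(7)[OF ok] inputs_less by auto
  then have 1: "eval (CardE 20 3 (litE A0 20)) \<sigma> \<rho> = card (inputs C)" by (simp add: eval_CardE)
  have 2: "tr (activeE 20 21) (\<sigma>(20 := h, 21 := c)) \<rho> \<longleftrightarrow> active C (L ! h) c" if "h < length L" for h c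
    using tr_activeE[of C k L "\<sigma>(20 := h, 21 := c)" \<rho> 20 21] ok that by simp
  have "tr verdictE \<sigma> \<rho> \<longleftrightarrow> k \<le> card (inputs C) \<and> (\<exists>h < length L. \<forall>c < length (labels C). \<not> active C (L ! h) c)"
    unfolding verdictE_def using 1 2 search_okD(5,7)[OF ok] assms(2) by auto
  also have "\<dots> \<longleftrightarrow> k \<le> card (inputs C) \<and> (\<exists>r \<in> set L. \<forall>c. \<not> active C r c)"
    using active_clause_less[OF search_okD(1)[OF ok]] by (metis in_set_conv_nth)
  finally have "tr verdictE \<sigma> \<rho> \<longleftrightarrow> k \<le> card (inputs C) \<and> (\<exists>r \<in> set L. \<forall>c. \<not> active C r c)" .
  moreover have "eval verdictE \<sigma> \<rho> \<le> 1" by (simp add: verdictE_def AndE_def NotE_def)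
  ultimately show ?thesis unfolding tr_def by auto
qed

text \<open>The new rows are read off \<open>A1\<close>, so they are built in \<open>A2\<close> and
  copied back. Their number is put into variable 9, because variable 6 must keep the old number
  until all of them are built.\<close>

definition level_program :: ram where
  "level_program = Seq (assign 9 child_countE) (Seq (compile_emit (To A2) child_emit 3)
     (Seq (assign 6 (Var 9)) (Seq (assign 10 (Sum 20 1 (Var 6)))
     (Seq (Const (tmp (arr_index A1)) 0) (Seq (compile_emit (To A1) copy_emit 3)
     (Seq (Const (tmp (arr_index A2)) 0) (Seq (assign 7 (Plus (Var 7) (Num 1)))
       (assign 8 (Minus (Var 8) (Num 1))))))))))"

definition level_time :: "nat \<Rightarrow> nat" where
  "level_time B = (expr_cost child_countE B + 2) + (emit_cost child_emit B + ((expr_cost (Var 9) B + 2) +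
     ((expr_cost (Sum 20 1 (Var 6)) B + 2) + (1 + (emit_cost copy_emit B + (1 +
     ((expr_cost (Plus (Var 7) (Num 1)) B + 2) + (expr_cost (Minus (Var 8) (Num 1)) B + 2))))))))"

definition level_inv :: "circuit \<Rightarrow> nat \<Rightarrow> nat \<Rightarrow> nat \<Rightarrow> astate \<Rightarrow> bool" where
  "level_inv C k B i a \<longleftrightarrow> search_ok C k (level C k i) (av a) (aa a) \<and> av a 5 = length (labels C) + 1 \<and>
     av a 6 = length (level C k i) \<and> av a 7 = i \<and> av a 8 = k - i \<and> dims_le (av a) B \<and> aa a A2 = [] \<and> aout a = []"

lemma does_level_program:
  assumes inv: "level_inv C k B i a" and i: "i < k"
    and len: "length (level C k (Suc i)) \<le> B" "k * length (level C k (Suc i)) \<le> B" and kB: "k + 1 \<le> B"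
  shows "\<exists>a'. does level_program a (level_time B) a' \<and> level_inv C k B (Suc i) a'"
proof -
  let ?L = "level C k i" and ?L' = "level C k (Suc i)"
  define \<sigma> where "\<sigma> = av a"
  have ok: "search_ok C k ?L \<sigma> (aa a)" and v: "\<sigma> 5 = length (labels C) + 1" "\<sigma> 6 = length ?L" "\<sigma> 7 = i"
    "\<sigma> 8 = k - i" and dims: "dims_le \<sigma> B" and A2: "aa a A2 = []" and out: "aout a = []"
    using inv unfolding level_inv_def \<sigma>_def by auto
  have a: "a\<lparr>av := \<sigma>\<rparr> = a" by (simp add: \<sigma>_def)
  have v1: "\<sigma> 1 = k" using search_okD(5)[OF ok] .
  have rows: "length r = k" if "r \<in> set ?L'" for r using level_rows[OF that] by simp
  have lenL': "length (concat ?L') = k * length ?L'"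
  proof -
    have "length (concat ?L') = (\<Sum>r\<leftarrow>?L'. length r)" by (simp only: length_concat)
    also have "\<dots> = (\<Sum>r\<leftarrow>?L'. k)" using rows by (intro arg_cong[where f = sum_list] map_cong) auto
    finally show ?thesis by (simp add: sum_list_triv mult.commute)
  qed
  define \<sigma>1 where "\<sigma>1 = \<sigma>(9 := length ?L')"
  define \<sigma>2 where "\<sigma>2 = \<sigma>1(6 := length ?L')"
  define \<sigma>3 where "\<sigma>3 = \<sigma>2(10 := k * length ?L')"
  define \<sigma>4 where "\<sigma>4 = \<sigma>3(7 := Suc i)"
  define \<sigma>5 where "\<sigma>5 = \<sigma>4(8 := k - Suc i)"
  define \<rho>1 where "\<rho>1 = (aa a)(A2 := concat ?L')"
  define \<rho>2 where "\<rho>2 = \<rho>1(A1 := [])"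
  define \<rho>3 where "\<rho>3 = \<rho>1(A1 := concat ?L')"
  define \<rho>4 where "\<rho>4 = (aa a)(A1 := concat ?L')"
  note sdefs = \<sigma>1_def \<sigma>2_def \<sigma>3_def \<sigma>4_def \<sigma>5_def
  have d1: "dims_le \<sigma>1 B" using dims len by (auto simp: \<sigma>1_def)
  have d2: "dims_le \<sigma>2 B" using d1 len by (auto simp: \<sigma>2_def)
  have d3: "dims_le \<sigma>3 B" using d2 len by (auto simp: \<sigma>3_def)
  have d4: "dims_le \<sigma>4 B" using d3 i kB by (auto simp: \<sigma>4_def)
  have d5: "dims_le \<sigma>5 B" using d4 kB by (auto simp: \<sigma>5_def)
  have step: "does (assign x e) (a\<lparr>av := \<tau>, aa := \<rho>\<rparr>) (expr_cost e B + 2) (a\<lparr>av := \<tau>(x := u), aa := \<rho>\<rparr>)"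
    if "wf_expr e" "dims_le \<tau> B" "eval e \<tau> \<rho> = u" for x e \<tau> u \<rho>
  proof -
    have comm: "a\<lparr>aa := \<rho>, av := \<tau>(x := u)\<rparr> = a\<lparr>av := \<tau>(x := u), aa := \<rho>\<rparr>" by (cases a) simp
    show ?thesis using does_assign_eq[of e "a\<lparr>av := \<tau>, aa := \<rho>\<rparr>" B u x] that by (simp add: comm)
  qed
  have a0: "a\<lparr>av := \<sigma>, aa := aa a\<rparr> = a" by (simp add: \<sigma>_def)
  have 1: "does (assign 9 child_countE) a (expr_cost child_countE B + 2) (a\<lparr>av := \<sigma>1, aa := aa a\<rparr>)"
    using step[OF wf_search(1) dims, of "aa a" _ 9] eval_child_countE[OF ok v(1,2), of i]
    unfolding a0 \<sigma>1_def by simp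
  have 2: "does (compile_emit (To A2) child_emit 3) (a\<lparr>av := \<sigma>1, aa := aa a\<rparr>) (emit_cost child_emit B)
      (a\<lparr>av := \<sigma>1, aa := \<rho>1\<rparr>)"
  proof -
    have "den child_emit \<sigma>1 (aa a) = concat ?L'"
      using den_child_emit[of C k ?L \<sigma>1 "aa a" i] ok v by (simp add: \<sigma>1_def)
    then show ?thesis using does_emit[of child_emit "a\<lparr>av := \<sigma>1, aa := aa a\<rparr>" B "To A2"] wf_search d1 A2
      by (simp add: \<rho>1_def)
  qed
  have 3: "does (assign 6 (Var 9)) (a\<lparr>av := \<sigma>1, aa := \<rho>1\<rparr>) (expr_cost (Var 9) B + 2) (a\<lparr>av := \<sigma>2, aa := \<rho>1\<rparr>)"
    unfolding \<sigma>2_def by (rule step[OF _ d1]) (simp_all add: \<sigma>1_def)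
  have 4: "does (assign 10 (Sum 20 1 (Var 6))) (a\<lparr>av := \<sigma>2, aa := \<rho>1\<rparr>) (expr_cost (Sum 20 1 (Var 6)) B + 2)
      (a\<lparr>av := \<sigma>3, aa := \<rho>1\<rparr>)"
    unfolding \<sigma>3_def by (rule step[OF _ d2]) (use v1 in \<open>simp_all add: \<sigma>1_def \<sigma>2_def\<close>)
  have 5: "does (Const (tmp (arr_index A1)) 0) (a\<lparr>av := \<sigma>3, aa := \<rho>1\<rparr>) 1 (a\<lparr>av := \<sigma>3, aa := \<rho>2\<rparr>)"
    using does_clear[of A1 "a\<lparr>av := \<sigma>3, aa := \<rho>1\<rparr>"] by (simp add: \<rho>2_def)
  have 6: "does (compile_emit (To A1) copy_emit 3) (a\<lparr>av := \<sigma>3, aa := \<rho>2\<rparr>) (emit_cost copy_emit B)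
      (a\<lparr>av := \<sigma>3, aa := \<rho>3\<rparr>)"
  proof -
    have "den copy_emit \<sigma>3 \<rho>2 = concat (map (\<lambda>j. [concat ?L' ! j]) [0..<length (concat ?L')])"
      unfolding copy_emit_def den.simps(4) using lenL'
      by (intro arg_cong[where f = concat] map_cong) (auto simp: \<sigma>3_def \<rho>2_def \<rho>1_def)
    also have "\<dots> = map (\<lambda>j. concat ?L' ! j) [0..<length (concat ?L')]" by (rule concat_map_singleton)
    also have "\<dots> = concat ?L'" by (rule map_nth)
    finally show ?thesis using does_emit[of copy_emit "a\<lparr>av := \<sigma>3, aa := \<rho>2\<rparr>" B "To A1"] wf_search d3
      by (simp add: \<rho>2_def \<rho>3_def)
  qed
  have 7: "does (Const (tmp (arr_index A2)) 0) (a\<lparr>av := \<sigma>3, aa := \<rho>3\<rparr>) 1 (a\<lparr>av := \<sigma>3, aa := \<rho>4\<rparr>)"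
  proof -
    have "\<rho>3(A2 := []) = \<rho>4" using A2 by (auto simp: \<rho>3_def \<rho>4_def \<rho>1_def)
    then show ?thesis using does_clear[of A2 "a\<lparr>av := \<sigma>3, aa := \<rho>3\<rparr>"] by simp
  qed
  have 8: "does (assign 7 (Plus (Var 7) (Num 1))) (a\<lparr>av := \<sigma>3, aa := \<rho>4\<rparr>)
      (expr_cost (Plus (Var 7) (Num 1)) B + 2) (a\<lparr>av := \<sigma>4, aa := \<rho>4\<rparr>)"
    unfolding \<sigma>4_def by (rule step[OF _ d3]) (use v in \<open>simp_all add: \<sigma>1_def \<sigma>2_def \<sigma>3_def\<close>)
  have 9: "does (assign 8 (Minus (Var 8) (Num 1))) (a\<lparr>av := \<sigma>4, aa := \<rho>4\<rparr>)
      (expr_cost (Minus (Var 8) (Num 1)) B + 2) (a\<lparr>av := \<sigma>5, aa := \<rho>4\<rparr>)"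
    unfolding \<sigma>5_def by (rule step[OF _ d4]) (use v in \<open>simp_all add: \<sigma>1_def \<sigma>2_def \<sigma>3_def \<sigma>4_def\<close>)
  have "does level_program a (level_time B) (a\<lparr>av := \<sigma>5, aa := \<rho>4\<rparr>)"
    unfolding level_program_def level_time_def
    by (rule does_Seq[OF 1 does_Seq[OF 2 does_Seq[OF 3 does_Seq[OF 4 does_Seq[OF 5 does_Seq[OF 6
      does_Seq[OF 7 does_Seq[OF 8 9]]]]]]]])
  moreover have "level_inv C k B (Suc i) (a\<lparr>av := \<sigma>5, aa := \<rho>4\<rparr>)"
  proof -
    have "search_ok C k ?L' \<sigma>5 \<rho>4"
      using ok rows unfolding search_ok_def loaded_def by (simp add: sdefs \<rho>4_def del: tape.simps level.simps)
    then show ?thesis unfolding level_inv_def using d5 v A2 out by (simp add: sdefs \<rho>4_def del: level.simps)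
  qed
  ultimately show ?thesis by blast
qed

definition search_program :: ram where
  "search_program = Seq read_input (Seq (load_circuit A0) (Seq (assign 5 (Plus (Var 3) (Num 1)))
     (Seq (assign 6 (Num 1)) (Seq (assign 8 (Var 1)) (Seq (compile_emit (To A1) (EFor 20 1 (Emit (Var 3))) 3)
     (Seq (While (reg 8) level_program) (compile_emit Tape (Emit verdictE) 3)))))))"

definition search_time :: "nat \<Rightarrow> nat" where
  "search_time B = 30 * B + (60 + ((expr_cost (Plus (Var 3) (Num 1)) B + 2) + ((expr_cost (Num 1) B + 2) +
     ((expr_cost (Var 1) B + 2) + (emit_cost (EFor 20 1 (Emit (Var 3))) B +
     ((B * (level_time B + 1) + 1) + emit_cost (Emit verdictE) B))))))"

lemma poly_bounded_search_time: "poly_bounded search_time"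
  unfolding search_time_def[abs_def] level_time_def[abs_def] by (intro poly_bounded_intros)

text \<open>Everything but the number of rows is polynomial in the input size and \<open>k\<close>.
  A \<open>B\<close> that also exceeds the space for every level bounds all loops, and the time is
  polynomial in it.\<close>

lemma runs_search_program:
  assumes C: "Pi_circuit 2 C" "monotone_circuit C"
    and B: "k + 1 \<le> B" "length (enc_circuit C) + 2 \<le> B"
      "\<And>i. i \<le> k \<Longrightarrow> (k + 1) * length (level C k i) \<le> B"
  shows "\<exists>t \<le> search_time B. runs search_program (tape (enc_circuit C, k)) t
    [if weight_sat C k then 1 else 0]"
proof -
  have wf: "wf_circuit C" using C by (simp add: Pi_circuit_def)
  let ?n = "length (labels C)"
  have nB: "?n + 1 \<le> B" "length (wires C) \<le> B" "outgate C \<le> B"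
    using B(2) wf by (auto simp: length_enc_circuit wf_circuit_def verts_def)
  have lenB: "length (level C k i) \<le> B" "k * length (level C k i) \<le> B" if "i \<le> k" for i
    using B(3)[OF that] by auto
  let ?a1 = "loaded_state (enc_circuit C) k"
  define \<sigma>2 where "\<sigma>2 = (av ?a1)(1 := k, 2 := outgate C, 3 := ?n, 4 := length (wires C))"
  define \<sigma>3 where "\<sigma>3 = \<sigma>2(5 := ?n + 1)"
  define \<sigma>4 where "\<sigma>4 = \<sigma>3(6 := 1)"
  define \<sigma>5 where "\<sigma>5 = \<sigma>4(8 := k)"
  define a6 where "a6 = push (To A1) (replicate k ?n) (?a1\<lparr>av := \<sigma>5\<rparr>)"
  have d2: "dims_le \<sigma>2 B" using nB B(1) by (auto simp: \<sigma>2_def loaded_state_def)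
  have d3: "dims_le \<sigma>3 B" using nB d2 by (auto simp: \<sigma>3_def)
  have d4: "dims_le \<sigma>4 B" using B(1) d3 by (auto simp: \<sigma>4_def)
  have d5: "dims_le \<sigma>5 B" using B(1) d4 by (auto simp: \<sigma>5_def)
  have A0: "aa ?a1 A0 = tape (enc_circuit C, k)" by (simp add: loaded_state_def)
  have "30 * (length (enc_circuit C) + 2) \<le> 30 * B" using B(2) by simp
  then have 1: "does read_input (init (tape (enc_circuit C, k))) (30 * B) ?a1"
    by (rule does_mono[OF does_read_input])
  have 2: "does (load_circuit A0) ?a1 60 (?a1\<lparr>av := \<sigma>2\<rparr>)"
    unfolding \<sigma>2_def by (rule does_load_circuit[OF A0])
  have step: "does (assign x e) (?a1\<lparr>av := \<tau>\<rparr>) (expr_cost e B + 2) (?a1\<lparr>av := \<tau>(x := u)\<rparr>)"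
    if "wf_expr e" "dims_le \<tau> B" "eval e \<tau> (aa ?a1) = u" for x e \<tau> u
    using does_assign_eq[of e "?a1\<lparr>av := \<tau>\<rparr>" B u x] that by simp
  have 3: "does (assign 5 (Plus (Var 3) (Num 1))) (?a1\<lparr>av := \<sigma>2\<rparr>) (expr_cost (Plus (Var 3) (Num 1)) B + 2) (?a1\<lparr>av := \<sigma>3\<rparr>)"
    unfolding \<sigma>3_def by (rule step[OF _ d2]) (simp_all add: \<sigma>2_def)
  have 4: "does (assign 6 (Num 1)) (?a1\<lparr>av := \<sigma>3\<rparr>) (expr_cost (Num 1) B + 2) (?a1\<lparr>av := \<sigma>4\<rparr>)"
    unfolding \<sigma>4_def by (rule step[OF _ d3]) simp_all
  have 5: "does (assign 8 (Var 1)) (?a1\<lparr>av := \<sigma>4\<rparr>) (expr_cost (Var 1) B + 2) (?a1\<lparr>av := \<sigma>5\<rparr>)"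
    unfolding \<sigma>5_def by (rule step[OF _ d4]) (simp_all add: \<sigma>2_def \<sigma>3_def \<sigma>4_def)
  have 6: "does (compile_emit (To A1) (EFor 20 1 (Emit (Var 3))) 3) (?a1\<lparr>av := \<sigma>5\<rparr>)
      (emit_cost (EFor 20 1 (Emit (Var 3))) B) a6"
  proof -
    have "\<sigma>5 1 = k" "\<sigma>5 3 = ?n" by (simp_all add: \<sigma>2_def \<sigma>3_def \<sigma>4_def \<sigma>5_def)
    then have "den (EFor 20 1 (Emit (Var 3))) \<sigma>5 (aa ?a1) = replicate k ?n"
      by (simp add: concat_map_singleton map_replicate_const)
    then show ?thesis
      using does_emit[of "EFor 20 1 (Emit (Var 3))" "?a1\<lparr>av := \<sigma>5\<rparr>" B "To A1"] d5 by (simp add: a6_def)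
  qed
  have inv0: "level_inv C k B 0 a6"
  proof -
    have "loaded A0 C k \<sigma>5 (aa a6)" unfolding loaded_def
      using A0 by (simp add: a6_def \<sigma>2_def \<sigma>3_def \<sigma>4_def \<sigma>5_def del: tape.simps)
    then show ?thesis unfolding level_inv_def search_ok_def using wf d5
      by (simp add: a6_def loaded_state_def init_def) (simp add: \<sigma>2_def \<sigma>3_def \<sigma>4_def \<sigma>5_def loaded_state_def)
  qed
  have "\<exists>a'. does (While (reg 8) level_program) a6 (k * (level_time B + 1) + 1) a' \<and> level_inv C k B k a'"
  proof (rule does_While_inv[where I = "level_inv C k B"])
    fix i a assume i: "i < k" and inv: "level_inv C k B i a"
    have "av a 8 \<noteq> 0" using inv i by (simp add: level_inv_def)
    then show "av a 8 \<noteq> 0 \<and> (\<exists>a'. does level_program a (level_time B) a' \<and> level_inv C k B (Suc i) a')"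
      using does_level_program[OF inv i _ _ B(1)] lenB[of "Suc i"] i by simp
  qed (use inv0 in \<open>auto simp: level_inv_def\<close>)
  then obtain a7 where 7: "does (While (reg 8) level_program) a6 (k * (level_time B + 1) + 1) a7"
    and inv: "level_inv C k B k a7" by blast
  have "k * (level_time B + 1) + 1 \<le> B * (level_time B + 1) + 1" using B(1) by (intro add_mono mult_right_mono) auto
  note 7 = does_mono[OF 7 this]
  have 8: "does (compile_emit Tape (Emit verdictE) 3) a7 (emit_cost (Emit verdictE) B)
      (push Tape (den (Emit verdictE) (av a7) (aa a7)) a7)"
    using inv wf_search(4) unfolding level_inv_def by (intro does_emit) auto
  have "search_ok C k (level C k k) (av a7) (aa a7)" "av a7 6 = length (level C k k)" "aout a7 = []"
    using inv by (auto simp: level_inv_def)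
  then have "aout (push Tape (den (Emit verdictE) (av a7) (aa a7)) a7) = [if weight_sat C k then 1 else 0]"
    using eval_verdictE[of C k "level C k k" "av a7" "aa a7"] weight_sat_level[OF C, of k] by simp
  then show ?thesis
    using runs_does[OF does_Seq[OF 1 does_Seq[OF 2 does_Seq[OF 3 does_Seq[OF 4 does_Seq[OF 5 does_Seq[OF 6
      does_Seq[OF 7 8]]]]]]]] unfolding search_program_def search_time_def by simp
qed

section \<open>Fixed-parameter tractability\<close>

text \<open>Brings a bound on the number of rows into the form \<open>2 ^ f k\<close>, for which
  computability was shown.\<close>

lemma power_le_exp2: "(x::nat) ^ k \<le> 2 ^ (x * k)"
proof -
  have "x \<le> 2 ^ x" using less_exp[of x] by simp
  then have "x ^ k \<le> (2 ^ x) ^ k" by (rule power_mono) simp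
  then show ?thesis by (simp add: power_mult)
qed

text \<open>If \<open>k\<close> is positive and at most \<open>\<mu> n\<close>, then
  \<open>e n\<close> is at most \<open>1 / k\<close>, so the power \<open>g n ^ k\<close> is at most
  \<open>n\<close>. The factor \<open>2 ^ 6\<close> absorbs 15 + 24 = 39.\<close>

lemma branching_bound:
  assumes "\<And>n. n1 \<le> n \<Longrightarrow> e n \<le> 1 / real (\<mu> n)" "\<And>n. n1 \<le> n \<Longrightarrow> real (g n) \<le> real n powr e n"
    and n: "n1 \<le> n" "1 \<le> n" "k \<le> \<mu> n" and \<gamma>: "\<gamma> \<le> g n"
  shows "(15 + 24 * \<gamma>) ^ k \<le> 2 ^ (6 * k) * n"
proof (cases "k = 0")
  case True
  then show ?thesis using n by simp
next
  case False
  have "e n \<le> 1 / real k"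
  proof -
    have "e n \<le> 1 / real (\<mu> n)" using assms(1) n by blast
    also have "\<dots> \<le> 1 / real k" using n False by (intro divide_left_mono) auto
    finally show ?thesis .
  qed
  have "real (max 1 (g n)) \<le> real n powr (1 / real k)"
  proof -
    have "real (g n) \<le> real n powr e n" using assms(2) n by blast
    also have "\<dots> \<le> real n powr (1 / real k)" using n \<open>e n \<le> 1 / real k\<close> by (intro powr_mono) auto
    finally have "real (g n) \<le> real n powr (1 / real k)" .
    moreover have "1 \<le> real n powr (1 / real k)" using n by (intro ge_one_powr_ge_zero) auto
    ultimately show ?thesis by (simp add: max_def)
  qed
  then have "real (max 1 (g n)) ^ k \<le> (real n powr (1 / real k)) ^ k" by (rule power_mono) simp
  also have "\<dots> = real n" using n False by (simp add: powr_realpow[symmetric] powr_powr)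
  finally have "max 1 (g n) ^ k \<le> n" by (metis of_nat_le_iff of_nat_power)
  moreover have "15 + 24 * \<gamma> \<le> 2 ^ 6 * max 1 (g n)" using \<gamma> by (auto simp: max_def)
  then have "(15 + 24 * \<gamma>) ^ k \<le> (2 ^ 6 * max 1 (g n)) ^ k" by (rule power_mono) simp
  then have "(15 + 24 * \<gamma>) ^ k \<le> 2 ^ (6 * k) * max 1 (g n) ^ k" unfolding power_mult_distrib power_mult .
  ultimately show ?thesis using mult_le_mono2 order_trans by blast
qed

theorem subpolynomial_FPT:
  assumes "subpolynomial g"
  shows "wsat_pos_genus g \<in> FPT"
proof -
  obtain e where e: "eff_small_o e (\<lambda>_. 1)" "\<forall>\<^sub>F n in sequentially. real (g n) \<le> real n powr e n"
    using assms unfolding subpolynomial_def by blast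
  then obtain \<mu> :: "nat \<Rightarrow> nat" where \<mu>: "computable \<mu>" "mono \<mu>" "\<forall>b. \<exists>n. b \<le> \<mu> n"
    "\<forall>\<^sub>F n in sequentially. e n \<le> 1 / real (\<mu> n)" unfolding eff_small_o_def by blast
  obtain m1 m2 where m: "\<And>n. m1 \<le> n \<Longrightarrow> e n \<le> 1 / real (\<mu> n)" "\<And>n. m2 \<le> n \<Longrightarrow> real (g n) \<le> real n powr e n"
    using e(2) \<mu>(4) unfolding eventually_sequentially by blast
  \<comment> \<open>The added 1 makes \<open>n\<close> positive in the first case below, and the
    branching bound positive in the second.\<close>
  define n1 where "n1 = m1 + m2 + 1"
  define M where "M k = (LEAST n. k \<le> \<mu> n)" for k
  have compM: "computable M" unfolding M_def using \<mu>(1,3) by (intro computable_Least) auto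
  have M: "k \<le> \<mu> n" if "M k \<le> n" for k n
  proof -
    have "k \<le> \<mu> (M k)" unfolding M_def using \<mu>(3) LeastI_ex by (metis (mono_tags, lifting))
    also have "\<dots> \<le> \<mu> n" using \<mu>(2) that by (rule monoD)
    finally show ?thesis .
  qed
  \<comment> \<open>The first summand, times the number of variables, bounds the rows once
    \<open>\<mu>\<close> has reached \<open>k\<close>; the second is for fewer variables than the
    threshold \<open>n1 + M k\<close>.\<close>
  define F :: "nat \<Rightarrow> nat" where "F k = 2 ^ (6 * k) + 2 ^ ((n1 + M k) * k)" for k
  obtain Ct nt where T: "\<And>B. search_time B \<le> Ct * (B + 1) ^ nt"
    using poly_bounded_search_time by (auto simp: poly_bounded_def)
  define f where "f k = Ct * ((k + 1) * F k + 2) ^ nt" for k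
  have compF: "computable F" unfolding F_def
    by (intro computable_add computable_exp2 computable_mult computable_const computable_id compM)
  have compf: "computable f" unfolding f_def
    by (intro computable_mult computable_power computable_add computable_const computable_id compF)
  have main: "\<exists>t \<le> f k * word_size (enc_circuit C) ^ (2 * nt).
      runs search_program (tape (enc_circuit C, k)) t [if weight_sat C k then 1 else 0]"
    if C: "Pi_circuit 2 C" "monotone_circuit C" "circuit_genus C \<le> g (card (vars C))" for C k
  proof -
    let ?ws = "word_size (enc_circuit C)" and ?n = "card (vars C)"
    have n: "?n = card (inputs C)" using weight_sat_inputs(2)[OF C(1,2)] .
    have "card (inputs C) \<le> card {..<length (labels C)}" by (rule card_mono) (auto dest: inputs_less)
    then have nws: "?n \<le> ?ws" using n length_word_size[of "enc_circuit C"] by (simp add: length_enc_circuit)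
    have ws: "1 \<le> ?ws" using length_word_size[of "enc_circuit C"] by linarith
    \<comment> \<open>A branching bound that is uniform over the tree, in both cases; being at least
      1, it bounds every level by \<open>D ^ k\<close>.\<close>
    have "\<exists>D \<ge> 1. (\<forall>i r. length (children C i r) \<le> D) \<and> D ^ k \<le> F k * ?ws"
    proof (cases "n1 + M k \<le> ?n")
      case True
      have "(15 + 24 * circuit_genus C) ^ k \<le> 2 ^ (6 * k) * ?n"
        by (rule branching_bound[of n1 e \<mu> g]) (use m M[of k ?n] True C(3) in \<open>auto simp: n1_def\<close>)
      also have "\<dots> \<le> F k * ?ws" using nws unfolding F_def by (intro mult_mono) auto
      finally show ?thesis using length_children(1)[OF C(1)] by (intro exI[of _ "15 + 24 * circuit_genus C"]) auto
    next
      case False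
      have "(n1 + M k) ^ k \<le> 2 ^ ((n1 + M k) * k)" by (rule power_le_exp2)
      also have "\<dots> \<le> F k * 1" unfolding F_def by simp
      also have "\<dots> \<le> F k * ?ws" using ws by (intro mult_left_mono) auto
      finally have "(n1 + M k) ^ k \<le> F k * ?ws" .
      moreover have "length (children C i r) \<le> n1 + M k" for i r
        using length_children(2)[OF C(1), of i r] False n by linarith
      moreover have "1 \<le> n1 + M k" by (simp add: n1_def)
      ultimately show ?thesis by blast
    qed
    then obtain D where D: "1 \<le> D" "\<And>i r. length (children C i r) \<le> D" "D ^ k \<le> F k * ?ws" by blast
    have lev: "length (level C k i) \<le> F k * ?ws" if "i \<le> k" for i
    proof -
      have "length (level C k i) \<le> D ^ i" using D(2) by (rule length_level)
      also have "\<dots> \<le> D ^ k" using D(1) that by (intro power_increasing)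
      finally show ?thesis using D(3) by linarith
    qed
    have "(1 :: nat) \<le> 2 ^ (6 * k)" by simp
    then have F1: "1 \<le> F k" unfolding F_def by linarith
    \<comment> \<open>Room for the rows of every level and for the input itself; linear in the word
      size for fixed \<open>k\<close>.\<close>
    let ?B = "((k + 1) * F k + 1) * ?ws"
    have "?B + 1 \<le> ((k + 1) * F k + 2) * ?ws ^ 2"
    proof -
      have "?ws \<le> ?ws ^ 2" using ws by (simp add: power2_eq_square)
      then have "((k + 1) * F k + 2) * ?ws \<le> ((k + 1) * F k + 2) * ?ws ^ 2" by (rule mult_left_mono) simp
      moreover have "?B + 1 \<le> ((k + 1) * F k + 2) * ?ws" using ws by (simp add: distrib_right)
      ultimately show ?thesis by linarith
    qed
    then have "(?B + 1) ^ nt \<le> (((k + 1) * F k + 2) * ?ws ^ 2) ^ nt" by (rule power_mono) simp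
    also have "\<dots> = ((k + 1) * F k + 2) ^ nt * ?ws ^ (2 * nt)" by (simp only: power_mult_distrib power_mult)
    finally have "Ct * (?B + 1) ^ nt \<le> Ct * (((k + 1) * F k + 2) ^ nt * ?ws ^ (2 * nt))" by (rule mult_left_mono) simp
    then have time: "search_time ?B \<le> f k * ?ws ^ (2 * nt)" using T[of ?B] unfolding f_def mult.assoc by linarith
    have "\<exists>t \<le> search_time ?B. runs search_program (tape (enc_circuit C, k)) t [if weight_sat C k then 1 else 0]"
    proof (rule runs_search_program[OF C(1,2)])
      have "(k + 1) * 1 * 1 \<le> (k + 1) * F k * ?ws" using F1 ws by (intro mult_mono) auto
      then show "k + 1 \<le> ?B" unfolding distrib_right by linarith
      have "1 * 1 * ?ws \<le> (k + 1) * F k * ?ws" using F1 by (intro mult_mono) auto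
      then show "length (enc_circuit C) + 2 \<le> ?B" unfolding distrib_right
        using length_word_size[of "enc_circuit C"] ws by linarith
      fix i assume "i \<le> k"
      then have "(k + 1) * length (level C k i) \<le> (k + 1) * (F k * ?ws)" using lev by (intro mult_left_mono) auto
      then show "(k + 1) * length (level C k i) \<le> ?B" unfolding distrib_right mult.assoc by linarith
    qed
    then show ?thesis using time order_trans by blast
  qed
  show ?thesis unfolding FPT_def mem_Collect_eq
  proof (rule exI[of _ search_program], rule exI[of _ f], rule exI[of _ "2 * nt"], intro conjI allI impI)
    show "computable f" by (rule compf)
    fix w k
    show "\<exists>t \<le> f k * word_size w ^ (2 * nt). runs search_program (tape (w, k)) t [1]"
      if wk: "(w, k) \<in> yes (wsat_pos_genus g)"
    proof -
      obtain C where "w = enc_circuit C" "Pi_circuit 2 C" "monotone_circuit C"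
        "circuit_genus C \<le> g (card (vars C))" "weight_sat C k"
        using wk unfolding wsat_pos_genus_def wsat_on_def by auto
      then show ?thesis using main[of C k] by simp
    qed
    show "\<exists>t \<le> f k * word_size w ^ (2 * nt). runs search_program (tape (w, k)) t [0]"
      if wk: "(w, k) \<in> no (wsat_pos_genus g)"
    proof -
      obtain C where "w = enc_circuit C" "Pi_circuit 2 C" "monotone_circuit C"
        "circuit_genus C \<le> g (card (vars C))" "\<not> weight_sat C k"
        using wk unfolding wsat_pos_genus_def wsat_on_def by auto
      then show ?thesis using main[of C k] by simp
    qed
  qed
qed

theorem theorem7:
  fixes g :: "nat \<Rightarrow> nat"
  shows "(subpolynomial g \<longrightarrow> wsat_pos_genus g \<in> FPT) \<and>
         (polynomial_growth g \<longrightarrow> W_complete 2 (wsat_pos_genus g))"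
  using subpolynomial_FPT W2_complete by blast

end
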